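(* Let $m\ge1$ be an integer. Let $(\zeta^{\rm in},q^{\rm in})\in H^m(\mathcal E)\times H^{m+1}(\mathcal E)$ and $q_i^{\rm in}\in\mathbb R$ be such that $$\inf_{\mathcal E}(1+\varepsilon\zeta^{\rm in})>0,\qquad\llbracket q^{\rm in}\rrbracket=0,\qquad\langle q^{\rm in}\rangle=q_i^{\rm in}\qquad\text{and}\qquad q^{\rm in}=0\ \text{ at }x=\ell .$$ Then, for any $\varepsilon\in(0,1]$ and $\widetilde\mu>0$, there exists $T>0$ such that the transmission problem $$\begin{cases}\partial_t\zeta+\partial_xq=0\\ (1-\widetilde\mu^2\partial_x^2)\partial_tq+\varepsilon\partial_x\big(\frac{q^2}h\big)+h\,\partial_x\zeta=0\end{cases}\quad\text{in }\mathcal E,$$ with boundary conditions $(\zeta,q)\to(0,0)$ as $x\to-\infty$ and $q=0$ at $x=\ell$, transmission conditions $\llbracket q\rrbracket=0$, $\langle q\rangle=q_i$, and $$\big(\alpha+\mathcal T_{\widetilde\mu}(h)\big)\frac{dq_i}{dt}-\frac\varepsilon2\Big\llbracket\frac1{h^2}\Big\rrbracket q_i^2=-\llbracket\mathcal F\rrbracket-P_0(I-\kappa\mathcal D)\overline\zeta,$$ admits a unique solution $(\zeta,q,q_i)\in C^1\big([0,T);H^m(\mathcal E)\times H^{m+1}(\mathcal E)\times\mathbb R\big)$ satisfying the initial conditions $(\zeta,q)(0,\cdot)=(\zeta^{\rm in},q^{\rm in})$ in $\mathcal E$ and $q_i(0)=q_i^{\rm in}$. In addition, denoting by $T_{\rm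 max}$ the maximal existence time, if $T_{\rm max}$ is finite then $$\limsup_{t\to T_{\rm max}^-}\Big(\Big\|\zeta(t),q(t),\frac1{h(t)}\Big\|_{L^\infty(\mathcal E)}+|q_i(t)|\Big)=+\infty .$$
   Context: Parameters: $0<r<\ell$, $\alpha=2r/h_{\rm w}$ with a constant $h_{\rm w}>0$, $P_0>0$, $\kappa\ge0$. Domains: $\mathcal E_-=(-\infty,-r)$, $\mathcal E_+=(r,\ell)$, $\mathcal E=\mathcal E_-\cup\mathcal E_+$, $|\mathcal E_+|=\ell-r$ (Sobolev spaces on $\mathcal E$ are those of the disconnected open set). $h=1+\varepsilon\zeta$. For a function $G$ on $\mathcal E$ with traces at $\pm r$: $\llbracket G\rrbracket=G(r)-G(-r)$, $\langle G\rangle=\frac{G(r)+G(-r)}2$. $\overline\zeta(t)=\frac1{|\mathcal E_+|}\int_{\mathcal E_+}\zeta(t,x)\,dx$; $I$ is the identity; $\mathcal Df(t)=\int_0^te^{-\kappa(t-s)}f(s)\,ds$. $$\mathcal T_{\widetilde\mu}(h)=\widetilde\mu\Big(C_{1,\widetilde\mu}\Big\langle\frac1h\Big\rangle+C_{2,\widetilde\mu}\Big\llbracket\frac1h\Big\rrbracket\Big),\qquad C_{1,\widetilde\mu}=\frac{e^{\frac{\ell-r}{\widetilde\mu}}}{\sinh(\frac{\ell-r}{\widetilde\mu})},\qquad C_{2,\widetilde\mu}=\frac{e^{-\frac{\ell-r}{\widetilde\mu}}}{2\sinh(\frac{\ell-r}{\widetilde\mu})},$$ $$\mathcal F=\frac1h\Big(\varepsilon\frac{\zeta^2}2+R_1\varphi\Big),\qquad\varphi=\zeta+\varepsilon\frac{\zeta^2}2+\varepsilon\frac{q^2}h,$$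 where $u=R_1v$ iff $(I-\widetilde\mu^2\partial_x^2)u=v$ in $\mathcal E$, $\partial_xu\to0$ as $x\to-\infty$, $\partial_xu=0$ at $x=\pm r$ and $x=\ell$ (solved on each connected component in $L^2$-based Sobolev spaces). The norm $\|f_1,f_2,f_3\|_{L^\infty}$ denotes the $L^\infty$ norm of the triple. *)

theory Defs
  imports "HOL-Analysis.Analysis" "HOL-Probability.Essential_Supremum"
begin

text \<open>
  Elements of Lebesgue and Sobolev spaces are represented by functions \<open>real \<Rightarrow> real\<close>; every notion
  below depends only on the a.e. class of the restriction of such a function to the open set
  under consideration (values outside of it are irrelevant).
\<close>

section \<open>Sobolev spaces on an open subset of the line\<close>

definition test_function :: "real set \<Rightarrow> (real \<Rightarrow> real) \<Rightarrow> bool" where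
  "test_function E \<phi> \<longleftrightarrow>
     (\<forall>k x. (deriv ^^ k) \<phi> differentiable (at x)) \<and>
     (\<exists>K. compact K \<and> K \<subseteq> E \<and> (\<forall>x. x \<notin> K \<longrightarrow> \<phi> x = 0))"

definition locally_integrable :: "real set \<Rightarrow> (real \<Rightarrow> real) \<Rightarrow> bool" where
  "locally_integrable E f \<longleftrightarrow> (\<forall>K. compact K \<longrightarrow> K \<subseteq> E \<longrightarrow> set_integrable lebesgue K f)"

definition has_weak_deriv :: "real set \<Rightarrow> nat \<Rightarrow> (real \<Rightarrow> real) \<Rightarrow> (real \<Rightarrow> real) \<Rightarrow> bool" where
  "has_weak_deriv E k f g \<longleftrightarrow>
     locally_integrable E f \<and> locally_integrable E g \<and>
     (\<forall>\<phi>. test_function E \<phi> \<longrightarrow>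
        (LINT x:E|lebesgue. f x * (deriv ^^ k) \<phi> x) = (- 1) ^ k * (LINT x:E|lebesgue. g x * \<phi> x))"

text \<open>The weak derivative is unique only up to null sets; an arbitrary representative is chosen.\<close>

definition weak_deriv :: "real set \<Rightarrow> nat \<Rightarrow> (real \<Rightarrow> real) \<Rightarrow> real \<Rightarrow> real" where
  "weak_deriv E k f = (SOME g. has_weak_deriv E k f g)"

definition L2 :: "real set \<Rightarrow> (real \<Rightarrow> real) set" where
  "L2 E = {f. set_borel_measurable lebesgue E f \<and> set_integrable lebesgue E (\<lambda>x. (f x)\<^sup>2)}"

definition Sobolev :: "real set \<Rightarrow> nat \<Rightarrow> (real \<Rightarrow> real) set" where
  "Sobolev E m = {f. \<forall>k\<le>m. \<exists>g \<in> L2 E. has_weak_deriv E k f g}"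

definition Sobolev_norm :: "real set \<Rightarrow> nat \<Rightarrow> (real \<Rightarrow> real) \<Rightarrow> real" where
  "Sobolev_norm E m f = sqrt (\<Sum>k\<le>m. LINT x:E|lebesgue. (weak_deriv E k f x)\<^sup>2)"

text \<open>\<open>f \<in> C\<^sup>1(I; H\<^sup>m(E))\<close> with (strong) time derivative \<open>f'\<close>; one-sided at end points of \<open>I\<close> in \<open>I\<close>.\<close>

definition C1_Sobolev ::
  "real set \<Rightarrow> nat \<Rightarrow> real set \<Rightarrow> (real \<Rightarrow> real \<Rightarrow> real) \<Rightarrow> (real \<Rightarrow> real \<Rightarrow> real) \<Rightarrow> bool" where
  "C1_Sobolev E m I f f' \<longleftrightarrow>
     (\<forall>t\<in>I. f t \<in> Sobolev E m \<and> f' t \<in> Sobolev E m \<and>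
        ((\<lambda>s. Sobolev_norm E m (\<lambda>x. (f s x - f t x) / (s - t) - f' t x)) \<longlongrightarrow> 0) (at t within I) \<and>
        ((\<lambda>s. Sobolev_norm E m (\<lambda>x. f' s x - f' t x)) \<longlongrightarrow> 0) (at t within I))"

text \<open>
  Limits and boundary values modulo null sets: for a function having a representative
  with a limit along \<open>F\<close>, e.g. the continuous representative of an \<open>H\<^sup>1\<close> function with
  \<open>F = at_right a\<close>, this is the limit of that representative.
\<close>

definition ess_tendsto :: "(real \<Rightarrow> real) \<Rightarrow> real \<Rightarrow> real filter \<Rightarrow> bool" where
  "ess_tendsto f c F \<longleftrightarrow>
     (\<forall>e>0. \<exists>S. eventually (\<lambda>x. x \<in> S) F \<and> (AE x in lebesgue. x \<in> S \<longrightarrow> \<bar>f x - c\<bar> < e))"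

definition ess_lim :: "(real \<Rightarrow> real) \<Rightarrow> real filter \<Rightarrow> real" where
  "ess_lim f F = (THE c. ess_tendsto f c F)"

definition Linf_norm3 :: "real set \<Rightarrow> (real \<Rightarrow> real) \<Rightarrow> (real \<Rightarrow> real) \<Rightarrow> (real \<Rightarrow> real) \<Rightarrow> ereal" where
  "Linf_norm3 E f1 f2 f3 =
     esssup (restrict_space lebesgue E) (\<lambda>x. ereal (max \<bar>f1 x\<bar> (max \<bar>f2 x\<bar> \<bar>f3 x\<bar>)))"

section \<open>The transmission problem\<close>

definition domE :: "real \<Rightarrow> real \<Rightarrow> real set" where
  "domE r l = {..< - r} \<union> {r <..< l}"

definition jump :: "real \<Rightarrow> (real \<Rightarrow> real) \<Rightarrow> real" where
  "jump r G = ess_lim G (at_right r) - ess_lim G (at_left (- r))"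

definition mean :: "real \<Rightarrow> (real \<Rightarrow> real) \<Rightarrow> real" where
  "mean r G = (ess_lim G (at_right r) + ess_lim G (at_left (- r))) / 2"

definition average :: "real \<Rightarrow> real \<Rightarrow> (real \<Rightarrow> real) \<Rightarrow> real" where
  "average r l z = (LINT x:{r<..<l}|lebesgue. z x) / (l - r)"

definition duhamel :: "real \<Rightarrow> (real \<Rightarrow> real) \<Rightarrow> real \<Rightarrow> real" where
  "duhamel \<kappa> f t = (LINT s:{0..t}|lebesgue. exp (- \<kappa> * (t - s)) * f s)"

definition height :: "real \<Rightarrow> (real \<Rightarrow> real) \<Rightarrow> real \<Rightarrow> real" where
  "height \<epsilon> z x = 1 + \<epsilon> * z x"

definition C1_coeff :: "real \<Rightarrow> real \<Rightarrow> real \<Rightarrow> real" where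
  "C1_coeff r l \<mu> = exp ((l - r) / \<mu>) / sinh ((l - r) / \<mu>)"

definition C2_coeff :: "real \<Rightarrow> real \<Rightarrow> real \<Rightarrow> real" where
  "C2_coeff r l \<mu> = exp (- ((l - r) / \<mu>)) / (2 * sinh ((l - r) / \<mu>))"

definition T_coeff :: "real \<Rightarrow> real \<Rightarrow> real \<Rightarrow> (real \<Rightarrow> real) \<Rightarrow> real" where
  "T_coeff r l \<mu> h =
     \<mu> * (C1_coeff r l \<mu> * mean r (\<lambda>x. 1 / h x) + C2_coeff r l \<mu> * jump r (\<lambda>x. 1 / h x))"

definition solves_R1 :: "real \<Rightarrow> real \<Rightarrow> real \<Rightarrow> (real \<Rightarrow> real) \<Rightarrow> (real \<Rightarrow> real) \<Rightarrow> bool" where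
  "solves_R1 r l \<mu> v u \<longleftrightarrow>
     u \<in> Sobolev (domE r l) 2 \<and>
     (AE x in lebesgue. x \<in> domE r l \<longrightarrow> u x - \<mu>\<^sup>2 * weak_deriv (domE r l) 2 u x = v x) \<and>
     (let u' = weak_deriv (domE r l) 1 u in
        ess_tendsto u' 0 at_bot \<and> ess_tendsto u' 0 (at_left (- r)) \<and>
        ess_tendsto u' 0 (at_right r) \<and> ess_tendsto u' 0 (at_left l))"

text \<open>\<open>R1 v\<close> is determined up to null sets for \<open>v\<close> in \<open>L2\<close>; an arbitrary representative is chosen.\<close>

definition R1 :: "real \<Rightarrow> real \<Rightarrow> real \<Rightarrow> (real \<Rightarrow> real) \<Rightarrow> real \<Rightarrow> real" where
  "R1 r l \<mu> v = (SOME u. solves_R1 r l \<mu> v u)"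

definition phi :: "real \<Rightarrow> (real \<Rightarrow> real) \<Rightarrow> (real \<Rightarrow> real) \<Rightarrow> real \<Rightarrow> real" where
  "phi \<epsilon> z q x = z x + \<epsilon> * (z x)\<^sup>2 / 2 + \<epsilon> * (q x)\<^sup>2 / height \<epsilon> z x"

definition calF ::
  "real \<Rightarrow> real \<Rightarrow> real \<Rightarrow> real \<Rightarrow> (real \<Rightarrow> real) \<Rightarrow> (real \<Rightarrow> real) \<Rightarrow> real \<Rightarrow> real" where
  "calF r l \<epsilon> \<mu> z q x =
     1 / height \<epsilon> z x * (\<epsilon> * (z x)\<^sup>2 / 2 + R1 r l \<mu> (phi \<epsilon> z q) x)"

definition ess_inf_pos :: "real set \<Rightarrow> (real \<Rightarrow> real) \<Rightarrow> bool" where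
  "ess_inf_pos E f \<longleftrightarrow> (\<exists>c>0. AE x in lebesgue. x \<in> E \<longrightarrow> c \<le> f x)"

text \<open>
  Solutions in \<open>C\<^sup>1([0,T); H\<^sup>m \<times> H\<^sup>m\<^sup>+\<^sup>1 \<times> \<real>)\<close>. Since the equations involve \<open>1/h\<close>, positivity of
  \<open>inf h\<close> at each time is part of the notion of solution.
\<close>

definition is_solution ::
  "real \<Rightarrow> real \<Rightarrow> real \<Rightarrow> real \<Rightarrow> real \<Rightarrow> real \<Rightarrow> real \<Rightarrow> nat \<Rightarrow>
   (real \<Rightarrow> real) \<Rightarrow> (real \<Rightarrow> real) \<Rightarrow> real \<Rightarrow>
   real \<Rightarrow> (real \<Rightarrow> real \<Rightarrow> real) \<Rightarrow> (real \<Rightarrow> real \<Rightarrow> real) \<Rightarrow> (real \<Rightarrow> real) \<Rightarrow> bool" where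
  "is_solution r l hw P0 \<kappa> \<epsilon> \<mu> m \<zeta>in qin qiin T \<zeta> q qi \<longleftrightarrow>
    (\<exists>\<zeta>t qt qit.
      C1_Sobolev (domE r l) m {0..<T} \<zeta> \<zeta>t \<and>
      C1_Sobolev (domE r l) (m + 1) {0..<T} q qt \<and>
      (\<forall>t\<in>{0..<T}. (qi has_real_derivative qit t) (at t within {0..<T})) \<and>
      continuous_on {0..<T} qit \<and>
      (AE x in lebesgue. x \<in> domE r l \<longrightarrow> \<zeta> 0 x = \<zeta>in x \<and> q 0 x = qin x) \<and>
      qi 0 = qiin \<and>
      (\<forall>t\<in>{0..<T}. let h = height \<epsilon> (\<zeta> t) in
        ess_inf_pos (domE r l) h \<and>
        (AE x in lebesgue. x \<in> domE r l \<longrightarrow> \<zeta>t t x + weak_deriv (domE r l) 1 (q t) x = 0) \<and>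
        (AE x in lebesgue. x \<in> domE r l \<longrightarrow>
           (qt t x - \<mu>\<^sup>2 * weak_deriv (domE r l) 2 (qt t) x)
           + \<epsilon> * weak_deriv (domE r l) 1 (\<lambda>y. (q t y)\<^sup>2 / h y) x
           + h x * weak_deriv (domE r l) 1 (\<zeta> t) x = 0) \<and>
        ess_tendsto (\<zeta> t) 0 at_bot \<and> ess_tendsto (q t) 0 at_bot \<and>
        ess_tendsto (q t) 0 (at_left l) \<and>
        jump r (q t) = 0 \<and> mean r (q t) = qi t \<and>
        (2 * r / hw + T_coeff r l \<mu> h) * qit t
          - \<epsilon> / 2 * jump r (\<lambda>x. 1 / (h x)\<^sup>2) * (qi t)\<^sup>2
        = - jump r (calF r l \<epsilon> \<mu> (\<zeta> t) (q t))
          - P0 * (average r l (\<zeta> t) - \<kappa> * duhamel \<kappa> (\<lambda>s. average r l (\<zeta> s)) t)))"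

definition is_unique_solution ::
  "real \<Rightarrow> real \<Rightarrow> real \<Rightarrow> real \<Rightarrow> real \<Rightarrow> real \<Rightarrow> real \<Rightarrow> nat \<Rightarrow>
   (real \<Rightarrow> real) \<Rightarrow> (real \<Rightarrow> real) \<Rightarrow> real \<Rightarrow>
   real \<Rightarrow> (real \<Rightarrow> real \<Rightarrow> real) \<Rightarrow> (real \<Rightarrow> real \<Rightarrow> real) \<Rightarrow> (real \<Rightarrow> real) \<Rightarrow> bool" where
  "is_unique_solution r l hw P0 \<kappa> \<epsilon> \<mu> m \<zeta>in qin qiin T \<zeta> q qi \<longleftrightarrow>
     is_solution r l hw P0 \<kappa> \<epsilon> \<mu> m \<zeta>in qin qiin T \<zeta> q qi \<and>
     (\<forall>\<zeta>2 q2 qi2. is_solution r l hw P0 \<kappa> \<epsilon> \<mu> m \<zeta>in qin qiin T \<zeta>2 q2 qi2 \<longrightarrow>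
        (\<forall>t\<in>{0..<T}. (AE x in lebesgue. x \<in> domE r l \<longrightarrow> \<zeta>2 t x = \<zeta> t x \<and> q2 t x = q t x) \<and>
           qi2 t = qi t))"

definition max_existence_time ::
  "real \<Rightarrow> real \<Rightarrow> real \<Rightarrow> real \<Rightarrow> real \<Rightarrow> real \<Rightarrow> real \<Rightarrow> nat \<Rightarrow>
   (real \<Rightarrow> real) \<Rightarrow> (real \<Rightarrow> real) \<Rightarrow> real \<Rightarrow> ereal" where
  "max_existence_time r l hw P0 \<kappa> \<epsilon> \<mu> m \<zeta>in qin qiin =
     Sup {ereal T |T. 0 < T \<and> (\<exists>\<zeta> q qi. is_solution r l hw P0 \<kappa> \<epsilon> \<mu> m \<zeta>in qin qiin T \<zeta> q qi)}"

end

theory Submission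
  imports Defs
begin

text \<open>
  Applying the inverse of \<open>I - \<mu>\<^sup>2 \<partial>\<^sub>x\<^sup>2\<close> to the momentum equation turns the problem into an ordinary
  differential equation in \<open>H\<^sup>m \<times> H\<^sup>m\<^sup>+\<^sup>1 \<times> \<real> \<times> \<real>\<close>, the last component being the memory term. Indeed, the
  nonlinear terms of the momentum equation form the gradient of \<open>\<phi>\<close>, and if \<open>u = R\<^sub>1 \<phi>\<close>, then \<open>- \<partial>\<^sub>x u\<close> solves this
  equation for \<open>\<partial>\<^sub>t q\<close> with zero traces; the transmission condition determines the multiple of the
  homogeneous solution to be added, because the coefficient of \<open>dq\<^sub>i/dt\<close> is bounded below by \<open>\<alpha>\<close>. The vector
  field is locally Lipschitz as \<open>H\<^sup>m\<close> is an algebra for \<open>m \<ge> 1\<close>, and existence and uniqueness follow by the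
  contraction principle. Its \<open>H\<^sup>k\<close> norms grow at most linearly in the top order norm of the unknowns once lower order
  norms are controlled; so Gronwall's inequality, used for \<open>k = 0, \<dots>, m\<close> in turn, converts an \<open>L\<^sup>\<infinity>\<close> bound
  into a bound in \<open>H\<^sup>m\<close>, which gives the blow-up criterion.
\<close>

section \<open>Smooth bump functions\<close>

text \<open>No derivative is lost: \<open>h\<close> times the derivative of zeta is the derivative
  of zeta + \<epsilon> zeta^2 / 2, so the whole momentum nonlinearity is the derivative of phi; the
  derivative of R_1 phi lies one order above phi, hence dq/dt is in H^(m+1) when phi is in H^m,
  while dzeta/dt = - dq/dx takes H^(m+1) to H^m. The obstacle is one of setting. Sobolev elements
  are raw functions with weak derivatives picked by choice, whereas a contraction argument wants a
  Banach type. A function is therefore replaced by its jet (f, f', ..., f^(m), 0, 0, ...) in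
  \<open>nat \<Rightarrow>\<^sub>C l2\<close>; \<open>emb\<close> and \<open>fn\<close> go back and
  forth, \<open>fn\<close> returning the representative that is absolutely continuous up to the
  boundary of each component. The conditions at -r, r and l become linear trace conditions cutting
  out a closed subspace, to which the vector field is tangent. Since \<open>E\<close> is unbounded,
  1/h is not square integrable; estimates use 1/h - 1. The blow-up alternative is driven by a size
  containing sup 1/h, not by the norm alone.\<close>

primrec Cn :: "nat \<Rightarrow> (real \<Rightarrow> real) \<Rightarrow> bool" where
  "Cn 0 f \<longleftrightarrow> (\<forall>x. f differentiable (at x))"
| "Cn (Suc n) f \<longleftrightarrow> (\<forall>x. f differentiable (at x)) \<and> Cn n (deriv f)"

lemma Cn_Suc_imp: "Cn (Suc n) f \<Longrightarrow> Cn n f"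
  by (induction n arbitrary: f) auto

text \<open>Peeling one derivative off the function, as \<open>Cn\<close> does, lets the closure
  rules be proved by induction; this equivalence returns to the iterated derivatives in
  \<open>test_function\<close>.\<close>

lemma Cn_deriv_funpow: "(\<forall>k x. (deriv ^^ k) f differentiable (at x)) \<longleftrightarrow> (\<forall>n. Cn n f)"
proof -
  have 1: "Cn n f \<longleftrightarrow> (\<forall>k\<le>n. \<forall>x. (deriv ^^ k) f differentiable (at x))" for n f
  proof (induction n arbitrary: f)
    case (Suc n)
    show ?case (is "?L \<longleftrightarrow> ?R")
    proof
      assume L: ?L
      show ?R
      proof (intro allI impI)
        fix k x assume "k \<le> Suc n"
        then show "(deriv ^^ k) f differentiable (at x)"
          using L Suc[of "deriv f"] by (cases k) (auto simp: funpow_Suc_right simp del: funpow.simps(2))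
      qed
    next
      assume R: ?R
      have "(deriv ^^ k) (deriv f) differentiable (at x)" if "k \<le> n" for k x
        using R[rule_format, of "Suc k" x] that by (simp add: funpow_Suc_right del: funpow.simps(2))
      then show ?L using R[rule_format, of 0] Suc[of "deriv f"] by auto
    qed
  qed auto
  show ?thesis unfolding 1 by blast
qed

lemma differentiable_imp_DERIV: "(f::real\<Rightarrow>real) differentiable (at x) \<Longrightarrow> (f has_real_derivative deriv f x) (at x)"
  using DERIV_deriv_iff_real_differentiable by blast

lemma Cn_SucI:
  assumes "\<And>x. (f has_real_derivative g x) (at x)" "Cn n g"
  shows "Cn (Suc n) f"
proof -
  have "deriv f = g" using assms(1) by (auto intro: DERIV_imp_deriv)
  then show ?thesis using assms by (auto simp: real_differentiable_def)
qed

lemma Cn_add: "Cn n f \<Longrightarrow> Cn n g \<Longrightarrow> Cn n (\<lambda>x. f x + g x)"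
proof (induction n arbitrary: f g)
  case (Suc n)
  show ?case
    by (rule Cn_SucI[where g="\<lambda>x. deriv f x + deriv g x"])
      (use Suc in \<open>auto intro!: DERIV_add differentiable_imp_DERIV\<close>)
qed auto

lemma Cn_mult: "Cn n f \<Longrightarrow> Cn n g \<Longrightarrow> Cn n (\<lambda>x. f x * g x)"
proof (induction n arbitrary: f g)
  case (Suc n)
  have "Cn n f" "Cn n g" using Suc.prems Cn_Suc_imp by blast+
  then show ?case
    by (intro Cn_SucI[where g="\<lambda>x. deriv f x * g x + deriv g x * f x"] Cn_add Suc.IH)
      (use Suc.prems in \<open>auto intro!: DERIV_mult differentiable_imp_DERIV\<close>)
qed auto

lemma Cn_const: "Cn n (\<lambda>x. c)"
proof (induction n arbitrary: c)
  case (Suc n)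
  show ?case by (rule Cn_SucI[where g="\<lambda>x. 0"]) (use Suc in auto)
qed auto

lemma Cn_affine: "Cn n f \<Longrightarrow> Cn n (\<lambda>x. f (a * x + b))"
proof (induction n arbitrary: f)
  case 0
  show ?case
  proof (simp, intro allI)
    fix x
    have "((\<lambda>x. f (a * x + b)) has_real_derivative deriv f (a * x + b) * a) (at x)"
      using 0 by (intro DERIV_chain2[where g="\<lambda>x. a * x + b"] differentiable_imp_DERIV) (auto intro!: derivative_eq_intros)
    then show "(\<lambda>x. f (a * x + b)) differentiable at x"
      by (auto simp: real_differentiable_def)
  qed
next
  case (Suc n)
  have d: "((\<lambda>x. f (a * x + b)) has_real_derivative deriv f (a * x + b) * a) (at x)" for x
    using Suc.prems
    by (intro DERIV_chain2[where g="\<lambda>x. a * x + b"] differentiable_imp_DERIV) (auto intro!: derivative_eq_intros)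
  show ?case
    by (rule Cn_SucI[OF d]) (use Suc in \<open>auto intro!: Cn_mult Cn_const\<close>)
qed

lemma Cn_cmult: "Cn n f \<Longrightarrow> Cn n (\<lambda>x. c * f x)"
  by (intro Cn_mult Cn_const)

lemma DERIV_eventually:
  "(f has_real_derivative D) (at x) \<Longrightarrow> \<forall>\<^sub>F y in nhds x. f y = g y \<Longrightarrow> (g has_real_derivative D) (at x)"
  using DERIV_cong_ev[OF refl _ refl, where f=f and g=g] by iprover

text \<open>The family exp(-1/x) / x^n, extended by 0, is closed under differentiation up to linear
  combinations; smoothness of every member then follows by one induction over the order of
  differentiability.\<close>

definition flat :: "nat \<Rightarrow> real \<Rightarrow> real" where
  "flat n x = (if x > 0 then exp (- (1 / x)) / x ^ n else 0)"

lemma flat_DERIV: "(flat n has_real_derivative (flat (n + 2) x - real n * flat (n + 1) x)) (at x)"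
proof -
  consider "x > 0" | "x < 0" | "x = 0" by linarith
  then show ?thesis
  proof cases
    case 1
    have "((\<lambda>x. exp (- (1 / x)) / x ^ n) has_real_derivative (flat (n + 2) x - real n * flat (n + 1) x)) (at x)"
    proof -
      have a: "((\<lambda>x. - (1 / x)) has_real_derivative 1 / (x * x)) (at x)"
        using 1 by (auto intro!: derivative_eq_intros)
      have b: "((\<lambda>x. x ^ n) has_real_derivative real n * x ^ (n - 1)) (at x)"
        by (auto intro!: derivative_eq_intros)
      have "(exp (- (1 / x)) * (1 / (x * x)) * x ^ n - exp (- (1 / x)) * (real n * x ^ (n - 1))) / (x ^ n * x ^ n)
        = flat (n + 2) x - real n * flat (n + 1) x"
      proof -
        have "(e * (1 / (x * x)) * x ^ n - e * (real n * x ^ (n - 1))) / (x ^ n * x ^ n)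
          = e / x ^ (n + 2) - real n * (e / x ^ (n + 1))" for e
        proof -
          have n: "real n * x ^ (n - 1) = real n * (x ^ n / x)"
            using 1 by (cases n) simp_all
          have "(e * (1 / (x * x)) * X - e * (real n * (X / x))) / (X * X) = e / (X * x\<^sup>2) - real n * (e / (X * x))"
            if "X \<noteq> 0" for X
            using 1 that by (simp add: power2_eq_square diff_divide_distrib ac_simps)
          from this[of "x ^ n"] show ?thesis unfolding n power_add using 1 by auto
        qed
        from this[of "exp (- (1 / x))"] show ?thesis using 1 unfolding flat_def by auto
      qed
      then show ?thesis
        using DERIV_cong[OF DERIV_divide[OF DERIV_fun_exp[OF a] b]] 1 by auto
    qed
    moreover have "\<forall>\<^sub>F y in nhds x. exp (- (1 / y)) / y ^ n = flat n y"
      using eventually_nhds_in_open[of "{0<..}" x] 1 by (auto elim!: eventually_mono simp: flat_def)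
    ultimately show ?thesis by (rule DERIV_eventually)
  next
    case 2
    have "\<forall>\<^sub>F y in nhds x. 0 = flat n y"
      using eventually_nhds_in_open[of "{..<0}" x] 2 by (auto elim!: eventually_mono simp: flat_def)
    moreover have "((\<lambda>x. 0) has_real_derivative (flat (n + 2) x - real n * flat (n + 1) x)) (at x)"
      using 2 by (simp add: flat_def)
    ultimately show ?thesis by (rule DERIV_eventually[rotated])
  next
    case 3
    have R: "((\<lambda>y. flat n y / y) \<longlongrightarrow> 0) (at_right 0)"
    proof -
      \<comment> \<open>The substitution y -> 1/y turns the difference quotient at 0 from the right
        into a power divided by exp at infinity.\<close>
      have "((\<lambda>y. y ^ (n + 1) / exp y) \<longlongrightarrow> (0::real)) at_top" by (rule tendsto_power_div_exp_0)
      then have "((\<lambda>y::real. inverse y ^ (n + 1) / exp (inverse y)) \<longlongrightarrow> 0) (at_right 0)"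
        by (rule filterlim_compose[OF _ filterlim_inverse_at_top_right])
      moreover have "\<forall>\<^sub>F y::real in at_right 0. inverse y ^ (n + 1) / exp (inverse y) = flat n y / y"
        by (auto simp: eventually_at_right_field flat_def exp_minus field_simps intro!: exI[of _ 1])
      ultimately show ?thesis by (rule Lim_transform_eventually)
    qed
    have L: "((\<lambda>y. flat n y / y) \<longlongrightarrow> 0) (at_left 0)"
    proof -
      have "\<forall>\<^sub>F y::real in at_left 0. 0 = flat n y / y"
        by (auto simp: eventually_at_left_field flat_def intro!: exI[of _ "-1"])
      then show ?thesis by (rule Lim_transform_eventually[rotated]) simp
    qed
    have "((\<lambda>y. flat n y / y) \<longlongrightarrow> 0) (at 0)" using L R by (simp add: filterlim_split_at)
    then show ?thesis using 3 by (simp add: has_field_derivative_iff flat_def)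
  qed
qed

lemma Cn_flat: "Cn k (flat n)"
proof (induction k arbitrary: n)
  case 0
  show ?case using flat_DERIV real_differentiable_def by (auto simp: real_differentiable_def)
next
  case (Suc k)
  have "Cn k (\<lambda>x. flat (n + 2) x + (- real n) * flat (n + 1) x)"
    by (intro Cn_add Cn_cmult Suc)
  then show ?case by (intro Cn_SucI[OF flat_DERIV]) simp
qed

definition bump :: "real \<Rightarrow> real \<Rightarrow> real \<Rightarrow> real" where
  "bump a b x = flat 0 (1 * x + (- a)) * flat 0 ((-1) * x + b)"

lemma Cn_bump: "Cn k (bump a b)"
  unfolding bump_def by (intro Cn_mult Cn_affine Cn_flat)

lemma bump_pos: "a < x \<Longrightarrow> x < b \<Longrightarrow> bump a b x > 0"
  and bump_zero: "x \<le> a \<or> b \<le> x \<Longrightarrow> bump a b x = 0"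
  and bump_nonneg: "bump a b x \<ge> 0"
  by (auto simp: bump_def flat_def)

lemma continuous_bump: "continuous_on A (bump a b)"
  using Cn_bump[of 0 a b] by (auto intro!: continuous_at_imp_continuous_on differentiable_imp_continuous_within)

lemma integral_bump_pos: "a < b \<Longrightarrow> integral {a..b} (bump a b) > 0"
proof -
  assume ab: "a < b"
  have "integral {a..b} (bump a b) \<ge> 0" by (intro integral_nonneg integrable_continuous_interval continuous_bump bump_nonneg)
  moreover have "integral {a..b} (bump a b) \<noteq> 0"
  proof
    assume "integral {a..b} (bump a b) = 0"
    then have "\<forall>x\<in>cbox a b. bump a b x = 0"
      using integral_eq_0_iff[of a b "bump a b"] ab by (simp add: continuous_bump bump_nonneg)
    then show False using bump_pos[of a "(a+b)/2" b] ab by force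
  qed
  ultimately show ?thesis by simp
qed

text \<open>A smooth cutoff rising from 0 at x = 0 to 1 at x = 1: the normalised primitive of a
  bump.\<close>

definition step :: "real \<Rightarrow> real" where
  "step x = integral {0..max 0 x} (bump 0 1) / integral {0..1} (bump 0 1)"

text \<open>Since \<open>g\<close> vanishes to the left of \<open>a\<close>, the base point
  \<open>a\<close> may be moved further left without changing the primitive; the derivative formula
  then holds on the whole line, \<open>a\<close> included.\<close>

lemma integral_DERIV_ext:
  assumes "continuous_on UNIV (g::real\<Rightarrow>real)" and z: "\<And>x. x \<le> a \<Longrightarrow> g x = 0"
  shows "((\<lambda>x. integral {a..max a x} g) has_real_derivative g x) (at x)"
proof -
  \<comment> \<open>The new base point lies strictly to the left of both \<open>a\<close> and
    \<open>x\<close>, so that \<open>x\<close> is interior to the interval of integration.\<close>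
  have e: "integral {a..max a y} g = integral {min a x - 1..y} g" if "y > min a x - 1" for y
  proof (cases "y \<ge> a")
    case True
    have "integral {min a x - 1..a} g + integral {a..y} g = integral {min a x - 1..y} g"
      using True by (intro Henstock_Kurzweil_Integration.integral_combine integrable_continuous_interval continuous_on_subset[OF assms(1)]) auto
    moreover have "integral {min a x - 1..a} g = integral {min a x - 1..a} (\<lambda>_. 0)"
      by (intro Henstock_Kurzweil_Integration.integral_cong) (use z in auto)
    ultimately show ?thesis using True by (simp add: max_def)
  next
    case False
    have "integral {min a x - 1..y} g = integral {min a x - 1..y} (\<lambda>_. 0)"
      by (intro Henstock_Kurzweil_Integration.integral_cong) (use z False in auto)
    then show ?thesis using False by (simp add: max_def)
  qed
  have "((\<lambda>y. integral {min a x - 1..y} g) has_real_derivative g x) (at x within {min a x - 1..x+1})"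
    by (intro integral_has_real_derivative continuous_on_subset[OF assms(1)]) auto
  then have "((\<lambda>y. integral {min a x - 1..y} g) has_real_derivative g x) (at x)"
    by (simp add: at_within_Icc_at)
  moreover have "\<forall>\<^sub>F y in nhds x. integral {min a x - 1..y} g = integral {a..max a y} g"
    using eventually_nhds_in_open[of "{min a x - 1<..}" x] by (rule eventually_mono[rotated 2]) (auto simp: e)
  ultimately show ?thesis by (rule DERIV_eventually)
qed

lemma Cn_integral_ext:
  assumes "\<And>n. Cn n g" and z: "\<And>x. x \<le> a \<Longrightarrow> g x = 0"
  shows "Cn n (\<lambda>x. integral {a..max a x} g)"
proof -
  have "continuous_on UNIV g"
    using assms(1)[of 0] by (auto intro!: continuous_at_imp_continuous_on differentiable_imp_continuous_within)
  then have "Cn (Suc n) (\<lambda>x. integral {a..max a x} g)"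
    by (intro Cn_SucI[OF integral_DERIV_ext] assms)
  then show ?thesis by (rule Cn_Suc_imp)
qed

lemma Cn_step: "Cn n step"
proof -
  have "Cn n (\<lambda>x. (1 / integral {0..1} (bump 0 1)) * integral {0..max 0 x} (bump 0 1))"
    by (intro Cn_cmult Cn_integral_ext Cn_bump bump_zero) auto
  then show ?thesis unfolding step_def[abs_def] by simp
qed

lemma step_0: "x \<le> 0 \<Longrightarrow> step x = 0"
  by (simp add: step_def max_def)

lemma integral_bump_ge: "x \<ge> b \<Longrightarrow> a \<le> b \<Longrightarrow> integral {a..x} (bump a b) = integral {a..b} (bump a b)"
proof -
  assume x: "x \<ge> b" "a \<le> b"
  have "integral {a..b} (bump a b) + integral {b..x} (bump a b) = integral {a..x} (bump a b)"
    using x by (intro Henstock_Kurzweil_Integration.integral_combine integrable_continuous_interval continuous_bump) auto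
  moreover have "integral {b..x} (bump a b) = integral {b..x} (\<lambda>_. 0)"
    by (intro Henstock_Kurzweil_Integration.integral_cong) (auto simp: bump_zero)
  ultimately show ?thesis by simp
qed

lemma step_1: "x \<ge> 1 \<Longrightarrow> step x = 1"
  using integral_bump_pos[of 0 1] integral_bump_ge[of 1 x 0] by (simp add: step_def max_def)

lemma step_bounds: "0 \<le> step x" "step x \<le> 1"
proof -
  have p: "integral {0..1} (bump 0 1) > 0" by (rule integral_bump_pos) simp
  show "0 \<le> step x" using p by (auto simp: step_def intro!: divide_nonneg_pos integral_nonneg integrable_continuous_interval continuous_bump bump_nonneg)
  show "step x \<le> 1"
  proof (cases "x \<le> 1")
    case True
    have "integral {0..max 0 x} (bump 0 1) \<le> integral {0..1} (bump 0 1)"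
      using True by (intro integral_subset_le integrable_continuous_interval continuous_bump) (auto simp: bump_nonneg)
    then show ?thesis using p by (simp add: step_def)
  qed (simp add: step_1)
qed

section \<open>Test functions: stability under differentiation, supports, boundedness\<close>

lemma test_functionI:
  assumes "\<And>n. Cn n \<phi>" "compact K" "K \<subseteq> E" "\<And>x. x \<notin> K \<Longrightarrow> \<phi> x = 0"
  shows "test_function E \<phi>"
  using assms Cn_deriv_funpow unfolding test_function_def by blast

lemma test_function_Cn: "test_function E \<phi> \<Longrightarrow> Cn n \<phi>"
  using Cn_deriv_funpow unfolding test_function_def by blast

lemma test_function_continuous: "test_function E \<phi> \<Longrightarrow> continuous_on A \<phi>"
  using test_function_Cn[of E \<phi> 0] by (auto intro!: continuous_at_imp_continuous_on differentiable_imp_continuous_within)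

lemma test_function_DERIV: "test_function E \<phi> \<Longrightarrow> (\<phi> has_real_derivative deriv \<phi> x) (at x)"
  using test_function_Cn[of E \<phi> 0] differentiable_imp_DERIV by auto

lemma test_function_supp: assumes "test_function E \<phi>"
  obtains K where "compact K" "K \<subseteq> E" "\<And>x. x \<notin> K \<Longrightarrow> \<phi> x = 0" "\<And>x. x \<notin> K \<Longrightarrow> deriv \<phi> x = 0"
proof -
  obtain K where K: "compact K" "K \<subseteq> E" "\<And>x. x \<notin> K \<Longrightarrow> \<phi> x = 0"
    using assms by (auto simp: test_function_def)
  have "deriv \<phi> x = 0" if "x \<notin> K" for x
  proof -
    have "\<forall>\<^sub>F y in nhds x. \<phi> y = 0"
      using eventually_nhds_in_open[of "- K" x] K that
      by (auto elim!: eventually_mono simp: compact_imp_closed open_Compl)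
    then have "deriv \<phi> x = deriv (\<lambda>_. 0) x" by (intro deriv_cong_ev) auto
    then show ?thesis by simp
  qed
  then show ?thesis using K that by blast
qed

lemma test_function_deriv: "test_function E \<phi> \<Longrightarrow> test_function E (deriv \<phi>)"
proof -
  assume t: "test_function E \<phi>"
  then obtain K where "compact K" "K \<subseteq> E" "\<And>x. x \<notin> K \<Longrightarrow> deriv \<phi> x = 0"
    using test_function_supp by metis
  then show ?thesis by (intro test_functionI) (use test_function_Cn[OF t, of "Suc _"] in auto)
qed

lemma test_function_mono: "test_function E \<phi> \<Longrightarrow> E \<subseteq> E' \<Longrightarrow> test_function E' \<phi>"
  unfolding test_function_def by blast

lemma test_function_bounded: assumes "test_function E \<phi>" shows "\<exists>B>0. \<forall>x. \<bar>\<phi> x\<bar> \<le> B"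
proof -
  obtain K where K: "compact K" "\<And>x. x \<notin> K \<Longrightarrow> \<phi> x = 0" using assms by (auto simp: test_function_def)
  have "bounded (\<phi> ` K)" by (intro compact_imp_bounded compact_continuous_image test_function_continuous[OF assms] K)
  then obtain B where "B > 0" "\<forall>x\<in>K. \<bar>\<phi> x\<bar> \<le> B" by (auto simp: bounded_pos)
  then show ?thesis using K by (intro exI[of _ B]) (metis abs_zero less_imp_le)
qed

section \<open>Absolutely continuous functions\<close>

text \<open>Absolute continuity is expressed by the fundamental theorem with the derivative carried
  as an explicit argument, which only matters up to null sets. As only compact subintervals of
  \<open>J\<close> enter, \<open>J\<close> may be disconnected; when \<open>J\<close> contains
  boundary points, the derivative is integrable up to them and \<open>f\<close> has its trace
  there.\<close>

definition AC :: "real set \<Rightarrow> (real \<Rightarrow> real) \<Rightarrow> (real \<Rightarrow> real) \<Rightarrow> bool" where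
  "AC J f g \<longleftrightarrow> (\<forall>a b. a \<le> b \<longrightarrow> {a..b} \<subseteq> J \<longrightarrow>
     g absolutely_integrable_on {a..b} \<and> (g has_integral (f b - f a)) {a..b})"

lemma ACD: assumes "AC J f g" "a \<le> b" "{a..b} \<subseteq> J"
  shows "g absolutely_integrable_on {a..b}" "(g has_integral (f b - f a)) {a..b}"
    "integral {a..b} g = f b - f a" "g integrable_on {a..b}"
  using assms by (auto simp: AC_def integral_unique)

lemma AC_mono: "AC J f g \<Longrightarrow> K \<subseteq> J \<Longrightarrow> AC K f g"
  unfolding AC_def by blast

lemma AC_continuous: assumes "AC J f g" "{a..b} \<subseteq> J" shows "continuous_on {a..b} f"
proof (cases "a \<le> b")
  case True
  have "continuous_on {a..b} (\<lambda>x. f a + integral {a..x} g)"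
    by (intro continuous_intros indefinite_integral_continuous_1 ACD(4)[OF assms(1) True assms(2)])
  moreover have "f a + integral {a..x} g = f x" if "x \<in> {a..b}" for x
    using ACD(3)[OF assms(1), of a x] that assms(2) by force
  ultimately show ?thesis by (rule continuous_on_eq)
qed simp

lemma AC_add: "AC J f1 g1 \<Longrightarrow> AC J f2 g2 \<Longrightarrow> AC J (\<lambda>x. f1 x + f2 x) (\<lambda>x. g1 x + g2 x)"
  unfolding AC_def
proof (intro allI impI, elim allE impE conjE; (assumption)?)
  fix a b assume "a \<le> b" "{a..b} \<subseteq> J"
    "g1 absolutely_integrable_on {a..b}" "g2 absolutely_integrable_on {a..b}"
    "(g1 has_integral f1 b - f1 a) {a..b}" "(g2 has_integral f2 b - f2 a) {a..b}"
  then show "(\<lambda>x. g1 x + g2 x) absolutely_integrable_on {a..b} \<and>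
       ((\<lambda>x. g1 x + g2 x) has_integral f1 b + f2 b - (f1 a + f2 a)) {a..b}"
    using has_integral_add[of g1 "f1 b - f1 a" "{a..b}" g2 "f2 b - f2 a"]
    by (auto intro!: set_integral_add simp: algebra_simps)
qed

lemma AC_cmult: "AC J f g \<Longrightarrow> AC J (\<lambda>x. c * f x) (\<lambda>x. c * g x)"
  unfolding AC_def
  by (auto simp: right_diff_distrib[symmetric] intro!: has_integral_mult_right)

lemma AC_diff: "AC J f1 g1 \<Longrightarrow> AC J f2 g2 \<Longrightarrow> AC J (\<lambda>x. f1 x - f2 x) (\<lambda>x. g1 x - g2 x)"
  using AC_add[of J f1 g1 "\<lambda>x. (-1) * f2 x" "\<lambda>x. (-1) * g2 x"] AC_cmult[of J f2 g2 "-1"] by simp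

lemma AC_const: "AC J (\<lambda>x. c) (\<lambda>x. 0)"
  unfolding AC_def by (auto intro: has_integral_0)

lemma AC_cong: assumes "AC J f g" "\<And>x. x \<in> J \<Longrightarrow> f x = f' x" "\<And>x. x \<in> J \<Longrightarrow> g x = g' x"
  shows "AC J f' g'"
  unfolding AC_def
proof (intro allI impI)
  fix a b :: real assume ab: "a \<le> b" "{a..b} \<subseteq> J"
  have e: "f a = f' a" "f b = f' b" using assms(2) ab by auto
  have "g' absolutely_integrable_on {a..b}"
    using absolutely_integrable_spike[OF ACD(1)[OF assms(1) ab] negligible_empty, of g'] assms(3) ab(2) by (metis DiffD1 subsetD)
  moreover have "(g' has_integral (f b - f a)) {a..b}"
    by (rule has_integral_eq[OF _ ACD(2)[OF assms(1) ab]]) (use assms(3) ab(2) in blast)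
  ultimately show "g' absolutely_integrable_on {a..b} \<and> (g' has_integral (f' b - f' a)) {a..b}"
    using e by simp
qed

lemma AC_AE_cong: assumes "AC J f g" "AE x in lebesgue. x \<in> J \<longrightarrow> g x = g' x" "J \<in> sets lebesgue"
  shows "AC J f g'"
  unfolding AC_def
proof (intro allI impI)
  fix a b :: real assume ab: "a \<le> b" "{a..b} \<subseteq> J"
  obtain N where N: "N \<in> null_sets lebesgue" "{x. \<not> (x \<in> J \<longrightarrow> g x = g' x)} \<subseteq> N"
    using assms(2) by (auto simp: eventually_ae_filter)
  then have neg: "negligible N" by (simp add: negligible_iff_null_sets)
  have sp: "g x = g' x" if "x \<in> {a..b} - N" for x using N(2) that ab(2) by blast
  have "g' absolutely_integrable_on {a..b}"
    by (rule absolutely_integrable_spike[OF ACD(1)[OF assms(1) ab] neg]) (use sp in auto)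
  moreover have "(g' has_integral (f b - f a)) {a..b}"
    by (rule has_integral_spike[OF neg _ ACD(2)[OF assms(1) ab]]) (use sp in auto)
  ultimately show "g' absolutely_integrable_on {a..b} \<and> (g' has_integral (f b - f a)) {a..b}" by simp
qed

lemma AC_C1: assumes "\<And>x. x \<in> J \<Longrightarrow> (f has_real_derivative g x) (at x)" "continuous_on J g"
  shows "AC J f g"
  unfolding AC_def
proof (intro allI impI)
  fix a b :: real assume ab: "a \<le> b" "{a..b} \<subseteq> J"
  have "g absolutely_integrable_on {a..b}"
    by (intro absolutely_integrable_continuous_real continuous_on_subset[OF assms(2) ab(2)])
  moreover have "(g has_integral (f b - f a)) {a..b}"
  proof (rule fundamental_theorem_of_calculus[OF ab(1)])
    fix x assume "x \<in> {a..b}"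
    then show "(f has_vector_derivative g x) (at x within {a..b})"
      using assms(1)[of x] ab(2) has_field_derivative_at_within has_real_derivative_iff_has_vector_derivative by blast
  qed
  ultimately show "g absolutely_integrable_on {a..b} \<and> (g has_integral (f b - f a)) {a..b}" by simp
qed

text \<open>On a fine equidistant partition the bounds for the increments of \<open>H\<close>
  telescope to \<open>e\<close> times the total increment of \<open>\<Gamma>\<close>, and
  \<open>e\<close> is arbitrary.\<close>

lemma small_increments_const:
  fixes H \<Gamma> :: "real \<Rightarrow> real"
  assumes "a \<le> b"
    and small: "\<And>e. e > 0 \<Longrightarrow> \<exists>d>0. \<forall>x y. a \<le> x \<longrightarrow> x \<le> y \<longrightarrow> y \<le> b \<longrightarrow> y - x < d \<longrightarrow> \<bar>H y - H x\<bar> \<le> e * (\<Gamma> y - \<Gamma> x)"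
  shows "H b = H a"
proof -
  have main: "\<bar>H b - H a\<bar> \<le> e * (\<Gamma> b - \<Gamma> a)" if "e > 0" for e
  proof -
    obtain d where d: "d > 0" "\<And>x y. a \<le> x \<Longrightarrow> x \<le> y \<Longrightarrow> y \<le> b \<Longrightarrow> y - x < d \<Longrightarrow> \<bar>H y - H x\<bar> \<le> e * (\<Gamma> y - \<Gamma> x)"
      using small[OF \<open>e > 0\<close>] by blast
    obtain N :: nat where N: "(b - a) / d < real N" using reals_Archimedean2 by blast
    have N0: "real N > 0" using N d(1) assms(1) by (meson divide_nonneg_pos diff_ge_0_iff_ge le_less_trans)
    define h where "h = (b - a) / real N"
    have h: "0 \<le> h" "h < d" using N N0 d(1) assms(1) by (auto simp: h_def field_simps)
    have "\<bar>H (a + real n * h) - H a\<bar> \<le> e * (\<Gamma> (a + real n * h) - \<Gamma> a)" if "n \<le> N" for n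
      using that
    proof (induction n)
      case (Suc n)
      have "real (Suc n) * h \<le> real N * h" using Suc.prems h by (intro mult_right_mono) auto
      then have le: "a + real (Suc n) * h \<le> b" using N0 by (simp add: h_def)
      have eqn: "a + real (Suc n) * h = a + real n * h + h" by (simp add: algebra_simps)
      have "\<bar>H (a + real (Suc n) * h) - H (a + real n * h)\<bar> \<le> e * (\<Gamma> (a + real (Suc n) * h) - \<Gamma> (a + real n * h))"
        using le h unfolding eqn by (intro d(2)) auto
      then show ?case using Suc by (simp add: right_diff_distrib)
    qed simp
    from this[of N] show ?thesis using N0 by (simp add: h_def)
  qed
  have "\<bar>H b - H a\<bar> \<le> 0"
  proof (rule field_le_epsilon)
    fix e :: real assume e: "e > 0"
    show "\<bar>H b - H a\<bar> \<le> 0 + e"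
    proof (cases "\<Gamma> b - \<Gamma> a > 0")
      case True
      then show ?thesis using main[of "e / (\<Gamma> b - \<Gamma> a)"] e by simp
    next
      case False
      then show ?thesis using main[of 1] e by simp
    qed
  qed
  then show ?thesis by simp
qed

lemma absolutely_integrable_mult_continuous:
  assumes "(g::real\<Rightarrow>real) absolutely_integrable_on {a..b}" "continuous_on {a..b} f"
  shows "(\<lambda>x. g x * f x) absolutely_integrable_on {a..b}"
proof -
  have "bounded (f ` {a..b})" by (intro compact_imp_bounded compact_continuous_image assms) auto
  moreover have "f \<in> borel_measurable (lebesgue_on {a..b})"
    by (intro continuous_imp_measurable_on_sets_lebesgue assms) auto
  ultimately show ?thesis
    using absolutely_integrable_bounded_measurable_product_real[of f "{a..b}" g] assms(1) by (simp add: mult.commute)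
qed

text \<open>The source of the product and reciprocal rules. On a short interval the candidate
  derivative \<open>g\<close> is compared with a simpler \<open>p\<close> whose integral is exactly
  the increment of \<open>F\<close>; uniform continuity makes the error a small multiple of a fixed
  integrable \<open>k\<close>, and \<open>small_increments_const\<close> sums the errors.\<close>

lemma has_integral_by_increments:
  fixes F g k :: "real \<Rightarrow> real"
  assumes ab: "a \<le> b" and g: "g absolutely_integrable_on {a..b}" and k: "k absolutely_integrable_on {a..b}"
    and incr: "\<And>e. e > 0 \<Longrightarrow> \<exists>d>0. \<forall>x y. a \<le> x \<longrightarrow> x \<le> y \<longrightarrow> y \<le> b \<longrightarrow> y - x < d \<longrightarrow>
      (\<exists>p. (p has_integral F y - F x) {x..y} \<and> (\<forall>s\<in>{x..y}. \<bar>g s - p s\<bar> \<le> e * k s))"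
  shows "(g has_integral F b - F a) {a..b}"
proof -
  have I: "integral {a..y} h - integral {a..x} h = integral {x..y} h" "h integrable_on {x..y}"
    if "h absolutely_integrable_on {a..b}" "a \<le> x" "x \<le> y" "y \<le> b" for h :: "real \<Rightarrow> real" and x y
  proof -
    have "h integrable_on {a..b}" using that by (simp add: absolutely_integrable_on_def)
    then have "h integrable_on {a..y}" "h integrable_on {x..y}" by (rule integrable_on_subinterval, use that in auto)+
    then show "integral {a..y} h - integral {a..x} h = integral {x..y} h" "h integrable_on {x..y}"
      using Henstock_Kurzweil_Integration.integral_combine[of a x y h] that by simp_all
  qed
  define H where "H x = integral {a..x} g - F x" for x
  have "H b = H a"
  proof (rule small_increments_const[OF ab, of _ "\<lambda>x. integral {a..x} k"])
    fix e :: real assume "e > 0"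
    then obtain d where d: "d > 0" "\<And>x y. a \<le> x \<Longrightarrow> x \<le> y \<Longrightarrow> y \<le> b \<Longrightarrow> y - x < d \<Longrightarrow>
      \<exists>p. (p has_integral F y - F x) {x..y} \<and> (\<forall>s\<in>{x..y}. \<bar>g s - p s\<bar> \<le> e * k s)" using incr by blast
    show "\<exists>d>0. \<forall>x y. a \<le> x \<longrightarrow> x \<le> y \<longrightarrow> y \<le> b \<longrightarrow> y - x < d \<longrightarrow> \<bar>H y - H x\<bar> \<le> e * (integral {a..y} k - integral {a..x} k)"
    proof (intro exI[of _ d] conjI allI impI d(1))
      fix x y assume xy: "a \<le> x" "x \<le> y" "y \<le> b" "y - x < d"
      obtain p where p: "(p has_integral F y - F x) {x..y}" "\<And>s. s \<in> {x..y} \<Longrightarrow> \<bar>g s - p s\<bar> \<le> e * k s" using d(2)[OF xy] by blast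
      note Ig = I[OF g xy(1-3)] and Ik = I[OF k xy(1-3)]
      have i: "(\<lambda>s. g s - p s) integrable_on {x..y}" using Ig(2) p(1) by (intro integrable_diff) auto
      have "H y - H x = integral {x..y} (\<lambda>s. g s - p s)"
        using Ig p(1) by (subst Henstock_Kurzweil_Integration.integral_diff) (auto simp: H_def integral_unique)
      also have "\<bar>\<dots>\<bar> \<le> integral {x..y} (\<lambda>s. e * k s)"
        using integral_norm_bound_integral[OF i integrable_on_mult_right[OF Ik(2), of e]] p(2) by simp
      also have "\<dots> = e * (integral {a..y} k - integral {a..x} k)" using Ik(1) by simp
      finally show "\<bar>H y - H x\<bar> \<le> e * (integral {a..y} k - integral {a..x} k)" .
    qed
  qed
  then have "integral {a..b} g = F b - F a" by (simp add: H_def)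
  then show ?thesis using g by (metis absolutely_integrable_on_def integrable_integral)
qed

lemma AC_mult: assumes "AC J f1 g1" "AC J f2 g2"
  shows "AC J (\<lambda>x. f1 x * f2 x) (\<lambda>x. g1 x * f2 x + f1 x * g2 x)"
  unfolding AC_def
proof (intro allI impI conjI)
  fix a b :: real assume ab: "a \<le> b" "{a..b} \<subseteq> J"
  note c1 = AC_continuous[OF assms(1) ab(2)] and c2 = AC_continuous[OF assms(2) ab(2)]
  let ?g = "\<lambda>x. g1 x * f2 x + f1 x * g2 x"
  have "(\<lambda>x. g1 x * f2 x + g2 x * f1 x) absolutely_integrable_on {a..b}"
    by (intro set_integral_add absolutely_integrable_mult_continuous ACD(1)[OF assms(1) ab] ACD(1)[OF assms(2) ab] c1 c2)
  then show ai: "?g absolutely_integrable_on {a..b}" by (simp add: mult.commute)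
  have "(\<lambda>x. \<bar>g1 x\<bar> + \<bar>g2 x\<bar>) absolutely_integrable_on {a..b}"
    by (intro set_integral_add set_integrable_abs ACD(1)[OF assms(1) ab] ACD(1)[OF assms(2) ab])
  then show "(?g has_integral f1 b * f2 b - f1 a * f2 a) {a..b}"
  proof (rule has_integral_by_increments[OF ab(1) ai])
    fix e :: real assume e: "e > 0"
    obtain d1 where d1: "d1 > 0" "\<And>x y. x \<in> {a..b} \<Longrightarrow> y \<in> {a..b} \<Longrightarrow> dist y x < d1 \<Longrightarrow> dist (f1 y) (f1 x) < e"
      using compact_uniformly_continuous[OF c1] e by (force simp: uniformly_continuous_on_def)
    obtain d2 where d2: "d2 > 0" "\<And>x y. x \<in> {a..b} \<Longrightarrow> y \<in> {a..b} \<Longrightarrow> dist y x < d2 \<Longrightarrow> dist (f2 y) (f2 x) < e"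
      using compact_uniformly_continuous[OF c2] e by (force simp: uniformly_continuous_on_def)
    have "\<exists>p. (p has_integral f1 y * f2 y - f1 x * f2 x) {x..y} \<and> (\<forall>s\<in>{x..y}. \<bar>?g s - p s\<bar> \<le> e * (\<bar>g1 s\<bar> + \<bar>g2 s\<bar>))"
      if xy: "a \<le> x" "x \<le> y" "y \<le> b" "y - x < min d1 d2" for x y
    \<comment> \<open>Freezing \<open>f2\<close> at the left end and \<open>f1\<close> at the right
      end makes the integral of the comparison function equal to the increment of the product, with
      no remainder.\<close>
    proof (intro exI[of _ "\<lambda>s. g1 s * f2 x + f1 y * g2 s"] conjI ballI)
      have xyJ: "{x..y} \<subseteq> J" using xy ab(2) by auto
      have "((\<lambda>s. g1 s * f2 x + f1 y * g2 s) has_integral (f1 y - f1 x) * f2 x + f1 y * (f2 y - f2 x)) {x..y}"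
        by (intro has_integral_add has_integral_mult_left has_integral_mult_right ACD(2)[OF assms(1) xy(2) xyJ] ACD(2)[OF assms(2) xy(2) xyJ])
      then show "((\<lambda>s. g1 s * f2 x + f1 y * g2 s) has_integral f1 y * f2 y - f1 x * f2 x) {x..y}" by (simp add: algebra_simps)
      fix s assume s: "s \<in> {x..y}"
      have "\<bar>f2 s - f2 x\<bar> \<le> e" using d2(2)[of x s] s xy by (force simp: dist_real_def)
      moreover have "\<bar>f1 s - f1 y\<bar> \<le> e" using d1(2)[of y s] s xy by (force simp: dist_real_def)
      ultimately have "\<bar>g1 s\<bar> * \<bar>f2 s - f2 x\<bar> + \<bar>g2 s\<bar> * \<bar>f1 s - f1 y\<bar> \<le> \<bar>g1 s\<bar> * e + \<bar>g2 s\<bar> * e"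
        by (intro add_mono mult_left_mono) auto
      moreover have "?g s - (g1 s * f2 x + f1 y * g2 s) = g1 s * (f2 s - f2 x) + g2 s * (f1 s - f1 y)"
        by (simp add: algebra_simps)
      moreover have "\<bar>g1 s * (f2 s - f2 x) + g2 s * (f1 s - f1 y)\<bar> \<le> \<bar>g1 s\<bar> * \<bar>f2 s - f2 x\<bar> + \<bar>g2 s\<bar> * \<bar>f1 s - f1 y\<bar>"
        by (metis abs_mult abs_triangle_ineq)
      ultimately show "\<bar>?g s - (g1 s * f2 x + f1 y * g2 s)\<bar> \<le> e * (\<bar>g1 s\<bar> + \<bar>g2 s\<bar>)" by (simp add: algebra_simps)
    qed
    then show "\<exists>d>0. \<forall>x y. a \<le> x \<longrightarrow> x \<le> y \<longrightarrow> y \<le> b \<longrightarrow> y - x < d \<longrightarrow>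
      (\<exists>p. (p has_integral f1 y * f2 y - f1 x * f2 x) {x..y} \<and> (\<forall>s\<in>{x..y}. \<bar>?g s - p s\<bar> \<le> e * (\<bar>g1 s\<bar> + \<bar>g2 s\<bar>)))"
      using d1(1) d2(1) by (intro exI[of _ "min d1 d2"]) simp
  qed
qed

lemma AC_inverse: assumes "AC J f g" "\<And>x. x \<in> J \<Longrightarrow> \<delta> \<le> f x" "\<delta> > 0"
  shows "AC J (\<lambda>x. 1 / f x) (\<lambda>x. - g x * (1 / f x * (1 / f x)))"
  unfolding AC_def
proof (intro allI impI conjI)
  fix a b :: real assume ab: "a \<le> b" "{a..b} \<subseteq> J"
  define w where "w x = 1 / f x" for x
  have f0: "f x > 0" if "x \<in> {a..b}" for x using assms(2)[of x] assms(3) ab that by force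
  have cf: "continuous_on {a..b} f" by (rule AC_continuous[OF assms(1) ab(2)])
  have cw: "continuous_on {a..b} w" unfolding w_def using f0 by (intro continuous_intros cf) force
  have wb: "0 \<le> w x" "w x \<le> 1 / \<delta>" if "x \<in> {a..b}" for x
    using f0[OF that] assms(2)[of x] assms(3) ab that by (auto simp: w_def intro!: frac_le)
  have gi: "g absolutely_integrable_on {a..b}" by (rule ACD(1)[OF assms(1) ab])
  have "(\<lambda>x. g x * (- (w x * w x))) absolutely_integrable_on {a..b}"
    by (intro absolutely_integrable_mult_continuous gi continuous_intros cw)
  then show hi: "(\<lambda>x. - g x * (1 / f x * (1 / f x))) absolutely_integrable_on {a..b}" by (simp add: w_def)
  show "((\<lambda>x. - g x * (1 / f x * (1 / f x))) has_integral 1 / f b - 1 / f a) {a..b}"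
  proof (rule has_integral_by_increments[OF ab(1) hi set_integrable_abs[OF gi]])
    fix e :: real assume e: "e > 0"
    \<comment> \<open>Below, a difference of products of two values of \<open>w\<close> is split
      into two terms, each at most \<open>e'\<close> / \<open>\<delta>\<close>; together they give
      \<open>e\<close>.\<close>
    define e' where "e' = e * \<delta> / 2"
    have e': "e' > 0" using e assms(3) by (simp add: e'_def)
    obtain d where d: "d > 0" "\<And>x y. x \<in> {a..b} \<Longrightarrow> y \<in> {a..b} \<Longrightarrow> dist y x < d \<Longrightarrow> dist (w y) (w x) < e'"
      using compact_uniformly_continuous[OF cw] e' by (force simp: uniformly_continuous_on_def)
    have "\<exists>p. (p has_integral 1 / f y - 1 / f x) {x..y} \<and> (\<forall>s\<in>{x..y}. \<bar>- g s * (1 / f s * (1 / f s)) - p s\<bar> \<le> e * \<bar>g s\<bar>)"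
      if xy: "a \<le> x" "x \<le> y" "y \<le> b" "y - x < d" for x y
    \<comment> \<open>The two values of 1/f are frozen at opposite ends because 1/f(y) - 1/f(x)
      equals - w(x) w(y) (f(y) - f(x)) exactly.\<close>
    proof (intro exI[of _ "\<lambda>s. - (w x * w y) * g s"] conjI ballI)
      have xyJ: "{x..y} \<subseteq> J" using xy ab(2) by auto
      have "f x > 0" "f y > 0" using f0 xy by auto
      then have "1 / f y - 1 / f x = - (w x * w y) * (f y - f x)" by (simp add: w_def field_simps)
      then show "((\<lambda>s. - (w x * w y) * g s) has_integral 1 / f y - 1 / f x) {x..y}"
        using has_integral_mult_right[OF ACD(2)[OF assms(1) xy(2) xyJ], of "- (w x * w y)"] by simp
      fix s assume s: "s \<in> {x..y}"
      have m: "s \<in> {a..b}" "x \<in> {a..b}" "y \<in> {a..b}" using s xy by auto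
      have 1: "\<bar>w s - w x\<bar> \<le> e'" using d(2)[of x s] s xy m by (force simp: dist_real_def)
      have 2: "\<bar>w s - w y\<bar> \<le> e'" using d(2)[of y s] s xy m by (force simp: dist_real_def)
      have "w s * w s - w x * w y = w s * (w s - w y) + w y * (w s - w x)" by (simp add: algebra_simps)
      then have "\<bar>w s * w s - w x * w y\<bar> \<le> \<bar>w s\<bar> * \<bar>w s - w y\<bar> + \<bar>w y\<bar> * \<bar>w s - w x\<bar>"
        by (metis abs_mult abs_triangle_ineq)
      also have "\<dots> \<le> (1 / \<delta>) * e' + (1 / \<delta>) * e'"
        using wb m 1 2 assms(3) by (intro add_mono mult_mono) auto
      also have "\<dots> = e" using assms(3) by (simp add: e'_def)
      finally have "\<bar>g s\<bar> * \<bar>w s * w s - w x * w y\<bar> \<le> \<bar>g s\<bar> * e" by (intro mult_left_mono) auto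
      moreover have "- g s * (1 / f s * (1 / f s)) - - (w x * w y) * g s = - (g s * (w s * w s - w x * w y))" by (simp add: w_def algebra_simps)
      ultimately show "\<bar>- g s * (1 / f s * (1 / f s)) - - (w x * w y) * g s\<bar> \<le> e * \<bar>g s\<bar>" by (simp add: abs_mult mult.commute)
    qed
    then show "\<exists>d>0. \<forall>x y. a \<le> x \<longrightarrow> x \<le> y \<longrightarrow> y \<le> b \<longrightarrow> y - x < d \<longrightarrow>
      (\<exists>p. (p has_integral 1 / f y - 1 / f x) {x..y} \<and> (\<forall>s\<in>{x..y}. \<bar>- g s * (1 / f s * (1 / f s)) - p s\<bar> \<le> e * \<bar>g s\<bar>))"
      using d(1) by (intro exI[of _ d]) simp
  qed
qed

section \<open>The fundamental lemma of the calculus of variations\<close>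

lemma borel_imp_lebesgue_measurable: "f \<in> borel_measurable borel \<Longrightarrow> f \<in> borel_measurable lebesgue"
  by (simp add: measurable_completion)

text \<open>The positive and negative parts of \<open>f\<close> (the coercion \<open>ennreal\<close>
  cuts off negative values) define measures that are finite and equal on half-lines, hence equal;
  uniqueness of densities makes the two parts agree, and they are never positive
  simultaneously.\<close>

lemma AE_zero_of_halflines:
  assumes i: "integrable lborel (f::real\<Rightarrow>real)" and z: "\<And>x. (LINT y:{x<..}|lborel. f y) = 0"
  shows "AE y in lborel. f y = 0"
proof -
  have [measurable]: "f \<in> borel_measurable borel" using i by auto
  define M1 where "M1 = density lborel (\<lambda>x. ennreal (f x))"
  define M2 where "M2 = density lborel (\<lambda>x. ennreal (- f x))"
  have key: "emeasure M1 {x<..} < \<infinity> \<and> emeasure M1 {x<..} = emeasure M2 {x<..}" for x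
  proof -
    let ?F = "\<lambda>y. indicator {x<..} y * f y"
    have iF: "integrable lborel ?F" using integrable_mult_indicator[OF _ i, of "{x<..}"] by simp
    have e1: "emeasure M1 {x<..} = (\<integral>\<^sup>+y. ennreal (?F y) \<partial>lborel)"
      unfolding M1_def by (subst emeasure_density) (auto intro!: nn_integral_cong split: split_indicator)
    have e2: "emeasure M2 {x<..} = (\<integral>\<^sup>+y. ennreal (- ?F y) \<partial>lborel)"
      unfolding M2_def by (subst emeasure_density) (auto intro!: nn_integral_cong split: split_indicator)
    have f1: "(\<integral>\<^sup>+y. ennreal (?F y) \<partial>lborel) < \<infinity>" and f2: "(\<integral>\<^sup>+y. ennreal (- ?F y) \<partial>lborel) < \<infinity>"
      using iF by (auto simp: real_integrable_def less_top)
    have "enn2real (\<integral>\<^sup>+y. ennreal (?F y) \<partial>lborel) = enn2real (\<integral>\<^sup>+y. ennreal (- ?F y) \<partial>lborel)"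
      using real_lebesgue_integral_def[OF iF] z[of x] by (simp add: set_lebesgue_integral_def)
    then show ?thesis using f1 f2 unfolding e1 e2 by (metis ennreal_enn2real infinity_ennreal_def)
  qed
  have "M1 = M2"
  proof (rule measure_eqI_lessThan)
    show "emeasure M1 {x<..} < \<infinity>" for x by (rule key[THEN conjunct1])
    show "emeasure M1 {x<..} = emeasure M2 {x<..}" for x by (rule key[THEN conjunct2])
  qed (auto simp: M1_def M2_def)
  then have "AE x in lborel. ennreal (f x) = ennreal (- f x)"
    unfolding M1_def M2_def by (intro sigma_finite_measure.density_unique[OF sigma_finite_lborel]) auto
  then show ?thesis
  proof eventually_elim
    case (elim y)
    then show ?case using ennreal_eq_0_iff[of "f y"] ennreal_eq_0_iff[of "- f y"] by (cases "f y \<ge> 0") auto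
  qed
qed

lemma AE_zero_of_intervals:
  assumes i: "(f::real\<Rightarrow>real) absolutely_integrable_on {a..b}" and z: "\<And>x. x \<in> {a..b} \<Longrightarrow> integral {x..b} f = 0"
  shows "AE x in lebesgue. x \<in> {a..b} \<longrightarrow> f x = 0"
proof -
  let ?g = "\<lambda>x. indicator {a..b} x * f x"
  have ig: "integrable lebesgue ?g" using i by (simp add: set_integrable_def)
  then have "?g \<in> borel_measurable (completion lborel)" by auto
  then obtain g' where g': "g' \<in> borel_measurable lborel" "AE x in lborel. ?g x = g' x"
    using completion_ex_borel_measurable_real by blast
  have ae: "AE x in lebesgue. ?g x = g' x" using g'(2) by (rule AE_completion)
  have m': "g' \<in> borel_measurable lebesgue" using g'(1) by (simp add: measurable_completion)
  have "integrable lebesgue g'" using integrable_cong_AE_imp[OF ig m'] ae by (auto elim!: eventually_mono)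
  then have ig': "integrable lborel g'" using g'(1) integrable_completion by blast
  have "(LINT y:{x<..}|lborel. g' y) = 0" for x
  proof -
    have "(LINT y:{x<..}|lborel. g' y) = (LINT y:{x<..}|lebesgue. g' y)"
      unfolding set_lebesgue_integral_def using g'(1) by (intro integral_completion[symmetric]) auto
    also have "\<dots> = (LINT y:{x<..}|lebesgue. ?g y)"
      unfolding set_lebesgue_integral_def
    proof (rule integral_cong_AE)
      have "(\<lambda>y. indicat_real {x<..} y *\<^sub>R h y) \<in> borel_measurable lebesgue" if "h \<in> borel_measurable lebesgue" for h :: "real \<Rightarrow> real"
        using that by (intro borel_measurable_scaleR borel_measurable_indicator) auto
      then show "(\<lambda>y. indicat_real {x<..} y *\<^sub>R g' y) \<in> borel_measurable lebesgue"
        "(\<lambda>y. indicat_real {x<..} y *\<^sub>R (indicat_real {a..b} y * f y)) \<in> borel_measurable lebesgue"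
        using m' borel_measurable_integrable[OF ig] by blast+
      show "AE y in lebesgue. indicat_real {x<..} y *\<^sub>R g' y = indicat_real {x<..} y *\<^sub>R (indicat_real {a..b} y * f y)"
        using ae by eventually_elim simp
    qed
    also have "\<dots> = 0"
    proof (cases "x < b")
      case True
      have "(LINT y:{x<..}|lebesgue. ?g y) = (LINT y:{max a x..b}|lebesgue. f y)"
        unfolding set_lebesgue_integral_def
      proof (rule integral_cong_AE)
        have "AE y in lebesgue. y \<noteq> x" 
          by (rule AE_I'[where N="{x}"]) auto
        then show "AE y in lebesgue. indicat_real {x<..} y *\<^sub>R (indicat_real {a..b} y * f y) = indicat_real {max a x..b} y *\<^sub>R f y"
          by eventually_elim (auto split: split_indicator)
        have "(\<lambda>y. indicat_real {max a x..b} y * (indicat_real {a..b} y * f y)) \<in> borel_measurable lebesgue"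
          by (intro borel_measurable_times[OF borel_measurable_indicator borel_measurable_integrable[OF ig]]) auto
        moreover have "(\<lambda>y. indicat_real {max a x..b} y * (indicat_real {a..b} y * f y)) = (\<lambda>y. indicat_real {max a x..b} y *\<^sub>R f y)"
          by (auto split: split_indicator)
        ultimately show "(\<lambda>y. indicat_real {max a x..b} y *\<^sub>R f y) \<in> borel_measurable lebesgue" by simp
        show "(\<lambda>y. indicat_real {x<..} y *\<^sub>R (indicat_real {a..b} y * f y)) \<in> borel_measurable lebesgue"
          by (intro borel_measurable_scaleR[OF borel_measurable_indicator borel_measurable_integrable[OF ig]]) auto
      qed
      also have "\<dots> = integral {max a x..b} f"
        by (intro set_lebesgue_integral_eq_integral(2) set_integrable_subset[OF i]) auto
      also have "\<dots> = 0"
        using z[of "max a x"] True by (cases "a \<le> b") auto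
      finally show ?thesis .
    next
      case False
      then have "(\<lambda>y. indicat_real {x<..} y *\<^sub>R (indicat_real {a..b} y * f y)) = (\<lambda>y. 0)"
        by (auto split: split_indicator)
      then show ?thesis unfolding set_lebesgue_integral_def by simp
    qed
    finally show ?thesis .
  qed
  then have "AE y in lborel. g' y = 0" by (rule AE_zero_of_halflines[OF ig'])
  then have "AE y in lebesgue. g' y = 0" by (rule AE_completion)
  then show ?thesis using ae by eventually_elim (auto split: split_indicator)
qed

lemma LINT_supported:
  assumes "{s..t} \<subseteq> I" "h absolutely_integrable_on {s..t}" "\<And>x. x \<in> I - {s..t} \<Longrightarrow> h x = (0::real)"
  shows "(LINT x:I|lebesgue. h x) = integral {s..t} h"
proof -
  have "(LINT x:I|lebesgue. h x) = (LINT x:{s..t}|lebesgue. h x)"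
    unfolding set_lebesgue_integral_def
    by (rule Bochner_Integration.integral_cong) (use assms in \<open>auto split: split_indicator\<close>)
  then show ?thesis using set_lebesgue_integral_eq_integral(2)[OF assms(2)] by simp
qed

text \<open>Smooth plateaus converge boundedly to the indicator of an open interval, so by dominated
  convergence \<open>f\<close> has zero integral over every compact interval in \<open>E\<close>;
  this forces \<open>f\<close> to vanish almost everywhere on each of them.\<close>

lemma fundamental_lemma:
  assumes E: "open E" and f: "locally_integrable E f"
    and z: "\<And>\<phi>. test_function E \<phi> \<Longrightarrow> (LINT x:E|lebesgue. f x * \<phi> x) = 0"
  shows "AE x in lebesgue. x \<in> E \<longrightarrow> f x = 0"
proof -
  have int0: "integral {a..b} f = 0" if "{a..b} \<subseteq> E" "a \<le> b" for a b
  proof -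
    have fi: "f absolutely_integrable_on {a..b}" using f that by (auto simp: locally_integrable_def)
    \<comment> \<open>A plateau supported in [a, b], equal to 1 at distance at least 1/(n+1) from
      both ends.\<close>
    define \<phi> where "\<phi> n x = step (real (Suc n) * x + (- real (Suc n) * a)) * step (- real (Suc n) * x + real (Suc n) * b)" for n x
    have cn: "Cn k (\<phi> n)" for k n unfolding \<phi>_def by (intro Cn_mult Cn_affine Cn_step)
    have supp: "\<phi> n x = 0" if "x \<notin> {a..b}" for n x
    proof -
      have "real (Suc n) * (x - a) \<le> 0 \<or> real (Suc n) * (b - x) \<le> 0"
        using that by (auto simp: mult_le_0_iff)
      then show ?thesis unfolding \<phi>_def by (auto simp: algebra_simps intro!: step_0)
    qed
    have tf: "test_function E (\<phi> n)" for n
      by (rule test_functionI[OF cn, of "{a..b}"]) (use that supp in auto)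
    have b1: "\<bar>\<phi> n x\<bar> \<le> 1" for n x
      unfolding \<phi>_def using step_bounds by (simp add: abs_mult mult_le_one)
    have lim: "(\<lambda>n. \<phi> n x) \<longlonglongrightarrow> 1" if "x \<in> {a<..<b}" for x
    proof -
      obtain N :: nat where N: "max (1 / (x - a)) (1 / (b - x)) < real N" using reals_Archimedean2 by blast
      have "\<phi> n x = 1" if "n \<ge> N" for n
      proof -
        have "1 / (x - a) \<le> real (Suc n)" "1 / (b - x) \<le> real (Suc n)" using N that by auto
        then have "1 \<le> real (Suc n) * (x - a)" "1 \<le> real (Suc n) * (b - x)"
          using \<open>x \<in> {a<..<b}\<close> by (simp_all add: pos_divide_le_eq del: of_nat_Suc)
        then show ?thesis unfolding \<phi>_def by (subst (1 2) step_1) (auto simp: algebra_simps)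
      qed
      then show ?thesis by (intro tendsto_eventually eventually_sequentiallyI[of N]) auto
    qed
    have "(\<lambda>n. (LINT x|lebesgue. (indicat_real {a..b} x * f x) * \<phi> n x)) \<longlonglongrightarrow> (LINT x|lebesgue. indicat_real {a..b} x * f x)"
    proof (rule integral_dominated_convergence[where w="\<lambda>x. \<bar>indicat_real {a..b} x * f x\<bar>"])
      have m: "integrable lebesgue (\<lambda>x. indicat_real {a..b} x * f x)" using fi by (simp add: set_integrable_def)
      then show "(\<lambda>x. indicat_real {a..b} x * f x) \<in> borel_measurable lebesgue" "integrable lebesgue (\<lambda>x. \<bar>indicat_real {a..b} x * f x\<bar>)" by auto
      have "\<phi> n \<in> borel_measurable borel" for n
        by (intro borel_measurable_continuous_onI test_function_continuous[OF tf])
      then have "\<phi> n \<in> borel_measurable lebesgue" for n by (simp add: borel_imp_lebesgue_measurable)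
      then show "(\<lambda>x. indicat_real {a..b} x * f x * \<phi> n x) \<in> borel_measurable lebesgue" for n
        using borel_measurable_times[OF borel_measurable_integrable[OF m]] by blast
      have "AE x in lebesgue. x \<noteq> a" by (rule AE_I'[where N="{a}"]) auto
      moreover have "AE x in lebesgue. x \<noteq> b" by (rule AE_I'[where N="{b}"]) auto
      ultimately show "AE x in lebesgue. (\<lambda>n. indicat_real {a..b} x * f x * \<phi> n x) \<longlonglongrightarrow> indicat_real {a..b} x * f x"
      proof eventually_elim
        case (elim x)
        show ?case
        proof (cases "x \<in> {a<..<b}")
          case True
          from tendsto_mult[OF tendsto_const lim[OF this], of "indicat_real {a..b} x * f x"] show ?thesis by simp
        next
          case False
          then have "x \<notin> {a..b}" using elim by auto
          then show ?thesis by simp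
        qed
      qed
      show "AE x in lebesgue. norm (indicat_real {a..b} x * f x * \<phi> n x) \<le> \<bar>indicat_real {a..b} x * f x\<bar>" for n
        by (rule AE_I2) (use b1 in \<open>auto simp: abs_mult intro!: mult_left_le split: split_indicator\<close>)
    qed
    moreover have "(LINT x|lebesgue. (indicat_real {a..b} x * f x) * \<phi> n x) = 0" for n
    proof -
      have "(LINT x|lebesgue. (indicat_real {a..b} x * f x) * \<phi> n x) = (LINT x:E|lebesgue. f x * \<phi> n x)"
        unfolding set_lebesgue_integral_def
        by (rule Bochner_Integration.integral_cong) (use supp[of _ n] that in \<open>auto split: split_indicator\<close>)
      then show ?thesis using z[OF tf] by simp
    qed
    ultimately have "(LINT x|lebesgue. indicat_real {a..b} x * f x) = 0"
      using LIMSEQ_unique[OF tendsto_const] by (metis (no_types, lifting) LIMSEQ_const_iff LIMSEQ_unique ext)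
    then show ?thesis
      using set_lebesgue_integral_eq_integral(2)[OF fi] by (simp add: set_lebesgue_integral_def)
  qed
  \<comment> \<open>Rational end points keep the union of exceptional null sets countable, and such
    intervals cover the open set \<open>E\<close>.\<close>
  have "AE x in lebesgue. \<forall>p::rat\<times>rat. {of_rat (fst p)..of_rat (snd p)} \<subseteq> E \<longrightarrow> x \<in> {of_rat (fst p)..of_rat (snd p)} \<longrightarrow> f x = 0"
    unfolding AE_all_countable
  proof
    fix p :: "rat \<times> rat"
    let ?a = "of_rat (fst p) :: real" and ?b = "of_rat (snd p) :: real"
    show "AE x in lebesgue. {?a..?b} \<subseteq> E \<longrightarrow> x \<in> {?a..?b} \<longrightarrow> f x = 0"
    proof (cases "{?a..?b} \<subseteq> E")
      case True
      have "f absolutely_integrable_on {?a..?b}" using f True by (auto simp: locally_integrable_def)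
      moreover have "integral {x..?b} f = 0" if "x \<in> {?a..?b}" for x
        using that True by (intro int0) auto
      ultimately show ?thesis using AE_zero_of_intervals[where f=f and a="?a" and b="?b"] by auto
    qed auto
  qed
  then show ?thesis
  proof eventually_elim
    case (elim x)
    show ?case
    proof
      assume "x \<in> E"
      then obtain d where d: "d > 0" "ball x d \<subseteq> E" using E openE by blast
      obtain a where a: "x - d < of_rat a" "of_rat a < x" using of_rat_dense[of "x - d" x] d by auto
      obtain b where b: "x < of_rat b" "of_rat b < x + d" using of_rat_dense[of x "x + d"] d by auto
      have "{of_rat a..of_rat b} \<subseteq> ball x d" using a b by (auto simp: dist_real_def)
      then show "f x = 0" using elim[rule_format, of "(a, b)"] d a b by auto
    qed
  qed
qed

lemma locally_integrable_diff:
  "locally_integrable E f \<Longrightarrow> locally_integrable E g \<Longrightarrow> locally_integrable E (\<lambda>x. f x - g x)"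
  unfolding locally_integrable_def by (auto intro: set_integral_diff)

lemma locally_integrable_test:
  assumes "locally_integrable E f" "test_function E \<phi>"
  shows "set_integrable lebesgue E (\<lambda>x. f x * \<phi> x)"
proof -
  obtain K where K: "compact K" "K \<subseteq> E" "\<And>x. x \<notin> K \<Longrightarrow> \<phi> x = 0" using test_function_supp[OF assms(2)] by metis
  obtain B where B: "\<And>x. \<bar>\<phi> x\<bar> \<le> B" using test_function_bounded[OF assms(2)] by auto
  have fi: "integrable lebesgue (\<lambda>x. indicat_real K x * f x)"
    using assms(1) K by (auto simp: locally_integrable_def set_integrable_def)
  have "\<phi> \<in> borel_measurable borel"
    by (intro borel_measurable_continuous_onI test_function_continuous[OF assms(2)])
  then have pm: "\<phi> \<in> borel_measurable lebesgue" by (simp add: borel_imp_lebesgue_measurable)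
  have "integrable lebesgue (\<lambda>x. (indicat_real K x * f x) * \<phi> x)"
  proof (rule Bochner_Integration.integrable_bound[where f="\<lambda>x. B * (indicat_real K x * f x)"])
    show "integrable lebesgue (\<lambda>x. B * (indicat_real K x * f x))" using fi by simp
    show "(\<lambda>x. indicat_real K x * f x * \<phi> x) \<in> borel_measurable lebesgue"
      by (rule borel_measurable_times[OF borel_measurable_integrable[OF fi] pm])
    show "AE x in lebesgue. norm (indicat_real K x * f x * \<phi> x) \<le> norm (B * (indicat_real K x * f x))"
    proof (rule AE_I2)
      fix x
      have "\<bar>indicat_real K x * f x\<bar> * \<bar>\<phi> x\<bar> \<le> \<bar>indicat_real K x * f x\<bar> * B"
        by (intro mult_left_mono B) auto
      moreover have "B \<ge> 0" using B[of 0] by linarith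
      ultimately show "norm (indicat_real K x * f x * \<phi> x) \<le> norm (B * (indicat_real K x * f x))"
        unfolding real_norm_def abs_mult by (simp add: mult.commute)
    qed
  qed
  moreover have "(\<lambda>x. (indicat_real K x * f x) * \<phi> x) = (\<lambda>x. indicat_real E x *\<^sub>R (f x * \<phi> x))"
  proof
    show "(indicat_real K x * f x) * \<phi> x = indicat_real E x *\<^sub>R (f x * \<phi> x)" for x
      using K(2) K(3)[of x] by (cases "x \<in> K") auto
  qed
  ultimately show ?thesis by (simp add: set_integrable_def)
qed

lemma weak_deriv_unique:
  assumes "open E" "has_weak_deriv E k f g1" "has_weak_deriv E k f g2"
  shows "AE x in lebesgue. x \<in> E \<longrightarrow> g1 x = g2 x"
proof -
  have l: "locally_integrable E g1" "locally_integrable E g2" using assms by (auto simp: has_weak_deriv_def)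
  have "AE x in lebesgue. x \<in> E \<longrightarrow> g1 x - g2 x = 0"
  proof (rule fundamental_lemma[OF assms(1) locally_integrable_diff[OF l]])
    fix \<phi> assume t: "test_function E \<phi>"
    have "(LINT x:E|lebesgue. (g1 x - g2 x) * \<phi> x) = (LINT x:E|lebesgue. g1 x * \<phi> x) - (LINT x:E|lebesgue. g2 x * \<phi> x)"
      using set_integral_diff(2)[OF locally_integrable_test[OF l(1) t] locally_integrable_test[OF l(2) t]]
      by (simp add: left_diff_distrib)
    also have "\<dots> = 0"
    proof -
      have "(-1::real) ^ k * (LINT x:E|lebesgue. g1 x * \<phi> x) = (-1) ^ k * (LINT x:E|lebesgue. g2 x * \<phi> x)"
        using assms(2,3)[unfolded has_weak_deriv_def, THEN conjunct2, THEN conjunct2, rule_format, OF t] by linarith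
      then show ?thesis by (simp add: power_not_zero)
    qed
    finally show "(LINT x:E|lebesgue. (g1 x - g2 x) * \<phi> x) = 0" .
  qed
  then show ?thesis by eventually_elim auto
qed

section \<open>Weak derivatives and absolute continuity\<close>

lemma AC_test:
  assumes "AC {a..b} f g" "a \<le> b" "test_function E \<phi>" "\<phi> a = 0" "\<phi> b = 0"
  shows "integral {a..b} (\<lambda>x. f x * deriv \<phi> x) = - integral {a..b} (\<lambda>x. g x * \<phi> x)"
    "(\<lambda>x. f x * deriv \<phi> x) absolutely_integrable_on {a..b}" "(\<lambda>x. g x * \<phi> x) absolutely_integrable_on {a..b}"
proof -
  note cd = test_function_continuous[OF test_function_deriv[OF assms(3)]]
  have "AC {a..b} \<phi> (deriv \<phi>)"
    by (rule AC_C1[OF test_function_DERIV[OF assms(3)] cd])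
  from ACD(3)[OF AC_mult[OF assms(1) this] assms(2)]
  have 1: "integral {a..b} (\<lambda>x. g x * \<phi> x + f x * deriv \<phi> x) = 0" using assms by simp
  show 2: "(\<lambda>x. f x * deriv \<phi> x) absolutely_integrable_on {a..b}"
    by (intro absolutely_integrable_continuous_real continuous_intros AC_continuous[OF assms(1)] cd) auto
  show 3: "(\<lambda>x. g x * \<phi> x) absolutely_integrable_on {a..b}"
    by (intro absolutely_integrable_mult_continuous ACD(1)[OF assms(1,2)] test_function_continuous[OF assms(3)]) auto
  show "integral {a..b} (\<lambda>x. f x * deriv \<phi> x) = - integral {a..b} (\<lambda>x. g x * \<phi> x)"
    using 1 Henstock_Kurzweil_Integration.integral_add[of "\<lambda>x. g x * \<phi> x" "{a..b}" "\<lambda>x. f x * deriv \<phi> x"] 2 3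
    by (simp add: absolutely_integrable_on_def)
qed

definition primitive :: "real \<Rightarrow> (real \<Rightarrow> real) \<Rightarrow> real \<Rightarrow> real" where
  "primitive c g x = (if c \<le> x then integral {c..x} g else - integral {x..c} g)"

lemma AC_primitive:
  assumes J: "convex J" "c \<in> J" and g: "\<And>a b. {a..b} \<subseteq> J \<Longrightarrow> g absolutely_integrable_on {a..b}"
  shows "AC J (primitive c g) g"
  unfolding AC_def
proof (intro allI impI conjI)
  fix a b :: real assume ab: "a \<le> b" "{a..b} \<subseteq> J"
  show gi: "g absolutely_integrable_on {a..b}" by (rule g[OF ab(2)])
  have "integral {a..b} g = primitive c g b - primitive c g a"
  proof -
    have sub: "{x..y} \<subseteq> J" if "x \<in> J" "y \<in> J" for x y
    proof (cases "x \<le> y")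
      case True
      then show ?thesis
        using convex_contains_segment[THEN iffD1, OF J(1), rule_format, OF that] by (simp add: closed_segment_eq_real_ivl1)
    qed simp
    have gi: "g integrable_on {x..y}" if "x \<in> J" "y \<in> J" for x y
      using g[OF sub[OF that]] by (simp add: absolutely_integrable_on_def)
    have "a \<in> J" "b \<in> J" using ab by auto
    consider "c \<le> a" | "a < c" "c \<le> b" | "b < c" by linarith
    then show ?thesis
    proof cases
      case 1
      then show ?thesis using ab Henstock_Kurzweil_Integration.integral_combine[of c a b g] gi[OF J(2) \<open>b \<in> J\<close>]
        by (auto simp: primitive_def)
    next
      case 2
      then show ?thesis using ab Henstock_Kurzweil_Integration.integral_combine[of a c b g] gi[OF \<open>a \<in> J\<close> \<open>b \<in> J\<close>]
        by (auto simp: primitive_def)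
    next
      case 3
      then show ?thesis using ab Henstock_Kurzweil_Integration.integral_combine[of a b c g] gi[OF \<open>a \<in> J\<close> J(2)]
        by (auto simp: primitive_def)
    qed
  qed
  then show "(g has_integral primitive c g b - primitive c g a) {a..b}"
    using gi by (metis absolutely_integrable_on_def integrable_integral)
qed

lemma interval_hull:
  assumes "open I" "convex I" "compact K" "K \<subseteq> I" "p \<in> I" "q \<in> (I::real set)" "p \<le> q"
  obtains s t where "s < p" "q < t" "{s..t} \<subseteq> I" "K \<subseteq> {s<..<t}"
proof -
  let ?K = "insert p (insert q K)"
  have K: "compact ?K" "?K \<noteq> {}" using assms by auto
  obtain s where s: "s \<in> ?K" "\<And>x. x \<in> ?K \<Longrightarrow> s \<le> x" using compact_attains_inf[OF K] by blast
  obtain t where t: "t \<in> ?K" "\<And>x. x \<in> ?K \<Longrightarrow> x \<le> t" using compact_attains_sup[OF K] by blast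
  have st: "s \<in> I" "t \<in> I" using s t assms by auto
  obtain d where d: "d > 0" "ball s d \<subseteq> I" using assms(1) st openE by blast
  obtain d' where d': "d' > 0" "ball t d' \<subseteq> I" using assms(1) st openE by blast
  have "s - d / 2 \<in> I" "t + d' / 2 \<in> I" using d d' by (auto simp: subset_iff dist_real_def)
  moreover have "s - d / 2 \<le> t + d' / 2" using s(2)[OF t(1)] d d' by linarith
  ultimately have "{s - d / 2..t + d' / 2} \<subseteq> I"
    using convex_contains_segment[THEN iffD1, OF assms(2), rule_format, of "s - d / 2" "t + d' / 2"]
    by (simp add: closed_segment_eq_real_ivl1)
  moreover have "K \<subseteq> {s - d / 2<..<t + d' / 2}" using s(2) t(2) d d' by force
  moreover have "s - d / 2 < p" "q < t + d' / 2" using s(2)[of p] t(2)[of q] d d' by auto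
  ultimately show ?thesis using that by blast
qed

lemma locally_integrable_continuous:
  assumes "convex (I::real set)" "open I" "\<And>a b. {a..b} \<subseteq> I \<Longrightarrow> continuous_on {a..b} f"
  shows "locally_integrable I f"
  unfolding locally_integrable_def
proof (intro allI impI)
  fix K assume K: "compact K" "K \<subseteq> I"
  show "set_integrable lebesgue K f"
  proof (cases "K = {}")
    case False
    then obtain p where p: "p \<in> K" by blast
    obtain s t where st: "{s..t} \<subseteq> I" "K \<subseteq> {s<..<t}"
      by (rule interval_hull[OF assms(2,1) K, of p p]) (use p K in auto)
    have "f absolutely_integrable_on {s..t}"
      by (intro absolutely_integrable_continuous_real assms st)
    moreover have "K \<in> sets lebesgue" using K(1) by (simp add: lmeasurable_compact fmeasurableD)
    moreover have "K \<subseteq> {s..t}" using st(2) by auto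
    ultimately show ?thesis by (rule set_integrable_subset)
  qed simp
qed

lemma integral_supported:
  assumes "{p..q} \<subseteq> {s..t}" "\<And>x. x \<notin> {p..q} \<Longrightarrow> (h::real\<Rightarrow>real) x = 0"
  shows "integral {s..t} h = integral {p..q} h"
proof (rule integral_spike_set)
  have "{x \<in> {s..t} - {p..q}. h x \<noteq> 0} = {}" "{x \<in> {p..q} - {s..t}. h x \<noteq> 0} = {}" using assms by auto
  then show "negligible {x \<in> {s..t} - {p..q}. h x \<noteq> 0}" "negligible {x \<in> {p..q} - {s..t}. h x \<noteq> 0}"
    by (simp_all only: negligible_empty)
qed

text \<open>Subtracting a primitive leaves a function with vanishing weak derivative; a test function of
  vanishing mean is the derivative of a test function, so such a function is constant.\<close>

lemma weak_deriv_imp_AC: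
  assumes w: "has_weak_deriv I 1 f g" and I: "open I" "convex I" "c \<in> I" "I \<subseteq> J"
    and J: "convex J" "\<And>a b. {a..b} \<subseteq> J \<Longrightarrow> g absolutely_integrable_on {a..b}"
  obtains k where "AE x in lebesgue. x \<in> I \<longrightarrow> f x = primitive c g x + k"
proof -
  define G where "G = primitive c g"
  have AG: "AC J G g" unfolding G_def using J I by (intro AC_primitive) auto
  have fl: "locally_integrable I f" and gl: "locally_integrable I g" using w by (auto simp: has_weak_deriv_def)
  have Gl: "locally_integrable I G"
    using I AC_continuous[OF AG] by (intro locally_integrable_continuous) auto
  have cl: "locally_integrable I (\<lambda>x. k)" for k
    using I by (intro locally_integrable_continuous) auto
  obtain d where d: "d > 0" "ball c d \<subseteq> I" using I openE by blast
  define p q where "p = c - d / 2" and "q = c + d / 2"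
  have pq: "p < q" "p \<in> I" "q \<in> I" "{p..q} \<subseteq> I" using d by (auto simp: p_def q_def dist_real_def subset_iff)
  \<comment> \<open>A test function of integral 1; its multiples serve to remove the mean of an
    arbitrary test function.\<close>
  define \<rho> where "\<rho> x = (1 / integral {p..q} (bump p q)) * bump p q x" for x
  have bp: "integral {p..q} (bump p q) > 0" by (rule integral_bump_pos[OF pq(1)])
  have \<rho>Cn: "Cn n \<rho>" for n unfolding \<rho>_def by (intro Cn_cmult Cn_bump)
  have \<rho>0: "\<rho> x = 0" if "x \<notin> {p..q}" for x using that by (auto simp: \<rho>_def bump_zero)
  have \<rho>t: "test_function I \<rho>" by (rule test_functionI[OF \<rho>Cn, of "{p..q}"]) (use pq \<rho>0 in auto)
  have \<rho>c: "continuous_on A \<rho>" for A by (rule test_function_continuous[OF \<rho>t])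
  have \<rho>1: "integral {s..t} \<rho> = 1" if "s \<le> p" "q \<le> t" for s t
  proof -
    have "integral {s..t} \<rho> = integral {p..q} \<rho>"
      by (rule integral_supported) (use that \<rho>0 in auto)
    then show ?thesis using bp by (simp add: \<rho>_def[abs_def])
  qed
  \<comment> \<open>If \<open>f\<close> - \<open>G\<close> is to be a constant, pairing it with the
    unit mass \<open>\<rho>\<close> must give that constant.\<close>
  define k where "k = (LINT x:I|lebesgue. (f x - G x) * \<rho> x)"
  have fGl: "locally_integrable I (\<lambda>x. f x - G x)" by (intro locally_integrable_diff fl Gl)
  have "AE x in lebesgue. x \<in> I \<longrightarrow> f x - G x - k = 0"
  proof (rule fundamental_lemma[OF I(1)])
    show "locally_integrable I (\<lambda>x. f x - G x - k)" by (intro locally_integrable_diff fl Gl cl)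
    fix \<phi> assume t: "test_function I \<phi>"
    then obtain K where K: "compact K" "K \<subseteq> I" "\<And>x. x \<notin> K \<Longrightarrow> \<phi> x = 0" using test_function_supp by metis
    obtain s t where st: "s < p" "q < t" "{s..t} \<subseteq> I" "K \<subseteq> {s<..<t}"
      using interval_hull[OF I(1,2) K(1,2) pq(2,3)] pq(1) by (metis less_imp_le)
    note \<phi>c = test_function_continuous[OF t]
    have st_le: "s \<le> t" using st pq by linarith
    define c0 where "c0 = integral {s..t} \<phi>"
    \<comment> \<open>The mean is removed, so the primitive \<open>\<psi>\<close> of
      \<open>\<eta>\<close> vanishes again to the right of \<open>t\<close> and is admissible in the
      weak formulation.\<close>
    define \<eta> where "\<eta> x = \<phi> x - c0 * \<rho> x" for x
    have \<eta>Cn: "Cn n \<eta>" for n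
      using Cn_add[OF test_function_Cn[OF t] Cn_cmult[OF \<rho>Cn, of n "- c0"]] by (simp add: \<eta>_def[abs_def])
    have \<eta>0: "\<eta> x = 0" if "x \<le> s \<or> t \<le> x" for x
    proof -
      have "x \<notin> K" "x \<notin> {p..q}" using that st pq by auto
      then show ?thesis using K(3) \<rho>0 by (simp add: \<eta>_def)
    qed
    define \<psi> where "\<psi> x = integral {s..max s x} \<eta>" for x
    have \<eta>c: "continuous_on A \<eta>" for A unfolding \<eta>_def by (intro continuous_intros \<phi>c \<rho>c)
    have \<psi>d: "(\<psi> has_real_derivative \<eta> x) (at x)" for x
      unfolding \<psi>_def[abs_def] by (rule integral_DERIV_ext[OF \<eta>c]) (use \<eta>0 in auto)
    have d\<psi>: "deriv \<psi> = \<eta>" using \<psi>d by (auto intro: DERIV_imp_deriv)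
    have \<eta>int: "integral {s..t} \<eta> = 0"
    proof -
      have "integral {s..t} \<eta> = integral {s..t} \<phi> - integral {s..t} (\<lambda>x. c0 * \<rho> x)"
        unfolding \<eta>_def
        by (intro Henstock_Kurzweil_Integration.integral_diff integrable_continuous_interval continuous_intros \<phi>c \<rho>c)
      then show ?thesis using \<rho>1[of s t] st by (simp add: c0_def)
    qed
    have \<psi>0: "\<psi> x = 0" if "x \<le> s \<or> t \<le> x" for x
    proof (cases "x \<le> s")
      case False
      then have "t \<le> x" using that by simp
      have "integral {s..x} \<eta> = integral {s..t} \<eta>"
        by (rule integral_supported) (use \<open>t \<le> x\<close> \<eta>0 in auto)
      then show ?thesis using False \<eta>int by (simp add: \<psi>_def max_def)
    qed (simp add: \<psi>_def max_def)
    have \<psi>t: "test_function I \<psi>"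
    proof (rule test_functionI[of _ "{s..t}"])
      show "Cn n \<psi>" for n unfolding \<psi>_def[abs_def] by (rule Cn_integral_ext[OF \<eta>Cn]) (use \<eta>0 in auto)
    qed (use st \<psi>0 in auto)
    have AGst: "AC {s..t} G g" by (rule AC_mono[OF AG]) (use st I in auto)
    note A = AC_test[OF AGst st_le \<psi>t] 
    have \<psi>s: "\<psi> s = 0" "\<psi> t = 0" using \<psi>0 by auto
    have 1: "(LINT x:I|lebesgue. f x * \<eta> x) = - (LINT x:I|lebesgue. g x * \<psi> x)"
      using w \<psi>t d\<psi> by (auto simp: has_weak_deriv_def)
    have 2: "(LINT x:I|lebesgue. g x * \<psi> x) = integral {s..t} (\<lambda>x. g x * \<psi> x)"
      by (rule LINT_supported[OF st(3) A(3)[OF \<psi>s]]) (use \<psi>0 in auto)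
    have 3: "(LINT x:I|lebesgue. G x * \<eta> x) = integral {s..t} (\<lambda>x. G x * \<eta> x)"
      by (rule LINT_supported[OF st(3)]) (use A(2)[OF \<psi>s] d\<psi> \<eta>0 in auto)
    have \<eta>t: "test_function I \<eta>" using test_function_deriv[OF \<psi>t] d\<psi> by simp
    have "(LINT x:I|lebesgue. (f x - G x) * \<eta> x) = (LINT x:I|lebesgue. f x * \<eta> x) - (LINT x:I|lebesgue. G x * \<eta> x)"
      using set_integral_diff(2)[OF locally_integrable_test[OF fl \<eta>t] locally_integrable_test[OF Gl \<eta>t]]
      by (simp add: left_diff_distrib)
    also have "\<dots> = 0" using 1 2 3 A(1)[OF \<psi>s] d\<psi> by simp
    finally have 4: "(LINT x:I|lebesgue. (f x - G x) * \<eta> x) = 0" .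
    have 5: "(LINT x:I|lebesgue. k * \<phi> x) = k * c0"
    proof -
      have "(LINT x:I|lebesgue. k * \<phi> x) = integral {s..t} (\<lambda>x. k * \<phi> x)"
      proof (rule LINT_supported[OF st(3)])
        show "(\<lambda>x. k * \<phi> x) absolutely_integrable_on {s..t}"
          by (intro absolutely_integrable_continuous_real continuous_intros \<phi>c)
        show "k * \<phi> x = 0" if "x \<in> I - {s..t}" for x
        proof -
          have "x \<notin> K" using that st(4) by auto
          then show ?thesis using K(3) by simp
        qed
      qed
      then show ?thesis by (simp add: c0_def)
    qed
    have "(LINT x:I|lebesgue. (f x - G x - k) * \<phi> x) = (LINT x:I|lebesgue. ((f x - G x) * \<eta> x + (c0 * ((f x - G x) * \<rho> x))) - k * \<phi> x)"
      by (simp add: \<eta>_def algebra_simps)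
    also have "\<dots> = (LINT x:I|lebesgue. (f x - G x) * \<eta> x + c0 * ((f x - G x) * \<rho> x)) - (LINT x:I|lebesgue. k * \<phi> x)"
      by (intro set_integral_diff(2) set_integral_add(1) set_integrable_mult_right locally_integrable_test fGl \<eta>t \<rho>t t cl)
    also have "(LINT x:I|lebesgue. (f x - G x) * \<eta> x + c0 * ((f x - G x) * \<rho> x)) = 
       (LINT x:I|lebesgue. (f x - G x) * \<eta> x) + (LINT x:I|lebesgue. c0 * ((f x - G x) * \<rho> x))"
      by (intro set_integral_add(2) set_integrable_mult_right locally_integrable_test fGl \<eta>t \<rho>t)
    also have "\<dots> = c0 * k" using 4 by (simp add: k_def)
    finally show "(LINT x:I|lebesgue. (f x - G x - k) * \<phi> x) = 0" using 5 by auto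
  qed
  then have "AE x in lebesgue. x \<in> I \<longrightarrow> f x = primitive c g x + k"
    by eventually_elim (simp add: G_def algebra_simps)
  then show ?thesis by (rule that)
qed

section \<open>The Banach space of square integrable functions on the line\<close>

definition sqi :: "(real \<Rightarrow> real) \<Rightarrow> bool" where
  "sqi f \<longleftrightarrow> f \<in> borel_measurable lebesgue \<and> integrable lebesgue (\<lambda>x. (f x)\<^sup>2)"

definition nrm2 :: "(real \<Rightarrow> real) \<Rightarrow> real" where
  "nrm2 f = sqrt (LINT x|lebesgue. (f x)\<^sup>2)"

lemma sqi_mult_integrable: assumes "sqi f" "sqi g" shows "integrable lebesgue (\<lambda>x. f x * g x)"
proof (rule Bochner_Integration.integrable_bound[where f="\<lambda>x. (f x)\<^sup>2 + (g x)\<^sup>2"])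
  show "integrable lebesgue (\<lambda>x. (f x)\<^sup>2 + (g x)\<^sup>2)" "(\<lambda>x. f x * g x) \<in> borel_measurable lebesgue"
    using assms by (auto simp: sqi_def)
  have "\<bar>f x * g x\<bar> \<le> (f x)\<^sup>2 + (g x)\<^sup>2" for x
  proof -
    have "2 * \<bar>f x\<bar> * \<bar>g x\<bar> \<le> (f x)\<^sup>2 + (g x)\<^sup>2" using sum_squares_bound[of "\<bar>f x\<bar>" "\<bar>g x\<bar>"] by simp
    moreover have "0 \<le> \<bar>f x\<bar> * \<bar>g x\<bar>" by simp
    ultimately show ?thesis unfolding abs_mult by linarith
  qed
  then show "AE x in lebesgue. norm (f x * g x) \<le> norm ((f x)\<^sup>2 + (g x)\<^sup>2)" by (intro AE_I2) auto
qed

lemma sqi_add: assumes "sqi f" "sqi g" shows "sqi (\<lambda>x. f x + g x)"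
proof -
  have "integrable lebesgue (\<lambda>x. (f x)\<^sup>2 + 2 * (f x * g x) + (g x)\<^sup>2)"
    using assms sqi_mult_integrable[OF assms] by (intro Bochner_Integration.integrable_add integrable_mult_right) (auto simp: sqi_def)
  then show ?thesis using assms by (auto simp: sqi_def power2_sum algebra_simps)
qed

lemma sqi_cmult: "sqi f \<Longrightarrow> sqi (\<lambda>x. c * f x)"
  by (auto simp: sqi_def power_mult_distrib)

lemma sqi_diff: "sqi f \<Longrightarrow> sqi g \<Longrightarrow> sqi (\<lambda>x. f x - g x)"
  using sqi_add[of f "\<lambda>x. (-1) * g x"] sqi_cmult[of g "-1"] by simp

lemma sqi_zero: "sqi (\<lambda>x. 0)" by (simp add: sqi_def)

lemma sqi_cong_AE: assumes "sqi f" "AE x in lebesgue. f x = g x" shows "sqi g"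
proof -
  have m: "g \<in> borel_measurable lebesgue"
    by (rule borel_measurable_AE[OF _ assms(2)]) (use assms(1) in \<open>simp add: sqi_def\<close>)
  have "AE x in lebesgue. (f x)\<^sup>2 = (g x)\<^sup>2" using assms(2) by eventually_elim simp
  then show ?thesis
    using assms m integrable_cong_AE_imp[of lebesgue "\<lambda>x. (f x)\<^sup>2" "\<lambda>x. (g x)\<^sup>2"]
    by (auto simp: sqi_def)
qed

lemma nrm2_nonneg: "nrm2 f \<ge> 0" by (simp add: nrm2_def)

lemma nrm2_sq: "(nrm2 f)\<^sup>2 = (LINT x|lebesgue. (f x)\<^sup>2)"
  by (simp add: nrm2_def)

lemma nrm2_cong_AE: "sqi f \<Longrightarrow> sqi g \<Longrightarrow> AE x in lebesgue. f x = g x \<Longrightarrow> nrm2 f = nrm2 g"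
  unfolding nrm2_def by (intro arg_cong[where f=sqrt] integral_cong_AE) (auto simp: sqi_def elim: eventually_mono)

lemma nrm2_Cauchy_Schwarz: assumes "sqi f" "sqi g"
  shows "\<bar>LINT x|lebesgue. f x * g x\<bar> \<le> nrm2 f * nrm2 g"
proof -
  define A B C where "A = (LINT x|lebesgue. (f x)\<^sup>2)" and "B = (LINT x|lebesgue. f x * g x)" and "C = (LINT x|lebesgue. (g x)\<^sup>2)"
  have i: "integrable lebesgue (\<lambda>x. (f x)\<^sup>2)" "integrable lebesgue (\<lambda>x. (g x)\<^sup>2)" "integrable lebesgue (\<lambda>x. f x * g x)"
    using assms sqi_mult_integrable by (auto simp: sqi_def)
  have q: "0 \<le> A + 2 * t * B + t\<^sup>2 * C" for t
  proof -
    have "0 \<le> (LINT x|lebesgue. (f x + t * g x)\<^sup>2)" by simp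
    also have "\<dots> = (LINT x|lebesgue. (f x)\<^sup>2 + (2 * t) * (f x * g x) + t\<^sup>2 * (g x)\<^sup>2)"
      by (intro Bochner_Integration.integral_cong) (auto simp: power2_eq_square algebra_simps)
    also have "\<dots> = A + 2 * t * B + t\<^sup>2 * C"
      using i by (simp add: A_def B_def C_def)
    finally show ?thesis .
  qed
  have C: "C \<ge> 0" and A: "A \<ge> 0" by (auto simp: C_def A_def)
  have "B\<^sup>2 \<le> A * C"
  proof (cases "C = 0")
    case True
    have "B = 0"
    proof (rule ccontr)
      assume "B \<noteq> 0"
      \<comment> \<open>With \<open>C\<close> = 0 the quadratic is affine in its argument, and at
        this point its value is -1.\<close>
      then show False using q[of "- (A + 1) / (2 * B)"] True A by (simp add: field_simps)
    qed
    then show ?thesis using A C by simp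
  next
    case False
    then have "C > 0" using C by simp
    have "0 \<le> A + 2 * (- B / C) * B + (- B / C)\<^sup>2 * C" by (rule q)
    also have "\<dots> = A - B\<^sup>2 / C" using \<open>C > 0\<close> by (simp add: field_simps power2_eq_square)
    finally show ?thesis using \<open>C > 0\<close> by (simp add: field_simps)
  qed
  then have "sqrt (B\<^sup>2) \<le> sqrt (A * C)" by (rule real_sqrt_le_mono)
  then show ?thesis by (simp add: nrm2_def A_def B_def C_def real_sqrt_mult)
qed

lemma nrm2_triangle: assumes "sqi f" "sqi g" shows "nrm2 (\<lambda>x. f x + g x) \<le> nrm2 f + nrm2 g"
proof (rule power2_le_imp_le)
  have i: "integrable lebesgue (\<lambda>x. (f x)\<^sup>2)" "integrable lebesgue (\<lambda>x. (g x)\<^sup>2)" "integrable lebesgue (\<lambda>x. f x * g x)"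
    using assms sqi_mult_integrable by (auto simp: sqi_def)
  have "(nrm2 (\<lambda>x. f x + g x))\<^sup>2 = (LINT x|lebesgue. (f x)\<^sup>2 + 2 * (f x * g x) + (g x)\<^sup>2)"
    unfolding nrm2_sq by (intro Bochner_Integration.integral_cong) (auto simp: power2_eq_square algebra_simps)
  also have "\<dots> = (nrm2 f)\<^sup>2 + 2 * (LINT x|lebesgue. f x * g x) + (nrm2 g)\<^sup>2"
    unfolding nrm2_sq using i by simp
  also have "\<dots> \<le> (nrm2 f)\<^sup>2 + 2 * (nrm2 f * nrm2 g) + (nrm2 g)\<^sup>2"
    using nrm2_Cauchy_Schwarz[OF assms] by linarith
  also have "\<dots> = (nrm2 f + nrm2 g)\<^sup>2" by (simp add: power2_sum)
  finally show "(nrm2 (\<lambda>x. f x + g x))\<^sup>2 \<le> (nrm2 f + nrm2 g)\<^sup>2" .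
qed (simp add: nrm2_nonneg)

lemma nrm2_cmult: "nrm2 (\<lambda>x. c * f x) = \<bar>c\<bar> * nrm2 f"
  by (simp add: nrm2_def power_mult_distrib real_sqrt_mult)

\<comment> \<open>The quotient is partial, the relation being reflexive exactly on square integrable
  functions. The functions live on the whole line; elements of L2 on a domain are embedded by zero
  extension, so a single type serves all domains.\<close>
quotient_type l2 = "real \<Rightarrow> real" / partial: "\<lambda>f g. sqi f \<and> sqi g \<and> (AE x in lebesgue. f x = g x)"
  by (rule part_equivpI) (auto intro: exI[of _ "\<lambda>x. 0"] sqi_zero symp_def[THEN iffD2] transp_def[THEN iffD2] elim: eventually_elim2 eventually_mono)

instantiation l2 :: real_normed_vector
begin

lift_definition zero_l2 :: l2 is "\<lambda>x. 0" by (simp add: sqi_zero)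
lift_definition plus_l2 :: "l2 \<Rightarrow> l2 \<Rightarrow> l2" is "\<lambda>f g x. f x + g x" by (auto intro: sqi_add elim: eventually_elim2)
lift_definition minus_l2 :: "l2 \<Rightarrow> l2 \<Rightarrow> l2" is "\<lambda>f g x. f x - g x" by (auto intro: sqi_diff elim: eventually_elim2)
lift_definition uminus_l2 :: "l2 \<Rightarrow> l2" is "\<lambda>f x. (-1) * f x" by (auto intro: sqi_cmult[of _ "-1", simplified] elim: eventually_mono)
lift_definition scaleR_l2 :: "real \<Rightarrow> l2 \<Rightarrow> l2" is "\<lambda>c f x. c * f x" by (auto intro: sqi_cmult elim: eventually_mono)
lift_definition norm_l2 :: "l2 \<Rightarrow> real" is nrm2 by (auto intro: nrm2_cong_AE)
definition "dist_l2 (f::l2) g = norm (f - g)"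
definition "sgn_l2 (f::l2) = inverse (norm f) *\<^sub>R f"
definition "uniformity_l2 = (INF e\<in>{0<..}. principal {(x::l2, y). dist x y < e})"
definition "open_l2 (U::l2 set) \<longleftrightarrow> (\<forall>x\<in>U. \<forall>\<^sub>F (x', y) in uniformity. x' = x \<longrightarrow> y \<in> U)"

instance
proof
  fix x y z :: l2 and a b :: real
  show "x + y + z = x + (y + z)" by transfer (auto intro!: sqi_add simp: algebra_simps)
  show "x + y = y + x" by transfer (auto intro!: sqi_add simp: algebra_simps)
  show "0 + x = x" by transfer auto
  show "- x + x = 0" by transfer (auto intro!: sqi_add sqi_zero sqi_cmult[of _ "-1", simplified])
  show "x - y = x + - y" by transfer (auto intro!: sqi_add sqi_diff sqi_cmult[of _ "-1", simplified])
  show "a *\<^sub>R (x + y) = a *\<^sub>R x + a *\<^sub>R y" by transfer (auto intro!: sqi_add sqi_cmult simp: algebra_simps)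
  show "(a + b) *\<^sub>R x = a *\<^sub>R x + b *\<^sub>R x" by transfer (auto intro!: sqi_add sqi_cmult simp: algebra_simps)
  show "a *\<^sub>R b *\<^sub>R x = (a * b) *\<^sub>R x" by transfer (auto intro!: sqi_cmult simp: algebra_simps)
  show "1 *\<^sub>R x = x" by transfer auto
  show "dist x y = norm (x - y)" by (rule dist_l2_def)
  show "sgn x = inverse (norm x) *\<^sub>R x" by (rule sgn_l2_def)
  show "(uniformity :: (l2 \<times> l2) filter) = (INF e\<in>{0<..}. principal {(x, y). dist x y < e})" by (rule uniformity_l2_def)
  show "open U \<longleftrightarrow> (\<forall>x\<in>U. \<forall>\<^sub>F (x', y) in uniformity. x' = x \<longrightarrow> y \<in> U)" for U :: "l2 set" by (rule open_l2_def)
  show "norm x = 0 \<longleftrightarrow> x = 0"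
  proof transfer
    fix f assume "sqi f \<and> sqi f \<and> (AE x in lebesgue. f x = f x)"
    then have f: "sqi f" by simp
    have "nrm2 f = 0 \<longleftrightarrow> (AE x in lebesgue. (f x)\<^sup>2 = 0)"
      unfolding nrm2_def using f by (simp add: integral_nonneg_eq_0_iff_AE sqi_def)
    then show "nrm2 f = 0 \<longleftrightarrow> (sqi f \<and> sqi (\<lambda>x. 0) \<and> (AE x in lebesgue. f x = 0))"
      using f sqi_zero by simp
  qed
  show "norm (x + y) \<le> norm x + norm y" by transfer (auto intro: nrm2_triangle)
  show "norm (a *\<^sub>R x) = \<bar>a\<bar> * norm x" by transfer (rule nrm2_cmult)
qed

end

lemma abs_l2_eq_iff: "sqi f \<Longrightarrow> sqi g \<Longrightarrow> abs_l2 f = abs_l2 g \<longleftrightarrow> (AE x in lebesgue. f x = g x)"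
  using Quotient3_rel[OF Quotient3_l2, of f g] by simp

lemma rep_l2_sqi: "sqi (rep_l2 u)"
  using Quotient3_rep_reflp[OF Quotient3_l2, of u] by simp

lemma abs_rep_l2: "abs_l2 (rep_l2 u) = u"
  by (rule Quotient3_abs_rep[OF Quotient3_l2])

lemma norm_abs_l2: "sqi f \<Longrightarrow> norm (abs_l2 f) = nrm2 f"
  by (simp add: norm_l2.abs_eq)

lemma abs_l2_add: "sqi f \<Longrightarrow> sqi g \<Longrightarrow> abs_l2 f + abs_l2 g = abs_l2 (\<lambda>x. f x + g x)"
  and abs_l2_diff: "sqi f \<Longrightarrow> sqi g \<Longrightarrow> abs_l2 f - abs_l2 g = abs_l2 (\<lambda>x. f x - g x)"
  and abs_l2_scaleR: "sqi f \<Longrightarrow> c *\<^sub>R abs_l2 f = abs_l2 (\<lambda>x. c * f x)"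
  by (simp_all add: plus_l2.abs_eq minus_l2.abs_eq scaleR_l2.abs_eq)

lemma nn_integral_sqi: "sqi f \<Longrightarrow> (\<integral>\<^sup>+x. ennreal ((f x)\<^sup>2) \<partial>lebesgue) = ennreal ((nrm2 f)\<^sup>2)"
  unfolding nrm2_sq by (intro nn_integral_eq_integral) (auto simp: sqi_def)

lemma sqi_nn_integral: assumes "f \<in> borel_measurable lebesgue" "(\<integral>\<^sup>+x. ennreal ((f x)\<^sup>2) \<partial>lebesgue) \<le> ennreal (c\<^sup>2)" "c \<ge> 0"
  shows "sqi f" "nrm2 f \<le> c"
proof -
  have "integrable lebesgue (\<lambda>x. (f x)\<^sup>2)"
    using assms by (intro integrableI_bounded) (auto intro: le_less_trans)
  then show 1: "sqi f" using assms by (simp add: sqi_def)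
  have "(nrm2 f)\<^sup>2 \<le> c\<^sup>2" using nn_integral_sqi[OF 1] assms(2) by (simp add: ennreal_le_iff)
  then show "nrm2 f \<le> c" using assms(3) by (rule power2_le_imp_le)
qed

lemma nrm2_sum_le: fixes n :: nat shows "(\<And>i. i < n \<Longrightarrow> sqi (f i)) \<Longrightarrow> sqi (\<lambda>x. \<Sum>i<n. f i x) \<and> nrm2 (\<lambda>x. \<Sum>i<n. f i x) \<le> (\<Sum>i<n. nrm2 (f i))"
proof (induction n)
  case 0
  then show ?case by (simp add: sqi_zero nrm2_def)
next
  case (Suc n)
  then have IH: "sqi (\<lambda>x. \<Sum>i<n. f i x)" "nrm2 (\<lambda>x. \<Sum>i<n. f i x) \<le> (\<Sum>i<n. nrm2 (f i))" and s: "sqi (f n)" by auto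
  show ?case using sqi_add[OF IH(1) s] nrm2_triangle[OF IH(1) s] IH(2) by simp
qed

text \<open>Riesz-Fischer for a fast sequence: the sums of absolute increments are bounded in L2, so
  monotone convergence makes them finite almost everywhere and the telescoping series converges
  there. Fatou's lemma then gives the rate in norm.\<close>

lemma sqi_complete:
  assumes f: "\<And>n. sqi (f n)" and d: "\<And>n. nrm2 (\<lambda>x. f (Suc n) x - f n x) \<le> (1/2)^n"
  obtains F where "sqi F" "\<And>n. nrm2 (\<lambda>x. F x - f n x) \<le> 2 * (1/2)^n"
proof -
  have m: "f n \<in> borel_measurable lebesgue" for n using f by (simp add: sqi_def)
  define S where "S N x = (\<Sum>n<N. \<bar>f (Suc n) x - f n x\<bar>)" for N x
  have ab: "sqi (\<lambda>x. \<bar>f (Suc n) x - f n x\<bar>)" "nrm2 (\<lambda>x. \<bar>f (Suc n) x - f n x\<bar>) \<le> (1/2)^n" for n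
  proof -
    have "nrm2 (\<lambda>x. \<bar>f (Suc n) x - f n x\<bar>) = nrm2 (\<lambda>x. f (Suc n) x - f n x)" by (simp add: nrm2_def)
    then show "nrm2 (\<lambda>x. \<bar>f (Suc n) x - f n x\<bar>) \<le> (1/2)^n" using d by simp
    show "sqi (\<lambda>x. \<bar>f (Suc n) x - f n x\<bar>)" using sqi_diff[OF f f, of "Suc n" n] by (auto simp: sqi_def intro!: borel_measurable_abs)
  qed
  have S: "sqi (S N)" "nrm2 (S N) \<le> 2" for N
  proof -
    have "(\<Sum>n<N. nrm2 (\<lambda>x. \<bar>f (Suc n) x - f n x\<bar>)) \<le> (\<Sum>n<N. (1/2::real)^n)" by (intro sum_mono ab)
    also have "\<dots> \<le> 2" by (simp add: geometric_sum)
    finally show "sqi (S N)" "nrm2 (S N) \<le> 2"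
      using nrm2_sum_le[of N "\<lambda>n x. \<bar>f (Suc n) x - f n x\<bar>"] ab unfolding S_def[abs_def] by auto
  qed
  have Smono: "mono (\<lambda>N. S N x)" for x unfolding S_def by (intro monoI sum_mono2) auto
  have Spos: "S N x \<ge> 0" for N x unfolding S_def by (intro sum_nonneg) auto
  have "(\<integral>\<^sup>+x. (SUP N. ennreal ((S N x)\<^sup>2)) \<partial>lebesgue) = (SUP N. \<integral>\<^sup>+x. ennreal ((S N x)\<^sup>2) \<partial>lebesgue)"
    using S(1) Smono Spos
    by (intro nn_integral_monotone_convergence_SUP)
      (auto simp: sqi_def incseq_def le_fun_def mono_def intro!: ennreal_leI power_mono)
  also have "\<dots> \<le> ennreal (2\<^sup>2)"
  proof (rule SUP_least)
    fix N
    have "(nrm2 (S N))\<^sup>2 \<le> 2\<^sup>2" by (intro power_mono S nrm2_nonneg)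
    then show "(\<integral>\<^sup>+x. ennreal ((S N x)\<^sup>2) \<partial>lebesgue) \<le> ennreal (2\<^sup>2)"
      unfolding nn_integral_sqi[OF S(1)] by (rule ennreal_leI)
  qed
  finally have "(\<integral>\<^sup>+x. (SUP N. ennreal ((S N x)\<^sup>2)) \<partial>lebesgue) \<noteq> \<infinity>"
    by (metis ennreal_neq_top infinity_ennreal_def neq_top_trans)
  then have "AE x in lebesgue. (SUP N. ennreal ((S N x)\<^sup>2)) \<noteq> \<infinity>"
  proof (intro nn_integral_PInf_AE)
    have "S N \<in> borel_measurable lebesgue" for N using S(1) by (simp add: sqi_def)
    then show "(\<lambda>x. SUP N. ennreal ((S N x)\<^sup>2)) \<in> borel_measurable lebesgue"
      by (intro borel_measurable_SUP) auto
  qed auto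
  then have conv: "AE x in lebesgue. convergent (\<lambda>n. f n x)"
  proof eventually_elim
    case (elim x)
    define c where "c = enn2real (SUP N. ennreal ((S N x)\<^sup>2))"
    have c: "c \<ge> 0" "(SUP N. ennreal ((S N x)\<^sup>2)) = ennreal c"
    proof -
      show "c \<ge> 0" unfolding c_def by (rule enn2real_nonneg)
      show "(SUP N. ennreal ((S N x)\<^sup>2)) = ennreal c"
        unfolding c_def by (rule ennreal_enn2real[symmetric]) (use elim in \<open>simp only: infinity_ennreal_def less_top\<close>)
    qed
    have "S N x \<le> c + 1" for N
    proof -
      have "ennreal ((S N x)\<^sup>2) \<le> ennreal c" unfolding c(2)[symmetric] by (rule SUP_upper) simp
      then have "(S N x)\<^sup>2 \<le> c" using c(1) by (simp add: ennreal_le_iff)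
      also have "c \<le> (c + 1)\<^sup>2" using c(1) by (simp add: power2_eq_square algebra_simps)
      finally show ?thesis by (rule power2_le_imp_le) (use c(1) in simp)
    qed
    then have "summable (\<lambda>n. \<bar>f (Suc n) x - f n x\<bar>)"
      unfolding S_def by (intro summableI_nonneg_bounded[of _ "c + 1"]) auto
    then have "summable (\<lambda>n. f (Suc n) x - f n x)" by (rule summable_rabs_cancel)
    then have "convergent (\<lambda>n. \<Sum>i<n. f (Suc i) x - f i x)" by (simp add: summable_iff_convergent)
    then have "convergent (\<lambda>n. f n x - f 0 x)" by (simp only: sum_lessThan_telescope[of "\<lambda>i. f i x"])
    then have "convergent (\<lambda>n. (f n x - f 0 x) + f 0 x)" by (intro convergent_add convergent_const)
    then show ?case by simp
  qed
  define F where "F x = lim (\<lambda>n. f n x)" for x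
  have mF: "F \<in> borel_measurable lebesgue" unfolding F_def using m by (intro borel_measurable_lim_metric) auto
  have lim: "AE x in lebesgue. (\<lambda>n. f n x) \<longlonglongrightarrow> F x"
    using conv by eventually_elim (simp add: F_def convergent_LIMSEQ_iff)
  have fdist: "nrm2 (\<lambda>x. f (n + k) x - f n x) \<le> 2 * (1/2)^n" for n k
  proof -
    have "(\<lambda>x. f (n + k) x - f n x) = (\<lambda>x. \<Sum>i<k. (f (Suc (n + i)) x - f (n + i) x))"
      using sum_lessThan_telescope[of "\<lambda>i. f (n + i) _" k] by auto
    then have "nrm2 (\<lambda>x. f (n + k) x - f n x) \<le> (\<Sum>i<k. nrm2 (\<lambda>x. f (Suc (n + i)) x - f (n + i) x))"
      using nrm2_sum_le[of k "\<lambda>i x. f (Suc (n + i)) x - f (n + i) x"] sqi_diff[OF f f] by simp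
    also have "\<dots> \<le> (\<Sum>i<k. (1/2)^n * (1/2::real)^i)" using d[of "n + _"] by (intro sum_mono) (simp only: power_add[symmetric])
    also have "\<dots> = (1/2)^n * (\<Sum>i<k. (1/2::real)^i)" by (simp add: sum_distrib_left)
    also have "\<dots> \<le> (1/2)^n * 2" by (intro mult_left_mono) (auto simp: geometric_sum)
    finally show ?thesis by simp
  qed
  \<comment> \<open>Fatou's lemma applied to the estimate \<open>fdist\<close> as the second index
    tends to infinity.\<close>
  have bnd: "(\<integral>\<^sup>+x. ennreal ((F x - f n x)\<^sup>2) \<partial>lebesgue) \<le> ennreal ((2 * (1/2)^n)\<^sup>2)" for n
  proof -
    have "(\<integral>\<^sup>+x. ennreal ((F x - f n x)\<^sup>2) \<partial>lebesgue) = (\<integral>\<^sup>+x. liminf (\<lambda>k. ennreal ((f (n + k) x - f n x)\<^sup>2)) \<partial>lebesgue)"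
    proof (rule nn_integral_cong_AE)
      show "AE x in lebesgue. ennreal ((F x - f n x)\<^sup>2) = liminf (\<lambda>k. ennreal ((f (n + k) x - f n x)\<^sup>2))"
        using lim
      proof eventually_elim
        case (elim x)
        have "(\<lambda>k. f (k + n) x) \<longlonglongrightarrow> F x" using elim by (rule LIMSEQ_ignore_initial_segment)
        then have "(\<lambda>k. ennreal ((f (n + k) x - f n x)\<^sup>2)) \<longlonglongrightarrow> ennreal ((F x - f n x)\<^sup>2)"
          by (intro tendsto_intros) (simp add: add.commute)
        then show ?case using lim_imp_Liminf[OF sequentially_bot] by metis
      qed
    qed
    also have "\<dots> \<le> liminf (\<lambda>k. \<integral>\<^sup>+x. ennreal ((f (n + k) x - f n x)\<^sup>2) \<partial>lebesgue)"
      using m by (intro nn_integral_liminf) auto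
    also have "\<dots> \<le> ennreal ((2 * (1/2)^n)\<^sup>2)"
    proof (rule Liminf_le)
      show "\<forall>\<^sub>F k in sequentially. (\<integral>\<^sup>+x. ennreal ((f (n + k) x - f n x)\<^sup>2) \<partial>lebesgue) \<le> ennreal ((2 * (1/2)^n)\<^sup>2)"
        unfolding nn_integral_sqi[OF sqi_diff[OF f f]]
        by (intro always_eventually allI ennreal_leI power_mono fdist nrm2_nonneg)
    qed simp
    finally show ?thesis .
  qed
  have Ff: "sqi (\<lambda>x. F x - f n x)" "nrm2 (\<lambda>x. F x - f n x) \<le> 2 * (1/2)^n" for n
    using sqi_nn_integral[OF _ bnd] mF m by auto
  have "sqi F" using sqi_add[OF Ff(1)[of 0] f[of 0]] by simp
  then show ?thesis using Ff(2) that by blast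
qed

instance l2 :: banach
proof
  fix X :: "nat \<Rightarrow> l2" assume X: "Cauchy X"
  have "\<exists>N. \<forall>m\<ge>N. \<forall>k\<ge>N. norm (X m - X k) < (1/2)^n" for n :: nat
    using X[unfolded Cauchy_iff, rule_format, of "(1/2)^n"] by simp
  then obtain N where N: "\<And>n m k. m \<ge> N n \<Longrightarrow> k \<ge> N n \<Longrightarrow> norm (X m - X k) < (1/2)^n" by metis
  \<comment> \<open>Partial sums make the indices increasing, so that both \<open>r n\<close> and
    \<open>r (Suc n)\<close> exceed the threshold \<open>N n\<close>.\<close>
  define r where "r n = (\<Sum>i\<le>n. N i)" for n
  have r: "r n \<ge> N n" "r (Suc n) \<ge> N n" for n unfolding r_def by (simp_all add: sum.atMost_Suc lessThan_Suc_atMost[symmetric])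
  define f where "f n = rep_l2 (X (r n))" for n
  have f: "sqi (f n)" "abs_l2 (f n) = X (r n)" for n by (auto simp: f_def rep_l2_sqi abs_rep_l2)
  have "nrm2 (\<lambda>x. f (Suc n) x - f n x) = norm (X (r (Suc n)) - X (r n))" for n
    using norm_abs_l2[OF sqi_diff[OF f(1) f(1)], of "Suc n" n] abs_l2_diff[OF f(1) f(1)] f(2) by simp
  then have d: "nrm2 (\<lambda>x. f (Suc n) x - f n x) \<le> (1/2)^n" for n using N[of n "r (Suc n)" "r n"] r by (simp add: less_imp_le)
  obtain F where F: "sqi F" "\<And>n. nrm2 (\<lambda>x. F x - f n x) \<le> 2 * (1/2)^n"
    by (rule sqi_complete[OF f(1) d]) blast
  have F': "norm (abs_l2 F - X (r n)) \<le> 2 * (1/2)^n" for n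
    using norm_abs_l2[OF sqi_diff[OF F(1) f(1)], of n] abs_l2_diff[OF F(1) f(1), of n] f(2)[of n] F(2)[of n] by simp
  have "X \<longlonglongrightarrow> abs_l2 F"
  proof (rule LIMSEQ_I)
    fix e :: real assume e: "e > 0"
    obtain n where n: "(1/2::real)^n < e / 3" using real_arch_pow_inv[of "e/3" "1/2"] e by auto
    have "norm (X k - abs_l2 F) < e" if "k \<ge> N n" for k
    proof -
      have "norm (X k - abs_l2 F) \<le> norm (X k - X (r n)) + norm (abs_l2 F - X (r n))"
        using norm_triangle_ineq4[of "X k - X (r n)" "abs_l2 F - X (r n)"] by simp
      also have "\<dots> < (1/2)^n + 2 * (1/2)^n" using N[of n k "r n"] r that F'[of n] by simp
      also have "\<dots> < e" using n by simp
      finally show ?thesis .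
    qed
    then show "\<exists>N. \<forall>k\<ge>N. norm (X k - abs_l2 F) < e" by blast
  qed
  then show "convergent X" by (rule convergentI)
qed

text \<open>This metric induces the discrete topology, so bounded continuous functions on
  \<open>nat\<close> are simply bounded sequences; having a metric on the index type makes the
  completeness of \<open>bcontfun\<close> available for sequences in \<open>l2\<close>.\<close>

instantiation nat :: metric_space
begin

definition dist_nat :: "nat \<Rightarrow> nat \<Rightarrow> real" where "dist_nat m n = \<bar>real m - real n\<bar>"

definition uniformity_nat :: "(nat \<times> nat) filter" where
  "uniformity_nat = (INF e\<in>{0<..}. principal {(x, y). dist x y < e})"

instance
proof
  show "uniformity = (INF e\<in>{0<..}. principal {(x::nat, y). dist x y < e})" by (rule uniformity_nat_def)
  fix U :: "nat set"
  have sep: "x = y" if "dist x y < 1" for x y :: nat using that by (auto simp: dist_nat_def)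
  have "\<forall>\<^sub>F (x', y) in uniformity. x' = x \<longrightarrow> y \<in> U" if "x \<in> U" for x
    unfolding uniformity_nat_def
    by (rule eventually_INF1[of 1]) (use that sep in \<open>auto simp: eventually_principal\<close>)
  then show "open U \<longleftrightarrow> (\<forall>x\<in>U. \<forall>\<^sub>F (x', y) in uniformity. x' = x \<longrightarrow> y \<in> U)" by (simp add: open_discrete)
qed (auto simp: dist_nat_def)

end

instance bcontfun :: (metric_space, banach) banach ..

section \<open>Sobolev functions on the exterior domain\<close>

lemma has_weak_deriv_Suc:
  assumes "has_weak_deriv E k f g" "has_weak_deriv E 1 g h" shows "has_weak_deriv E (Suc k) f h"
  unfolding has_weak_deriv_def
proof (intro conjI allI impI)
  fix \<phi> assume t: "test_function E \<phi>"
  have "(LINT x:E|lebesgue. f x * (deriv ^^ Suc k) \<phi> x) = (LINT x:E|lebesgue. f x * (deriv ^^ k) (deriv \<phi>) x)"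
    by (simp add: funpow_Suc_right del: funpow.simps(2))
  also have "\<dots> = (-1) ^ k * (LINT x:E|lebesgue. g x * deriv \<phi> x)"
    using assms(1) test_function_deriv[OF t] unfolding has_weak_deriv_def by blast
  also have "(LINT x:E|lebesgue. g x * deriv \<phi> x) = - (LINT x:E|lebesgue. h x * \<phi> x)"
    using assms(2) t by (auto simp: has_weak_deriv_def)
  finally show "(LINT x:E|lebesgue. f x * (deriv ^^ Suc k) \<phi> x) = (-1) ^ Suc k * (LINT x:E|lebesgue. h x * \<phi> x)" by simp
qed (use assms in \<open>auto simp: has_weak_deriv_def\<close>)

text \<open>The derivative of a test function is a test function, so both hypotheses evaluate the
  same pairing of \<open>f\<close> with the derivative of order k+1.\<close>

lemma has_weak_deriv_Suc_D:
  assumes "has_weak_deriv E k f g" "has_weak_deriv E (Suc k) f h" shows "has_weak_deriv E 1 g h"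
  unfolding has_weak_deriv_def
proof (intro conjI allI impI)
  fix \<phi> assume t: "test_function E \<phi>"
  have "(-1) ^ k * (LINT x:E|lebesgue. g x * deriv \<phi> x) = (LINT x:E|lebesgue. f x * (deriv ^^ k) (deriv \<phi>) x)"
    using assms(1) test_function_deriv[OF t] by (simp add: has_weak_deriv_def)
  also have "\<dots> = (LINT x:E|lebesgue. f x * (deriv ^^ Suc k) \<phi> x)"
    by (simp add: funpow_Suc_right del: funpow.simps(2))
  also have "\<dots> = (-1) ^ Suc k * (LINT x:E|lebesgue. h x * \<phi> x)"
    using assms(2) t unfolding has_weak_deriv_def by blast
  finally have "(-1::real) ^ k * (LINT x:E|lebesgue. g x * deriv \<phi> x) = (-1) ^ k * (- (LINT x:E|lebesgue. h x * \<phi> x))" by simp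
  then have "(LINT x:E|lebesgue. g x * deriv \<phi> x) = - (LINT x:E|lebesgue. h x * \<phi> x)"
    by (subst (asm) mult_left_cancel) auto
  then show "(LINT x:E|lebesgue. g x * (deriv ^^ 1) \<phi> x) = (-1) ^ 1 * (LINT x:E|lebesgue. h x * \<phi> x)"
    by simp
qed (use assms in \<open>auto simp: has_weak_deriv_def\<close>)

lemma sqi_indicator: "sqi (\<lambda>x. indicat_real {a..b} x)"
proof -
  have "(\<lambda>x. (indicat_real {a..b} x)\<^sup>2) = indicat_real {a..b}" by (auto split: split_indicator)
  then show ?thesis by (auto simp: sqi_def emeasure_lborel_Icc_eq intro!: borel_measurable_indicator)
qed

lemma nrm2_indicator: "a \<le> b \<Longrightarrow> nrm2 (\<lambda>x. indicat_real {a..b} x) = sqrt (b - a)"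
proof -
  have "(\<lambda>x. (indicat_real {a..b} x)\<^sup>2) = indicat_real {a..b}" by (auto split: split_indicator)
  then show "a \<le> b \<Longrightarrow> ?thesis" by (simp add: nrm2_def)
qed

locale dom =
  fixes r l :: real
  assumes r0: "0 < r" and rl: "r < l"
begin

abbreviation E where "E \<equiv> domE r l"
abbreviation aeE :: "(real \<Rightarrow> bool) \<Rightarrow> bool" (binder "AEE " 10) where
  "aeE P \<equiv> AE x in lebesgue. x \<in> E \<longrightarrow> P x"

text \<open>The boundary points -r, r, l are attached to \<open>E\<close> so that
  \<open>AC Eb\<close> includes traces. Because the inner gap has positive length, intervals inside
  \<open>Eb\<close> never cross from one component to the other.\<close>

definition Eb :: "real set" where "Eb = {..-r} \<union> {r..l}"
definition ext :: "(real \<Rightarrow> real) \<Rightarrow> real \<Rightarrow> real" where "ext f x = indicat_real E x * f x"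
definition nE :: "(real \<Rightarrow> real) \<Rightarrow> real" where "nE f = nrm2 (ext f)"

lemma open_E: "open E" by (auto simp: domE_def intro!: open_Un)
lemma E_Eb: "E \<subseteq> Eb" by (auto simp: domE_def Eb_def)
lemma E_sets: "E \<in> sets lebesgue" using open_E by (simp add: borel_open)
lemma Eb_sets: "Eb \<in> sets lebesgue" by (auto simp: Eb_def)
lemma bdry_Eb: "-r \<in> Eb" "r \<in> Eb" "l \<in> Eb" using rl by (auto simp: Eb_def)

lemma AE_E_Eb: "(AEE x. P x) \<Longrightarrow> (AE x in lebesgue. x \<in> Eb \<longrightarrow> P x)"
proof -
  assume a: "AEE x. P x"
  have "AE x in lebesgue. x \<notin> {-r, r, l}" by (rule AE_I'[where N="{-r, r, l}"]) (auto intro: finite_imp_null_set_lborel)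
  then show ?thesis using a by eventually_elim (auto simp: domE_def Eb_def)
qed

lemma L2_iff_sqi: "f \<in> L2 E \<longleftrightarrow> sqi (ext f)"
proof -
  have "(\<lambda>x. indicat_real E x *\<^sub>R (f x)\<^sup>2) = (\<lambda>x. (ext f x)\<^sup>2)"
    by (auto simp: ext_def split: split_indicator)
  then show ?thesis by (simp add: L2_def sqi_def set_borel_measurable_def set_integrable_def ext_def[abs_def])
qed

lemma nE_sq: "(nE f)\<^sup>2 = (LINT x:E|lebesgue. (f x)\<^sup>2)"
  unfolding nE_def nrm2_sq set_lebesgue_integral_def
  by (rule Bochner_Integration.integral_cong) (auto simp: ext_def split: split_indicator)

lemma nE_nonneg: "nE f \<ge> 0" by (simp add: nE_def nrm2_nonneg)

lemma ext_add: "ext (\<lambda>x. f x + g x) = (\<lambda>x. ext f x + ext g x)"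
  and ext_diff: "ext (\<lambda>x. f x - g x) = (\<lambda>x. ext f x - ext g x)"
  and ext_cmult: "ext (\<lambda>x. c * f x) = (\<lambda>x. c * ext f x)"
  and ext_mult: "ext (\<lambda>x. f x * g x) = (\<lambda>x. ext f x * ext g x)"
  by (auto simp: ext_def algebra_simps split: split_indicator)

lemma ext_AE_cong: "AEE x. f x = g x \<Longrightarrow> AE x in lebesgue. ext f x = ext g x"
  by (rule eventually_mono[of "\<lambda>x. x \<in> E \<longrightarrow> f x = g x"]) (auto simp: ext_def split: split_indicator)

lemma ext_AE_D: "AE x in lebesgue. ext f x = ext g x \<Longrightarrow> AEE x. f x = g x"
  by (rule eventually_mono[of "\<lambda>x. ext f x = ext g x"]) (auto simp: ext_def split: split_indicator)

lemma sqi_ext_cong: "sqi (ext f) \<Longrightarrow> AEE x. f x = g x \<Longrightarrow> sqi (ext g)"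
  using sqi_cong_AE ext_AE_cong by blast

lemma nE_add: "sqi (ext f) \<Longrightarrow> sqi (ext g) \<Longrightarrow> nE (\<lambda>x. f x + g x) \<le> nE f + nE g"
  unfolding nE_def ext_add by (rule nrm2_triangle)

lemma nE_cmult: "nE (\<lambda>x. c * f x) = \<bar>c\<bar> * nE f"
  unfolding nE_def ext_cmult by (rule nrm2_cmult)

lemma nE_mult:
  assumes "sqi (ext f)" "sqi (ext g)" "\<And>x. x \<in> E \<Longrightarrow> \<bar>g x\<bar> \<le> b"
  shows "sqi (ext (\<lambda>x. f x * g x))" "nE (\<lambda>x. f x * g x) \<le> b * nE f"
proof -
  have b: "b \<ge> 0" using assms(3)[of "-r-1"] by (auto simp: domE_def intro: order_trans[rotated])
  have m: "ext (\<lambda>x. f x * g x) \<in> borel_measurable lebesgue" using assms by (auto simp: ext_mult sqi_def)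
  have le: "(ext (\<lambda>x. f x * g x) x)\<^sup>2 \<le> (b * ext f x)\<^sup>2" for x
    using assms(3)[of x] mult_mono[OF assms(3)[of x] order_refl[of "\<bar>f x\<bar>"] b] b
    by (auto simp: ext_def abs_le_square_iff[symmetric] abs_mult mult.commute split: split_indicator)
  have s: "sqi (\<lambda>x. b * ext f x)" using assms by (intro sqi_cmult)
  have i: "integrable lebesgue (\<lambda>x. (ext (\<lambda>x. f x * g x) x)\<^sup>2)"
    by (rule Bochner_Integration.integrable_bound[where f="\<lambda>x. (b * ext f x)\<^sup>2"]) (use s m le in \<open>auto simp: sqi_def\<close>)
  then show "sqi (ext (\<lambda>x. f x * g x))" using m by (simp add: sqi_def)
  have "nE (\<lambda>x. f x * g x) \<le> nrm2 (\<lambda>x. b * ext f x)"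
    unfolding nE_def nrm2_def using i s le by (intro real_sqrt_le_mono integral_mono) (auto simp: sqi_def)
  then show "nE (\<lambda>x. f x * g x) \<le> b * nE f" using b by (simp add: nrm2_cmult nE_def)
qed

lemma sqi_abs_integrable:
  assumes s: "sqi (ext f)" and sub: "{a..b} \<subseteq> Eb"
  shows "f absolutely_integrable_on {a..b}" "a \<le> b \<Longrightarrow> integral {a..b} (\<lambda>x. \<bar>f x\<bar>) \<le> sqrt (b - a) * nE f"
proof -
  have "AE x in lebesgue. x \<in> Eb \<longrightarrow> ext f x = f x"
    by (rule AE_E_Eb) (auto simp: ext_def)
  then have ae: "AE x in lebesgue. indicat_real {a..b} x * \<bar>ext f x\<bar> = indicat_real {a..b} x * \<bar>f x\<bar>"
    and ae1: "AE x in lebesgue. indicat_real {a..b} x * ext f x = indicat_real {a..b} x * f x"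
    using sub by (auto elim!: eventually_mono split: split_indicator)
  have i: "integrable lebesgue (\<lambda>x. indicat_real {a..b} x * ext f x)"
    by (rule sqi_mult_integrable[OF sqi_indicator s])
  have "(\<lambda>x. indicat_real {a..b} x * f x) \<in> borel_measurable lebesgue"
    by (rule borel_measurable_AE[OF borel_measurable_integrable[OF i] ae1])
  then have if1: "integrable lebesgue (\<lambda>x. indicat_real {a..b} x * f x)"
    by (rule integrable_cong_AE_imp[OF i]) (use ae1 in \<open>auto elim: eventually_mono\<close>)
  then show 1: "f absolutely_integrable_on {a..b}" by (simp add: set_integrable_def)
  have s': "sqi (\<lambda>x. \<bar>ext f x\<bar>)" and n': "nrm2 (\<lambda>x. \<bar>ext f x\<bar>) = nrm2 (ext f)"
    using s by (auto simp: sqi_def nrm2_def)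
  assume ab: "a \<le> b"
  have "integral {a..b} (\<lambda>x. \<bar>f x\<bar>) = (LINT x:{a..b}|lebesgue. \<bar>f x\<bar>)"
    using set_lebesgue_integral_eq_integral(2)[OF set_integrable_abs[OF 1]] by simp
  also have "\<dots> = (LINT x|lebesgue. indicat_real {a..b} x * \<bar>ext f x\<bar>)"
    unfolding set_lebesgue_integral_def
  proof (rule integral_cong_AE)
    show "AE x in lebesgue. indicat_real {a..b} x *\<^sub>R \<bar>f x\<bar> = indicat_real {a..b} x * \<bar>ext f x\<bar>" using ae by (auto elim: eventually_mono)
    have "(\<lambda>x. \<bar>indicat_real {a..b} x * f x\<bar>) \<in> borel_measurable lebesgue" using if1 by auto
    then show "(\<lambda>x. indicat_real {a..b} x *\<^sub>R \<bar>f x\<bar>) \<in> borel_measurable lebesgue" by (simp add: abs_mult)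
    show "(\<lambda>x. indicat_real {a..b} x * \<bar>ext f x\<bar>) \<in> borel_measurable lebesgue"
      using sqi_mult_integrable[OF sqi_indicator s'] by auto
  qed
  also have "\<dots> \<le> sqrt (b - a) * nE f"
    using nrm2_Cauchy_Schwarz[OF sqi_indicator s', of a b] nrm2_indicator[OF ab] n' by (simp add: nE_def)
  finally show "integral {a..b} (\<lambda>x. \<bar>f x\<bar>) \<le> sqrt (b - a) * nE f" .
qed

text \<open>The constant of the embedding of H^1 into bounded functions: (1 + d) / d with d =
  \<open>min 1 (l - r)\<close>, a length for which every point of \<open>Eb\<close> lies in an
  interval of length d inside its own component.\<close>

definition CS :: real where "CS = 1 / min 1 (l - r) + 1"

lemma CS_ge: "CS \<ge> 1" using rl by (auto simp: CS_def)

lemma interval_around: assumes "x \<in> Eb"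
  obtains a where "x \<in> {a..a + min 1 (l - r)}" "{a..a + min 1 (l - r)} \<subseteq> Eb"
proof -
  let ?d = "min 1 (l - r)"
  have d: "?d > 0" "?d \<le> l - r" using rl by auto
  show ?thesis
  proof (cases "x \<le> -r")
    case True
    have "{x - ?d..x - ?d + ?d} \<subseteq> {..-r}" using True by auto
    moreover have "x \<in> {x - ?d..x - ?d + ?d}" using d by auto
    ultimately show ?thesis using that[of "x - ?d"] unfolding Eb_def by blast
  next
    case False
    then have x: "r \<le> x" "x \<le> l" using assms by (auto simp: Eb_def)
    have "{min x (l - ?d)..min x (l - ?d) + ?d} \<subseteq> {r..l}" using x d(2) by (auto simp: min_le_iff_disj)
    moreover have "x \<in> {min x (l - ?d)..min x (l - ?d) + ?d}" using x d by (auto simp: min_def)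
    ultimately show ?thesis using that[of "min x (l - ?d)"] unfolding Eb_def by blast
  qed
qed

text \<open>On an interval of length d around the point, |f(x)| is at most |f(y)| plus the integral
  of |g|; averaging over y and using Cauchy-Schwarz with d at most 1 gives d |f(x)| <= c + d
  c.\<close>

lemma sup_bound:
  assumes AC: "AC Eb f g" and s: "sqi (ext f)" "sqi (ext g)" and c: "nE f \<le> c" "nE g \<le> c" and x: "x \<in> Eb"
  shows "\<bar>f x\<bar> \<le> CS * c"
proof -
  let ?d = "min 1 (l - r)"
  obtain a where a: "x \<in> {a..a + ?d}" "{a..a + ?d} \<subseteq> Eb" using interval_around[OF x] .
  have d: "0 < ?d" "?d \<le> 1" using rl by auto
  define b where "b = a + ?d"
  have ab: "a \<le> b" "{a..b} \<subseteq> Eb" "b - a = ?d" using a d by (auto simp: b_def)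
  have sq: "sqrt (b - a) \<le> 1" using ab d by simp
  have c0: "c \<ge> 0" using c nE_nonneg[of f] by linarith
  have Lf: "integral {a..b} (\<lambda>x. \<bar>f x\<bar>) \<le> c" and Lg: "integral {a..b} (\<lambda>x. \<bar>g x\<bar>) \<le> c"
  proof -
    have "sqrt (b - a) * nE h \<le> 1 * nE h" for h by (rule mult_right_mono[OF sq nE_nonneg])
    then show "integral {a..b} (\<lambda>x. \<bar>f x\<bar>) \<le> c" "integral {a..b} (\<lambda>x. \<bar>g x\<bar>) \<le> c"
      using sqi_abs_integrable(2)[OF s(1) ab(2,1)] sqi_abs_integrable(2)[OF s(2) ab(2,1)] c by (metis mult_1 order_trans)+
  qed
  have gi: "(\<lambda>x. \<bar>g x\<bar>) integrable_on {a..b}" and fi: "(\<lambda>x. \<bar>f x\<bar>) integrable_on {a..b}"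
    using set_integrable_abs[OF sqi_abs_integrable(1)[OF s(2) ab(2)]] set_integrable_abs[OF sqi_abs_integrable(1)[OF s(1) ab(2)]]
    by (simp_all add: absolutely_integrable_on_def)
  have pw: "\<bar>f x\<bar> \<le> \<bar>f y\<bar> + c" if y: "y \<in> {a..b}" for y
  proof -
    have *: "\<bar>f v - f u\<bar> \<le> c" if "u \<le> v" "u \<in> {a..b}" "v \<in> {a..b}" for u v
    proof -
      have sub: "{u..v} \<subseteq> {a..b}" using that by auto
      have "f v - f u = integral {u..v} g" using ACD(3)[OF AC that(1) order_trans[OF sub ab(2)]] by simp
      moreover have "\<bar>integral {u..v} g\<bar> \<le> integral {u..v} (\<lambda>x. \<bar>g x\<bar>)"
        using integral_norm_bound_integral[of g "{u..v}" "\<lambda>x. \<bar>g x\<bar>"] ACD(4)[OF AC that(1) order_trans[OF sub ab(2)]]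
          integrable_on_subinterval[OF gi sub] by auto
      moreover have "integral {u..v} (\<lambda>x. \<bar>g x\<bar>) \<le> integral {a..b} (\<lambda>x. \<bar>g x\<bar>)"
        by (rule integral_subset_le) (use sub gi integrable_on_subinterval[OF gi] in auto)
      ultimately show ?thesis using Lg by linarith
    qed
    have "x \<in> {a..b}" using a by (simp add: b_def)
    then have "\<bar>f x - f y\<bar> \<le> c" using *[of x y] *[of y x] y by (cases "x \<le> y") (auto simp: abs_minus_commute)
    then show ?thesis by linarith
  qed
  have "?d * \<bar>f x\<bar> = integral {a..b} (\<lambda>y. \<bar>f x\<bar>)" using ab by simp
  also have "\<dots> \<le> integral {a..b} (\<lambda>y. \<bar>f y\<bar> + c)"
    by (rule integral_le) (use pw fi in \<open>auto intro!: integrable_add\<close>)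
  also have "\<dots> = integral {a..b} (\<lambda>y. \<bar>f y\<bar>) + ?d * c"
    using ab fi by (subst Henstock_Kurzweil_Integration.integral_add) auto
  also have "\<dots> \<le> c + ?d * c" using Lf by simp
  finally have "\<bar>f x\<bar> \<le> (c + ?d * c) / ?d" using d by (simp add: pos_le_divide_eq mult.commute)
  also have "\<dots> = CS * c" using d by (simp add: CS_def field_simps)
  finally show ?thesis .
qed

text \<open>\<open>Hb k f c\<close>: the function \<open>f\<close> belongs to \<open>H\<^sup>k\<close>, is the absolutely continuous representative
  up to the boundary if \<open>k > 0\<close>, and all its derivatives of order up to \<open>k\<close> have norm at most \<open>c\<close>.\<close>

primrec Hb :: "nat \<Rightarrow> (real \<Rightarrow> real) \<Rightarrow> real \<Rightarrow> bool" where
  "Hb 0 f c \<longleftrightarrow> sqi (ext f) \<and> nE f \<le> c"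
| "Hb (Suc k) f c \<longleftrightarrow> sqi (ext f) \<and> nE f \<le> c \<and> (\<exists>g. AC Eb f g \<and> Hb k g c)"

lemma Hb_0D: "Hb k f c \<Longrightarrow> sqi (ext f)" "Hb k f c \<Longrightarrow> nE f \<le> c"
  by (cases k; simp)+

lemma Hb_nonneg: "Hb k f c \<Longrightarrow> c \<ge> 0"
  using Hb_0D(2) nE_nonneg order_trans by blast

lemma Hb_Suc_D: "Hb (Suc k) f c \<Longrightarrow> Hb k f c"
  by (induction k arbitrary: f) auto

lemma Hb_le: "Hb k f c \<Longrightarrow> j \<le> k \<Longrightarrow> Hb j f c"
  by (induction k) (auto simp del: Hb.simps(2) dest: Hb_Suc_D simp: le_Suc_eq)

lemma Hb_mono: "Hb k f c \<Longrightarrow> c \<le> d \<Longrightarrow> Hb k f d"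
  by (induction k arbitrary: f) (auto intro: order_trans)

lemma Hb_add: "Hb k f c \<Longrightarrow> Hb k g d \<Longrightarrow> Hb k (\<lambda>x. f x + g x) (c + d)"
proof (induction k arbitrary: f g)
  case 0
  then show ?case using nE_add[of f g] by (auto simp: ext_add intro: sqi_add)
next
  case (Suc k)
  then obtain f' g' where "AC Eb f f'" "Hb k f' c" "AC Eb g g'" "Hb k g' d" by auto
  then have "AC Eb (\<lambda>x. f x + g x) (\<lambda>x. f' x + g' x) \<and> Hb k (\<lambda>x. f' x + g' x) (c + d)"
    using Suc.IH AC_add by blast
  moreover have "sqi (ext (\<lambda>x. f x + g x)) \<and> nE (\<lambda>x. f x + g x) \<le> c + d"
    using Suc.prems nE_add[of f g] by (auto simp: ext_add intro: sqi_add)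
  ultimately show ?case unfolding Hb.simps by blast
qed

lemma Hb_cmult: "Hb k f c \<Longrightarrow> Hb k (\<lambda>x. a * f x) (\<bar>a\<bar> * c)"
proof (induction k arbitrary: f)
  case 0
  then show ?case by (auto simp: ext_cmult nE_cmult intro: sqi_cmult mult_left_mono)
next
  case (Suc k)
  then obtain f' where "AC Eb f f'" "Hb k f' c" by auto
  then have "AC Eb (\<lambda>x. a * f x) (\<lambda>x. a * f' x) \<and> Hb k (\<lambda>x. a * f' x) (\<bar>a\<bar> * c)"
    using Suc.IH AC_cmult by blast
  moreover have "sqi (ext (\<lambda>x. a * f x)) \<and> nE (\<lambda>x. a * f x) \<le> \<bar>a\<bar> * c"
    using Suc.prems by (auto simp: ext_cmult nE_cmult intro: sqi_cmult mult_left_mono)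
  ultimately show ?case unfolding Hb.simps by blast
qed

lemma Hb_minus: "Hb k f c \<Longrightarrow> Hb k (\<lambda>x. - f x) c"
  using Hb_cmult[of k f c "-1"] by simp

lemma Hb_diff: "Hb k f c \<Longrightarrow> Hb k g d \<Longrightarrow> Hb k (\<lambda>x. f x - g x) (c + d)"
  using Hb_add[of k f c "\<lambda>x. - g x" d] Hb_minus by auto

lemma ext_eqI: assumes "\<And>x. x \<in> Eb \<Longrightarrow> f x = g x" shows "ext f = ext g"
proof
  show "ext f x = ext g x" for x using assms[of x] E_Eb by (cases "x \<in> E") (auto simp: ext_def)
qed

lemma ext_zero: "ext (\<lambda>x. 0) = (\<lambda>x. 0)" by (simp add: ext_def[abs_def])

lemma Hb_cong: "Hb k f c \<Longrightarrow> (\<And>x. x \<in> Eb \<Longrightarrow> f x = g x) \<Longrightarrow> Hb k g c"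
proof (cases k)
  case 0
  assume a: "Hb k f c" "\<And>x. x \<in> Eb \<Longrightarrow> f x = g x"
  have "ext f = ext g" by (rule ext_eqI[OF a(2)])
  then show ?thesis using 0 a by (simp add: nE_def)
next
  case (Suc j)
  assume a: "Hb k f c" "\<And>x. x \<in> Eb \<Longrightarrow> f x = g x"
  have "ext f = ext g" by (rule ext_eqI[OF a(2)])
  moreover obtain f' where "AC Eb f f'" "Hb j f' c" using a Suc by auto
  moreover from this a(2) have "AC Eb g f'" by (auto intro: AC_cong)
  ultimately show ?thesis using Suc a by (auto simp: nE_def)
qed

lemma Hb_zero: "c \<ge> 0 \<Longrightarrow> Hb k (\<lambda>x. 0) c"
proof (induction k)
  case 0
  then show ?case by (simp add: nE_def ext_zero nrm2_def sqi_zero)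
next
  case (Suc k)
  then have "sqi (ext (\<lambda>x. 0)) \<and> nE (\<lambda>x. 0) \<le> c" by (simp add: nE_def ext_zero nrm2_def sqi_zero)
  then show ?case using Suc AC_const[of Eb 0] by auto
qed

lemma Hb_sup: "Hb k f c \<Longrightarrow> k \<ge> 1 \<Longrightarrow> x \<in> Eb \<Longrightarrow> \<bar>f x\<bar> \<le> CS * c"
proof -
  assume a: "Hb k f c" "k \<ge> 1" "x \<in> Eb"
  then have "Hb (Suc 0) f c" using Hb_le[OF a(1), of "Suc 0"] by simp
  then show ?thesis using sup_bound a(3) by auto
qed

primrec MC :: "nat \<Rightarrow> real" where
  "MC 0 = 1" | "MC (Suc k) = MC k * (1 + CS)"

lemma MC_ge: "MC k \<ge> 1"
proof (induction k)
  case (Suc k)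
  then have "1 * 1 \<le> MC k * (1 + CS)" using CS_ge by (intro mult_mono) auto
  then show ?case by simp
qed simp

text \<open>At order 0 the norm does not control the supremum, so the supremum bound is a separate
  clause. Bounded functions in H^k form an algebra for every k, including 0, which allows inductions
  starting at order 0.\<close>

definition Hs :: "nat \<Rightarrow> (real \<Rightarrow> real) \<Rightarrow> real \<Rightarrow> bool" where
  "Hs k f c \<longleftrightarrow> Hb k f c \<and> (\<forall>x\<in>Eb. \<bar>f x\<bar> \<le> c)"

text \<open>In f' g + f g' the factor without derivative is estimated in the supremum:
  \<open>g\<close> by hypothesis, \<open>f\<close> by the Sobolev embedding, available because
  \<open>f\<close> has at least one derivative in the inductive step. This is the origin of the
  factor 1 + \<open>CS\<close> in \<open>MC\<close>.\<close>

lemma Hb_mult: "Hb k f a \<Longrightarrow> Hs k g b \<Longrightarrow> Hb k (\<lambda>x. f x * g x) (MC k * a * b)"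
proof (induction k arbitrary: f g a b)
  case 0
  have sg: "sqi (ext g)" "\<And>x. x \<in> E \<Longrightarrow> \<bar>g x\<bar> \<le> b" and sf: "sqi (ext f)" "nE f \<le> a"
    using 0 E_Eb by (auto simp: Hs_def)
  have b: "b \<ge> 0" using 0 Hb_nonneg by (auto simp: Hs_def simp del: Hb.simps)
  have "b * nE f \<le> b * a" by (rule mult_left_mono[OF sf(2) b])
  then show ?case using nE_mult[OF sf(1) sg] by (auto simp: mult.commute)
next
  case (Suc k)
  have a0: "a \<ge> 0" and b0: "b \<ge> 0" using Suc.prems Hb_nonneg unfolding Hs_def by blast+
  obtain f' where f': "AC Eb f f'" "Hb k f' a" using Suc.prems by auto
  obtain g' where g': "AC Eb g g'" "Hb k g' b" using Suc.prems by (auto simp: Hs_def)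
  have fk: "Hb k f a" and gk: "Hb k g b" using Suc.prems Hb_Suc_D unfolding Hs_def by blast+
  have aCS: "a \<le> CS * a" using mult_right_mono[OF CS_ge a0] by simp
  have gs: "Hs k g b" using Suc.prems gk by (simp add: Hs_def)
  have fs: "Hs k f (CS * a)"
    unfolding Hs_def using Hb_mono[OF fk aCS] Hb_sup[OF Suc.prems(1)] by auto
  have h1: "Hb k (\<lambda>x. f' x * g x) (MC k * a * b)" by (rule Suc.IH[OF f'(2) gs])
  have "Hb k (\<lambda>x. g' x * f x) (MC k * b * (CS * a))" by (rule Suc.IH[OF g'(2) fs])
  then have h2: "Hb k (\<lambda>x. f x * g' x) (MC k * b * (CS * a))" by (simp add: mult.commute)
  have "Hb k (\<lambda>x. f' x * g x + f x * g' x) (MC k * a * b + MC k * b * (CS * a))" by (rule Hb_add[OF h1 h2])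
  moreover have eq: "MC k * a * b + MC k * b * (CS * a) = MC (Suc k) * a * b" by (simp add: algebra_simps)
  moreover have "AC Eb (\<lambda>x. f x * g x) (\<lambda>x. f' x * g x + f x * g' x)" by (rule AC_mult[OF f'(1) g'(1)])
  moreover have "Hb k (\<lambda>x. f x * g x) (MC k * a * b)" by (rule Suc.IH[OF fk gs])
  moreover have "MC k * a * b \<le> MC (Suc k) * a * b"
  proof -
    have "0 \<le> MC k * b * (CS * a)" using MC_ge[of k] CS_ge a0 b0 by simp
    then show ?thesis using eq by linarith
  qed
  ultimately show ?case using Hb_0D[of k "\<lambda>x. f x * g x" "MC k * a * b"] by auto
qed

text \<open>At most one factor carries the top order derivative, so the bound is linear in the top order norms.\<close>

lemma Hb_mult_tame:
  assumes "Hs k f a" "Hb (Suc k) f A" "Hs k g b" "Hb (Suc k) g B"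
  shows "Hb (Suc k) (\<lambda>x. f x * g x) (MC k * (A * b + B * a))"
proof -
  obtain f' where f': "AC Eb f f'" "Hb k f' A" using assms by auto
  obtain g' where g': "AC Eb g g'" "Hb k g' B" using assms by auto
  have pos: "a \<ge> 0" "b \<ge> 0" "A \<ge> 0" "B \<ge> 0" using assms Hb_nonneg unfolding Hs_def by blast+
  have h1: "Hb k (\<lambda>x. f' x * g x) (MC k * A * b)" by (rule Hb_mult[OF f'(2) assms(3)])
  have "Hb k (\<lambda>x. g' x * f x) (MC k * B * a)" by (rule Hb_mult[OF g'(2) assms(1)])
  then have h2: "Hb k (\<lambda>x. f x * g' x) (MC k * B * a)" by (simp add: mult.commute)
  have h: "Hb k (\<lambda>x. f' x * g x + f x * g' x) (MC k * (A * b + B * a))"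
    using Hb_add[OF h1 h2] by (simp add: algebra_simps)
  have "Hb k (\<lambda>x. f x * g x) (MC k * A * b)" by (rule Hb_mult[OF Hb_Suc_D[OF assms(2)] assms(3)])
  moreover have "MC k * A * b \<le> MC k * (A * b + B * a)" using pos MC_ge[of k] by (simp add: algebra_simps)
  ultimately have "Hb k (\<lambda>x. f x * g x) (MC k * (A * b + B * a))" by (rule Hb_mono)
  then show ?thesis using h AC_mult[OF f'(1) g'(1)] Hb_0D by auto
qed

section \<open>Chains of derivatives\<close>

text \<open>The same information as \<open>Hb\<close> without the bound, but with every intermediate
  derivative named. All members below the top order are absolutely continuous up to the boundary;
  the top one is only a class in L2.\<close>

definition chain :: "nat \<Rightarrow> (nat \<Rightarrow> real \<Rightarrow> real) \<Rightarrow> bool" where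
  "chain m u \<longleftrightarrow> (\<forall>k<m. AC Eb (u k) (u (Suc k))) \<and> (\<forall>k\<le>m. sqi (ext (u k)))"

lemma Hb_imp_chain: "Hb m f c \<Longrightarrow> \<exists>u. chain m u \<and> u 0 = f \<and> (\<forall>k\<le>m. nE (u k) \<le> c)"
proof (induction m arbitrary: f)
  case 0
  then show ?case by (intro exI[of _ "\<lambda>k. f"]) (auto simp: chain_def)
next
  case (Suc m)
  then obtain g where g: "AC Eb f g" "Hb m g c" by auto
  then obtain u where u: "chain m u" "u 0 = g" "\<forall>k\<le>m. nE (u k) \<le> c" using Suc.IH by blast
  let ?v = "\<lambda>k. case k of 0 \<Rightarrow> f | Suc j \<Rightarrow> u j"
  have "chain (Suc m) ?v"
    using u g Suc.prems unfolding chain_def by (auto split: nat.split simp: less_Suc_eq_0_disj le_Suc_eq)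
  then show ?case using u Suc.prems by (intro exI[of _ ?v]) (auto split: nat.split)
qed

lemma chain_imp_Hb: "chain m u \<Longrightarrow> (\<And>k. k \<le> m \<Longrightarrow> nE (u k) \<le> c) \<Longrightarrow> Hb m (u 0) c"
proof (induction m arbitrary: u)
  case 0
  then show ?case by (auto simp: chain_def)
next
  case (Suc m)
  have "chain m (\<lambda>k. u (Suc k))" using Suc.prems(1) by (auto simp: chain_def)
  then have "Hb m (u (Suc 0)) c" using Suc.IH[of "\<lambda>k. u (Suc k)"] Suc.prems(2) by auto
  then show ?case using Suc.prems by (auto simp: chain_def)
qed

lemma AC_Eb_I: assumes F1: "AC {..-r} F g" and F2: "AC {r..l} F g" shows "AC Eb F g"
  unfolding AC_def
proof (intro allI impI)
  fix a b :: real assume ab: "a \<le> b" "{a..b} \<subseteq> Eb"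
  have "{a..b} \<subseteq> {..-r} \<or> {a..b} \<subseteq> {r..l}"
  proof (cases "a \<le> -r")
    case True
    have "\<not> (-r < b)"
    proof
      assume "-r < b"
      \<comment> \<open>This point is min b 0, which lies in the gap between the two
        components.\<close>
      then have "min b ((-r + r) / 2) \<in> {a..b}" using True r0 by auto
      then have "min b ((-r + r) / 2) \<in> Eb" using ab by blast
      then show False using \<open>-r < b\<close> r0 by (auto simp: Eb_def min_def split: if_splits)
    qed
    then show ?thesis by auto
  next
    case False
    have "a \<in> Eb" using ab by auto
    then have "r \<le> a" using False by (auto simp: Eb_def)
    moreover have "b \<in> Eb" using ab by auto
    ultimately show ?thesis using ab r0 by (auto simp: Eb_def)
  qed
  then show "g absolutely_integrable_on {a..b} \<and> (g has_integral F b - F a) {a..b}"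
    using F1 F2 ab(1) by (auto simp: AC_def)
qed

text \<open>The support of a test function meets only [c, -r] and [r, l] for some c. Integration by
  parts on both intervals has no boundary terms, since the support stays away from -r, r and
  l.\<close>

lemma AC_imp_weak_deriv: assumes AC: "AC Eb f g" shows "has_weak_deriv E 1 f g"
proof -
  have sub1: "{c..-r} \<subseteq> Eb" "{r..l} \<subseteq> Eb" for c by (auto simp: Eb_def)
  have cover: "\<exists>c. c < -r \<and> K \<subseteq> {c<..-r} \<union> {r..l}" if K: "compact K" "K \<subseteq> E" for K
  proof -
    obtain B where B: "\<And>x. x \<in> K \<Longrightarrow> \<bar>x\<bar> \<le> B" using compact_imp_bounded[OF K(1)] by (auto simp: bounded_iff)
    show ?thesis using K B by (intro exI[of _ "min (-r) (-B) - 1"]) (fastforce simp: domE_def)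
  qed
  have li: "locally_integrable E h" if "\<And>a b. {a..b} \<subseteq> Eb \<Longrightarrow> h absolutely_integrable_on {a..b}" for h
    unfolding locally_integrable_def
  proof (intro allI impI)
    fix K assume K: "compact K" "K \<subseteq> E"
    obtain c where c: "c < -r" "K \<subseteq> {c<..-r} \<union> {r..l}" using cover[OF K] by blast
    have "h absolutely_integrable_on {c..-r} \<union> {r..l}"
      using that[OF sub1(1)] that[OF sub1(2)] by (rule absolutely_integrable_Un)
    moreover have "K \<in> sets lebesgue" using K(1) by (simp add: lmeasurable_compact fmeasurableD)
    ultimately show "set_integrable lebesgue K h" by (rule set_integrable_subset) (use c in auto)
  qed
  show ?thesis unfolding has_weak_deriv_def
  proof (intro conjI allI impI)
    show "locally_integrable E f" using AC_continuous[OF AC] by (intro li absolutely_integrable_continuous_real) auto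
    show "locally_integrable E g"
    proof (rule li)
      fix a b assume "{a..b} \<subseteq> Eb"
      then show "g absolutely_integrable_on {a..b}" using ACD(1)[OF AC] by (cases "a \<le> b") auto
    qed
    fix \<phi> assume t: "test_function E \<phi>"
    obtain K where K: "compact K" "K \<subseteq> E" "\<And>x. x \<notin> K \<Longrightarrow> \<phi> x = 0" "\<And>x. x \<notin> K \<Longrightarrow> deriv \<phi> x = 0"
      using test_function_supp[OF t] by metis
    obtain c where c: "c < -r" "K \<subseteq> {c<..-r} \<union> {r..l}" using cover[OF K(1,2)] by blast
    have 0: "\<phi> c = 0" "\<phi> (-r) = 0" "\<phi> r = 0" "\<phi> l = 0"
      using K c r0 rl by (auto simp: domE_def intro!: K(3))
    have split: "(LINT x:E|lebesgue. h x) = integral {c..-r} h + integral {r..l} h"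
      if "\<And>x. x \<notin> K \<Longrightarrow> h x = 0" "h absolutely_integrable_on {c..-r}" "h absolutely_integrable_on {r..l}" for h :: "real \<Rightarrow> real"
    proof -
      have "(LINT x:E|lebesgue. h x) = (LINT x:{c..-r} \<union> {r..l}|lebesgue. h x)"
        unfolding set_lebesgue_integral_def
      proof (rule Bochner_Integration.integral_cong)
        show "indicat_real E x *\<^sub>R h x = indicat_real ({c..-r} \<union> {r..l}) x *\<^sub>R h x" for x
          using that(1)[of x] K(2) c(2) by (cases "x \<in> K") (auto split: split_indicator)
      qed simp
      also have "\<dots> = (LINT x:{c..-r}|lebesgue. h x) + (LINT x:{r..l}|lebesgue. h x)"
        by (rule set_integral_Un) (use that r0 in auto)
      finally show ?thesis
        using set_lebesgue_integral_eq_integral(2)[OF that(2)] set_lebesgue_integral_eq_integral(2)[OF that(3)] by simp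
    qed
    have A1: "AC {c..-r} f g" and A2: "AC {r..l} f g" using AC AC_mono sub1 by blast+
    note T1 = AC_test[OF A1 _ t 0(1,2)] and T2 = AC_test[OF A2 _ t 0(3,4)]
    have "(LINT x:E|lebesgue. f x * deriv \<phi> x) = integral {c..-r} (\<lambda>x. f x * deriv \<phi> x) + integral {r..l} (\<lambda>x. f x * deriv \<phi> x)"
      by (rule split) (use T1(2) T2(2) K c rl in auto)
    moreover have "(LINT x:E|lebesgue. g x * \<phi> x) = integral {c..-r} (\<lambda>x. g x * \<phi> x) + integral {r..l} (\<lambda>x. g x * \<phi> x)"
      by (rule split) (use T1(3) T2(3) K c rl in auto)
    ultimately show "(LINT x:E|lebesgue. f x * (deriv ^^ 1) \<phi> x) = (- 1) ^ 1 * (LINT x:E|lebesgue. g x * \<phi> x)"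
      using T1(1) T2(1) c rl by simp
  qed
qed

lemma AC_deriv_unique: "AC Eb f g1 \<Longrightarrow> AC Eb f g2 \<Longrightarrow> AEE x. g1 x = g2 x"
  using weak_deriv_unique[OF open_E] AC_imp_weak_deriv by blast

lemma sqi_locally_integrable: assumes "sqi (ext f)" shows "locally_integrable E f"
  unfolding locally_integrable_def
proof (intro allI impI)
  fix K assume K: "compact K" "K \<subseteq> E"
  obtain a b where ab: "K \<subseteq> {a..b}" using compact_imp_bounded[OF K(1)] bounded_subset_cbox_symmetric[of K] by (metis cbox_interval)
  have Ks: "K \<in> sets lebesgue" using K(1) by (simp add: lmeasurable_compact fmeasurableD)
  have "integrable lebesgue (\<lambda>x. indicat_real K x * (indicat_real {a..b} x * ext f x))"
    using integrable_mult_indicator[OF Ks sqi_mult_integrable[OF sqi_indicator assms, of a b]] by simp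
  moreover have "(\<lambda>x. indicat_real K x * (indicat_real {a..b} x * ext f x)) = (\<lambda>x. indicat_real K x *\<^sub>R f x)"
  proof
    show "indicat_real K x * (indicat_real {a..b} x * ext f x) = indicat_real K x *\<^sub>R f x" for x
      using subsetD[OF ab, of x] subsetD[OF K(2), of x] by (cases "x \<in> K") (auto simp: ext_def simp del: atLeastAtMost_iff)
  qed
  ultimately show "set_integrable lebesgue K f" by (simp add: set_integrable_def)
qed

lemma has_weak_deriv_0: assumes "sqi (ext f)" "AEE x. f x = g x"
  shows "has_weak_deriv E 0 f g"
  unfolding has_weak_deriv_def
proof (intro conjI allI impI)
  have sg: "sqi (ext g)" by (rule sqi_ext_cong[OF assms])
  show l: "locally_integrable E f" "locally_integrable E g" using assms(1) sg by (auto intro: sqi_locally_integrable)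
  fix \<phi> assume t: "test_function E \<phi>"
  have "(LINT x:E|lebesgue. f x * \<phi> x) = (LINT x:E|lebesgue. g x * \<phi> x)"
    unfolding set_lebesgue_integral_def
  proof (rule integral_cong_AE)
    show "AE x in lebesgue. indicat_real E x *\<^sub>R (f x * \<phi> x) = indicat_real E x *\<^sub>R (g x * \<phi> x)"
      using assms(2) by eventually_elim (auto split: split_indicator)
  qed (use locally_integrable_test[OF l(1) t] locally_integrable_test[OF l(2) t] in \<open>auto simp: set_integrable_def\<close>)
  then show "(LINT x:E|lebesgue. f x * (deriv ^^ 0) \<phi> x) = (- 1) ^ 0 * (LINT x:E|lebesgue. g x * \<phi> x)" by simp
qed

lemma chain_has_weak_deriv: assumes "chain m u" "AEE x. f x = u 0 x" "k \<le> m"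
  shows "has_weak_deriv E k f (u k)"
  using assms(3)
proof (induction k)
  case 0
  have "AEE x. u 0 x = f x" using assms(2) by (auto elim: eventually_mono)
  then have "sqi (ext f)" using assms(1) sqi_ext_cong[of "u 0" f] by (auto simp: chain_def)
  then show ?case using assms(2) by (rule has_weak_deriv_0)
next
  case (Suc k)
  then show ?case using assms(1) AC_imp_weak_deriv by (intro has_weak_deriv_Suc[of _ k]) (auto simp: chain_def)
qed

text \<open>This identifies the arbitrary choice made in \<open>weak_deriv\<close> with an explicit
  derivative; all later computations with weak derivatives go through it.\<close>

lemma chain_weak_deriv: assumes "chain m u" "AEE x. f x = u 0 x" "k \<le> m"
  shows "AEE x. weak_deriv E k f x = u k x"
proof -
  note h = chain_has_weak_deriv[OF assms]
  have "has_weak_deriv E k f (weak_deriv E k f)" unfolding weak_deriv_def by (rule someI[of "has_weak_deriv E k f", OF h])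
  then show ?thesis using weak_deriv_unique[OF open_E _ h] by blast
qed

lemma chain_Sobolev: assumes "chain m u" "AEE x. f x = u 0 x" shows "f \<in> Sobolev E m"
  unfolding Sobolev_def
proof (intro CollectI allI impI)
  fix k assume "k \<le> m"
  then show "\<exists>g\<in>L2 E. has_weak_deriv E k f g"
    using chain_has_weak_deriv[OF assms] assms(1) L2_iff_sqi[of "u k"] unfolding chain_def by blast
qed

text \<open>On each component \<open>f\<close> is a primitive of \<open>g\<close> plus a constant;
  square integrability makes \<open>g\<close> integrable up to the boundary, so the two primitives
  extend to the closed components and are glued along the gap.\<close>

lemma weak_deriv_L2_imp_AC: assumes "has_weak_deriv E 1 f g" "sqi (ext g)"
  obtains F where "AC Eb F g" "AEE x. f x = F x"
proof -
  have restr: "has_weak_deriv I 1 f g" if I: "I \<subseteq> E" "open I" for I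
    unfolding has_weak_deriv_def
  proof (intro conjI allI impI)
    show "locally_integrable I f" "locally_integrable I g"
      using assms(1) I unfolding has_weak_deriv_def locally_integrable_def by (meson order_trans)+
    fix \<phi> assume t: "test_function I \<phi>"
    then have tE: "test_function E \<phi>" using I(1) by (rule test_function_mono)
    obtain K where K: "K \<subseteq> I" "\<And>x. x \<notin> K \<Longrightarrow> \<phi> x = 0" "\<And>x. x \<notin> K \<Longrightarrow> deriv \<phi> x = 0" using test_function_supp[OF t] by metis
    have e: "(LINT x:E|lebesgue. h x) = (LINT x:I|lebesgue. h x)" if "\<And>x. x \<notin> K \<Longrightarrow> h x = 0" for h :: "real \<Rightarrow> real"
      unfolding set_lebesgue_integral_def
    proof (rule Bochner_Integration.integral_cong)
      show "indicat_real E x *\<^sub>R h x = indicat_real I x *\<^sub>R h x" for x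
        using that[of x] K I by (cases "x \<in> K") (auto split: split_indicator)
    qed simp
    have "(LINT x:E|lebesgue. f x * deriv \<phi> x) = - (LINT x:E|lebesgue. g x * \<phi> x)"
      using assms(1) tE by (auto simp: has_weak_deriv_def)
    then show "(LINT x:I|lebesgue. f x * (deriv ^^ 1) \<phi> x) = (- 1) ^ 1 * (LINT x:I|lebesgue. g x * \<phi> x)"
      using e[of "\<lambda>x. f x * deriv \<phi> x"] e[of "\<lambda>x. g x * \<phi> x"] K by simp
  qed
  define m where "m = (r + l) / 2"
  obtain k1 where k1: "AE x in lebesgue. x \<in> {..<-r} \<longrightarrow> f x = primitive (-r-1) g x + k1"
    by (rule weak_deriv_imp_AC[OF restr, of "{..<-r}" "-r-1" "{..-r}"])
      (auto simp: domE_def Eb_def intro!: sqi_abs_integrable(1)[OF assms(2)])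
  obtain k2 where k2: "AE x in lebesgue. x \<in> {r<..<l} \<longrightarrow> f x = primitive m g x + k2"
    by (rule weak_deriv_imp_AC[OF restr, of "{r<..<l}" m "{r..l}"])
      (use rl in \<open>auto simp: domE_def Eb_def m_def intro!: sqi_abs_integrable(1)[OF assms(2)]\<close>)
  define F where "F x = (if x \<le> 0 then primitive (-r-1) g x + k1 else primitive m g x + k2)" for x
  have A1: "AC {..-r} (primitive (-r-1) g) g"
  proof (rule AC_primitive)
    fix a b assume "{a..b} \<subseteq> {..-r}"
    then have "{a..b} \<subseteq> Eb" unfolding Eb_def by blast
    then show "g absolutely_integrable_on {a..b}" by (rule sqi_abs_integrable(1)[OF assms(2)])
  qed auto
  have A2: "AC {r..l} (primitive m g) g"
  proof (rule AC_primitive)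
    fix a b assume "{a..b} \<subseteq> {r..l}"
    then have "{a..b} \<subseteq> Eb" unfolding Eb_def by blast
    then show "g absolutely_integrable_on {a..b}" by (rule sqi_abs_integrable(1)[OF assms(2)])
  qed (use rl in \<open>auto simp: m_def\<close>)
  have P1: "AC {..-r} (\<lambda>x. primitive (-r-1) g x + k1) g" using AC_add[OF A1 AC_const[of _ k1]] by simp
  have P2: "AC {r..l} (\<lambda>x. primitive m g x + k2) g" using AC_add[OF A2 AC_const[of _ k2]] by simp
  have F1: "AC {..-r} F g" by (rule AC_cong[OF P1]) (use r0 in \<open>auto simp: F_def\<close>)
  have F2: "AC {r..l} F g" by (rule AC_cong[OF P2]) (use r0 in \<open>auto simp: F_def\<close>)
  have "AC Eb F g" by (rule AC_Eb_I[OF F1 F2])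
  moreover have "AEE x. f x = F x"
    using k1 k2 by eventually_elim (use r0 in \<open>auto simp: domE_def F_def\<close>)
  ultimately show ?thesis by (rule that)
qed

text \<open>Consecutive weak derivatives are weak derivatives of one another, so each one below the
  top order may be replaced by its absolutely continuous representative.\<close>

lemma Sobolev_imp_chain: assumes "f \<in> Sobolev E m"
  obtains u where "chain m u" "AEE x. f x = u 0 x"
proof -
  have "\<forall>k. \<exists>g. k \<le> m \<longrightarrow> sqi (ext g) \<and> has_weak_deriv E k f g"
    using assms unfolding Sobolev_def Bex_def L2_iff_sqi by blast
  then obtain g where g: "\<And>k. k \<le> m \<Longrightarrow> sqi (ext (g k)) \<and> has_weak_deriv E k f (g k)" by metis
  have "\<exists>F. AC Eb F (g (Suc k)) \<and> (AEE x. g k x = F x)" if "k < m" for k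
    using weak_deriv_L2_imp_AC[OF has_weak_deriv_Suc_D[of E k f "g k" "g (Suc k)"]] g[of k] g[of "Suc k"] that
    by (metis Suc_leI less_imp_le)
  then obtain F where F: "\<And>k. k < m \<Longrightarrow> AC Eb (F k) (g (Suc k))" "\<And>k. k < m \<Longrightarrow> AEE x. g k x = F k x"
    by metis
  define u where "u k = (if k < m then F k else g k)" for k
  have ae: "AEE x. g k x = u k x" if "k \<le> m" for k using F(2) that by (auto simp: u_def)
  have "chain m u"
    unfolding chain_def
  proof (intro conjI allI impI)
    fix k assume k: "k < m"
    have "AC Eb (u k) (g (Suc k))" using F(1) k by (simp add: u_def)
    then show "AC Eb (u k) (u (Suc k))" by (rule AC_AE_cong[OF _ AE_E_Eb[OF ae] Eb_sets]) (use k in simp)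
  next
    fix k assume "k \<le> m"
    then show "sqi (ext (u k))" using sqi_ext_cong[OF _ ae] g by blast
  qed
  moreover have "AEE x. f x = u 0 x"
  proof -
    have h0: "has_weak_deriv E 0 f (g 0)" using g by blast
    have "has_weak_deriv E 0 f f" using h0 by (auto simp: has_weak_deriv_def)
    from weak_deriv_unique[OF open_E this h0] ae[of 0] show ?thesis by (auto elim: eventually_elim2)
  qed
  ultimately show ?thesis by (rule that)
qed

end

section \<open>Sobolev spaces as closed subspaces of a Banach space\<close>

lemma finite_support_bcontfun: "(\<lambda>k::nat. if k \<le> m then g k else (0::l2)) \<in> bcontfun"
proof -
  have "range (\<lambda>k::nat. if k \<le> m then g k else 0) \<subseteq> insert 0 (g ` {..m})" by auto
  then have "finite (range (\<lambda>k::nat. if k \<le> m then g k else 0))" by (rule finite_subset) auto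
  then show ?thesis by (auto simp: bcontfun_def intro!: finite_imp_bounded)
qed

lemma test_function_sqi: assumes "test_function E \<phi>" shows "sqi \<phi>"
proof -
  obtain K where K: "compact K" "\<And>x. x \<notin> K \<Longrightarrow> \<phi> x = 0" using test_function_supp[OF assms] by metis
  obtain a b where ab: "K \<subseteq> {a..b}" using compact_imp_bounded[OF K(1)] bounded_subset_cbox_symmetric[of K] by (metis cbox_interval)
  have c: "continuous_on UNIV \<phi>" by (rule test_function_continuous[OF assms])
  have "(\<lambda>x. (\<phi> x)\<^sup>2) absolutely_integrable_on {a..b}"
    by (intro absolutely_integrable_continuous_real continuous_intros continuous_on_subset[OF c]) auto
  moreover have "(\<lambda>x. indicat_real {a..b} x *\<^sub>R (\<phi> x)\<^sup>2) = (\<lambda>x. (\<phi> x)\<^sup>2)"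
  proof
    show "indicat_real {a..b} x *\<^sub>R (\<phi> x)\<^sup>2 = (\<phi> x)\<^sup>2" for x
      using K(2)[of x] subsetD[OF ab, of x] by (cases "x \<in> K") (auto simp del: atLeastAtMost_iff)
  qed
  ultimately have "integrable lebesgue (\<lambda>x. (\<phi> x)\<^sup>2)" by (simp only: set_integrable_def)
  moreover have "\<phi> \<in> borel_measurable lebesgue"
    using c by (intro borel_imp_lebesgue_measurable borel_measurable_continuous_onI)
  ultimately show ?thesis by (simp add: sqi_def)
qed

context dom
begin

definition cl :: "(real \<Rightarrow> real) \<Rightarrow> l2" where "cl f = abs_l2 (ext f)"

lemma norm_cl: "sqi (ext f) \<Longrightarrow> norm (cl f) = nE f"
  by (simp add: cl_def norm_abs_l2 nE_def)

lemma cl_eq_iff: "sqi (ext f) \<Longrightarrow> sqi (ext g) \<Longrightarrow> cl f = cl g \<longleftrightarrow> (AEE x. f x = g x)"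
  unfolding cl_def using abs_l2_eq_iff ext_AE_cong ext_AE_D by blast

lemma cl_eqI: "sqi (ext f) \<Longrightarrow> AEE x. f x = g x \<Longrightarrow> cl f = cl g"
  using cl_eq_iff sqi_ext_cong by blast

lemma cl_lin: "sqi (ext f) \<Longrightarrow> sqi (ext g) \<Longrightarrow> cl (\<lambda>x. a * f x + b * g x) = a *\<^sub>R cl f + b *\<^sub>R cl g"
  unfolding cl_def ext_add ext_cmult by (simp add: abs_l2_scaleR abs_l2_add sqi_cmult)

lemma sqi_ext: "sqi f \<Longrightarrow> sqi (ext f)"
proof -
  assume f: "sqi f"
  have m: "ext f \<in> borel_measurable lebesgue" unfolding ext_def[abs_def]
    using f E_sets by (intro borel_measurable_times borel_measurable_indicator) (auto simp: sqi_def)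
  have "integrable lebesgue (\<lambda>x. (ext f x)\<^sup>2)"
  proof (rule Bochner_Integration.integrable_bound[where f="\<lambda>x. (f x)\<^sup>2"])
    show "(\<lambda>x. (ext f x)\<^sup>2) \<in> borel_measurable lebesgue" using m by auto
  qed (use f in \<open>auto simp: sqi_def ext_def split: split_indicator\<close>)
  then show ?thesis using m by (simp add: sqi_def)
qed

lemma nE_le_nrm2: "sqi f \<Longrightarrow> nE f \<le> nrm2 f"
  unfolding nE_def nrm2_def using sqi_ext[of f]
  by (intro real_sqrt_le_mono integral_mono) (auto simp: sqi_def ext_def split: split_indicator)

text \<open>The range of \<open>cl\<close> is closed since restriction to \<open>E\<close> is a contraction.\<close>

lemma cl_rep_limit:
  assumes "(\<lambda>n. cl (f n)) \<longlonglongrightarrow> u" "\<And>n. sqi (ext (f n))"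
  shows "cl (rep_l2 u) = u"
proof -
  have le: "norm (cl (rep_l2 u) - u) \<le> 2 * norm (cl (f n) - u)" for n
  proof -
    have s: "sqi (\<lambda>x. rep_l2 u x - ext (f n) x)" by (intro sqi_diff rep_l2_sqi assms)
    have "cl (rep_l2 u) - cl (f n) = cl (\<lambda>x. rep_l2 u x - ext (f n) x)"
    proof -
      have "ext (ext g) = ext g" for g by (auto simp: ext_def split: split_indicator)
      then show ?thesis unfolding cl_def ext_diff using abs_l2_diff[OF sqi_ext[OF rep_l2_sqi] assms(2)] by simp
    qed
    then have "norm (cl (rep_l2 u) - cl (f n)) \<le> nrm2 (\<lambda>x. rep_l2 u x - ext (f n) x)"
      using norm_cl[OF sqi_ext[OF s]] nE_le_nrm2[OF s] by simp
    also have "\<dots> = norm (u - cl (f n))"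
      using norm_abs_l2[OF s] abs_l2_diff[OF rep_l2_sqi assms(2), of u n] by (simp add: abs_rep_l2 cl_def)
    finally have "norm (cl (rep_l2 u) - cl (f n)) \<le> norm (cl (f n) - u)" by (simp add: norm_minus_commute)
    then show ?thesis using norm_triangle_ineq[of "cl (rep_l2 u) - cl (f n)" "cl (f n) - u"] by simp
  qed
  have "(\<lambda>n. 2 * norm (cl (f n) - u)) \<longlonglongrightarrow> 0"
    using assms(1) by (auto intro!: tendsto_eq_intros tendsto_norm_zero simp: LIM_zero)
  then have "norm (cl (rep_l2 u) - u) \<le> 0"
    by (rule LIMSEQ_le_const) (use le in auto)
  then show ?thesis by simp
qed

lemma LINT_E_test: "test_function E \<phi> \<Longrightarrow> (LINT x:E|lebesgue. f x * \<phi> x) = (LINT x|lebesgue. f x * \<phi> x)"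
  unfolding set_lebesgue_integral_def
proof (rule Bochner_Integration.integral_cong)
  assume "test_function E \<phi>"
  then obtain K where "K \<subseteq> E" "\<And>x. x \<notin> K \<Longrightarrow> \<phi> x = 0" using test_function_supp by metis
  then show "indicat_real E x *\<^sub>R (f x * \<phi> x) = f x * \<phi> x" for x by (cases "x \<in> E") auto
qed simp

text \<open>Pairing with a test function is continuous in L2 by Cauchy-Schwarz; this is what carries
  weak derivatives to limits.\<close>

lemma LINT_E_test_limit:
  assumes "(\<lambda>n. cl (f n)) \<longlonglongrightarrow> u" "\<And>n. sqi (ext (f n))" "test_function E \<phi>"
  shows "(\<lambda>n. LINT x:E|lebesgue. f n x * \<phi> x) \<longlonglongrightarrow> (LINT x:E|lebesgue. rep_l2 u x * \<phi> x)"
proof -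
  note \<phi> = test_function_sqi[OF assms(3)]
  have e: "(LINT x:E|lebesgue. f n x * \<phi> x) = (LINT x|lebesgue. ext (f n) x * \<phi> x)" for n
    unfolding set_lebesgue_integral_def ext_def by (simp add: mult.assoc)
  have "\<bar>(LINT x|lebesgue. ext (f n) x * \<phi> x) - (LINT x|lebesgue. rep_l2 u x * \<phi> x)\<bar> \<le> norm (cl (f n) - u) * nrm2 \<phi>" for n
  proof -
    have s: "sqi (\<lambda>x. ext (f n) x - rep_l2 u x)" by (intro sqi_diff rep_l2_sqi assms)
    have "(LINT x|lebesgue. ext (f n) x * \<phi> x) - (LINT x|lebesgue. rep_l2 u x * \<phi> x) = (LINT x|lebesgue. (ext (f n) x - rep_l2 u x) * \<phi> x)"
      using Bochner_Integration.integral_diff[OF sqi_mult_integrable[OF assms(2) \<phi>] sqi_mult_integrable[OF rep_l2_sqi \<phi>], of n u]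
      by (simp add: left_diff_distrib)
    moreover have "nrm2 (\<lambda>x. ext (f n) x - rep_l2 u x) = norm (cl (f n) - u)"
      using norm_abs_l2[OF s] abs_l2_diff[OF assms(2) rep_l2_sqi, of n u] by (simp add: abs_rep_l2 cl_def)
    ultimately show ?thesis using nrm2_Cauchy_Schwarz[OF s \<phi>] by simp
  qed
  moreover have "(\<lambda>n. norm (cl (f n) - u) * nrm2 \<phi>) \<longlonglongrightarrow> 0"
    using assms(1) by (auto intro!: tendsto_eq_intros tendsto_norm_zero simp: LIM_zero)
  ultimately have "(\<lambda>n. (LINT x|lebesgue. ext (f n) x * \<phi> x) - (LINT x|lebesgue. rep_l2 u x * \<phi> x)) \<longlonglongrightarrow> 0"
    using tendsto_rabs_zero_cancel tendsto_sandwich[OF _ _ tendsto_const] by (smt (verit, ccfv_SIG) Lim_null_comparison always_eventually real_norm_def)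
  then show ?thesis unfolding e LINT_E_test[OF assms(3)] by (rule LIM_zero_cancel)
qed

text \<open>The jet of \<open>f\<close> padded with zeros. The supremum norm of the sequence is the
  largest L2 norm among the derivatives, and Sobolev spaces of all orders become subspaces of one
  and the same Banach type.\<close>

definition emb :: "nat \<Rightarrow> (real \<Rightarrow> real) \<Rightarrow> nat \<Rightarrow>\<^sub>C l2" where
  "emb m f = Bcontfun (\<lambda>k. if k \<le> m then cl (weak_deriv E k f) else 0)"

lemma emb_apply: "apply_bcontfun (emb m f) k = (if k \<le> m then cl (weak_deriv E k f) else 0)"
  unfolding emb_def by (subst Bcontfun_inverse[OF finite_support_bcontfun]) simp

lemma emb_chain: assumes "chain m u" "AEE x. f x = u 0 x" "k \<le> m"
  shows "apply_bcontfun (emb m f) k = cl (u k)"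
proof -
  note w = chain_weak_deriv[OF assms]
  have "cl (u k) = cl (weak_deriv E k f)"
    by (rule cl_eqI) (use w assms in \<open>auto simp: chain_def elim!: eventually_mono\<close>)
  then show ?thesis using assms by (simp add: emb_apply)
qed

lemma norm_emb_chain: assumes "chain m u" "AEE x. f x = u 0 x"
  shows "norm (emb m f) \<le> c \<longleftrightarrow> c \<ge> 0 \<and> (\<forall>k\<le>m. nE (u k) \<le> c)"
proof
  assume n: "norm (emb m f) \<le> c"
  have "nE (u k) \<le> c" if "k \<le> m" for k
    using norm_bounded[of "emb m f" k] emb_chain[OF assms that] norm_cl[of "u k"] assms(1) that n
    by (auto simp: chain_def)
  then show "c \<ge> 0 \<and> (\<forall>k\<le>m. nE (u k) \<le> c)" using n norm_ge_zero order_trans by blast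
next
  assume c: "c \<ge> 0 \<and> (\<forall>k\<le>m. nE (u k) \<le> c)"
  show "norm (emb m f) \<le> c"
  proof (rule norm_bound)
    fix k
    show "norm (apply_bcontfun (emb m f) k) \<le> c"
    proof (cases "k \<le> m")
      case True
      then show ?thesis using emb_chain[OF assms True] norm_cl[of "u k"] assms(1) c by (auto simp: chain_def)
    qed (use c in \<open>simp add: emb_apply\<close>)
  qed
qed

definition Hm :: "nat \<Rightarrow> (real \<Rightarrow> real) \<Rightarrow> bool" where "Hm m f \<longleftrightarrow> (\<exists>c. Hb m f c)"

lemma Hm_chain: "Hm m f \<Longrightarrow> \<exists>u. chain m u \<and> u 0 = f"
  unfolding Hm_def using Hb_imp_chain by blast

lemma chain_Hm: "chain m u \<Longrightarrow> Hm m (u 0)"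
  unfolding Hm_def
  by (rule exI[of _ "\<Sum>k\<le>m. nE (u k)"], rule chain_imp_Hb) (auto intro!: member_le_sum nE_nonneg)

text \<open>The hinge between explicit bounds on functions and norms in the Banach space: estimates
  are derived with \<open>Hb\<close> and read off as norm estimates.\<close>

lemma Hb_iff_norm: "Hm m f \<Longrightarrow> Hb m f c \<longleftrightarrow> norm (emb m f) \<le> c"
proof
  assume "Hb m f c"
  then obtain u where u: "chain m u" "u 0 = f" "\<forall>k\<le>m. nE (u k) \<le> c" using Hb_imp_chain by blast
  show "norm (emb m f) \<le> c"
    using norm_emb_chain[OF u(1), of f c] u(2,3) Hb_nonneg[OF \<open>Hb m f c\<close>] by auto
next
  assume "Hm m f" "norm (emb m f) \<le> c"
  moreover then obtain u where u: "chain m u" "u 0 = f" using Hm_chain by blast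
  ultimately show "Hb m f c"
    using norm_emb_chain[OF u(1), of f c] chain_imp_Hb[OF u(1), of c] u(2) by auto
qed

lemma Hb_norm_emb: "Hm m f \<Longrightarrow> Hb m f (norm (emb m f))"
  using Hb_iff_norm by blast

lemma norm_emb_le: "Hb m f c \<Longrightarrow> norm (emb m f) \<le> c"
  using Hb_iff_norm Hm_def by blast

lemma Hm_lin: "Hm m f \<Longrightarrow> Hm m g \<Longrightarrow> Hm m (\<lambda>x. a * f x + b * g x)"
  unfolding Hm_def using Hb_add Hb_cmult by metis

lemma emb_lin_AE:
  assumes u: "chain m u" "AEE x. f x = u 0 x" and v: "chain m v" "AEE x. g x = v 0 x"
  shows "emb m (\<lambda>x. a * f x + b * g x) = a *\<^sub>R emb m f + b *\<^sub>R emb m g"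
proof -
  let ?w = "\<lambda>k x. a * u k x + b * v k x"
  have sw: "sqi (ext (?w k))" if "k \<le> m" for k
    using u v that unfolding ext_add ext_cmult chain_def by (intro sqi_add sqi_cmult) auto
  have w: "chain m ?w"
    unfolding chain_def using u v sw by (auto simp: chain_def intro!: AC_add AC_cmult)
  have ae: "AEE x. a * f x + b * g x = ?w 0 x"
    using u(2) v(2) by eventually_elim auto
  show ?thesis
  proof (rule bcontfun_eqI)
    fix k
    show "apply_bcontfun (emb m (\<lambda>x. a * f x + b * g x)) k = apply_bcontfun (a *\<^sub>R emb m f + b *\<^sub>R emb m g) k"
    proof (cases "k \<le> m")
      case True
      then show ?thesis
        using emb_chain[OF w ae True] emb_chain[OF u True] emb_chain[OF v True] cl_lin[of "u k" "v k"] u v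
        by (simp add: chain_def)
    qed (simp add: emb_apply)
  qed
qed

lemma emb_lin: "Hm m f \<Longrightarrow> Hm m g \<Longrightarrow> emb m (\<lambda>x. a * f x + b * g x) = a *\<^sub>R emb m f + b *\<^sub>R emb m g"
proof -
  assume "Hm m f" "Hm m g"
  then obtain u v where "chain m u" "u 0 = f" "chain m v" "v 0 = g" using Hm_chain by metis
  then show ?thesis using emb_lin_AE[of m u f v g a b] by simp
qed

lemma emb_diff: "Hm m f \<Longrightarrow> Hm m g \<Longrightarrow> emb m (\<lambda>x. f x - g x) = emb m f - emb m g"
  using emb_lin[of m f g 1 "-1"] by simp

lemma Hm_zero: "Hm m (\<lambda>x. 0)" unfolding Hm_def using Hb_zero[of 0] by blast

lemma emb_zero: "emb m (\<lambda>x. 0) = 0"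
  using emb_lin[OF Hm_zero Hm_zero, of m 0 0] by simp

lemma Sobolev_rep: assumes "f \<in> Sobolev E m"
  obtains g where "Hm m g" "AEE x. f x = g x" "emb m f = emb m g"
proof -
  obtain u where u: "chain m u" "AEE x. f x = u 0 x" using Sobolev_imp_chain[OF assms] .
  have "emb m f = emb m (u 0)"
  proof (rule bcontfun_eqI)
    show "apply_bcontfun (emb m f) k = apply_bcontfun (emb m (u 0)) k" for k
      by (cases "k \<le> m") (use emb_chain[OF u] emb_chain[OF u(1), of "u 0"] in \<open>auto simp: emb_apply\<close>)
  qed
  then show ?thesis using that chain_Hm[OF u(1)] u(2) by blast
qed

lemma Hm_AE_Sobolev: assumes "Hm m g" "AEE x. f x = g x"
  shows "f \<in> Sobolev E m" "emb m f = emb m g"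
proof -
  obtain u where u: "chain m u" "u 0 = g" using Hm_chain[OF assms(1)] by blast
  then show "f \<in> Sobolev E m" using chain_Sobolev[OF u(1)] assms(2) by simp
  show "emb m f = emb m g"
  proof (rule bcontfun_eqI)
    show "apply_bcontfun (emb m f) k = apply_bcontfun (emb m g) k" for k
      by (cases "k \<le> m") (use emb_chain[OF u(1), of f] emb_chain[OF u(1), of g] u assms in \<open>auto simp: emb_apply\<close>)
  qed
qed

lemma Hm_sup: "Hm m f \<Longrightarrow> m \<ge> 1 \<Longrightarrow> x \<in> Eb \<Longrightarrow> \<bar>f x\<bar> \<le> CS * norm (emb m f)"
  using Hb_sup Hb_norm_emb by blast

lemma emb_inj: "Hm m f \<Longrightarrow> Hm m g \<Longrightarrow> m \<ge> 1 \<Longrightarrow> emb m f = emb m g \<Longrightarrow> x \<in> Eb \<Longrightarrow> f x = g x"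
  using Hm_sup[of m "\<lambda>x. f x - g x" x] emb_diff[of m f g] Hm_lin[of m f g 1 "-1"] by simp

lemma emb_eq_0_AE: "Hm m f \<Longrightarrow> emb m f = 0 \<Longrightarrow> AEE x. f x = 0"
proof -
  assume f: "Hm m f" "emb m f = 0"
  then have "Hb m f 0" using Hb_iff_norm by simp
  then have "sqi (ext f)" "nE f \<le> 0" using Hb_0D by blast+
  then have "cl f = cl (\<lambda>x. 0)" using norm_cl[of f] nE_nonneg[of f] norm_cl[of "\<lambda>x. 0"]
    by (simp add: ext_zero sqi_zero cl_def zero_l2.abs_eq[symmetric])
  then show ?thesis using cl_eq_iff[of f "\<lambda>x. 0"] \<open>sqi (ext f)\<close> by (simp add: ext_zero sqi_zero)
qed

definition hs :: "nat \<Rightarrow> (nat \<Rightarrow>\<^sub>C l2) set" where "hs m = emb m ` {f. Hm m f}"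

lemma hs_subspace: "subspace (hs m)"
proof (rule subspaceI)
  have "emb m (\<lambda>x. 0) \<in> hs m" unfolding hs_def using Hm_zero by blast
  then show "0 \<in> hs m" by (simp add: emb_zero)
next
  fix U V assume "U \<in> hs m" "V \<in> hs m"
  then obtain f g where "Hm m f" "U = emb m f" "Hm m g" "V = emb m g" by (auto simp: hs_def)
  moreover from this have "emb m (\<lambda>x. 1 * f x + 1 * g x) \<in> hs m" unfolding hs_def using Hm_lin by blast
  ultimately show "U + V \<in> hs m" using emb_lin[of m f g 1 1] by simp
next
  fix c U assume "U \<in> hs m"
  then obtain f where "Hm m f" "U = emb m f" by (auto simp: hs_def)
  moreover from this have "emb m (\<lambda>x. c * f x + 0 * f x) \<in> hs m" unfolding hs_def using Hm_lin by blast
  ultimately show "c *\<^sub>R U \<in> hs m" using emb_lin[of m f f c 0] by simp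
qed

text \<open>Convergence of jets is L2 convergence of each derivative. The defining identities of
  weak derivatives pass to the limit, so the limit sequence is the jet of its own zeroth
  entry.\<close>

lemma hs_closed: "closed (hs m)"
  unfolding closed_sequential_limits
proof (intro allI impI, elim conjE)
  fix X U assume X: "\<forall>n. X n \<in> hs m" and lim: "X \<longlonglongrightarrow> U"
  have "\<forall>n. \<exists>u. chain m u \<and> X n = emb m (u 0)"
    using X Hm_chain unfolding hs_def by blast
  then obtain u where u: "\<And>n. chain m (u n)" "\<And>n. X n = emb m (u n 0)" by metis
  have comp: "(\<lambda>n. apply_bcontfun (X n) k) \<longlonglongrightarrow> apply_bcontfun U k" for k
  proof -
    have le: "norm (apply_bcontfun (X n) k - apply_bcontfun U k) \<le> norm (X n - U)" for n
      using norm_bounded[of "X n - U" k] by simp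
    have 0: "(\<lambda>n. norm (X n - U)) \<longlonglongrightarrow> 0" using lim by (simp add: LIM_zero tendsto_norm_zero)
    show ?thesis
      by (rule LIM_zero_cancel, rule Lim_null_comparison[OF always_eventually 0]) (use le in blast)
  qed
  have Xk: "apply_bcontfun (X n) k = cl (u n k)" if "k \<le> m" for n k
    unfolding u(2) by (rule emb_chain[OF u(1) _ that]) simp
  have sq: "sqi (ext (u n k))" if "k \<le> m" for n k using u(1) that by (simp add: chain_def)
  have limk: "(\<lambda>n. cl (u n k)) \<longlonglongrightarrow> apply_bcontfun U k" if "k \<le> m" for k
    using comp[of k] Xk[OF that] by simp
  let ?g = "\<lambda>k. rep_l2 (apply_bcontfun U k)"
  have w: "has_weak_deriv E k (?g 0) (?g k)" if k: "k \<le> m" for k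
    unfolding has_weak_deriv_def
  proof (intro conjI allI impI)
    show "locally_integrable E (?g 0)" "locally_integrable E (?g k)"
      by (intro sqi_locally_integrable sqi_ext rep_l2_sqi)+
    fix \<phi> assume t: "test_function E \<phi>"
    have tk: "test_function E ((deriv ^^ j) \<phi>)" for j
      by (induction j) (use t test_function_deriv in auto)
    have A: "(\<lambda>n. LINT x:E|lebesgue. u n 0 x * (deriv ^^ k) \<phi> x) \<longlonglongrightarrow> (LINT x:E|lebesgue. ?g 0 x * (deriv ^^ k) \<phi> x)"
      by (rule LINT_E_test_limit[OF limk sq tk]) auto
    have B: "(LINT x:E|lebesgue. u n 0 x * (deriv ^^ k) \<phi> x) = (-1) ^ k * (LINT x:E|lebesgue. u n k x * \<phi> x)" for n
      using chain_has_weak_deriv[OF u(1)[of n], of "u n 0" k] k t by (simp add: has_weak_deriv_def)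
    have "(\<lambda>n. (-1) ^ k * (LINT x:E|lebesgue. u n k x * \<phi> x)) \<longlonglongrightarrow> (-1) ^ k * (LINT x:E|lebesgue. ?g k x * \<phi> x)"
      by (intro tendsto_mult tendsto_const LINT_E_test_limit[OF limk sq t] k)
    from LIMSEQ_unique[OF A this[folded B]]
    show "(LINT x:E|lebesgue. ?g 0 x * (deriv ^^ k) \<phi> x) = (-1) ^ k * (LINT x:E|lebesgue. ?g k x * \<phi> x)" .
  qed
  have "?g 0 \<in> Sobolev E m"
    unfolding Sobolev_def using w sqi_ext[OF rep_l2_sqi] L2_iff_sqi by blast
  then obtain f where f: "Hm m f" "emb m (?g 0) = emb m f" using Sobolev_rep by metis
  have "emb m (?g 0) = U"
  proof (rule bcontfun_eqI)
    fix k
    show "apply_bcontfun (emb m (?g 0)) k = apply_bcontfun U k"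
    proof (cases "k \<le> m")
      case True
      have "has_weak_deriv E k (?g 0) (weak_deriv E k (?g 0))" unfolding weak_deriv_def
        by (rule someI[of "has_weak_deriv E k (?g 0)", OF w[OF True]])
      from weak_deriv_unique[OF open_E w[OF True] this]
      have "cl (?g k) = cl (weak_deriv E k (?g 0))" by (intro cl_eqI sqi_ext rep_l2_sqi)
      then show ?thesis using True cl_rep_limit[OF limk[OF True] sq[OF True]] by (simp add: emb_apply)
    next
      case False
      then have "apply_bcontfun (X n) k = 0" for n unfolding u(2) by (simp add: emb_apply)
      then show ?thesis using comp[of k] False by (simp add: emb_apply LIMSEQ_const_iff)
    qed
  qed
  then show "U \<in> hs m" using f by (auto simp: hs_def)
qed

text \<open>A right inverse of \<open>emb\<close> on \<open>hs m\<close>. For \<open>m\<close> at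
  least 1 its values on \<open>Eb\<close> do not depend on the choice, by \<open>emb_inj\<close>,
  which is what makes traces of abstract states meaningful.\<close>

definition fn :: "nat \<Rightarrow> (nat \<Rightarrow>\<^sub>C l2) \<Rightarrow> real \<Rightarrow> real" where
  "fn m U = (SOME f. Hm m f \<and> emb m f = U)"

lemma fn_Hm: "U \<in> hs m \<Longrightarrow> Hm m (fn m U)" "U \<in> hs m \<Longrightarrow> emb m (fn m U) = U"
proof -
  assume "U \<in> hs m"
  then have "\<exists>f. Hm m f \<and> emb m f = U" by (auto simp: hs_def)
  from someI_ex[OF this] have "Hm m (fn m U) \<and> emb m (fn m U) = U" unfolding fn_def .
  then show "Hm m (fn m U)" "emb m (fn m U) = U" by auto
qed

lemma fn_emb: "Hm m f \<Longrightarrow> m \<ge> 1 \<Longrightarrow> x \<in> Eb \<Longrightarrow> fn m (emb m f) x = f x"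
  using fn_Hm[of "emb m f" m] emb_inj[of m "fn m (emb m f)" f x] by (auto simp: hs_def)

lemma fn_lin: "U \<in> hs m \<Longrightarrow> V \<in> hs m \<Longrightarrow> m \<ge> 1 \<Longrightarrow> x \<in> Eb \<Longrightarrow> fn m (a *\<^sub>R U + b *\<^sub>R V) x = a * fn m U x + b * fn m V x"
  using fn_emb[OF Hm_lin[OF fn_Hm(1) fn_Hm(1)], of U m V x a b] emb_lin[OF fn_Hm(1) fn_Hm(1), of U m V a b]
  by (simp add: fn_Hm)

lemma fn_diff_bound: "U \<in> hs m \<Longrightarrow> V \<in> hs m \<Longrightarrow> Hb m (\<lambda>x. fn m U x - fn m V x) (norm (U - V))"
  using Hb_norm_emb[OF Hm_lin[OF fn_Hm(1) fn_Hm(1), of U m V 1 "-1"]] emb_diff[OF fn_Hm(1) fn_Hm(1), of U m V]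
  by (simp add: fn_Hm)

lemma fn_bound: "U \<in> hs m \<Longrightarrow> Hb m (fn m U) (norm U)"
  using Hb_norm_emb[OF fn_Hm(1), of U m] by (simp add: fn_Hm)

lemma fn_tendsto:
  assumes "(U \<longlongrightarrow> V) F" "\<forall>\<^sub>F t in F. U t \<in> hs m" "V \<in> hs m" "m \<ge> 1" "x \<in> Eb"
  shows "((\<lambda>t. fn m (U t) x) \<longlongrightarrow> fn m V x) F"
proof (rule LIM_zero_cancel, rule Lim_null_comparison)
  show "\<forall>\<^sub>F t in F. norm (fn m (U t) x - fn m V x) \<le> CS * norm (U t - V)"
    using assms(2) by eventually_elim (use Hb_sup[OF fn_diff_bound] assms in auto)
  show "((\<lambda>t. CS * norm (U t - V)) \<longlongrightarrow> 0) F"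
    using assms(1) by (auto intro!: tendsto_eq_intros tendsto_norm_zero simp: LIM_zero)
qed

end

section \<open>The resolvent of the Laplacian\<close>

lemma sqi_exp_tail: assumes "\<mu> > 0"
  shows "sqi (\<lambda>y. indicat_real {x..} y * exp (- y / \<mu>))"
    "nrm2 (\<lambda>y. indicat_real {x..} y * exp (- y / \<mu>)) = sqrt (\<mu> / 2) * exp (- x / \<mu>)"
proof -
  have eq: "(\<lambda>y. (indicat_real {x..} y * exp (- y / \<mu>))\<^sup>2) = (\<lambda>y. indicat_real {x..} y *\<^sub>R exp (- (2 / \<mu>) * y))"
    using assms by (auto simp: power2_eq_square exp_add[symmetric] field_simps split: split_indicator)
  have h: "((\<lambda>y. exp (- (2 / \<mu>) * y)) has_integral exp (- (2 / \<mu>) * x) / (2 / \<mu>)) {x..}"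
    by (rule has_integral_exp_minus_to_infinity) (use assms in simp)
  have a: "(\<lambda>y. exp (- (2 / \<mu>) * y)) absolutely_integrable_on {x..}"
    by (rule nonnegative_absolutely_integrable_1[OF has_integral_integrable[OF h]]) auto
  have m: "(\<lambda>y. indicat_real {x..} y * exp (- y / \<mu>)) \<in> borel_measurable lebesgue"
    by (intro borel_imp_lebesgue_measurable borel_measurable_times borel_measurable_indicator borel_measurable_continuous_onI continuous_intros) (use assms in auto)
  show "sqi (\<lambda>y. indicat_real {x..} y * exp (- y / \<mu>))"
    using a m unfolding sqi_def eq by (simp add: set_integrable_def)
  have "(LINT y|lebesgue. indicat_real {x..} y *\<^sub>R exp (- (2 / \<mu>) * y)) = (\<mu> / 2) * exp (- (2 / \<mu>) * x)"
    using set_lebesgue_integral_eq_integral(2)[OF a] integral_unique[OF h] by (simp add: set_lebesgue_integral_def)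
  also have "\<dots> = (\<mu> / 2) * (exp (- x / \<mu>))\<^sup>2" by (simp add: power2_eq_square exp_add[symmetric])
  finally have I: "(LINT y|lebesgue. indicat_real {x..} y *\<^sub>R exp (- (2 / \<mu>) * y)) = (\<mu> / 2) * (exp (- x / \<mu>))\<^sup>2" .
  show "nrm2 (\<lambda>y. indicat_real {x..} y * exp (- y / \<mu>)) = sqrt (\<mu> / 2) * exp (- x / \<mu>)"
    unfolding nrm2_def eq I real_sqrt_mult by simp
qed

lemma sqi_of_local_bound:
  assumes "continuous_on UNIV (f::real\<Rightarrow>real)" "\<And>a b. a \<le> b \<Longrightarrow> integral {a..b} (\<lambda>x. (f x)\<^sup>2) \<le> c\<^sup>2" "c \<ge> 0"
  shows "sqi f" "nrm2 f \<le> c"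
proof -
  have m: "f \<in> borel_measurable lebesgue" using assms(1) by (intro borel_imp_lebesgue_measurable borel_measurable_continuous_onI)
  have "(\<integral>\<^sup>+x. ennreal ((f x)\<^sup>2) \<partial>lebesgue) = (\<integral>\<^sup>+x. (SUP n. ennreal (indicat_real {- real n..real n} x * (f x)\<^sup>2)) \<partial>lebesgue)"
  proof (rule nn_integral_cong)
    fix x
    obtain N :: nat where N: "\<bar>x\<bar> \<le> real N" using real_arch_simple by blast
    show "ennreal ((f x)\<^sup>2) = (SUP n. ennreal (indicat_real {- real n..real n} x * (f x)\<^sup>2))"
    proof (rule antisym)
      show "ennreal ((f x)\<^sup>2) \<le> (SUP n. ennreal (indicat_real {- real n..real n} x * (f x)\<^sup>2))"
        by (rule SUP_upper2[of N]) (use N in \<open>auto simp: indicator_def abs_le_iff\<close>)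
      show "(SUP n. ennreal (indicat_real {- real n..real n} x * (f x)\<^sup>2)) \<le> ennreal ((f x)\<^sup>2)"
        by (rule SUP_least, rule ennreal_leI) (auto split: split_indicator)
    qed
  qed
  also have "\<dots> = (SUP n. \<integral>\<^sup>+x. ennreal (indicat_real {- real n..real n} x * (f x)\<^sup>2) \<partial>lebesgue)"
  proof (rule nn_integral_monotone_convergence_SUP)
    show "incseq (\<lambda>n x. ennreal (indicat_real {- real n..real n} x * (f x)\<^sup>2))"
      by (auto simp: incseq_def le_fun_def intro!: ennreal_leI mult_right_mono split: split_indicator)
    show "(\<lambda>x. ennreal (indicat_real {- real n..real n} x * (f x)\<^sup>2)) \<in> borel_measurable lebesgue" for n
      using m by (intro measurable_compose[OF _ measurable_ennreal] borel_measurable_times borel_measurable_indicator borel_measurable_power) auto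
  qed
  also have "\<dots> \<le> ennreal (c\<^sup>2)"
  proof (rule SUP_least)
    fix n :: nat
    have a: "(\<lambda>x. (f x)\<^sup>2) absolutely_integrable_on {- real n..real n}"
      by (intro absolutely_integrable_continuous_real continuous_intros continuous_on_subset[OF assms(1)]) auto
    have "(\<integral>\<^sup>+x. ennreal (indicat_real {- real n..real n} x * (f x)\<^sup>2) \<partial>lebesgue) = ennreal (LINT x|lebesgue. indicat_real {- real n..real n} x * (f x)\<^sup>2)"
      using a by (intro nn_integral_eq_integral) (auto simp: set_integrable_def)
    also have "\<dots> = ennreal (integral {- real n..real n} (\<lambda>x. (f x)\<^sup>2))"
      using set_lebesgue_integral_eq_integral(2)[OF a] by (simp add: set_lebesgue_integral_def)
    also have "\<dots> \<le> ennreal (c\<^sup>2)" by (intro ennreal_leI assms) auto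
    finally show "(\<integral>\<^sup>+x. ennreal (indicat_real {- real n..real n} x * (f x)\<^sup>2) \<partial>lebesgue) \<le> ennreal (c\<^sup>2)" .
  qed
  finally show "sqi f" "nrm2 f \<le> c" using sqi_nn_integral[OF m _ assms(3)] by auto
qed

lemma integral_sq_le_nrm2: assumes "sqi f" shows "integral {a..b} (\<lambda>x. (f x)\<^sup>2) \<le> (nrm2 f)\<^sup>2"
proof -
  have i: "integrable lebesgue (\<lambda>x. (f x)\<^sup>2)" using assms by (simp add: sqi_def)
  then have s: "(\<lambda>x. (f x)\<^sup>2) absolutely_integrable_on {a..b}"
    using integrable_mult_indicator[of "{a..b}" lebesgue "\<lambda>x. (f x)\<^sup>2"] by (simp add: set_integrable_def)
  have "integral {a..b} (\<lambda>x. (f x)\<^sup>2) = (LINT x|lebesgue. indicat_real {a..b} x *\<^sub>R (f x)\<^sup>2)"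
    using set_lebesgue_integral_eq_integral(2)[OF s] by (simp add: set_lebesgue_integral_def)
  also have "\<dots> \<le> (LINT x|lebesgue. (f x)\<^sup>2)"
    by (rule integral_mono) (use i s in \<open>auto simp: set_integrable_def split: split_indicator\<close>)
  finally show ?thesis by (simp add: nrm2_sq)
qed

text \<open>The bounded solution \<open>A(x) = \<mu>\<^sup>-\<^sup>1 \<integral>\<^sub>x\<^sup>\<infinity> exp((x - y)/\<mu>) p(y) dy\<close> of \<open>A - \<mu> A' = p\<close>; its \<open>L\<^sup>2\<close> bound
  comes from multiplying the equation by \<open>A\<close>.\<close>

lemma first_order_backward:
  assumes \<mu>: "\<mu> > 0" and p: "sqi p"
  obtains A where "AC UNIV A (\<lambda>x. (A x - p x) / \<mu>)" "sqi A" "nrm2 A \<le> 2 * nrm2 p"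
    "\<And>x. \<bar>A x\<bar> \<le> nrm2 p / sqrt (2 * \<mu>)"
proof -
  define q where "q y = exp (- y / \<mu>) * p y" for y
  define J where "J x = (LINT y|lebesgue. (indicat_real {x..} y * exp (- y / \<mu>)) * p y)" for x
  have qi: "integrable lebesgue (\<lambda>y. (indicat_real {x..} y * exp (- y / \<mu>)) * p y)" for x
    by (rule sqi_mult_integrable[OF sqi_exp_tail(1)[OF \<mu>] p])
  have qa: "q absolutely_integrable_on {a..b}" for a b
  proof -
    have "integrable lebesgue (\<lambda>y. indicat_real {a..b} y *\<^sub>R ((indicat_real {a..} y * exp (- y / \<mu>)) * p y))"
      by (rule integrable_mult_indicator[OF _ qi]) auto
    moreover have "(\<lambda>y. indicat_real {a..b} y *\<^sub>R ((indicat_real {a..} y * exp (- y / \<mu>)) * p y)) = (\<lambda>y. indicat_real {a..b} y *\<^sub>R q y)"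
      by (auto simp: q_def split: split_indicator)
    ultimately show ?thesis by (simp add: set_integrable_def)
  qed
  have Jd: "J a - J b = integral {a..b} q" if "a \<le> b" for a b
  proof -
    have "J a - J b = (LINT y|lebesgue. (indicat_real {a..} y * exp (- y / \<mu>)) * p y - (indicat_real {b..} y * exp (- y / \<mu>)) * p y)"
      unfolding J_def using qi by simp
    also have "\<dots> = (LINT y:{a..b}|lebesgue. q y)"
      unfolding set_lebesgue_integral_def
    proof (rule integral_cong_AE)
      have "AE y in lebesgue. y \<noteq> b" by (rule AE_I'[where N="{b}"]) auto
      then show "AE y in lebesgue. (indicat_real {a..} y * exp (- y / \<mu>)) * p y - (indicat_real {b..} y * exp (- y / \<mu>)) * p y = indicat_real {a..b} y *\<^sub>R q y"
        by eventually_elim (use that in \<open>auto simp: q_def split: split_indicator\<close>)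
    qed (use borel_measurable_integrable[OF qi] qa in \<open>auto simp: set_integrable_def\<close>)
    finally show ?thesis using set_lebesgue_integral_eq_integral(2)[OF qa] by simp
  qed
  have ACJ: "AC UNIV J (\<lambda>y. - q y)"
    unfolding AC_def
  proof (intro allI impI conjI)
    fix a b :: real assume ab: "a \<le> b"
    show "(\<lambda>y. - q y) absolutely_integrable_on {a..b}" using qa[of a b] by (simp add: set_integrable_def)
    have "(q has_integral (J a - J b)) {a..b}"
      using Jd[OF ab] qa[of a b] by (metis absolutely_integrable_on_def integrable_integral)
    then show "((\<lambda>y. - q y) has_integral (J b - J a)) {a..b}" using has_integral_neg[of q "J a - J b" "{a..b}"] by simp
  qed
  define A where "A x = (exp (x / \<mu>) / \<mu>) * J x" for x
  have ACe: "AC UNIV (\<lambda>x. exp (x / \<mu>) / \<mu>) (\<lambda>x. exp (x / \<mu>) / \<mu> / \<mu>)"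
    by (rule AC_C1) (use \<mu> in \<open>auto intro!: derivative_eq_intros continuous_intros\<close>)
  have ACA: "AC UNIV A (\<lambda>x. (A x - p x) / \<mu>)"
  proof (rule AC_cong[OF AC_mult[OF ACe ACJ]])
    show "exp (x / \<mu>) / \<mu> / \<mu> * J x + exp (x / \<mu>) / \<mu> * - q x = (A x - p x) / \<mu>" for x
    proof -
      have "exp (x / \<mu>) * q x = p x" by (simp add: q_def exp_minus)
      then show ?thesis using \<mu> by (simp add: A_def field_simps)
    qed
  qed (simp add: A_def)
  have bnd: "\<bar>A x\<bar> \<le> nrm2 p / sqrt (2 * \<mu>)" for x
  proof -
    have "\<bar>J x\<bar> \<le> (sqrt (\<mu> / 2) * exp (- x / \<mu>)) * nrm2 p"
      unfolding J_def using nrm2_Cauchy_Schwarz[OF sqi_exp_tail(1)[OF \<mu>] p, of x] sqi_exp_tail(2)[OF \<mu>, of x] by simp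
    then have "exp (x / \<mu>) / \<mu> * \<bar>J x\<bar> \<le> exp (x / \<mu>) / \<mu> * ((sqrt (\<mu> / 2) * exp (- x / \<mu>)) * nrm2 p)"
      using \<mu> by (intro mult_left_mono) auto
    also have "\<dots> = sqrt (\<mu> / 2) / \<mu> * nrm2 p" by (simp add: exp_minus)
    also have "sqrt (\<mu> / 2) / \<mu> = 1 / sqrt (2 * \<mu>)"
    proof -
      have "sqrt (\<mu> / 2) * sqrt (2 * \<mu>) = \<mu>" using \<mu> by (simp add: real_sqrt_mult[symmetric])
      then show ?thesis using \<mu> by (simp add: field_simps)
    qed
    finally show ?thesis using \<mu> by (simp add: A_def abs_mult)
  qed
  have cont: "continuous_on {a..b} A" for a b by (rule AC_continuous[OF ACA]) auto
  then have contU: "continuous_on UNIV A"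
    unfolding continuous_on_eq_continuous_at[OF open_UNIV]
  proof (intro ballI)
    show "isCont A x" for x
      using continuous_on_interior[OF cont[of "x - 1" "x + 1"], of x] by simp
  qed
  have loc: "integral {a..b} (\<lambda>x. (A x)\<^sup>2) \<le> (2 * nrm2 p)\<^sup>2" if ab: "a \<le> b" for a b
  proof -
    have AA: "AC UNIV (\<lambda>x. A x * A x) (\<lambda>x. (A x - p x) / \<mu> * A x + A x * ((A x - p x) / \<mu>))"
      by (rule AC_mult[OF ACA ACA])
    define D where "D x = (A x - p x) / \<mu> * A x + A x * ((A x - p x) / \<mu>)" for x
    have DI: "(D has_integral (A b * A b - A a * A a)) {a..b}" using ACD(2)[OF AA ab] by (simp add: D_def[abs_def])
    have iA: "(\<lambda>x. (A x)\<^sup>2) integrable_on {a..b}"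
      by (intro integrable_continuous_interval continuous_intros cont)
    have ip: "(\<lambda>x. (p x)\<^sup>2) integrable_on {a..b}"
    proof -
      have "integrable lebesgue (\<lambda>x. (p x)\<^sup>2)" using p by (simp add: sqi_def)
      then have "(\<lambda>x. (p x)\<^sup>2) absolutely_integrable_on {a..b}"
        using integrable_mult_indicator[of "{a..b}" lebesgue "\<lambda>x. (p x)\<^sup>2"] by (simp add: set_integrable_def)
      then show ?thesis by (simp add: absolutely_integrable_on_def)
    qed
    \<comment> \<open>As \<open>D\<close> is the derivative of A^2, integrating this inequality
      leaves boundary values of A^2, and the uniform bound on \<open>A\<close> controls them
      independently of the interval.\<close>
    have le: "(A x)\<^sup>2 \<le> (p x)\<^sup>2 + \<mu> * D x" for x
    proof -
      have "\<mu> * D x = 2 * (A x)\<^sup>2 - 2 * (p x * A x)" using \<mu> by (simp add: D_def field_simps power2_eq_square)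
      moreover have "2 * (p x * A x) \<le> (p x)\<^sup>2 + (A x)\<^sup>2" using sum_squares_bound[of "p x" "A x"] by simp
      ultimately show ?thesis by simp
    qed
    have Di: "D integrable_on {a..b}" using DI by blast
    have "integral {a..b} (\<lambda>x. (A x)\<^sup>2) \<le> integral {a..b} (\<lambda>x. (p x)\<^sup>2 + \<mu> * D x)"
      by (rule integral_le[OF iA integrable_add[OF ip integrable_on_mult_right[OF Di]]]) (rule le)
    also have "\<dots> = integral {a..b} (\<lambda>x. (p x)\<^sup>2) + \<mu> * (A b * A b - A a * A a)"
      using Henstock_Kurzweil_Integration.integral_add[OF ip integrable_on_mult_right[OF Di, of \<mu>]] integral_unique[OF DI] by simp
    also have "\<dots> \<le> (nrm2 p)\<^sup>2 + \<mu> * (nrm2 p / sqrt (2 * \<mu>))\<^sup>2"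
    proof (rule add_mono[OF integral_sq_le_nrm2[OF p]])
      have "A b * A b \<le> (nrm2 p / sqrt (2 * \<mu>))\<^sup>2"
        using power_mono[OF bnd[of b], of 2] by (simp add: power2_eq_square)
      then have "A b * A b - A a * A a \<le> (nrm2 p / sqrt (2 * \<mu>))\<^sup>2"
        using zero_le_square[of "A a"] by linarith
      then show "\<mu> * (A b * A b - A a * A a) \<le> \<mu> * (nrm2 p / sqrt (2 * \<mu>))\<^sup>2"
        using \<mu> by (intro mult_left_mono) auto
    qed
    also have "\<dots> = (3 / 2) * (nrm2 p)\<^sup>2" using \<mu> by (simp add: power_divide field_simps)
    also have "\<dots> \<le> (2 * nrm2 p)\<^sup>2" by (simp add: power_mult_distrib)
    finally show ?thesis .
  qed
  show ?thesis
    by (rule that[OF ACA _ _ bnd]) (use sqi_of_local_bound[OF contU loc] nrm2_nonneg[of p] in auto)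
qed

lemma AC_reflect: assumes "AC UNIV f g" shows "AC UNIV (\<lambda>x. f (- x)) (\<lambda>x. - g (- x))"
  unfolding AC_def
proof (intro allI impI conjI)
  fix a b :: real assume ab: "a \<le> b"
  have 1: "g absolutely_integrable_on {-b..-a}" "(g has_integral (f (-a) - f (-b))) {-b..-a}"
    using ACD(1,2)[OF assms, of "-b" "-a"] ab by auto
  have i: "((\<lambda>x. g (- x)) has_integral (f (-a) - f (-b))) {a..b}"
    using has_integral_reflect_real[of g "f (-a) - f (-b)" "-a" "-b"] 1(2) by (simp add: has_integral_reflect_real)
  have "(\<lambda>x. g (- x)) absolutely_integrable_on {a..b}"
    using absolutely_integrable_reflect_real[where f=g and a="-b" and b="-a"] 1(1) by simp
  then show "(\<lambda>x. - g (- x)) absolutely_integrable_on {a..b}" by (simp add: set_integrable_def)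
  show "((\<lambda>x. - g (- x)) has_integral f (- b) - f (- a)) {a..b}"
    using has_integral_neg[OF i] by simp
qed

lemma sqi_reflect: assumes "sqi f" shows "sqi (\<lambda>x. f (- x))" "nrm2 (\<lambda>x. f (- x)) = nrm2 f"
proof -
  have m: "f \<in> borel_measurable lebesgue" and i: "integrable lebesgue (\<lambda>x. (f x)\<^sup>2)" using assms by (auto simp: sqi_def)
  have "(\<lambda>x::real. 0 + (-1) * x) \<in> lebesgue \<rightarrow>\<^sub>M lebesgue"
    using lebesgue_affine_measurable[where c="\<lambda>x::real. -1" and t=0] by simp
  from measurable_compose[OF this m] have "(\<lambda>x. f (- x)) \<in> borel_measurable lebesgue" by simp
  moreover have h: "has_bochner_integral lebesgue (\<lambda>x. (f (- x))\<^sup>2) (LINT x|lebesgue. (f x)\<^sup>2)"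
    using has_bochner_integral_lebesgue_real_affine_iff[of "-1" "\<lambda>x. (f x)\<^sup>2" "LINT x|lebesgue. (f x)\<^sup>2" 0]
      has_bochner_integral_integrable[OF i] by simp
  ultimately show "sqi (\<lambda>x. f (- x))" by (auto simp: sqi_def has_bochner_integral_iff)
  show "nrm2 (\<lambda>x. f (- x)) = nrm2 f" using h by (simp add: nrm2_def has_bochner_integral_iff)
qed

text \<open>The reflection x -> -x exchanges the operators I - \<mu> d/dx and I + \<mu> d/dx, so the
  backward solution for the reflected datum is reflected back.\<close>

lemma first_order_forward:
  assumes \<mu>: "\<mu> > 0" and p: "sqi p"
  obtains B where "AC UNIV B (\<lambda>x. (p x - B x) / \<mu>)" "sqi B" "nrm2 B \<le> 2 * nrm2 p"
    "\<And>x. \<bar>B x\<bar> \<le> nrm2 p / sqrt (2 * \<mu>)"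
proof -
  note r = sqi_reflect[OF p]
  obtain A where A: "AC UNIV A (\<lambda>x. (A x - p (- x)) / \<mu>)" "sqi A" "nrm2 A \<le> 2 * nrm2 p"
    "\<And>x. \<bar>A x\<bar> \<le> nrm2 p / sqrt (2 * \<mu>)"
    using first_order_backward[OF \<mu> r(1)] unfolding r(2) by blast
  have "AC UNIV (\<lambda>x. A (- x)) (\<lambda>x. (p x - A (- x)) / \<mu>)"
    by (rule AC_cong[OF AC_reflect[OF A(1)]]) (use \<mu> in \<open>auto simp: field_simps\<close>)
  then show ?thesis by (rule that) (use sqi_reflect[OF A(2)] A in auto)
qed

context dom
begin

lemma AC_UNIV_Eb: "AC UNIV f g \<Longrightarrow> AC Eb f g" by (rule AC_mono) auto

text \<open>The homogeneous solutions of \<open>u - \<mu>\<^sup>2 u'' = 0\<close> on the two components.\<close>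

definition hm :: "real \<Rightarrow> real \<Rightarrow> real" where "hm \<mu> x = (if x \<le> 0 then exp ((x + r) / \<mu>) else 0)"
definition hp :: "real \<Rightarrow> real \<Rightarrow> real" where "hp \<mu> x = (if x \<le> 0 then 0 else exp ((x - l) / \<mu>))"
definition hq :: "real \<Rightarrow> real \<Rightarrow> real" where "hq \<mu> x = (if x \<le> 0 then 0 else exp ((r - x) / \<mu>))"

lemma AC_homogeneous:
  assumes "\<mu> > 0"
  shows "AC Eb (hm \<mu>) (\<lambda>x. hm \<mu> x / \<mu>)" "AC Eb (hp \<mu>) (\<lambda>x. hp \<mu> x / \<mu>)" "AC Eb (hq \<mu>) (\<lambda>x. - hq \<mu> x / \<mu>)"
proof -
  have e: "AC J (\<lambda>x. exp ((x + c) / \<mu>)) (\<lambda>x. exp ((x + c) / \<mu>) / \<mu>)" for J c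
    by (rule AC_C1) (use assms in \<open>auto intro!: derivative_eq_intros continuous_intros\<close>)
  have e': "AC J (\<lambda>x. exp ((r - x) / \<mu>)) (\<lambda>x. - exp ((r - x) / \<mu>) / \<mu>)" for J
    by (rule AC_C1) (use assms in \<open>auto intro!: derivative_eq_intros continuous_intros\<close>)
  show "AC Eb (hm \<mu>) (\<lambda>x. hm \<mu> x / \<mu>)"
    by (rule AC_Eb_I; rule AC_cong[OF e[of _ r]] AC_cong[OF AC_const[of _ 0]]) (use r0 in \<open>auto simp: hm_def\<close>)
  show "AC Eb (hp \<mu>) (\<lambda>x. hp \<mu> x / \<mu>)"
  proof (rule AC_Eb_I)
    show "AC {..-r} (hp \<mu>) (\<lambda>x. hp \<mu> x / \<mu>)" by (rule AC_cong[OF AC_const[of _ 0]]) (use r0 in \<open>auto simp: hp_def\<close>)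
    show "AC {r..l} (hp \<mu>) (\<lambda>x. hp \<mu> x / \<mu>)" by (rule AC_cong[OF e[of _ "-l"]]) (use r0 in \<open>auto simp: hp_def\<close>)
  qed
  show "AC Eb (hq \<mu>) (\<lambda>x. - hq \<mu> x / \<mu>)"
  proof (rule AC_Eb_I)
    show "AC {..-r} (hq \<mu>) (\<lambda>x. - hq \<mu> x / \<mu>)" by (rule AC_cong[OF AC_const[of _ 0]]) (use r0 in \<open>auto simp: hq_def\<close>)
    show "AC {r..l} (hq \<mu>) (\<lambda>x. - hq \<mu> x / \<mu>)" by (rule AC_cong[OF e']) (use r0 in \<open>auto simp: hq_def\<close>)
  qed
qed

lemma sqi_homogeneous:
  assumes "\<mu> > 0"
  shows "sqi (ext (hm \<mu>))" "sqi (ext (hp \<mu>))" "sqi (ext (hq \<mu>))"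
proof -
  have bounded: "sqi (ext f)" if "AC Eb f f'" "\<And>x. x \<le> 0 \<Longrightarrow> f x = 0" for f f'
  proof -
    have c: "continuous_on {r..l} f" by (rule AC_continuous[OF that(1)]) (auto simp: Eb_def)
    have m: "(\<lambda>x. indicat_real {r..l} x *\<^sub>R f x) \<in> borel_measurable lebesgue"
      using absolutely_integrable_continuous_real[OF c] by (auto simp: set_integrable_def)
    have "(\<lambda>x. (f x)\<^sup>2) absolutely_integrable_on {r..l}"
      by (intro absolutely_integrable_continuous_real continuous_intros c)
    moreover have "(\<lambda>x. (indicat_real {r..l} x * f x)\<^sup>2) = (\<lambda>x. indicat_real {r..l} x *\<^sub>R (f x)\<^sup>2)"
      by (auto split: split_indicator)
    ultimately have "sqi (\<lambda>x. indicat_real {r..l} x * f x)" using m by (simp add: sqi_def set_integrable_def)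
    then have "sqi (ext (\<lambda>x. indicat_real {r..l} x * f x))" by (rule sqi_ext)
    moreover have "ext (\<lambda>x. indicat_real {r..l} x * f x) = ext f"
      by (rule ext_eqI) (use that(2) r0 in \<open>auto simp: Eb_def split: split_indicator\<close>)
    ultimately show ?thesis by simp
  qed
  show "sqi (ext (hp \<mu>))" by (rule bounded[OF AC_homogeneous(2)[OF assms]]) (simp add: hp_def)
  show "sqi (ext (hq \<mu>))" by (rule bounded[OF AC_homogeneous(3)[OF assms]]) (simp add: hq_def)
  have "sqi (\<lambda>y. exp (r / \<mu>) * (indicat_real {r..} (- y) * exp (- (- y) / \<mu>)))"
    by (intro sqi_cmult sqi_reflect(1)[OF sqi_exp_tail(1)[OF assms]])
  then have "sqi (ext (\<lambda>y. exp (r / \<mu>) * (indicat_real {r..} (- y) * exp (- (- y) / \<mu>))))" by (rule sqi_ext)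
  moreover have "ext (\<lambda>y. exp (r / \<mu>) * (indicat_real {r..} (- y) * exp (- (- y) / \<mu>))) = ext (hm \<mu>)"
    by (rule ext_eqI) (use r0 in \<open>auto simp: Eb_def hm_def exp_add[symmetric] add_divide_distrib split: split_indicator\<close>)
  ultimately show "sqi (ext (hm \<mu>))" by simp
qed

section \<open>The Neumann problem\<close>

text \<open>The problem u - \<mu>^2 u'' = phi with Neumann conditions, written as a first order
  system for \<open>u\<close> and \<open>w\<close> = u'. Decay at minus infinity is encoded by
  square integrability.\<close>

definition Neu :: "real \<Rightarrow> (real \<Rightarrow> real) \<Rightarrow> (real \<Rightarrow> real) \<Rightarrow> (real \<Rightarrow> real) \<Rightarrow> bool" where
  "Neu \<mu> \<phi> u w \<longleftrightarrow> AC Eb u w \<and> AC Eb w (\<lambda>x. (u x - \<phi> x) / \<mu>\<^sup>2) \<and> sqi (ext u) \<and> sqi (ext w) \<and>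
     w (- r) = 0 \<and> w r = 0 \<and> w l = 0"

text \<open>On the line the resolvent splits as half the sum of the inverses of I - \<mu> d/dx and I
  + \<mu> d/dx. Applied to the zero extension this solves the equation on \<open>E\<close>; one
  exponential on the left and two on the right then correct the three Neumann values.\<close>

lemma Neu_exists:
  assumes \<mu>: "\<mu> > 0"
  shows "\<exists>C\<ge>0. \<forall>\<phi>. sqi (ext \<phi>) \<longrightarrow> (\<exists>u w. Neu \<mu> \<phi> u w \<and> nE u \<le> C * nE \<phi> \<and> nE w \<le> C * nE \<phi>)"
proof -
  \<comment> \<open>The value of the exponentials \<open>hp\<close> and \<open>hq\<close> at the end
    opposite to where they equal 1.\<close>
  define Q where "Q = exp (- ((l - r) / \<mu>))"
  have Q: "0 < Q" "Q < 1" using rl \<mu> by (auto simp: Q_def)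
  have Q2: "1 - Q\<^sup>2 > 0" using mult_strict_mono[of Q 1 Q 1] Q by (simp add: power2_eq_square)
  define H where "H = nE (hm \<mu>) + nE (hp \<mu>) + nE (hq \<mu>)"
  have H: "nE (hm \<mu>) \<le> H" "nE (hp \<mu>) \<le> H" "nE (hq \<mu>) \<le> H" "H \<ge> 0" using nE_nonneg by (auto simp: H_def add_increasing add_increasing2)
  define c where "c = 1 / sqrt (2 * \<mu>)"
  have c: "c \<ge> 0" using \<mu> by (simp add: c_def)
  define C2 where "C2 = 2 * c / (1 - Q\<^sup>2)"
  define C3 where "C3 = C2 + c"
  have C2: "C2 \<ge> 0" "C3 \<ge> 0" using c Q2 by (auto simp: C2_def C3_def)
  define S where "S = (c + C2 + C3) * H"
  have S: "S \<ge> 0" unfolding S_def using c C2 H by simp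
  define C where "C = (2 + S) * (1 + 1 / \<mu>)"
  have C: "2 + S \<le> C" "(2 + S) / \<mu> \<le> C" using S \<mu> by (auto simp: C_def field_simps)
  show ?thesis
  proof (intro exI[of _ C] conjI allI impI)
    show "C \<ge> 0" using C S by linarith
    fix \<phi> assume p: "sqi (ext \<phi>)"
    let ?N = "nE \<phi>"
    have N0: "?N \<ge> 0" by (rule nE_nonneg)
    obtain A where A: "AC UNIV A (\<lambda>x. (A x - ext \<phi> x) / \<mu>)" "sqi A" "nrm2 A \<le> 2 * ?N" "\<And>x. \<bar>A x\<bar> \<le> c * ?N"
      using first_order_backward[OF \<mu> p] by (auto simp: nE_def c_def)
    obtain B where B: "AC UNIV B (\<lambda>x. (ext \<phi> x - B x) / \<mu>)" "sqi B" "nrm2 B \<le> 2 * ?N" "\<And>x. \<bar>B x\<bar> \<le> c * ?N"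
      using first_order_forward[OF \<mu> p] by (auto simp: nE_def c_def)
    \<comment> \<open>This is \<mu> times the derivative of (A + B) / 2, by the two first order
      equations.\<close>
    define w0 where "w0 x = (A x - B x) / 2" for x
    have w0: "\<bar>w0 x\<bar> \<le> c * ?N" for x using A(4)[of x] B(4)[of x] by (simp add: w0_def)
    define a1 where "a1 = - w0 (-r)"
    \<comment> \<open>Together with \<open>a3\<close> this solves w0(r) + Q a2 - a3 = 0 and w0(l) +
      a2 - Q a3 = 0, a system with determinant 1 - Q^2 up to sign.\<close>
    define a2 where "a2 = (Q * w0 r - w0 l) / (1 - Q\<^sup>2)"
    define a3 where "a3 = Q * a2 + w0 r"
    have a1: "\<bar>a1\<bar> \<le> c * ?N" using w0 by (simp add: a1_def)
    have a2: "\<bar>a2\<bar> \<le> C2 * ?N"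
    proof -
      have "\<bar>Q * w0 r - w0 l\<bar> \<le> Q * \<bar>w0 r\<bar> + \<bar>w0 l\<bar>" using Q by (metis abs_mult abs_of_pos abs_triangle_ineq4)
      also have "\<dots> \<le> 1 * \<bar>w0 r\<bar> + \<bar>w0 l\<bar>" using Q by (intro add_mono mult_right_mono) auto
      also have "\<dots> \<le> 2 * c * ?N" using w0[of r] w0[of l] by simp
      finally show ?thesis using Q2 by (simp add: a2_def C2_def abs_div divide_right_mono)
    qed
    have a3: "\<bar>a3\<bar> \<le> C3 * ?N"
    proof -
      have "\<bar>a3\<bar> \<le> Q * \<bar>a2\<bar> + \<bar>w0 r\<bar>" using Q unfolding a3_def by (metis abs_mult abs_of_pos abs_triangle_ineq)
      also have "\<dots> \<le> 1 * \<bar>a2\<bar> + \<bar>w0 r\<bar>" using Q by (intro add_mono mult_right_mono) auto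
      also have "\<dots> \<le> C3 * ?N" using a2 w0[of r] by (simp add: C3_def algebra_simps)
      finally show ?thesis .
    qed
    define u where "u x = (A x + B x) / 2 + (a1 * hm \<mu> x + (a2 * hp \<mu> x + a3 * hq \<mu> x))" for x
    define v where "v x = w0 x + (a1 * hm \<mu> x + (a2 * hp \<mu> x + (- a3) * hq \<mu> x))" for x
    define w where "w x = (1 / \<mu>) * v x" for x
    note hAC = AC_homogeneous[OF \<mu>] and hs = sqi_homogeneous[OF \<mu>]
    have ext_eq: "AE x in lebesgue. x \<in> Eb \<longrightarrow> ext \<phi> x = \<phi> x" by (rule AE_E_Eb) (auto simp: ext_def)
    have ACA: "AC Eb A (\<lambda>x. (A x - \<phi> x) / \<mu>)"
      by (rule AC_AE_cong[OF AC_UNIV_Eb[OF A(1)] _ Eb_sets]) (use ext_eq in \<open>auto elim: eventually_mono\<close>)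
    have ACB: "AC Eb B (\<lambda>x. (\<phi> x - B x) / \<mu>)"
      by (rule AC_AE_cong[OF AC_UNIV_Eb[OF B(1)] _ Eb_sets]) (use ext_eq in \<open>auto elim: eventually_mono\<close>)
    have uw: "AC Eb u w"
      by (rule AC_cong[OF AC_add[OF AC_cmult[OF AC_add[OF ACA ACB], of "1/2"]
         AC_add[OF AC_cmult[OF hAC(1), of a1] AC_add[OF AC_cmult[OF hAC(2), of a2] AC_cmult[OF hAC(3), of a3]]]]])
       (use \<mu> in \<open>auto simp: u_def w_def v_def w0_def field_simps\<close>)
    have ww: "AC Eb w (\<lambda>x. (u x - \<phi> x) / \<mu>\<^sup>2)"
      by (rule AC_cong[OF AC_cmult[OF AC_add[OF AC_cmult[OF AC_diff[OF ACA ACB], of "1/2"]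
         AC_add[OF AC_cmult[OF hAC(1), of a1] AC_add[OF AC_cmult[OF hAC(2), of a2] AC_cmult[OF hAC(3), of "- a3"]]]], of "1 / \<mu>"]])
       (use \<mu> in \<open>auto simp: u_def w_def v_def w0_def field_simps power2_eq_square\<close>)
    have hv: "hm \<mu> (-r) = 1" "hp \<mu> (-r) = 0" "hq \<mu> (-r) = 0" "hm \<mu> r = 0" "hp \<mu> r = Q" "hq \<mu> r = 1"
      "hm \<mu> l = 0" "hp \<mu> l = 1" "hq \<mu> l = Q"
      using r0 rl by (auto simp: hm_def hp_def hq_def Q_def minus_divide_left)
    have b1: "w (-r) = 0" by (simp add: w_def v_def hv a1_def)
    have b2: "w r = 0" by (simp add: w_def v_def hv a3_def mult.commute)
    have b3: "w l = 0"
    proof -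
      have "a2 * (1 - Q\<^sup>2) = Q * w0 r - w0 l" using Q2 by (simp add: a2_def)
      then have "w0 l + a2 - a3 * Q = 0" by (simp add: a3_def algebra_simps power2_eq_square)
      then show ?thesis by (simp add: w_def v_def hv)
    qed
    have hH: "Hb 0 (hm \<mu>) H" "Hb 0 (hp \<mu>) H" "Hb 0 (hq \<mu>) H" using hs H by auto
    have hA: "Hb 0 A (2 * ?N)" "Hb 0 B (2 * ?N)"
      using sqi_ext[OF A(2)] sqi_ext[OF B(2)] nE_le_nrm2[OF A(2)] nE_le_nrm2[OF B(2)] A(3) B(3) by auto
    have sumle: "\<bar>a1\<bar> * H + (\<bar>a2\<bar> * H + \<bar>a3\<bar> * H) \<le> S * ?N"
    proof -
      have "(\<bar>a1\<bar> + \<bar>a2\<bar> + \<bar>a3\<bar>) * H \<le> (c * ?N + C2 * ?N + C3 * ?N) * H"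
        using a1 a2 a3 H by (intro mult_right_mono add_mono) auto
      then show ?thesis by (simp add: S_def algebra_simps)
    qed
    have "Hb 0 u (\<bar>1/2\<bar> * (2 * ?N + 2 * ?N) + (\<bar>a1\<bar> * H + (\<bar>a2\<bar> * H + \<bar>a3\<bar> * H)))"
      using Hb_add[OF Hb_cmult[OF Hb_add[OF hA], of "1/2"] Hb_add[OF Hb_cmult[OF hH(1), of a1] Hb_add[OF Hb_cmult[OF hH(2), of a2] Hb_cmult[OF hH(3), of a3]]]]
      by (simp only: u_def[abs_def] times_divide_eq_left mult_1)
    then have hu: "Hb 0 u (C * ?N)"
      by (rule Hb_mono) (use sumle mult_right_mono[OF C(1) N0] in \<open>simp add: algebra_simps\<close>)
    have "Hb 0 v (\<bar>1/2\<bar> * (2 * ?N + 2 * ?N) + (\<bar>a1\<bar> * H + (\<bar>a2\<bar> * H + \<bar>- a3\<bar> * H)))"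
      using Hb_add[OF Hb_cmult[OF Hb_diff[OF hA], of "1/2"] Hb_add[OF Hb_cmult[OF hH(1), of a1] Hb_add[OF Hb_cmult[OF hH(2), of a2] Hb_cmult[OF hH(3), of "- a3"]]]]
      by (simp only: v_def[abs_def] w0_def[abs_def] times_divide_eq_left mult_1)
    then have hv: "Hb 0 v ((2 + S) * ?N)"
      by (rule Hb_mono) (use sumle in \<open>simp add: algebra_simps\<close>)
    have "\<bar>1 / \<mu>\<bar> * ((2 + S) * ?N) \<le> C * ?N"
      using mult_right_mono[OF C(2) N0] \<mu> by simp
    then have hw: "Hb 0 w (C * ?N)"
      using Hb_mono[OF Hb_cmult[OF hv, of "1 / \<mu>"]] by (simp only: w_def[abs_def])
    show "\<exists>u w. Neu \<mu> \<phi> u w \<and> nE u \<le> C * nE \<phi> \<and> nE w \<le> C * nE \<phi>"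
      using uw ww b1 b2 b3 hu hw by (auto simp: Neu_def)
  qed
qed

end

section \<open>Traces\<close>

text \<open>Every set of the filter contains an interval of positive length; such a set cannot be
  null, which is what makes essential limits unique.\<close>

definition thick :: "real filter \<Rightarrow> bool" where
  "thick F \<longleftrightarrow> (\<forall>S. eventually (\<lambda>x. x \<in> S) F \<longrightarrow> (\<exists>a b. a < b \<and> {a<..<b} \<subseteq> S))"

lemma thick_at_right: "thick (at_right (a::real))"
  unfolding thick_def eventually_at_right_field
  by (auto simp: subset_iff)

lemma thick_at_left: "thick (at_left (a::real))"
  unfolding thick_def eventually_at_left_field
  by (auto simp: subset_iff)

lemma not_AE_interval: "a < b \<Longrightarrow> \<not> (AE x in lebesgue. x \<notin> {a<..<b::real})"
proof
  assume ab: "a < b" and ae: "AE x in lebesgue. x \<notin> {a<..<b}"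
  then have "{a<..<b} \<in> null_sets lebesgue" by (subst AE_iff_null_sets) auto
  then have "emeasure lebesgue {a<..<b} = 0" by auto
  then show False using ab by simp
qed

lemma ess_tendsto_unique:
  assumes "thick F" "ess_tendsto f c F" "ess_tendsto f d F" shows "c = d"
proof (rule ccontr)
  assume "c \<noteq> d"
  then have e: "\<bar>c - d\<bar> / 2 > 0" by simp
  obtain S where S: "eventually (\<lambda>x. x \<in> S) F" "AE x in lebesgue. x \<in> S \<longrightarrow> \<bar>f x - c\<bar> < \<bar>c - d\<bar> / 2"
    using assms(2) e unfolding ess_tendsto_def by blast
  obtain S' where S': "eventually (\<lambda>x. x \<in> S') F" "AE x in lebesgue. x \<in> S' \<longrightarrow> \<bar>f x - d\<bar> < \<bar>c - d\<bar> / 2"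
    using assms(3) e unfolding ess_tendsto_def by blast
  have "eventually (\<lambda>x. x \<in> S \<inter> S') F" using S(1) S'(1) by eventually_elim auto
  then obtain a b where ab: "a < b" "{a<..<b} \<subseteq> S \<inter> S'" using assms(1) unfolding thick_def by blast
  have "AE x in lebesgue. x \<notin> {a<..<b}" using S(2) S'(2)
  proof eventually_elim
    case (elim x)
    show ?case
    proof
      assume "x \<in> {a<..<b}"
      then have "\<bar>f x - c\<bar> < \<bar>c - d\<bar> / 2" "\<bar>f x - d\<bar> < \<bar>c - d\<bar> / 2" using elim ab by auto
      moreover have "\<bar>c - d\<bar> \<le> \<bar>f x - c\<bar> + \<bar>f x - d\<bar>" by arith
      ultimately show False by argo
    qed
  qed
  then show False using not_AE_interval[OF ab(1)] by blast
qed

lemma ess_lim_eq: "thick F \<Longrightarrow> ess_tendsto f c F \<Longrightarrow> ess_lim f F = c"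
  unfolding ess_lim_def using ess_tendsto_unique by blast

lemma ess_tendsto_of_tendsto:
  assumes "(g \<longlongrightarrow> c) F" "AE x in lebesgue. x \<in> E \<longrightarrow> f x = g x" "eventually (\<lambda>x. x \<in> E) F"
  shows "ess_tendsto f c F"
  unfolding ess_tendsto_def
proof (intro allI impI)
  fix e :: real assume e: "e > 0"
  let ?S = "{x \<in> E. \<bar>g x - c\<bar> < e}"
  have "eventually (\<lambda>x. \<bar>g x - c\<bar> < e) F" using tendstoD[OF assms(1) e] by (simp add: dist_real_def)
  then have "eventually (\<lambda>x. x \<in> ?S) F" using assms(3) by eventually_elim auto
  moreover have "AE x in lebesgue. x \<in> ?S \<longrightarrow> \<bar>f x - c\<bar> < e" using assms(2) by eventually_elim auto
  ultimately show "\<exists>S. eventually (\<lambda>x. x \<in> S) F \<and> (AE x in lebesgue. x \<in> S \<longrightarrow> \<bar>f x - c\<bar> < e)" by blast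
qed

context dom
begin

text \<open>Continuity from inside at each of the three boundary points; on the unbounded component
  a unit interval next to -r determines the trace.\<close>

definition contB :: "(real \<Rightarrow> real) \<Rightarrow> bool" where
  "contB g \<longleftrightarrow> continuous_on {-r-1..-r} g \<and> continuous_on {r..l} g"

lemma AC_contB: "AC Eb f g \<Longrightarrow> contB f"
  unfolding contB_def by (auto intro!: AC_continuous simp: Eb_def)

lemma Hm_contB: "Hm m f \<Longrightarrow> m \<ge> 1 \<Longrightarrow> contB f"
  by (cases m) (auto simp: Hm_def intro: AC_contB)

lemma trace:
  assumes "contB g" "AEE x. f x = g x"
  shows "ess_tendsto f (g (-r)) (at_left (-r))" "ess_tendsto f (g r) (at_right r)" "ess_tendsto f (g l) (at_left l)"
    and "ess_lim f (at_left (-r)) = g (-r)" "ess_lim f (at_right r) = g r"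
    and "jump r f = g r - g (-r)" "mean r f = (g r + g (-r)) / 2"
proof -
  have c: "continuous_on {-r-1..-r} g" "continuous_on {r..l} g" using assms(1) by (auto simp: contB_def)
  have t1: "(g \<longlongrightarrow> g (-r)) (at_left (-r))"
    using continuous_on_Icc_at_leftD[OF c(1)] by simp
  have t2: "(g \<longlongrightarrow> g r) (at_right r)"
    using continuous_on_Icc_at_rightD[OF c(2)] rl by simp
  have t3: "(g \<longlongrightarrow> g l) (at_left l)"
    using continuous_on_Icc_at_leftD[OF c(2)] rl by simp
  show e1: "ess_tendsto f (g (-r)) (at_left (-r))"
    by (rule ess_tendsto_of_tendsto[OF t1 assms(2)]) (auto simp: domE_def eventually_at_left_field intro!: exI[of _ "-r-1"])
  show e2: "ess_tendsto f (g r) (at_right r)"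
    by (rule ess_tendsto_of_tendsto[OF t2 assms(2)]) (use rl in \<open>auto simp: domE_def eventually_at_right_field intro!: exI[of _ l]\<close>)
  show "ess_tendsto f (g l) (at_left l)"
    by (rule ess_tendsto_of_tendsto[OF t3 assms(2)]) (use rl in \<open>auto simp: domE_def eventually_at_left_field intro!: exI[of _ r]\<close>)
  show l1: "ess_lim f (at_left (-r)) = g (-r)" by (rule ess_lim_eq[OF thick_at_left e1])
  show l2: "ess_lim f (at_right r) = g r" by (rule ess_lim_eq[OF thick_at_right e2])
  show "jump r f = g r - g (-r)" "mean r f = (g r + g (-r)) / 2" by (simp_all add: jump_def mean_def l1 l2)
qed

text \<open>The square of f(x) is at most the integral over [x-1, x] of f^2 + 2 |f g|, which is
  bounded by a tail of an integrable function.\<close>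

lemma decay:
  assumes AC: "AC Eb f g" and s: "sqi (ext f)" "sqi (ext g)"
  shows "(f \<longlongrightarrow> 0) at_bot"
proof -
  define F where "F y = (ext f y)\<^sup>2 + 2 * \<bar>ext f y * ext g y\<bar>" for y
  have Fi: "integrable lebesgue F"
    unfolding F_def using s sqi_mult_integrable[OF s] by (intro Bochner_Integration.integrable_add integrable_mult_right integrable_abs) (auto simp: sqi_def)
  have F0: "F y \<ge> 0" for y by (simp add: F_def)
  define T where "T n = (LINT y|lebesgue. indicat_real {..- real n} y * F y)" for n
  have T0: "T \<longlonglongrightarrow> 0"
  proof -
    have "T \<longlonglongrightarrow> (LINT y|lebesgue. 0 * F y)" unfolding T_def
    proof (rule integral_dominated_convergence[where w=F])
      show "(\<lambda>x. indicat_real {..- real n} x * F x) \<in> borel_measurable lebesgue" for n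
        by (intro borel_measurable_times[OF borel_measurable_indicator borel_measurable_integrable[OF Fi]]) auto
      show "AE x in lebesgue. (\<lambda>n. indicat_real {..- real n} x * F x) \<longlonglongrightarrow> 0 * F x"
      proof (rule AE_I2)
        fix x
        obtain N :: nat where N: "- x < real N" using reals_Archimedean2 by blast
        have "indicat_real {..- real n} x * F x = 0 * F x" if "n \<ge> N" for n
        proof -
          have "real N \<le> real n" using that by simp
          then show ?thesis using N by (auto split: split_indicator)
        qed
        then show "(\<lambda>n. indicat_real {..- real n} x * F x) \<longlonglongrightarrow> 0 * F x"
          by (intro tendsto_eventually eventually_sequentiallyI[of N]) auto
      qed
      show "AE x in lebesgue. norm (indicat_real {..- real n} x * F x) \<le> F x" for n
        by (rule AE_I2) (use F0 in \<open>auto split: split_indicator\<close>)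
    qed (use Fi in auto)
    then show ?thesis by simp
  qed
  have bound: "(f x)\<^sup>2 \<le> T n" if x: "x < - r" "x \<le> - real n" for x n
  proof -
    have sub: "{x-1..x} \<subseteq> Eb" "{x-1..x} \<subseteq> E" using x by (auto simp: Eb_def domE_def)
    define G where "G y = (f y)\<^sup>2 + 2 * \<bar>f y * g y\<bar>" for y
    have GF: "indicat_real {x-1..x} y * G y = indicat_real {x-1..x} y * F y" for y
      using sub by (auto simp: G_def F_def ext_def split: split_indicator)
    have c: "continuous_on {x-1..x} f" by (rule AC_continuous[OF AC sub(1)])
    have ga: "(\<lambda>y. g y * f y) absolutely_integrable_on {x-1..x}"
      by (rule absolutely_integrable_mult_continuous[OF ACD(1)[OF AC _ sub(1)] c]) simp
    then have fg: "(\<lambda>y. \<bar>f y * g y\<bar>) integrable_on {x-1..x}" "(\<lambda>y. f y * g y) integrable_on {x-1..x}"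
      using set_integrable_abs[OF ga] by (simp_all add: absolutely_integrable_on_def mult.commute)
    have f2: "(\<lambda>y. (f y)\<^sup>2) integrable_on {x-1..x}" by (intro integrable_continuous_interval continuous_intros c)
    define I where "I = 2 * integral {x-1..x} (\<lambda>y. \<bar>f y * g y\<bar>)"
    \<comment> \<open>The increment of f^2 is the integral of 2 f g; the bound is then averaged over
      y in the unit interval ending at x.\<close>
    have pw: "(f x)\<^sup>2 \<le> (f y)\<^sup>2 + I" if y: "y \<in> {x-1..x}" for y
    proof -
      have yx: "y \<le> x" "{y..x} \<subseteq> {x-1..x}" using y by auto
      have "f x * f x - f y * f y = integral {y..x} (\<lambda>s. g s * f s + f s * g s)"
        using ACD(3)[OF AC_mult[OF AC AC] yx(1) order_trans[OF yx(2) sub(1)]] by simp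
      also have "\<dots> = 2 * integral {y..x} (\<lambda>s. f s * g s)"
        by (subst Henstock_Kurzweil_Integration.integral_mult_right[symmetric], rule Henstock_Kurzweil_Integration.integral_cong) (simp add: algebra_simps)
      also have "integral {y..x} (\<lambda>s. f s * g s) \<le> integral {y..x} (\<lambda>s. \<bar>f s * g s\<bar>)"
        by (rule integral_le[OF integrable_on_subinterval[OF fg(2) yx(2)] integrable_on_subinterval[OF fg(1) yx(2)]]) simp
      also have "\<dots> \<le> integral {x-1..x} (\<lambda>s. \<bar>f s * g s\<bar>)"
        by (rule integral_subset_le[OF yx(2) integrable_on_subinterval[OF fg(1) yx(2)] fg(1)]) simp
      finally show ?thesis by (simp add: I_def power2_eq_square)
    qed
    have "(f x)\<^sup>2 = integral {x-1..x} (\<lambda>y. (f x)\<^sup>2)" by simp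
    also have "\<dots> \<le> integral {x-1..x} (\<lambda>y. (f y)\<^sup>2 + I)"
      by (rule integral_le) (use pw f2 in \<open>auto intro!: integrable_add\<close>)
    also have "\<dots> = integral {x-1..x} (\<lambda>y. (f y)\<^sup>2) + I"
      using f2 by (subst Henstock_Kurzweil_Integration.integral_add) auto
    also have "\<dots> = integral {x-1..x} G"
      unfolding I_def G_def using Henstock_Kurzweil_Integration.integral_add[OF f2 integrable_on_mult_right[OF fg(1), of 2]] by simp
    also have "\<dots> = (LINT y:{x-1..x}|lebesgue. G y)"
    proof (rule set_lebesgue_integral_eq_integral(2)[symmetric])
      have "integrable lebesgue (\<lambda>y. indicat_real {x-1..x} y *\<^sub>R F y)" by (rule integrable_mult_indicator[OF _ Fi]) auto
      then show "G absolutely_integrable_on {x-1..x}" unfolding set_integrable_def real_scaleR_def GF .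
    qed
    also have "\<dots> = (LINT y|lebesgue. indicat_real {x-1..x} y * F y)" unfolding set_lebesgue_integral_def real_scaleR_def GF ..
    also have "\<dots> \<le> T n" unfolding T_def
    proof (rule integral_mono)
      show "integrable lebesgue (\<lambda>y. indicat_real {x-1..x} y * F y)"
        using integrable_mult_indicator[OF _ Fi, of "{x-1..x}"] by simp
      show "integrable lebesgue (\<lambda>y. indicat_real {..- real n} y * F y)"
        using integrable_mult_indicator[OF _ Fi, of "{..- real n}"] by simp
      show "indicat_real {x-1..x} y * F y \<le> indicat_real {..- real n} y * F y" for y
        using x F0[of y] by (auto split: split_indicator)
    qed
    finally show ?thesis .
  qed
  show ?thesis
  proof (rule tendstoI)
    fix e :: real assume e: "e > 0"
    then obtain n where n: "T n < e\<^sup>2" using order_tendstoD(2)[OF T0, of "e\<^sup>2"] by (auto simp: eventually_sequentially)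
    have "dist (f x) 0 < e" if "x < min (-r) (- real n)" for x
    proof -
      have "\<bar>f x\<bar>\<^sup>2 < e\<^sup>2" using bound[of x n] that n by simp
      then have "\<bar>f x\<bar> < e" by (rule power2_less_imp_less) (use e in simp)
      then show ?thesis by simp
    qed
    then show "\<forall>\<^sub>F x in at_bot. dist (f x) 0 < e"
      by (intro eventually_mono[OF eventually_at_bot_dense[THEN iffD2, OF exI[of _ "min (-r) (- real n)"]]]) auto
  qed
qed

lemma Hm_decay: assumes "Hm m f" "m \<ge> 1" "AEE x. h x = f x" shows "ess_tendsto h 0 at_bot"
proof -
  obtain c where c: "Hb m f c" using assms(1) by (auto simp: Hm_def)
  then have "Hb (Suc 0) f c" using Hb_le[OF c, of "Suc 0"] assms(2) by simp
  then obtain g where "AC Eb f g" "sqi (ext f)" "sqi (ext g)" by auto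
  then have "(f \<longlongrightarrow> 0) at_bot" by (rule decay)
  moreover have "\<forall>\<^sub>F x in at_bot. x \<in> E"
    by (rule eventually_mono[OF eventually_at_bot_dense[THEN iffD2, OF exI[of _ "-r"]]]) (auto simp: domE_def)
  ultimately show ?thesis using ess_tendsto_of_tendsto assms(3) by blast
qed

section \<open>Uniqueness for the resolvent equation\<close>

text \<open>Energy identity: the derivative of u w is w^2 + u^2 / \<mu>^2, and u w vanishes at the
  finite boundary points by hypothesis and at minus infinity by decay. Prescribing only the products
  covers both Neumann conditions (for \<open>Neu_unique\<close>) and Dirichlet conditions (for
  \<open>momentum_solution\<close>).\<close>

lemma homogeneous_zero:
  assumes \<mu>: "\<mu> > 0" and uw: "AC Eb u w" "AC Eb w (\<lambda>x. u x / \<mu>\<^sup>2)" and s: "sqi (ext u)" "sqi (ext w)"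
    and b: "u (-r) * w (-r) = 0" "u r * w r = 0" "u l * w l = 0" and x: "x \<in> Eb"
  shows "u x = 0" "w x = 0"
proof -
  define D where "D y = w y * w y + u y * (u y / \<mu>\<^sup>2)" for y
  have P: "AC Eb (\<lambda>x. u x * w x) D" unfolding D_def by (rule AC_mult[OF uw])
  have su: "sqi (ext (\<lambda>x. u x / \<mu>\<^sup>2))" using s(1) ext_cmult[of "1 / \<mu>\<^sup>2" u] sqi_cmult[of "ext u" "1 / \<mu>\<^sup>2"] by simp
  have "(u \<longlongrightarrow> 0) at_bot" "(w \<longlongrightarrow> 0) at_bot" using decay[OF uw(1) s] decay[OF uw(2) s(2) su] by auto
  then have P0: "((\<lambda>c. - (u c * w c)) \<longlongrightarrow> 0) at_bot" by (auto intro!: tendsto_eq_intros)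
  have D0: "D y \<ge> 0" "(u y)\<^sup>2 \<le> \<mu>\<^sup>2 * D y" "(w y)\<^sup>2 \<le> D y" for y
    using \<mu> by (auto simp: D_def power2_eq_square field_simps)
  have zero: "u y = 0 \<and> w y = 0" if ab: "a < b" "{a..b} \<subseteq> Eb" "integral {a..b} D \<le> 0" "y \<in> {a..b}" for a b y
  proof -
    have cu: "continuous_on {a..b} u" and cw: "continuous_on {a..b} w" using AC_continuous uw ab(2) by blast+
    have Di: "D integrable_on {a..b}" by (rule ACD(4)[OF P _ ab(2)]) (use ab in simp)
    have "integral {a..b} (\<lambda>y. (u y)\<^sup>2) \<le> integral {a..b} (\<lambda>y. \<mu>\<^sup>2 * D y)"
      by (rule integral_le) (use D0 in \<open>auto intro!: integrable_continuous_interval continuous_intros cu integrable_on_mult_right Di\<close>)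
    also have "\<dots> = \<mu>\<^sup>2 * integral {a..b} D" by simp
    also have "\<dots> \<le> 0" using ab(3) by (simp add: mult_nonneg_nonpos)
    finally have iu: "integral {a..b} (\<lambda>y. (u y)\<^sup>2) = 0"
      using integral_nonneg[of "\<lambda>y. (u y)\<^sup>2" "{a..b}"] by (intro antisym) (auto intro!: integrable_continuous_interval continuous_intros cu)
    have "integral {a..b} (\<lambda>y. (w y)\<^sup>2) \<le> integral {a..b} D"
      by (rule integral_le) (use D0 Di in \<open>auto intro!: integrable_continuous_interval continuous_intros cw\<close>)
    then have iw: "integral {a..b} (\<lambda>y. (w y)\<^sup>2) = 0"
      using ab(3) integral_nonneg[of "\<lambda>y. (w y)\<^sup>2" "{a..b}"] by (intro antisym) (auto intro!: integrable_continuous_interval continuous_intros cw)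
    have "(u y)\<^sup>2 = 0" "(w y)\<^sup>2 = 0"
      using integral_eq_0_iff[of a b "\<lambda>y. (u y)\<^sup>2"] integral_eq_0_iff[of a b "\<lambda>y. (w y)\<^sup>2"] iu iw ab
        continuous_on_power[OF cu, of 2] continuous_on_power[OF cw, of 2] by auto
    then show ?thesis by simp
  qed
  have "u x = 0 \<and> w x = 0"
  proof (cases "x \<le> -r")
    case True
    have sub: "{c..-r} \<subseteq> Eb" for c by (auto simp: Eb_def)
    have ev: "\<forall>\<^sub>F c in at_bot. integral {x-1..-r} D \<le> - (u c * w c)"
    proof (rule eventually_mono[OF eventually_le_at_bot[of "x-1"]])
      fix c assume c: "c \<le> x - 1"
      have "integral {x-1..-r} D \<le> integral {c..-r} D"
        by (rule integral_subset_le) (use c True D0 ACD(4)[OF P _ sub] in auto)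
      then show "integral {x-1..-r} D \<le> - (u c * w c)"
        using ACD(3)[OF P _ sub, of c] c True b by simp
    qed
    have "integral {x-1..-r} D \<le> 0"
      by (rule tendsto_lowerbound[OF P0 ev]) simp
    then show ?thesis using zero[OF _ sub, of "x - 1" x] True by simp
  next
    case False
    then have "x \<in> {r..l}" using x by (auto simp: Eb_def)
    moreover have "{r..l} \<subseteq> Eb" by (auto simp: Eb_def)
    ultimately show ?thesis using zero[OF rl] ACD(3)[OF P, of r l] rl b by simp
  qed
  then show "u x = 0" "w x = 0" by auto
qed

lemma Neu_diff: assumes "Neu \<mu> \<phi> u w" "Neu \<mu> \<psi> u' w'"
  shows "Neu \<mu> (\<lambda>x. \<phi> x - \<psi> x) (\<lambda>x. u x - u' x) (\<lambda>x. w x - w' x)"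
  unfolding Neu_def
proof (intro conjI)
  show "AC Eb (\<lambda>x. w x - w' x) (\<lambda>x. (u x - u' x - (\<phi> x - \<psi> x)) / \<mu>\<^sup>2)"
  proof (rule AC_cong[OF AC_diff])
    show "AC Eb w (\<lambda>x. (u x - \<phi> x) / \<mu>\<^sup>2)" "AC Eb w' (\<lambda>x. (u' x - \<psi> x) / \<mu>\<^sup>2)" using assms by (auto simp: Neu_def)
  qed (auto simp: diff_divide_distrib)
qed (use assms in \<open>auto simp: Neu_def ext_diff intro: AC_diff sqi_diff\<close>)

lemma Neu_unique:
  assumes \<mu>: "\<mu> > 0" and "Neu \<mu> \<phi> u w" "Neu \<mu> \<psi> u' w'" "AEE x. \<phi> x = \<psi> x" "x \<in> Eb"
  shows "u x = u' x" "w x = w' x"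
proof -
  note d = Neu_diff[OF assms(2,3)]
  have "AEE x. (u x - u' x - (\<phi> x - \<psi> x)) / \<mu>\<^sup>2 = (u x - u' x) / \<mu>\<^sup>2"
    using assms(4) by eventually_elim auto
  note ae = AE_E_Eb[OF this]
  have "AC Eb (\<lambda>x. w x - w' x) (\<lambda>x. (u x - u' x) / \<mu>\<^sup>2)"
    by (rule AC_AE_cong[OF _ ae Eb_sets]) (use d in \<open>simp add: Neu_def\<close>)
  then show "u x = u' x" "w x = w' x"
    using homogeneous_zero[OF \<mu>, of "\<lambda>x. u x - u' x" "\<lambda>x. w x - w' x" x] d assms(5) by (auto simp: Neu_def)
qed

section \<open>Solution operators of the Neumann problem and elliptic regularity\<close>

definition RU :: "real \<Rightarrow> (real \<Rightarrow> real) \<Rightarrow> real \<Rightarrow> real" where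
  "RU \<mu> \<phi> = fst (SOME p. Neu \<mu> \<phi> (fst p) (snd p))"
definition RW :: "real \<Rightarrow> (real \<Rightarrow> real) \<Rightarrow> real \<Rightarrow> real" where
  "RW \<mu> \<phi> = snd (SOME p. Neu \<mu> \<phi> (fst p) (snd p))"
definition CR :: "real \<Rightarrow> real" where
  "CR \<mu> = (SOME C. C\<ge>0 \<and> (\<forall>\<phi>. sqi (ext \<phi>) \<longrightarrow> (\<exists>u w. Neu \<mu> \<phi> u w \<and> nE u \<le> C * nE \<phi> \<and> nE w \<le> C * nE \<phi>)))"

lemma CR_prop: assumes "\<mu> > 0"
  shows "CR \<mu> \<ge> 0" "sqi (ext \<phi>) \<Longrightarrow> \<exists>u w. Neu \<mu> \<phi> u w \<and> nE u \<le> CR \<mu> * nE \<phi> \<and> nE w \<le> CR \<mu> * nE \<phi>"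
proof -
  from someI_ex[OF Neu_exists[OF assms]]
  have "CR \<mu> \<ge> 0 \<and> (\<forall>\<phi>. sqi (ext \<phi>) \<longrightarrow> (\<exists>u w. Neu \<mu> \<phi> u w \<and> nE u \<le> CR \<mu> * nE \<phi> \<and> nE w \<le> CR \<mu> * nE \<phi>))"
    unfolding CR_def[symmetric] .
  then show "CR \<mu> \<ge> 0" "sqi (ext \<phi>) \<Longrightarrow> \<exists>u w. Neu \<mu> \<phi> u w \<and> nE u \<le> CR \<mu> * nE \<phi> \<and> nE w \<le> CR \<mu> * nE \<phi>" by blast+
qed

lemma RU_Neu: assumes "\<mu> > 0" "sqi (ext \<phi>)" shows "Neu \<mu> \<phi> (RU \<mu> \<phi>) (RW \<mu> \<phi>)"
proof -
  obtain u w where "Neu \<mu> \<phi> u w" using CR_prop(2)[OF assms] by blast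
  then have "\<exists>p. Neu \<mu> \<phi> (fst p) (snd p)" by (metis fst_conv snd_conv)
  from someI_ex[OF this] show ?thesis unfolding RU_def RW_def .
qed

lemma RU_bound: assumes "\<mu> > 0" "sqi (ext \<phi>)"
  shows "nE (RU \<mu> \<phi>) \<le> CR \<mu> * nE \<phi>" "nE (RW \<mu> \<phi>) \<le> CR \<mu> * nE \<phi>"
proof -
  obtain u w where uw: "Neu \<mu> \<phi> u w" "nE u \<le> CR \<mu> * nE \<phi>" "nE w \<le> CR \<mu> * nE \<phi>" using CR_prop(2)[OF assms] by blast
  have e: "x \<in> Eb \<Longrightarrow> u x = RU \<mu> \<phi> x" "x \<in> Eb \<Longrightarrow> w x = RW \<mu> \<phi> x" for x
    using Neu_unique[OF assms(1) uw(1) RU_Neu[OF assms]] by auto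
  have "ext u = ext (RU \<mu> \<phi>)" "ext w = ext (RW \<mu> \<phi>)" using e ext_eqI by blast+
  then show "nE (RU \<mu> \<phi>) \<le> CR \<mu> * nE \<phi>" "nE (RW \<mu> \<phi>) \<le> CR \<mu> * nE \<phi>" using uw by (simp_all add: nE_def)
qed

primrec CRk :: "real \<Rightarrow> nat \<Rightarrow> real" where
  "CRk \<mu> 0 = CR \<mu> + (CR \<mu> + 1) / \<mu>\<^sup>2"
| "CRk \<mu> (Suc k) = CRk \<mu> k + (CRk \<mu> k + 1) / \<mu>\<^sup>2"

lemma CRk_nonneg: "\<mu> > 0 \<Longrightarrow> CRk \<mu> k \<ge> 0"
  using CR_prop(1)[of \<mu>] by (induction k) auto

text \<open>The equation expresses the derivative of \<open>w\<close> by u and phi, so any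
  regularity common to \<open>u\<close>, \<open>w\<close> and phi improves by one order for
  \<open>u\<close> and \<open>w\<close>. The constant is the recursion step of
  \<open>CRk\<close>.\<close>

lemma Neu_step:
  assumes \<mu>: "\<mu> > 0" and N: "Neu \<mu> \<phi> u w" and u: "Hb k u (C * c)" and w: "Hb k w (C * c)" and \<phi>: "Hb k \<phi> c" and C: "C \<ge> 0"
  shows "Hb (Suc k) u ((C + (C + 1) / \<mu>\<^sup>2) * c)" "Hb (Suc k) w ((C + (C + 1) / \<mu>\<^sup>2) * c)"
proof -
  have c: "c \<ge> 0" using \<phi> by (rule Hb_nonneg)
  have le: "C * c \<le> (C + (C + 1) / \<mu>\<^sup>2) * c" "(C * c + c) / \<mu>\<^sup>2 \<le> (C + (C + 1) / \<mu>\<^sup>2) * c"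
    using c C by (auto simp: field_simps intro!: mult_right_mono)
  have u': "Hb k u ((C + (C + 1) / \<mu>\<^sup>2) * c)" and w': "Hb k w ((C + (C + 1) / \<mu>\<^sup>2) * c)" using u w le Hb_mono by blast+
  show "Hb (Suc k) u ((C + (C + 1) / \<mu>\<^sup>2) * c)"
    using Hb_0D[OF u'] w' N by (auto simp: Neu_def)
  have "Hb k (\<lambda>x. (1 / \<mu>\<^sup>2) * (u x - \<phi> x)) (\<bar>1 / \<mu>\<^sup>2\<bar> * (C * c + c))" by (intro Hb_cmult Hb_diff u \<phi>)
  then have "Hb k (\<lambda>x. (u x - \<phi> x) / \<mu>\<^sup>2) ((C + (C + 1) / \<mu>\<^sup>2) * c)" by (auto intro: Hb_mono[OF _ le(2)])
  then show "Hb (Suc k) w ((C + (C + 1) / \<mu>\<^sup>2) * c)"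
    using Hb_0D[OF w'] N by (auto simp: Neu_def)
qed

text \<open>Bootstrapping with \<open>Neu_step\<close>. The gain for \<open>RW\<close>, the
  derivative of R_1 phi, is the smoothing that turns the evolution into an ordinary differential
  equation.\<close>

lemma RU_Hb: assumes \<mu>: "\<mu> > 0"
  shows "Hb k \<phi> c \<Longrightarrow> Hb (Suc k) (RU \<mu> \<phi>) (CRk \<mu> k * c) \<and> Hb (Suc k) (RW \<mu> \<phi>) (CRk \<mu> k * c)"
proof (induction k)
  case 0
  then have s: "sqi (ext \<phi>)" "nE \<phi> \<le> c" by auto
  have "CR \<mu> * nE \<phi> \<le> CR \<mu> * c" using s CR_prop(1)[OF \<mu>] by (intro mult_left_mono)
  then have "Hb 0 (RU \<mu> \<phi>) (CR \<mu> * c)" "Hb 0 (RW \<mu> \<phi>) (CR \<mu> * c)"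
    using RU_bound[OF \<mu> s(1)] RU_Neu[OF \<mu> s(1)] by (auto simp: Neu_def)
  then show ?case using Neu_step[OF \<mu> RU_Neu[OF \<mu> s(1)] _ _ 0 CR_prop(1)[OF \<mu>]] by simp
next
  case (Suc k)
  have s: "sqi (ext \<phi>)" using Suc.prems by simp
  have IH: "Hb (Suc k) (RU \<mu> \<phi>) (CRk \<mu> k * c)" "Hb (Suc k) (RW \<mu> \<phi>) (CRk \<mu> k * c)"
    using Suc.IH[OF Hb_Suc_D[OF Suc.prems]] by auto
  show ?case using Neu_step[OF \<mu> RU_Neu[OF \<mu> s] IH Suc.prems CRk_nonneg[OF \<mu>]] by simp
qed

lemma RU_diff: assumes "\<mu> > 0" "sqi (ext \<phi>)" "sqi (ext \<psi>)" "x \<in> Eb"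
  shows "RU \<mu> (\<lambda>x. \<phi> x - \<psi> x) x = RU \<mu> \<phi> x - RU \<mu> \<psi> x" "RW \<mu> (\<lambda>x. \<phi> x - \<psi> x) x = RW \<mu> \<phi> x - RW \<mu> \<psi> x"
proof -
  have s: "sqi (ext (\<lambda>x. \<phi> x - \<psi> x))" unfolding ext_diff by (intro sqi_diff assms)
  show "RU \<mu> (\<lambda>x. \<phi> x - \<psi> x) x = RU \<mu> \<phi> x - RU \<mu> \<psi> x" "RW \<mu> (\<lambda>x. \<phi> x - \<psi> x) x = RW \<mu> \<phi> x - RW \<mu> \<psi> x"
    using Neu_unique[OF assms(1) RU_Neu[OF assms(1) s] Neu_diff[OF RU_Neu[OF assms(1,2)] RU_Neu[OF assms(1,3)]] _ assms(4)] by auto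
qed

lemma RU_Hb_diff: assumes \<mu>: "\<mu> > 0" and h: "Hb k \<phi> a" "Hb k \<psi> b" "Hb k (\<lambda>x. \<phi> x - \<psi> x) c"
  shows "Hb (Suc k) (\<lambda>x. RU \<mu> \<phi> x - RU \<mu> \<psi> x) (CRk \<mu> k * c)" "Hb (Suc k) (\<lambda>x. RW \<mu> \<phi> x - RW \<mu> \<psi> x) (CRk \<mu> k * c)"
proof -
  have s: "sqi (ext \<phi>)" "sqi (ext \<psi>)" using h Hb_0D by blast+
  show "Hb (Suc k) (\<lambda>x. RU \<mu> \<phi> x - RU \<mu> \<psi> x) (CRk \<mu> k * c)" "Hb (Suc k) (\<lambda>x. RW \<mu> \<phi> x - RW \<mu> \<psi> x) (CRk \<mu> k * c)"
    using RU_Hb[OF \<mu> h(3)] by (auto intro: Hb_cong simp del: Hb.simps simp: RU_diff[OF \<mu> s])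
qed

section \<open>Lifting of the boundary values\<close>

lemma Hm_exponential: assumes "AC Eb f (\<lambda>x. a * f x)" "sqi (ext f)" shows "Hm k f"
proof (induction k)
  case 0
  then show ?case using assms(2) by (auto simp: Hm_def)
next
  case (Suc k)
  then obtain c where c: "Hb k f c" by (auto simp: Hm_def)
  have "Hb k (\<lambda>x. a * f x) (\<bar>a\<bar> * c)" by (rule Hb_cmult[OF c])
  then have "Hb k (\<lambda>x. a * f x) (\<bar>a\<bar> * c + c)" "Hb k f (\<bar>a\<bar> * c + c)"
    using c Hb_nonneg[OF c] by (auto intro: Hb_mono)
  then have "Hb (Suc k) f (\<bar>a\<bar> * c + c)" using assms Hb_0D by auto
  then show ?case by (auto simp: Hm_def)
qed

definition QQ :: "real \<Rightarrow> real" where "QQ \<mu> = exp (- ((l - r) / \<mu>))"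

text \<open>The homogeneous solution with Dirichlet data 1 at -r and r and 0 at l: exp((x +
  r)/\<mu>) on the left, sinh((l - x)/\<mu>) / sinh((l - r)/\<mu>) on the right, the latter written
  with decaying exponentials. The function \<open>ed\<close> is its derivative.\<close>

definition ef :: "real \<Rightarrow> real \<Rightarrow> real" where
  "ef \<mu> x = hm \<mu> x + (1 / (1 - (QQ \<mu>)\<^sup>2)) * (hq \<mu> x - QQ \<mu> * hp \<mu> x)"
definition ed :: "real \<Rightarrow> real \<Rightarrow> real" where
  "ed \<mu> x = (1 / \<mu>) * (hm \<mu> x - (1 / (1 - (QQ \<mu>)\<^sup>2)) * (hq \<mu> x + QQ \<mu> * hp \<mu> x))"

lemma ef_props: assumes \<mu>: "\<mu> > 0"
  shows "AC Eb (ef \<mu>) (ed \<mu>)" "AC Eb (ed \<mu>) (\<lambda>x. ef \<mu> x / \<mu>\<^sup>2)" "Hm k (ef \<mu>)" "Hm k (ed \<mu>)"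
    "ef \<mu> (-r) = 1" "ef \<mu> r = 1" "ef \<mu> l = 0"
proof -
  let ?Q = "QQ \<mu>"
  have Q: "0 < ?Q" "?Q < 1" using rl \<mu> by (auto simp: QQ_def)
  have Q2: "1 - ?Q\<^sup>2 > 0" using mult_strict_mono[of ?Q 1 ?Q 1] Q by (simp add: power2_eq_square)
  note h = AC_homogeneous[OF \<mu>] and s = sqi_homogeneous[OF \<mu>]
  define b where "b = 1 / (1 - ?Q\<^sup>2)"
  have efb: "ef \<mu> x = hm \<mu> x + b * (hq \<mu> x - ?Q * hp \<mu> x)" and
    edb: "ed \<mu> x = (1 / \<mu>) * (hm \<mu> x - b * (hq \<mu> x + ?Q * hp \<mu> x))" for x
    by (simp_all add: ef_def ed_def b_def)
  show "AC Eb (ef \<mu>) (ed \<mu>)"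
    by (rule AC_cong[OF AC_add[OF h(1) AC_cmult[OF AC_diff[OF h(3) AC_cmult[OF h(2), of ?Q]], of b]]])
      (use \<mu> in \<open>auto simp: efb edb field_simps\<close>)
  show "AC Eb (ed \<mu>) (\<lambda>x. ef \<mu> x / \<mu>\<^sup>2)"
    by (rule AC_cong[OF AC_cmult[OF AC_diff[OF h(1) AC_cmult[OF AC_add[OF h(3) AC_cmult[OF h(2), of ?Q]], of b]], of "1 / \<mu>"]])
      (use \<mu> in \<open>auto simp: efb edb field_simps power2_eq_square\<close>)
  have H: "Hm k (hm \<mu>)" "Hm k (hp \<mu>)" "Hm k (hq \<mu>)"
    by (rule Hm_exponential[of _ "1 / \<mu>"], use h s in simp_all)
      (rule Hm_exponential[of _ "1 / \<mu>"], use h s in simp_all, rule Hm_exponential[of _ "- 1 / \<mu>"], use h s in simp_all)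
  show "Hm k (ef \<mu>)"
    using Hm_lin[OF H(1) Hm_lin[OF H(3) H(2), of b "- (b * ?Q)"], of 1 1] by (simp add: efb[abs_def] algebra_simps)
  show "Hm k (ed \<mu>)"
    using Hm_lin[OF H(1) Hm_lin[OF H(3) H(2), of b "b * ?Q"], of "1 / \<mu>" "- (1 / \<mu>)"] by (simp add: edb[abs_def] algebra_simps)
  have hv: "hm \<mu> (-r) = 1" "hp \<mu> (-r) = 0" "hq \<mu> (-r) = 0" "hm \<mu> r = 0" "hp \<mu> r = ?Q" "hq \<mu> r = 1"
      "hm \<mu> l = 0" "hp \<mu> l = 1" "hq \<mu> l = ?Q"
    using r0 rl by (auto simp: hm_def hp_def hq_def QQ_def minus_divide_left)
  show "ef \<mu> (-r) = 1" "ef \<mu> r = 1" "ef \<mu> l = 0" using Q2 by (simp_all add: ef_def hv power2_eq_square)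
qed

end

section \<open>Ordinary differential equations in a closed subspace of a Banach space\<close>

text \<open>Riemann sums of the gauge integral are linear combinations of values in
  \<open>S\<close>, and \<open>S\<close> is closed. This keeps Picard iterates inside the state
  space.\<close>

lemma integral_mem_closed_subspace:
  fixes f :: "real \<Rightarrow> 'a::banach"
  assumes S: "subspace S" "closed S" and f: "continuous_on {a..b} f" "\<And>x. x \<in> {a..b} \<Longrightarrow> f x \<in> S"
  shows "integral {a..b} f \<in> S"
proof -
  have "(f has_integral integral {a..b} f) (cbox a b)"
    using integrable_continuous_interval[OF f(1)] by (simp add: has_integral_integral)
  note hi = this[unfolded has_integral]
  have "integral {a..b} f \<in> closure S"
    unfolding closure_approachable
  proof (intro allI impI)
    fix e :: real assume "e > 0"
    from hi[rule_format, OF this] obtain \<gamma> where g: "gauge \<gamma>" "\<forall>D. D tagged_division_of (cbox a b) \<and> \<gamma> fine D \<longrightarrow>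
        norm ((\<Sum>(x,k)\<in>D. measure lborel k *\<^sub>R f x) - integral {a..b} f) < e" by (elim exE conjE)
    obtain D where D: "D tagged_division_of (cbox a b)" "\<gamma> fine D" using fine_division_exists[OF g(1)] by blast
    have "(\<Sum>(x,k)\<in>D. measure lborel k *\<^sub>R f x) \<in> S"
    proof (rule subspace_sum[OF S(1)])
      fix p assume p: "p \<in> D"
      obtain x k where xk: "p = (x, k)" by force
      have "x \<in> {a..b}" using tag_in_interval[OF D(1)] p xk by simp
      then show "(case p of (x, k) \<Rightarrow> measure lborel k *\<^sub>R f x) \<in> S" using xk f(2) S(1) by (simp add: subspace_scale)
    qed
    then show "\<exists>y\<in>S. dist y (integral {a..b} f) < e" using g(2)[rule_format, OF conjI[OF D]] by (auto simp: dist_norm)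
  qed
  then show ?thesis using S(2) by (simp add: closure_closed)
qed

lemma vector_derivative_bound:
  fixes f :: "real \<Rightarrow> 'a::real_normed_vector"
  assumes d: "\<And>x. x \<in> {a..b} \<Longrightarrow> (f has_vector_derivative f' x) (at x within {a..b})"
    and B: "\<And>x. x \<in> {a..b} \<Longrightarrow> norm (f' x) \<le> B" and xy: "x \<in> {a..b}" "y \<in> {a..b}"
  shows "norm (f x - f y) \<le> B * \<bar>x - y\<bar>"
proof -
  have "norm (f x - f y) \<le> B * norm (x - y)"
  proof (rule differentiable_bound[of "{a..b}" f "\<lambda>x h. h *\<^sub>R f' x"])
    show "(f has_derivative (\<lambda>h. h *\<^sub>R f' x)) (at x within {a..b})" if "x \<in> {a..b}" for x
      using d[OF that] by (simp add: has_vector_derivative_def)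
    show "onorm (\<lambda>h. h *\<^sub>R f' x) \<le> B" if "x \<in> {a..b}" for x
    proof (rule onorm_bound)
      show "0 \<le> B" using B[OF that] norm_ge_zero order_trans by blast
      show "norm (h *\<^sub>R f' x) \<le> B * norm h" for h
        using mult_right_mono[OF B[OF that], of "norm h"] by (simp add: mult.commute)
    qed
  qed (use xy in auto)
  then show ?thesis by simp
qed

lemma has_vector_derivative_shift:
  assumes "(f has_vector_derivative v) (at (c + t) within {c + a..<c + b})"
  shows "((\<lambda>s. f (c + s)) has_vector_derivative v) (at t within {a..<b::real})"
proof -
  have "((\<lambda>s. c + s) has_vector_derivative 1) (at t within {a..<b})"
    by (auto intro!: derivative_eq_intros)
  moreover have "(\<lambda>s. c + s) ` {a..<b} = {c + a..<c + b}" by (simp add: add.commute)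
  ultimately have "((f \<circ> (\<lambda>s. c + s)) has_vector_derivative (1 *\<^sub>R v)) (at t within {a..<b})"
    using assms by (intro vector_diff_chain_within) auto
  then show ?thesis by (simp add: o_def)
qed

text \<open>Derivatives within a set depend only on the function and the set near the point; used to
  glue solutions defined on different intervals.\<close>

lemma has_vector_derivative_local:
  assumes "(f has_vector_derivative v) (at t within A)" "open N" "t \<in> N" "t \<in> A" "A \<inter> N = B \<inter> N" "\<And>s. s \<in> B \<inter> N \<Longrightarrow> f s = g s"
  shows "(g has_vector_derivative v) (at t within B)"
proof -
  have tB: "t \<in> B" using assms by blast
  have "(f has_vector_derivative v) (at t within A \<inter> N)" by (rule has_vector_derivative_within_subset[OF assms(1)]) auto
  then have "(g has_vector_derivative v) (at t within B \<inter> N)"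
    unfolding assms(5) by (rule has_vector_derivative_transform[rotated 2]) (use assms tB in auto)
  moreover have "at t within B \<inter> N = at t within B" 
    by (rule at_within_nhd[OF assms(3,2)]) auto
  ultimately show ?thesis by simp
qed

text \<open>The phase space is a relatively open part \<open>G\<close> of a closed subspace
  \<open>S\<close>. The radius and the Lipschitz constant in \<open>loc\<close> depend only on a
  bound for \<open>size\<close>, which measures distance to the boundary of \<open>G\<close> as well
  as magnitude; existence times are therefore uniform on sublevel sets of
  \<open>size\<close>.\<close>

locale ode =
  fixes S G :: "'a::banach set" and F :: "'a \<Rightarrow> 'a" and size :: "'a \<Rightarrow> real"
  assumes S: "subspace S" "closed S" and GS: "G \<subseteq> S" and FS: "\<And>u. u \<in> G \<Longrightarrow> F u \<in> S"
    and loc: "\<And>M. \<exists>\<rho>>0. \<exists>L. \<forall>u\<in>G. size u \<le> M \<longrightarrow> (\<forall>v\<in>S. norm (v - u) \<le> \<rho> \<longrightarrow> v \<in> G \<and> norm (F v) \<le> L \<and>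
        (\<forall>w\<in>S. norm (w - u) \<le> \<rho> \<longrightarrow> norm (F v - F w) \<le> L * norm (v - w)))"
begin

definition sol :: "real \<Rightarrow> (real \<Rightarrow> 'a) \<Rightarrow> 'a \<Rightarrow> bool" where
  "sol T U u \<longleftrightarrow> U 0 = u \<and> (\<forall>t\<in>{0..<T}. U t \<in> G \<and> (U has_vector_derivative F (U t)) (at t within {0..<T}))"

lemma sol_mono: "sol T U u \<Longrightarrow> T' \<le> T \<Longrightarrow> sol T' U u"
  unfolding sol_def by (auto intro!: has_vector_derivative_within_subset[where S="{0..<T}" and T="{0..<T'}"])

lemma sol_continuous: "sol T U u \<Longrightarrow> continuous_on {0..<T} U"
  unfolding sol_def continuous_on_eq_continuous_within
  using has_vector_derivative_continuous by blast

lemma sol_shift: assumes "sol T U u" "0 \<le> c" shows "sol (T - c) (\<lambda>s. U (c + s)) (U c)"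
  unfolding sol_def
proof (intro conjI ballI)
  fix t assume t: "t \<in> {0..<T - c}"
  then have ct: "c + t \<in> {0..<T}" using assms(2) by auto
  show "U (c + t) \<in> G" using assms(1) ct by (auto simp: sol_def)
  have "(U has_vector_derivative F (U (c + t))) (at (c + t) within {0..<T})"
    using assms(1) ct unfolding sol_def by blast
  then have "(U has_vector_derivative F (U (c + t))) (at (c + t) within {c + 0..<c + (T - c)})"
    by (rule has_vector_derivative_within_subset) (use assms(2) in auto)
  then show "((\<lambda>s. U (c + s)) has_vector_derivative F (U (c + t))) (at t within {0..<T - c})"
    by (rule has_vector_derivative_shift)
qed simp

text \<open>At a maximum of |U - V| over a short interval, the mean value inequality and the
  Lipschitz bound give at most half of that maximum.\<close>

lemma sol_unique_local:
  assumes "sol T U u" "sol T V u" "T > 0"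
  shows "\<exists>d>0. \<forall>t\<in>{0..<d}. t < T \<longrightarrow> U t = V t"
proof -
  have u: "u \<in> G" "U 0 = u" "V 0 = u" using assms by (auto simp: sol_def)
  obtain \<rho> L where \<rho>: "\<rho> > 0" and L: "\<And>v w. v \<in> S \<Longrightarrow> norm (v - u) \<le> \<rho> \<Longrightarrow> w \<in> S \<Longrightarrow> norm (w - u) \<le> \<rho> \<Longrightarrow> norm (F v - F w) \<le> L * norm (v - w)"
    using loc[of "size u"] u(1) by blast
  define L' where "L' = max L 1"
  have L': "L' \<ge> 1" "\<And>v w. v \<in> S \<Longrightarrow> norm (v - u) \<le> \<rho> \<Longrightarrow> w \<in> S \<Longrightarrow> norm (w - u) \<le> \<rho> \<Longrightarrow> norm (F v - F w) \<le> L' * norm (v - w)"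
  proof -
    show "L' \<ge> 1" by (simp add: L'_def)
    fix v w assume "v \<in> S" "norm (v - u) \<le> \<rho>" "w \<in> S" "norm (w - u) \<le> \<rho>"
    from L[OF this] show "norm (F v - F w) \<le> L' * norm (v - w)"
      by (rule order_trans) (simp add: L'_def mult_right_mono)
  qed
  have near: "\<exists>d>0. \<forall>t\<in>{0..<T}. t < d \<longrightarrow> norm (W t - u) \<le> \<rho>" if "sol T W u" for W
  proof -
    have "continuous (at 0 within {0..<T}) W" using sol_continuous[OF that] assms(3) by (auto simp: continuous_on_eq_continuous_within)
    moreover have "W 0 = u" using that by (simp add: sol_def)
    ultimately obtain d where "d > 0" "\<And>x. x \<in> {0..<T} \<Longrightarrow> dist x 0 < d \<Longrightarrow> dist (W x) u < \<rho>"
      using \<rho> unfolding continuous_within_eps_delta by metis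
    then show ?thesis by (intro exI[of _ d]) (force simp: dist_norm)
  qed
  obtain d1 where d1: "d1 > 0" "\<And>t. t \<in> {0..<T} \<Longrightarrow> t < d1 \<Longrightarrow> norm (U t - u) \<le> \<rho>" using near[OF assms(1)] by blast
  obtain d2 where d2: "d2 > 0" "\<And>t. t \<in> {0..<T} \<Longrightarrow> t < d2 \<Longrightarrow> norm (V t - u) \<le> \<rho>" using near[OF assms(2)] by blast
  \<comment> \<open>Both solutions stay in the Lipschitz ball up to time \<open>d\<close>, and
    \<open>d\<close> times the Lipschitz constant is at most 1/2.\<close>
  define d where "d = min (min d1 d2) (min T (1 / L')) / 2"
  have d: "d > 0" "d < d1" "d < d2" "d < T" "d * L' \<le> 1 / 2"
  proof -
    show "d > 0" using d1 d2 assms(3) L' by (auto simp: d_def)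
    have X: "min (min d1 d2) (min T (1 / L')) > 0" using d1(1) d2(1) assms(3) L'(1) by simp
    have half: "y / 2 < y" if "y > 0" for y :: real using that by simp
    have "d < min (min d1 d2) (min T (1 / L'))" unfolding d_def by (rule half[OF X])
    then show "d < d1" "d < d2" "d < T" by simp_all
    have "d \<le> (1 / L') / 2" by (simp add: d_def)
    then have "d * L' \<le> (1 / L') / 2 * L'" using L' by (intro mult_right_mono) auto
    then show "d * L' \<le> 1 / 2" using L' by simp
  qed
  have sub: "{0..d} \<subseteq> {0..<T}" using d by auto
  define W where "W t = U t - V t" for t
  have cW: "continuous_on {0..d} W" unfolding W_def
    by (intro continuous_intros continuous_on_subset[OF sol_continuous[OF assms(1)] sub] continuous_on_subset[OF sol_continuous[OF assms(2)] sub])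
  obtain tm where tm: "tm \<in> {0..d}" "\<And>t. t \<in> {0..d} \<Longrightarrow> norm (W t) \<le> norm (W tm)"
  proof -
    have "\<exists>x\<in>{0..d}. \<forall>y\<in>{0..d}. norm (W y) \<le> norm (W x)"
      by (rule continuous_attains_sup[OF _ _ continuous_on_norm[OF cW]]) (use d(1) in auto)
    then show ?thesis using that by blast
  qed
  have "norm (W tm - W 0) \<le> (L' * norm (W tm)) * \<bar>tm - 0\<bar>"
  proof (rule vector_derivative_bound[of 0 d W "\<lambda>t. F (U t) - F (V t)"])
    fix t assume t: "t \<in> {0..d}"
    show "(W has_vector_derivative F (U t) - F (V t)) (at t within {0..d})"
      unfolding W_def using assms sub t
      by (intro has_vector_derivative_diff) (auto simp: sol_def intro!: has_vector_derivative_within_subset[OF _ sub])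
    have "t \<in> {0..<T}" using sub t by blast
    then have "U t \<in> S" "V t \<in> S" using assms GS unfolding sol_def by blast+
    then have "norm (F (U t) - F (V t)) \<le> L' * norm (U t - V t)"
      using d1(2)[of t] d2(2)[of t] t d by (intro L') auto
    also have "\<dots> \<le> L' * norm (W tm)" using tm(2)[OF t] L'(1) by (simp add: W_def)
    finally show "norm (F (U t) - F (V t)) \<le> L' * norm (W tm)" .
  qed (use tm d in auto)
  also have "\<dots> \<le> (L' * norm (W tm)) * d" using tm(1) L'(1) by (intro mult_left_mono) auto
  also have "\<dots> = (d * L') * norm (W tm)" by simp
  also have "\<dots> \<le> 1 / 2 * norm (W tm)" by (rule mult_right_mono[OF d(5)]) simp
  finally have "norm (W tm) = 0" using u by (simp add: W_def)
  then have "U t = V t" if "t \<in> {0..d}" for t using tm(2)[OF that] by (simp add: W_def)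
  then show ?thesis using d(1) by (intro exI[of _ d]) auto
qed

text \<open>At the infimum of the times of disagreement the solutions still agree by continuity;
  restarting there, local uniqueness pushes the infimum further, a contradiction.\<close>

lemma sol_unique:
  assumes "sol T U u" "sol T V u" "t \<in> {0..<T}"
  shows "U t = V t"
proof (rule ccontr)
  assume ne: "U t \<noteq> V t"
  define A where "A = {s. 0 \<le> s \<and> s \<le> t \<and> U s \<noteq> V s}"
  have A: "A \<noteq> {}" "bdd_below A" using ne assms(3) by (auto simp: A_def intro!: bdd_belowI[of _ 0])
  define c where "c = Inf A"
  have c: "0 \<le> c" "c \<le> t"
  proof -
    show "0 \<le> c" unfolding c_def by (rule cInf_greatest[OF A(1)]) (auto simp: A_def)
    show "c \<le> t" unfolding c_def by (rule cInf_lower[OF _ A(2)]) (use ne assms(3) in \<open>auto simp: A_def\<close>)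
  qed
  have eq: "U s = V s" if "0 \<le> s" "s < c" for s
  proof (rule ccontr)
    assume "U s \<noteq> V s"
    then have "s \<in> A" using that c by (simp add: A_def)
    then show False using cInf_lower[OF _ A(2), of s] that(2) by (simp add: c_def)
  qed
  have Uc: "U c = V c"
  proof (cases "c = 0")
    case True
    then show ?thesis using assms by (simp add: sol_def)
  next
    case False
    then have c0: "c > 0" using c by simp
    have sub: "{0..c} \<subseteq> {0..<T}" using c assms(3) by auto
    have cc: "continuous_on {0..c} (\<lambda>s. U s - V s)"
      by (intro continuous_intros continuous_on_subset[OF sol_continuous[OF assms(1)] sub] continuous_on_subset[OF sol_continuous[OF assms(2)] sub])
    have "((\<lambda>s. U s - V s) \<longlongrightarrow> U c - V c) (at_left c)"
      using continuous_on_Icc_at_leftD[OF cc] c0 by simp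
    moreover have "\<forall>\<^sub>F s in at_left c. U s - V s = 0"
      using c0 eq by (auto simp: eventually_at_left_field intro!: exI[of _ 0])
    ultimately have "((\<lambda>s. 0) \<longlongrightarrow> U c - V c) (at_left c)" by (rule Lim_transform_eventually)
    then have "U c - V c = 0" by (rule tendsto_unique[OF trivial_limit_at_left_real _ tendsto_const])
    then show ?thesis by simp
  qed
  have "sol (T - c) (\<lambda>s. U (c + s)) (U c)" "sol (T - c) (\<lambda>s. V (c + s)) (U c)"
    using sol_shift[OF assms(1) c(1)] sol_shift[OF assms(2) c(1)] Uc by auto
  then obtain d where d: "d > 0" "\<forall>s\<in>{0..<d}. s < T - c \<longrightarrow> U (c + s) = V (c + s)"
    using sol_unique_local[OF \<open>sol (T - c) (\<lambda>s. U (c + s)) (U c)\<close> \<open>sol (T - c) (\<lambda>s. V (c + s)) (U c)\<close>] c assms(3) by auto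
  have "c + d \<le> s" if "s \<in> A" for s
  proof (rule ccontr)
    assume "\<not> c + d \<le> s"
    moreover have "c \<le> s" using cInf_lower[OF that A(2)] by (simp add: c_def)
    ultimately have "U (c + (s - c)) = V (c + (s - c))" using d(2) that assms(3) by (intro d(2)[rule_format]) (auto simp: A_def)
    then show False using that by (simp add: A_def)
  qed
  then have "c + d \<le> c" unfolding c_def by (intro cInf_greatest[OF A(1)])
  then show False using d(1) by simp
qed

text \<open>Banach's fixed point theorem for the Picard operator. The time \<open>\<tau>\<close>
  depends only on \<open>M\<close>, which is what the continuation argument in
  \<open>sol_maximal\<close> uses.\<close>

lemma sol_local: "\<exists>\<tau>>0. \<forall>u\<in>G. size u \<le> M \<longrightarrow> (\<exists>U. sol \<tau> U u)"
proof -
  obtain \<rho> L where \<rho>: "\<rho> > 0" and L0: "\<forall>u\<in>G. size u \<le> M \<longrightarrow> (\<forall>v\<in>S. norm (v - u) \<le> \<rho> \<longrightarrow> v \<in> G \<and> norm (F v) \<le> L \<and>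
        (\<forall>w\<in>S. norm (w - u) \<le> \<rho> \<longrightarrow> norm (F v - F w) \<le> L * norm (v - w)))" using loc[of M] by blast
  define K where "K = max L 1"
  have K: "K \<ge> 1" "L \<le> K" by (auto simp: K_def)
  \<comment> \<open>The first bound keeps the Picard operator inside the ball of radius
    \<open>\<rho>\<close>, the second makes it a contraction of factor 1/2.\<close>
  define \<tau> where "\<tau> = min (\<rho> / K) (1 / (2 * K))"
  have \<tau>: "\<tau> > 0" "\<tau> * K \<le> \<rho>" "\<tau> * K \<le> 1 / 2"
  proof -
    show "\<tau> > 0" using \<rho> K by (simp add: \<tau>_def)
    have "\<tau> * K \<le> \<rho> / K * K" using K by (intro mult_right_mono) (auto simp: \<tau>_def)
    then show "\<tau> * K \<le> \<rho>" using K by simp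
    have "\<tau> * K \<le> 1 / (2 * K) * K" using K by (intro mult_right_mono) (auto simp: \<tau>_def)
    then show "\<tau> * K \<le> 1 / 2" using K by simp
  qed
  show ?thesis
  proof (intro exI[of _ \<tau>] conjI ballI impI)
    fix u assume u: "u \<in> G" "size u \<le> M"
    have L: "v \<in> G" "norm (F v) \<le> K" if "v \<in> S" "norm (v - u) \<le> \<rho>" for v
      using L0 u that K by (auto intro: order_trans)
    have Lip: "norm (F v - F w) \<le> K * norm (v - w)" if "v \<in> S" "norm (v - u) \<le> \<rho>" "w \<in> S" "norm (w - u) \<le> \<rho>" for v w
      using L0 u that K by (meson mult_right_mono norm_ge_zero order_trans)
    define C where "C = {x :: real \<Rightarrow>\<^sub>C 'a. \<forall>t. apply_bcontfun x t \<in> S \<and> norm (apply_bcontfun x t - u) \<le> \<rho>}"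
    \<comment> \<open>Clamping time to [0, \<open>\<tau>\<close>] lets the iteration run in bounded
      continuous functions on the whole line, frozen outside that interval.\<close>
    define clm where "clm t = min \<tau> (max 0 t)" for t :: real
    have clm: "0 \<le> clm t" "clm t \<le> \<tau>" for t using \<tau> by (auto simp: clm_def)
    have contF: "continuous_on A (\<lambda>s. F (apply_bcontfun x s))" if x: "x \<in> C" for x A
    proof -
      have "continuous_on (S \<inter> cball u \<rho>) F"
      proof (rule continuous_onI)
        fix v e assume v: "v \<in> S \<inter> cball u \<rho>" and e: "e > (0::real)"
        show "\<exists>d>0. \<forall>x'\<in>S \<inter> cball u \<rho>. dist x' v < d \<longrightarrow> dist (F x') (F v) \<le> e"
        proof (intro exI[of _ "e / K"] conjI ballI impI)
          fix w assume w: "w \<in> S \<inter> cball u \<rho>" "dist w v < e / K"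
          have "dist (F w) (F v) \<le> K * norm (w - v)"
            unfolding dist_norm using v w by (intro Lip) (auto simp: dist_norm norm_minus_commute)
          also have "\<dots> \<le> K * (e / K)" using w K by (intro mult_left_mono) (auto simp: dist_norm)
          finally show "dist (F w) (F v) \<le> e" using K by simp
        qed (use e K in auto)
      qed
      moreover have "continuous_on A (apply_bcontfun x)" by (rule continuous_on_apply_bcontfun)
      moreover have "apply_bcontfun x ` A \<subseteq> S \<inter> cball u \<rho>" using x by (auto simp: C_def dist_norm norm_minus_commute)
      ultimately show ?thesis by (rule continuous_on_compose2)
    qed
    define P where "P x t = u + integral {0..clm t} (\<lambda>s. F (apply_bcontfun x s))" for x t
    have intS: "integral {0..c} (\<lambda>s. F (apply_bcontfun x s)) \<in> S" if "x \<in> C" for x c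
      by (rule integral_mem_closed_subspace[OF S contF[OF that]]) (use that L FS in \<open>auto simp: C_def\<close>)
    have PS: "P x t \<in> S" if "x \<in> C" for x t
      unfolding P_def using intS[OF that] u GS S(1) by (intro subspace_add) auto
    have Pb: "norm (P x t - u) \<le> \<rho>" if "x \<in> C" for x t
    proof -
      have "norm (integral {0..clm t} (\<lambda>s. F (apply_bcontfun x s))) \<le> K * (clm t - 0)"
        by (rule integral_bound[OF clm(1) contF[OF that]]) (use that L in \<open>auto simp: C_def\<close>)
      also have "\<dots> \<le> K * \<tau>" using K clm(2)[of t] by simp
      also have "\<dots> \<le> \<rho>" using \<tau>(2) by (simp add: mult.commute)
      finally show ?thesis by (simp add: P_def)
    qed
    have Pc: "P x \<in> bcontfun" if "x \<in> C" for x
    proof -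
      have "continuous_on {0..\<tau>} (\<lambda>t. integral {0..t} (\<lambda>s. F (apply_bcontfun x s)))"
        by (rule indefinite_integral_continuous_1[OF integrable_continuous_interval[OF contF[OF that]]])
      moreover have "continuous_on UNIV clm" unfolding clm_def by (intro continuous_intros)
      ultimately have "continuous_on UNIV (\<lambda>t. integral {0..clm t} (\<lambda>s. F (apply_bcontfun x s)))"
        by (rule continuous_on_compose2) (use clm in auto)
      then have "continuous_on UNIV (P x)" unfolding P_def[abs_def] by (intro continuous_intros)
      moreover have "bounded (range (P x))"
      proof (rule boundedI[of _ "norm u + \<rho>"])
        fix y assume "y \<in> range (P x)"
        then obtain t where "y = P x t" by blast
        then have "norm (y - u) \<le> \<rho>" using Pb[OF that, of t] by simp
        then show "norm y \<le> norm u + \<rho>" using norm_triangle_sub[of y u] by linarith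
      qed
      ultimately show ?thesis by (simp add: bcontfun_def)
    qed
    define \<Phi> where "\<Phi> x = Bcontfun (P x)" for x
    have \<Phi>: "apply_bcontfun (\<Phi> x) = P x" if "x \<in> C" for x
      unfolding \<Phi>_def by (rule Bcontfun_inverse[OF Pc[OF that]])
    have closedC: "closed C"
      unfolding closed_sequential_limits
    proof (intro allI impI, elim conjE)
      fix X x assume X: "\<forall>n. X n \<in> C" "X \<longlonglongrightarrow> x"
      have pt: "(\<lambda>n. apply_bcontfun (X n) t) \<longlonglongrightarrow> apply_bcontfun x t" for t
      proof (rule LIM_zero_cancel, rule Lim_null_comparison[OF always_eventually])
        show "\<forall>n. norm (apply_bcontfun (X n) t - apply_bcontfun x t) \<le> norm (X n - x)"
          using norm_bounded[of "X _ - x" t] by simp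
        show "(\<lambda>n. norm (X n - x)) \<longlonglongrightarrow> 0" using X(2) by (simp add: LIM_zero tendsto_norm_zero)
      qed
      show "x \<in> C" unfolding C_def
      proof (intro CollectI allI conjI)
        fix t
        show "apply_bcontfun x t \<in> S"
          by (rule closed_sequentially[OF S(2) _ pt]) (use X in \<open>auto simp: C_def\<close>)
        have "apply_bcontfun x t \<in> cball u \<rho>"
          by (rule closed_sequentially[OF closed_cball _ pt]) (use X in \<open>auto simp: C_def dist_norm norm_minus_commute\<close>)
        then show "norm (apply_bcontfun x t - u) \<le> \<rho>" by (simp add: dist_norm norm_minus_commute)
      qed
    qed
    have "const_bcontfun u \<in> C" using u GS \<rho> by (auto simp: C_def)
    then have neC: "C \<noteq> {}" by blast
    have "\<exists>!x. x \<in> C \<and> \<Phi> x = x"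
    proof (rule Banach_fix[of C "1/2" \<Phi>])
      show "complete C" using closedC by (simp add: complete_eq_closed)
      show "\<Phi> ` C \<subseteq> C" using \<Phi> PS Pb by (auto simp: C_def)
      fix x y assume "x \<in> C" "y \<in> C"
      then have xy: "x \<in> C \<and> y \<in> C" by simp
      show "dist (\<Phi> x) (\<Phi> y) \<le> 1 / 2 * dist x y"
      proof (rule dist_bound)
        fix t
        have "norm (P x t - P y t) = norm (integral {0..clm t} (\<lambda>s. F (apply_bcontfun x s) - F (apply_bcontfun y s)))"
          unfolding P_def using xy
          by (subst Henstock_Kurzweil_Integration.integral_diff) (auto intro!: integrable_continuous_interval contF)
        also have "\<dots> \<le> (K * dist x y) * (clm t - 0)"
        proof (rule integral_bound[OF clm(1)])
          show "continuous_on {0..clm t} (\<lambda>s. F (apply_bcontfun x s) - F (apply_bcontfun y s))"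
            using xy by (intro continuous_intros contF) auto
          fix s
          have "norm (F (apply_bcontfun x s) - F (apply_bcontfun y s)) \<le> K * norm (apply_bcontfun x s - apply_bcontfun y s)"
            using xy by (intro Lip) (auto simp: C_def)
          also have "\<dots> \<le> K * dist x y" using K dist_bounded[of x s y] by (simp add: dist_norm)
          finally show "norm (F (apply_bcontfun x s) - F (apply_bcontfun y s)) \<le> K * dist x y" .
        qed
        also have "\<dots> \<le> (K * dist x y) * \<tau>" using clm(2)[of t] K by (intro mult_left_mono) auto
        also have "\<dots> = (\<tau> * K) * dist x y" by simp
        also have "\<dots> \<le> 1 / 2 * dist x y" by (rule mult_right_mono[OF \<tau>(3)]) simp
        finally show "dist (apply_bcontfun (\<Phi> x) t) (apply_bcontfun (\<Phi> y) t) \<le> 1 / 2 * dist x y"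
          using \<Phi> xy by (simp add: dist_norm)
      qed
    qed (use neC in auto)
    then obtain x where x: "x \<in> C" "\<Phi> x = x" by blast
    have xP: "apply_bcontfun x t = P x t" for t using \<Phi>[OF x(1)] x(2) by metis
    have "sol \<tau> (apply_bcontfun x) u"
      unfolding sol_def
    proof (intro conjI ballI)
      show "apply_bcontfun x 0 = u" using xP[of 0] \<tau> by (simp add: P_def clm_def)
      fix t assume t: "t \<in> {0..<\<tau>}"
      show "apply_bcontfun x t \<in> G" using x(1) L by (auto simp: C_def)
      have "((\<lambda>t. integral {0..t} (\<lambda>s. F (apply_bcontfun x s))) has_vector_derivative F (apply_bcontfun x t)) (at t within {0..\<tau>})"
        by (rule integral_has_vector_derivative[OF contF[OF x(1)]]) (use t in auto)
      then have "((\<lambda>t. u + integral {0..t} (\<lambda>s. F (apply_bcontfun x s))) has_vector_derivative 0 + F (apply_bcontfun x t)) (at t within {0..\<tau>})"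
        by (intro has_vector_derivative_add has_vector_derivative_const)
      then have "((\<lambda>t. u + integral {0..t} (\<lambda>s. F (apply_bcontfun x s))) has_vector_derivative F (apply_bcontfun x t)) (at t within {0..<\<tau>})"
        by (auto elim!: has_vector_derivative_within_subset)
      then show "(apply_bcontfun x has_vector_derivative F (apply_bcontfun x t)) (at t within {0..<\<tau>})"
      proof (rule has_vector_derivative_transform[rotated 2])
        show "apply_bcontfun x s = u + integral {0..s} (\<lambda>s. F (apply_bcontfun x s))" if "s \<in> {0..<\<tau>}" for s
          using xP[of s] that by (simp add: P_def clm_def)
      qed (use t in auto)
    qed
    then show "\<exists>U. sol \<tau> U u" by blast
  qed (use \<tau> in auto)
qed

lemma sol_extend:
  assumes U: "sol T U u" and c: "0 \<le> c" "c < T" and V: "sol \<tau> V (U c)" and T: "T \<le> c + \<tau>"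
  shows "\<exists>W. sol (c + \<tau>) W u"
proof -
  define W where "W t = (if t < T then U t else V (t - c))" for t
  \<comment> \<open>On the overlap [c, T) uniqueness identifies both pieces, so near each time the
    glued curve is one of them, also across \<open>T\<close>.\<close>
  have agree: "U t = V (t - c)" if "c \<le> t" "t < T" for t
    using sol_unique[OF sol_shift[OF U c(1)] sol_mono[OF V, of "T - c"], of "t - c"] that T by simp
  have "sol (c + \<tau>) W u"
    unfolding sol_def
  proof (intro conjI ballI)
    show "W 0 = u" using U c by (simp add: W_def sol_def)
    fix t assume t: "t \<in> {0..<c + \<tau>}"
    show "W t \<in> G" using U V c t by (auto simp: W_def sol_def)
    show "(W has_vector_derivative F (W t)) (at t within {0..<c + \<tau>})"
    proof (cases "t < T")
      case True
      have "(U has_vector_derivative F (U t)) (at t within {0..<T})" using U t True by (auto simp: sol_def)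
      then have "(W has_vector_derivative F (U t)) (at t within {0..<c + \<tau>})"
        by (rule has_vector_derivative_local[of _ _ _ _ "{..<T}"]) (use t True T in \<open>auto simp: W_def\<close>)
      then show ?thesis using True by (simp add: W_def)
    next
      case False
      have "(V has_vector_derivative F (V (t - c))) (at (-c + t) within {-c + c..<-c + (c + \<tau>)})"
        using V t False c by (auto simp: sol_def)
      then have "((\<lambda>s. V (- c + s)) has_vector_derivative F (V (t - c))) (at t within {c..<c + \<tau>})"
        by (rule has_vector_derivative_shift)
      then have "(W has_vector_derivative F (V (t - c))) (at t within {0..<c + \<tau>})"
        by (rule has_vector_derivative_local[of _ _ _ _ "{c<..}"]) (use t False c agree in \<open>auto simp: W_def\<close>)
      then show ?thesis using False by (simp add: W_def)
    qed
  qed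
  then show ?thesis by blast
qed

text \<open>By uniqueness the local solutions are restrictions of one solution on [0, Tm). If
  \<open>size\<close> stayed bounded near \<open>Tm\<close>, a restart shortly before
  \<open>Tm\<close> with the uniform existence time would go beyond the supremum.\<close>

lemma sol_maximal:
  assumes Tm: "(SUP T\<in>{T. 0 < T \<and> (\<exists>U. sol T U u)}. ereal T) = ereal Tm" and u: "u \<in> G"
  shows "Tm > 0" "\<exists>U. sol Tm U u \<and> (\<forall>M. \<forall>t0<Tm. \<exists>t\<in>{t0..<Tm}. 0 \<le> t \<and> size (U t) > M)"
proof -
  let ?A = "{T. 0 < T \<and> (\<exists>U. sol T U u)}"
  have ub: "T \<le> Tm" if "T \<in> ?A" for T
    using SUP_upper[OF that, of ereal] Tm by simp
  obtain \<tau>0 where "\<tau>0 \<in> ?A" using sol_local[of "size u"] u by blast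
  then show Tm0: "Tm > 0" using ub by force
  have ex: "\<exists>T V. t < T \<and> T \<le> Tm \<and> sol T V u" if "t < Tm" for t
  proof -
    have "ereal t < (SUP T\<in>?A. ereal T)" using Tm that by simp
    then obtain T where "T \<in> ?A" "t < T" unfolding less_SUP_iff by auto
    then show ?thesis using ub by blast
  qed
  then obtain TT VV where V: "\<And>t. t < Tm \<Longrightarrow> t < TT t \<and> TT t \<le> Tm \<and> sol (TT t) (VV t) u" by metis
  \<comment> \<open>Diagonal definition: the solution chosen for \<open>t\<close> lives on an
    interval extending strictly past \<open>t\<close>.\<close>
  define U where "U t = VV t t" for t
  have UV: "U s = VV t s" if "0 \<le> s" "s < TT t" "t < Tm" for s t
  proof -
    have s: "s < Tm" using V[OF that(3)] that by simp
    have "sol (min (TT s) (TT t)) (VV s) u" "sol (min (TT s) (TT t)) (VV t) u"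
      using V[OF s] V[OF that(3)] sol_mono by (meson min.cobounded1 min.cobounded2)+
    then show ?thesis using sol_unique[of "min (TT s) (TT t)" "VV s" u "VV t" s] V[OF s] that by (simp add: U_def)
  qed
  have solU: "sol Tm U u"
    unfolding sol_def
  proof (intro conjI ballI)
    show "U 0 = u" using V[OF Tm0] by (simp add: U_def sol_def)
    fix t assume t: "t \<in> {0..<Tm}"
    then have Vt: "t < TT t" "TT t \<le> Tm" "sol (TT t) (VV t) u" using V[of t] by auto
    show "U t \<in> G" using Vt t by (auto simp: U_def sol_def)
    have "(VV t has_vector_derivative F (U t)) (at t within {0..<TT t})" using Vt t by (auto simp: U_def sol_def)
    then show "(U has_vector_derivative F (U t)) (at t within {0..<Tm})"
      by (rule has_vector_derivative_local[of _ _ _ _ "{..<TT t}"]) (use t Vt UV[of _ t] in auto)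
  qed
  have "\<exists>t\<in>{t0..<Tm}. 0 \<le> t \<and> size (U t) > M" if "t0 < Tm" for t0 M
  proof (rule ccontr)
    assume n: "\<not> ?thesis"
    obtain \<tau> where \<tau>: "\<tau> > 0" "\<forall>u\<in>G. size u \<le> M \<longrightarrow> (\<exists>U. sol \<tau> U u)" using sol_local[of M] by blast
    \<comment> \<open>The restart happens within \<open>\<tau>\<close> / 2 of \<open>Tm\<close>, so
      the restarted solution outlives \<open>Tm\<close>.\<close>
    define c where "c = max (max t0 0) (Tm - \<tau> / 2)"
    have c: "0 \<le> c" "c < Tm" "t0 \<le> c" "Tm < c + \<tau>" using that Tm0 \<tau>(1) by (auto simp: c_def)
    have "U c \<in> G" "size (U c) \<le> M" using solU c n by (auto simp: sol_def not_less)
    then obtain W where "sol \<tau> W (U c)" using \<tau>(2) by blast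
    from sol_extend[OF solU c(1,2) this] c(4) have "c + \<tau> \<in> ?A" using c by auto
    then show False using ub c(4) by force
  qed
  then show "\<exists>U. sol Tm U u \<and> (\<forall>M. \<forall>t0<Tm. \<exists>t\<in>{t0..<Tm}. 0 \<le> t \<and> size (U t) > M)" using solU by blast
qed

end

section \<open>Estimates for the vector field\<close>

lemma sqi_bounded_by:
  assumes "f \<in> borel_measurable lebesgue" "\<And>x. \<bar>f x\<bar> \<le> c * \<bar>p x\<bar>" "sqi p" "c \<ge> 0"
  shows "sqi f" "nrm2 f \<le> c * nrm2 p"
proof -
  have le: "(f x)\<^sup>2 \<le> (c * p x)\<^sup>2" for x
    using assms(2)[of x] assms(4) by (simp add: abs_le_square_iff[symmetric] abs_mult)
  have s: "sqi (\<lambda>x. c * p x)" by (rule sqi_cmult[OF assms(3)])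
  have i: "integrable lebesgue (\<lambda>x. (f x)\<^sup>2)"
    by (rule Bochner_Integration.integrable_bound[where f="\<lambda>x. (c * p x)\<^sup>2"]) (use s assms(1) le in \<open>auto simp: sqi_def\<close>)
  then show "sqi f" using assms(1) by (simp add: sqi_def)
  have "nrm2 f \<le> nrm2 (\<lambda>x. c * p x)"
    unfolding nrm2_def using i s le by (intro real_sqrt_le_mono integral_mono) (auto simp: sqi_def)
  then show "nrm2 f \<le> c * nrm2 p" using assms(4) by (simp add: nrm2_cmult)
qed

context dom
begin

lemma Hs_D: "Hs k f c \<Longrightarrow> Hb k f c" "Hs k f c \<Longrightarrow> x \<in> Eb \<Longrightarrow> \<bar>f x\<bar> \<le> c" "Hs k f c \<Longrightarrow> c \<ge> 0"
  unfolding Hs_def using Hb_nonneg by auto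

lemma Hs_mono: "Hs k f c \<Longrightarrow> c \<le> d \<Longrightarrow> Hs k f d"
  unfolding Hs_def using Hb_mono order_trans by blast

lemma Hs_le: "Hs k f c \<Longrightarrow> j \<le> k \<Longrightarrow> Hs j f c"
  unfolding Hs_def using Hb_le by blast

lemma Hs_add: "Hs k f a \<Longrightarrow> Hs k g b \<Longrightarrow> Hs k (\<lambda>x. f x + g x) (a + b)"
  unfolding Hs_def using Hb_add by (metis abs_triangle_ineq add_mono order_trans)

lemma Hs_cmult: "Hs k f a \<Longrightarrow> Hs k (\<lambda>x. c * f x) (\<bar>c\<bar> * a)"
  unfolding Hs_def using Hb_cmult by (auto simp: abs_mult mult_left_mono)

lemma Hs_mult: "Hs k f a \<Longrightarrow> Hs k g b \<Longrightarrow> Hs k (\<lambda>x. f x * g x) (MC k * a * b)"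
proof -
  assume f: "Hs k f a" and g: "Hs k g b"
  have "\<bar>f x * g x\<bar> \<le> MC k * a * b" if "x \<in> Eb" for x
  proof -
    have "\<bar>f x * g x\<bar> \<le> a * b" using Hs_D[OF f] Hs_D[OF g] that by (auto simp: abs_mult intro!: mult_mono)
    also have "\<dots> \<le> MC k * (a * b)" using MC_ge[of k] Hs_D(3)[OF f] Hs_D(3)[OF g] mult_right_mono[of 1 "MC k" "a * b"] by simp
    finally show ?thesis by (simp add: mult.assoc)
  qed
  then show ?thesis using Hb_mult[OF Hs_D(1)[OF f] g] by (simp add: Hs_def)
qed

lemma Hs_cong: "Hs k f c \<Longrightarrow> (\<And>x. x \<in> Eb \<Longrightarrow> f x = g x) \<Longrightarrow> Hs k g c"
  unfolding Hs_def using Hb_cong by auto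

lemma Hb_imp_Hs: "Hb k f c \<Longrightarrow> k \<ge> 1 \<Longrightarrow> Hs k f (CS * c)"
proof -
  assume f: "Hb k f c" "k \<ge> 1"
  have "c \<le> CS * c" using mult_right_mono[OF CS_ge Hb_nonneg[OF f(1)]] by simp
  then show ?thesis unfolding Hs_def using Hb_mono[OF f(1)] Hb_sup[OF f] by auto
qed

end

text \<open>A datum is \<open>(\<zeta>, q, q\<^sub>i, d)\<close>; carrying the memory term \<open>d\<close>, which solves \<open>d' = \<zeta>-average - \<kappa> d\<close>, as an
  additional unknown makes the problem autonomous.\<close>

type_synonym data = "(real \<Rightarrow> real) \<times> (real \<Rightarrow> real) \<times> real \<times> real"

locale prob = dom +
  fixes hw P0 \<kappa> \<epsilon> \<mu> :: real and m :: nat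
  assumes hw: "hw > 0" and P0: "P0 > 0" and \<kappa>: "\<kappa> \<ge> 0" and m1: "m \<ge> 1" and \<epsilon>: "0 < \<epsilon>" "\<epsilon> \<le> 1" and \<mu>: "\<mu> > 0"
begin

text \<open>On the unbounded domain 1/h tends to 1 and is not square integrable; the difference 1/h
  - 1 is of the size of zeta and belongs to the same Sobolev space.\<close>

definition gg :: "(real \<Rightarrow> real) \<Rightarrow> real \<Rightarrow> real" where "gg z x = 1 / height \<epsilon> z x - 1"

lemma gg_Hb0:
  assumes z: "Hb 0 z T" and h: "\<And>x. x \<in> Eb \<Longrightarrow> height \<epsilon> z x \<ge> 1 / A" and A: "A \<ge> 1"
  shows "Hb 0 (gg z) (A * T)"
proof -
  have e: "ext (gg z) = (\<lambda>x. 1 / (1 + \<epsilon> * ext z x) - 1)"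
    by (auto simp: ext_def gg_def height_def split: split_indicator)
  have "\<bar>ext (gg z) x\<bar> \<le> A * \<bar>ext z x\<bar>" for x
  proof (cases "x \<in> E")
    case True
    then have hx: "height \<epsilon> z x \<ge> 1 / A" using h E_Eb by blast
    then have h0: "height \<epsilon> z x > 0" using A by (auto intro: less_le_trans[of 0 "1 / A"])
    have inv: "1 / height \<epsilon> z x \<le> A" using hx h0 A by (simp add: field_simps)
    have "gg z x = - (\<epsilon> * z x * (1 / height \<epsilon> z x))" using h0 by (simp add: gg_def height_def field_simps)
    then have "\<bar>gg z x\<bar> = \<epsilon> * \<bar>z x\<bar> * (1 / height \<epsilon> z x)" using h0 \<epsilon> by (simp add: abs_mult)
    also have "\<dots> \<le> 1 * \<bar>z x\<bar> * A" using inv h0 \<epsilon> by (intro mult_mono) auto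
    finally show ?thesis using True by (simp add: ext_def mult.commute)
  qed (simp add: ext_def)
  moreover have "ext (gg z) \<in> borel_measurable lebesgue" unfolding e using Hb_0D(1)[OF z]
    by (intro borel_measurable_diff borel_measurable_divide borel_measurable_add borel_measurable_times) (auto simp: sqi_def)
  ultimately have "sqi (ext (gg z))" "nrm2 (ext (gg z)) \<le> A * nrm2 (ext z)"
    using sqi_bounded_by[of "ext (gg z)" A "ext z"] Hb_0D(1)[OF z] A by auto
  moreover have "A * nE z \<le> A * T" using Hb_0D(2)[OF z] A by (intro mult_left_mono) auto
  ultimately show ?thesis by (simp add: nE_def)
qed

lemma gg_sup: assumes "x \<in> Eb" "height \<epsilon> z x \<ge> 1 / A" "A \<ge> 1" shows "\<bar>gg z x\<bar> \<le> A"
proof -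
  have h0: "height \<epsilon> z x > 0" using assms by (auto intro: less_le_trans[of 0 "1 / A"])
  then have "1 / height \<epsilon> z x \<le> A" "1 / height \<epsilon> z x > 0" using assms by (auto simp: field_simps)
  then show ?thesis using assms(3) unfolding gg_def by linarith
qed

text \<open>The derivative of 1/h is - \<epsilon> zeta' (1 + \<open>gg\<close>)^2. The square is
  expanded so that each term is a product of zeta' with factors of the algebra, none of them the
  constant 1/h at infinity.\<close>

lemma gg_AC: assumes "AC Eb z z'" "\<And>x. x \<in> Eb \<Longrightarrow> height \<epsilon> z x \<ge> 1 / A" "A \<ge> 1"
  shows "AC Eb (gg z) (\<lambda>x. (- \<epsilon>) * (z' x + (2 * (z' x * gg z x) + z' x * gg z x * gg z x)))"
proof -
  have "AC Eb (height \<epsilon> z) (\<lambda>x. 0 + \<epsilon> * z' x)"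
    unfolding height_def[abs_def] by (intro AC_add AC_const AC_cmult assms)
  from AC_diff[OF AC_inverse[OF this assms(2)] AC_const[of _ 1]]
  have "AC Eb (\<lambda>x. 1 / height \<epsilon> z x - 1) (\<lambda>x. - (0 + \<epsilon> * z' x) * (1 / height \<epsilon> z x * (1 / height \<epsilon> z x)) - 0)"
    using assms(3) by simp
  then show ?thesis
    by (rule AC_cong) (auto simp: gg_def algebra_simps)
qed

text \<open>One derivative of \<open>1/h\<close> costs one derivative of \<open>\<zeta>\<close>, to which the bound is linear.\<close>

lemma gg_step:
  assumes A: "A \<ge> 1"
  shows "\<exists>C\<ge>0. \<forall>z T. Hs k (gg z) A \<longrightarrow> (\<forall>x\<in>Eb. height \<epsilon> z x \<ge> 1 / A) \<longrightarrow> Hb (Suc k) z T \<longrightarrow> Hb (Suc k) (gg z) (A + C * T)"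
proof -
  define C where "C = 1 + (2 * (MC k * A) + MC k * (MC k * A) * A)"
  have C0: "C \<ge> 0" using MC_ge[of k] A by (simp add: C_def)
  show ?thesis
  proof (intro exI[of _ C] conjI allI impI)
    fix z T assume g: "Hs k (gg z) A" and h: "\<forall>x\<in>Eb. height \<epsilon> z x \<ge> 1 / A" and z: "Hb (Suc k) z T"
    obtain z' where z': "AC Eb z z'" "Hb k z' T" using z by auto
    have T: "T \<ge> 0" using z by (rule Hb_nonneg)
    have 1: "Hb k (\<lambda>x. z' x * gg z x) (MC k * T * A)" by (rule Hb_mult[OF z'(2) g])
    have 2: "Hb k (\<lambda>x. z' x * gg z x * gg z x) (MC k * (MC k * T * A) * A)" by (rule Hb_mult[OF 1 g])
    have "Hb k (\<lambda>x. (- \<epsilon>) * (z' x + (2 * (z' x * gg z x) + z' x * gg z x * gg z x)))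
      (\<bar>- \<epsilon>\<bar> * (T + (\<bar>2\<bar> * (MC k * T * A) + MC k * (MC k * T * A) * A)))"
      by (intro Hb_cmult Hb_add z'(2) 1 2)
    moreover have "\<bar>- \<epsilon>\<bar> * (T + (\<bar>2\<bar> * (MC k * T * A) + MC k * (MC k * T * A) * A)) \<le> A + C * T"
    proof -
      have "\<bar>- \<epsilon>\<bar> * (C * T) \<le> 1 * (C * T)" using \<epsilon> C0 T by (intro mult_right_mono) auto
      then show ?thesis using A by (simp add: C_def algebra_simps)
    qed
    ultimately have d: "Hb k (\<lambda>x. (- \<epsilon>) * (z' x + (2 * (z' x * gg z x) + z' x * gg z x * gg z x))) (A + C * T)" by (rule Hb_mono)
    have "Hb k (gg z) (A + C * T)" by (rule Hb_mono[OF Hs_D(1)[OF g]]) (use C0 T in simp)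
    then show "Hb (Suc k) (gg z) (A + C * T)"
      using d gg_AC[OF z'(1) _ A] h Hb_0D by auto
  qed (rule C0)
qed

lemma gg_Hs: assumes "A \<ge> 1" shows "\<exists>C\<ge>1. \<forall>z. Hs k z A \<longrightarrow> (\<forall>x\<in>Eb. height \<epsilon> z x \<ge> 1 / A) \<longrightarrow> Hs k (gg z) C"
proof (induction k)
  case 0
  have "A \<le> A * A" using mult_left_mono[of 1 A A] assms by simp
  show ?case
  proof (intro exI[of _ "A * A"] conjI allI impI)
    show "1 \<le> A * A" using \<open>A \<le> A * A\<close> assms by linarith
    fix z assume z: "Hs 0 z A" and h: "\<forall>x\<in>Eb. height \<epsilon> z x \<ge> 1 / A"
    have "Hb 0 (gg z) (A * A)" using gg_Hb0[OF Hs_D(1)[OF z] _ assms] h by blast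
    moreover have "\<bar>gg z x\<bar> \<le> A * A" if "x \<in> Eb" for x
      using gg_sup[OF that h[rule_format, OF that] assms] \<open>A \<le> A * A\<close> by linarith
    ultimately show "Hs 0 (gg z) (A * A)" by (simp add: Hs_def del: Hb.simps)
  qed
next
  case (Suc k)
  then obtain C where C: "C \<ge> 1" "\<And>z. Hs k z A \<Longrightarrow> (\<forall>x\<in>Eb. height \<epsilon> z x \<ge> 1 / A) \<Longrightarrow> Hs k (gg z) C" by blast
  \<comment> \<open>In \<open>gg_step\<close> one constant is both the bound for \<open>gg\<close>
    and the inverse of the lower bound for the height.\<close>
  define B where "B = max A C"
  have B: "B \<ge> 1" "A \<le> B" "C \<le> B" using assms by (auto simp: B_def)
  obtain C' where C': "C' \<ge> 0" "\<And>z T. Hs k (gg z) B \<Longrightarrow> (\<forall>x\<in>Eb. height \<epsilon> z x \<ge> 1 / B) \<Longrightarrow> Hb (Suc k) z T \<Longrightarrow> Hb (Suc k) (gg z) (B + C' * T)"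
    using gg_step[OF B(1), of k] by blast
  show ?case
  proof (intro exI[of _ "B + C' * A"] conjI allI impI)
    show "1 \<le> B + C' * A" using B C' assms by (simp add: add_increasing2)
    fix z assume z: "Hs (Suc k) z A" and h: "\<forall>x\<in>Eb. height \<epsilon> z x \<ge> 1 / A"
    have g: "Hs k (gg z) C" using C(2)[OF Hs_le[OF z]] h by simp
    have h': "\<forall>x\<in>Eb. height \<epsilon> z x \<ge> 1 / B"
    proof
      fix x assume "x \<in> Eb"
      have "1 / B \<le> 1 / A" using B assms by (intro frac_le) auto
      then show "height \<epsilon> z x \<ge> 1 / B" using h \<open>x \<in> Eb\<close> by force
    qed
    have "Hb (Suc k) (gg z) (B + C' * A)" using C'(2)[OF Hs_mono[OF g B(3)] h' Hs_D(1)[OF z]] .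
    moreover have "\<bar>gg z x\<bar> \<le> B + C' * A" if "x \<in> Eb" for x
    proof -
      have "\<bar>gg z x\<bar> \<le> A" by (rule gg_sup[OF that _ assms]) (use h that in auto)
      also have "A \<le> B + C' * A" using B C'(1) assms by (simp add: add_increasing2)
      finally show ?thesis .
    qed
    ultimately show "Hs (Suc k) (gg z) (B + C' * A)" by (simp add: Hs_def del: Hb.simps)
  qed
qed

text \<open>As a polynomial without constant term in zeta, q and \<open>gg\<close>, phi is
  accessible to the product estimates.\<close>

lemma phi_eq: "height \<epsilon> z x \<noteq> 0 \<Longrightarrow> phi \<epsilon> z q x = z x + ((\<epsilon> / 2) * (z x * z x) + (\<epsilon> * (q x * q x) + \<epsilon> * (q x * q x * gg z x)))"
  by (simp add: phi_def gg_def power2_eq_square field_simps)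

section \<open>Lipschitz families\<close>

definition zt :: "data \<Rightarrow> real \<Rightarrow> real" where "zt D = fst D"
definition qu :: "data \<Rightarrow> real \<Rightarrow> real" where "qu D = fst (snd D)"
definition av :: "data \<Rightarrow> real" where "av D = fst (snd (snd D))"
definition dv :: "data \<Rightarrow> real" where "dv D = snd (snd (snd D))"

abbreviation ht :: "data \<Rightarrow> real \<Rightarrow> real" where "ht D \<equiv> height \<epsilon> (zt D)"

definition Bd :: "real \<Rightarrow> data \<Rightarrow> bool" where
  "Bd N D \<longleftrightarrow> N \<ge> 1 \<and> Hs m (zt D) N \<and> Hs (Suc m) (qu D) N \<and> \<bar>av D\<bar> \<le> N \<and> \<bar>dv D\<bar> \<le> N \<and> (\<forall>x\<in>Eb. ht D x \<ge> 1 / N)"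

text \<open>The number \<open>e\<close> is any bound for the distance of the two data, with both
  data bounded by \<open>N\<close>; taking \<open>e\<close> = 0 and equal data turns Lipschitz
  estimates into plain bounds.\<close>

definition Q :: "real \<Rightarrow> real \<Rightarrow> data \<Rightarrow> data \<Rightarrow> bool" where
  "Q N e D1 D2 \<longleftrightarrow> Bd N D1 \<and> Bd N D2 \<and> Hs m (\<lambda>x. zt D1 x - zt D2 x) e \<and> Hs (Suc m) (\<lambda>x. qu D1 x - qu D2 x) e \<and>
     \<bar>av D1 - av D2\<bar> \<le> e \<and> \<bar>dv D1 - dv D2\<bar> \<le> e"

text \<open>Boundedness and the Lipschitz bound are stated with one constant because the product
  rule consumes both; the families satisfying it for every \<open>N\<close> (\<open>Lp\<close>, and
  \<open>Ls\<close> for scalars) are closed under the operations from which the vector field is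
  built.\<close>

definition LB :: "real \<Rightarrow> real \<Rightarrow> (data \<Rightarrow> real \<Rightarrow> real) \<Rightarrow> bool" where
  "LB N L f \<longleftrightarrow> (\<forall>D1 D2 e. Q N e D1 D2 \<longrightarrow> Hs m (f D1) L \<and> Hs m (f D2) L \<and> Hs m (\<lambda>x. f D1 x - f D2 x) (L * e))"

definition SB :: "real \<Rightarrow> real \<Rightarrow> (data \<Rightarrow> real) \<Rightarrow> bool" where
  "SB N L s \<longleftrightarrow> (\<forall>D1 D2 e. Q N e D1 D2 \<longrightarrow> \<bar>s D1\<bar> \<le> L \<and> \<bar>s D2\<bar> \<le> L \<and> \<bar>s D1 - s D2\<bar> \<le> L * e)"

lemmas LB_D = LB_def[THEN iffD1, rule_format] and SB_D = SB_def[THEN iffD1, rule_format]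

definition Lp :: "(data \<Rightarrow> real \<Rightarrow> real) \<Rightarrow> bool" where "Lp f \<longleftrightarrow> (\<forall>N. \<exists>L. LB N L f)"

definition Ls :: "(data \<Rightarrow> real) \<Rightarrow> bool" where "Ls s \<longleftrightarrow> (\<forall>N. \<exists>L. SB N L s)"

lemma Q_nonneg: "Q N e D1 D2 \<Longrightarrow> e \<ge> 0" "Q N e D1 D2 \<Longrightarrow> N \<ge> 1"
  unfolding Q_def Bd_def using Hs_D(3) by auto

lemma LpI: assumes "\<And>N. N \<ge> 1 \<Longrightarrow> \<exists>L. LB N L f"
  shows "Lp f"
  unfolding Lp_def
proof
  fix N
  show "\<exists>L. LB N L f"
    using assms Q_nonneg(2) unfolding LB_def by (cases "N \<ge> 1") blast+
qed

lemma Lp_zt: "Lp zt"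
proof (rule LpI)
  fix N :: real assume N: "N \<ge> 1"
  show "\<exists>L. LB N L zt"
    unfolding LB_def
  proof (intro exI[of _ N] allI impI)
    fix D1 D2 e assume q: "Q N e D1 D2"
    have "e \<le> N * e" using mult_right_mono[OF N Q_nonneg(1)[OF q]] by simp
    then show "Hs m (zt D1) N \<and> Hs m (zt D2) N \<and> Hs m (\<lambda>x. zt D1 x - zt D2 x) (N * e)"
      using q Hs_mono unfolding Q_def Bd_def by blast
  qed
qed

lemma Lp_qu: "Lp qu"
proof (rule LpI)
  fix N :: real assume N: "N \<ge> 1"
  show "\<exists>L. LB N L qu"
    unfolding LB_def
  proof (intro exI[of _ N] allI impI)
    fix D1 D2 e assume q: "Q N e D1 D2"
    have "e \<le> N * e" using mult_right_mono[OF N Q_nonneg(1)[OF q]] by simp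
    then show "Hs m (qu D1) N \<and> Hs m (qu D2) N \<and> Hs m (\<lambda>x. qu D1 x - qu D2 x) (N * e)"
      using q Hs_mono Hs_le[of "Suc m" _ _ m] unfolding Q_def Bd_def by (metis le_SucI order_refl)
  qed
qed

lemma Lp_add: assumes "Lp f" "Lp g" shows "Lp (\<lambda>D x. f D x + g D x)"
proof (rule LpI)
  fix N
  obtain L1 where "LB N L1 f"
    using assms(1) unfolding Lp_def by blast
  note L1 = LB_D[OF this]
  obtain L2 where "LB N L2 g"
    using assms(2) unfolding Lp_def by blast
  note L2 = LB_D[OF this]
  show "\<exists>L. LB N L (\<lambda>D x. f D x + g D x)"
    unfolding LB_def
  proof (intro exI[of _ "L1 + L2"] allI impI conjI)
    fix D1 D2 e assume q: "Q N e D1 D2"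
    show "Hs m (\<lambda>x. f D1 x + g D1 x) (L1 + L2)" "Hs m (\<lambda>x. f D2 x + g D2 x) (L1 + L2)"
      using L1[OF q] L2[OF q] Hs_add by auto
    have "Hs m (\<lambda>x. (f D1 x - f D2 x) + (g D1 x - g D2 x)) (L1 * e + L2 * e)" using L1[OF q] L2[OF q] Hs_add by blast
    then show "Hs m (\<lambda>x. f D1 x + g D1 x - (f D2 x + g D2 x)) ((L1 + L2) * e)" by (simp add: algebra_simps)
  qed
qed

lemma Lp_cmult: assumes "Lp f" shows "Lp (\<lambda>D x. c * f D x)"
proof (rule LpI)
  fix N
  obtain L1 where "LB N L1 f"
    using assms(1) unfolding Lp_def by blast
  note L1 = LB_D[OF this]
  show "\<exists>L. LB N L (\<lambda>D x. c * f D x)"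
    unfolding LB_def
  proof (intro exI[of _ "\<bar>c\<bar> * L1"] allI impI conjI)
    fix D1 D2 e assume q: "Q N e D1 D2"
    show "Hs m (\<lambda>x. c * f D1 x) (\<bar>c\<bar> * L1)" "Hs m (\<lambda>x. c * f D2 x) (\<bar>c\<bar> * L1)" using L1[OF q] Hs_cmult by auto
    have "Hs m (\<lambda>x. c * (f D1 x - f D2 x)) (\<bar>c\<bar> * (L1 * e))" using L1[OF q] Hs_cmult by blast
    then show "Hs m (\<lambda>x. c * f D1 x - c * f D2 x) (\<bar>c\<bar> * L1 * e)" by (simp add: algebra_simps)
  qed
qed

lemma Lp_mult: assumes "Lp f" "Lp g" shows "Lp (\<lambda>D x. f D x * g D x)"
proof (rule LpI)
  fix N
  obtain L1 where "LB N L1 f"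
    using assms(1) unfolding Lp_def by blast
  note L1 = LB_D[OF this]
  obtain L2 where "LB N L2 g"
    using assms(2) unfolding Lp_def by blast
  note L2 = LB_D[OF this]
  let ?L = "2 * (MC m * L1 * L2)"
  show "\<exists>L. LB N L (\<lambda>D x. f D x * g D x)"
    unfolding LB_def
  proof (intro exI[of _ ?L] allI impI)
    fix D1 D2 e assume q: "Q N e D1 D2"
    have L: "L1 \<ge> 0" "L2 \<ge> 0" using L1[OF q] L2[OF q] Hs_D(3) by blast+
    have le: "MC m * L1 * L2 \<le> ?L" using L MC_ge[of m] by simp
    have 1: "Hs m (\<lambda>x. f D1 x * g D1 x) ?L" "Hs m (\<lambda>x. f D2 x * g D2 x) ?L"
      using L1[OF q] L2[OF q] Hs_mult Hs_mono[OF _ le] by blast+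
    have "Hs m (\<lambda>x. (f D1 x - f D2 x) * g D1 x + f D2 x * (g D1 x - g D2 x)) (MC m * (L1 * e) * L2 + MC m * L1 * (L2 * e))"
      using L1[OF q] L2[OF q] by (intro Hs_add Hs_mult) auto
    then have "Hs m (\<lambda>x. f D1 x * g D1 x - f D2 x * g D2 x) (?L * e)" by (simp add: algebra_simps)
    then show "Hs m (\<lambda>x. f D1 x * g D1 x) ?L \<and> Hs m (\<lambda>x. f D2 x * g D2 x) ?L \<and>
      Hs m (\<lambda>x. f D1 x * g D1 x - f D2 x * g D2 x) (?L * e)" using 1 by blast
  qed
qed

lemma Lp_cong:
  assumes "Lp f" "\<And>N D x. Bd N D \<Longrightarrow> x \<in> Eb \<Longrightarrow> f D x = g D x" shows "Lp g"
proof (rule LpI)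
  fix N
  obtain L1 where "LB N L1 f"
    using assms(1) unfolding Lp_def by blast
  note L1 = LB_D[OF this]
  show "\<exists>L. LB N L g"
    unfolding LB_def
  proof (intro exI[of _ L1] allI impI)
    fix D1 D2 e assume q: "Q N e D1 D2"
    have eq: "\<And>x. x \<in> Eb \<Longrightarrow> f D1 x = g D1 x" "\<And>x. x \<in> Eb \<Longrightarrow> f D2 x = g D2 x"
      using assms(2) q unfolding Q_def by blast+
    show "Hs m (g D1) L1 \<and> Hs m (g D2) L1 \<and> Hs m (\<lambda>x. g D1 x - g D2 x) (L1 * e)"
      using L1[OF q] Hs_cong[of m "f D1" L1 "g D1"] Hs_cong[of m "f D2" L1 "g D2"]
        Hs_cong[of m "\<lambda>x. f D1 x - f D2 x" "L1 * e" "\<lambda>x. g D1 x - g D2 x"] eq by simp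
  qed
qed

lemma Bd_height: "Bd N D \<Longrightarrow> x \<in> Eb \<Longrightarrow> ht D x > 0"
  unfolding Bd_def by (smt (verit, best) divide_pos_pos)

text \<open>The difference of two reciprocals 1/h_1 - 1/h_2 is - \<epsilon> (zeta_1 - zeta_2) / (h_1
  h_2); writing each 1/h as 1 + \<open>gg\<close> gives products in the algebra.\<close>

lemma Lp_gg: "Lp (\<lambda>D. gg (zt D))"
proof (rule LpI)
  fix N :: real assume N: "N \<ge> 1"
  obtain C where C: "C \<ge> 1" "\<And>z. Hs m z N \<Longrightarrow> (\<forall>x\<in>Eb. height \<epsilon> z x \<ge> 1 / N) \<Longrightarrow> Hs m (gg z) C" using gg_Hs[OF N, of m] by blast
  define L where "L = C + \<epsilon> * (1 + (2 * (MC m * C) + MC m * (MC m * C) * C))"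
  have L: "C \<le> L" "\<bar>-\<epsilon>\<bar> * (1 + (2 * (MC m * C) + MC m * (MC m * C) * C)) \<le> L"
    using C \<epsilon> MC_ge[of m] by (auto simp: L_def)
  show "\<exists>L. LB N L (\<lambda>D. gg (zt D))"
    unfolding LB_def
  proof (intro exI[of _ L] allI impI)
    fix D1 D2 e assume q: "Q N e D1 D2"
    have e: "e \<ge> 0" using Q_nonneg q by blast
    have g: "Hs m (gg (zt D1)) C" "Hs m (gg (zt D2)) C" using q C(2) by (auto simp: Q_def Bd_def)
    define w where "w x = zt D1 x - zt D2 x" for x
    have w: "Hs m w e" using q unfolding Q_def w_def[abs_def] by blast
    have "Hs m (\<lambda>x. (- \<epsilon>) * (w x + ((w x * gg (zt D1) x + w x * gg (zt D2) x) + w x * gg (zt D1) x * gg (zt D2) x)))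
       (\<bar>- \<epsilon>\<bar> * (e + ((MC m * e * C + MC m * e * C) + MC m * (MC m * e * C) * C)))"
      by (intro Hs_cmult Hs_add Hs_mult w g)
    then have "Hs m (\<lambda>x. gg (zt D1) x - gg (zt D2) x) (\<bar>- \<epsilon>\<bar> * (e + ((MC m * e * C + MC m * e * C) + MC m * (MC m * e * C) * C)))"
    proof (rule Hs_cong)
      fix x assume x: "x \<in> Eb"
      have h: "ht D1 x > 0" "ht D2 x > 0" using Bd_height q x unfolding Q_def by blast+
      have "w x + ((w x * gg (zt D1) x + w x * gg (zt D2) x) + w x * gg (zt D1) x * gg (zt D2) x) = w x * (1 / ht D1 x * (1 / ht D2 x))"
        by (simp add: gg_def algebra_simps)
      moreover have "gg (zt D1) x - gg (zt D2) x = - (ht D1 x - ht D2 x) * (1 / ht D1 x * (1 / ht D2 x))"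
        using h by (simp add: gg_def field_simps)
      moreover have "ht D1 x - ht D2 x = \<epsilon> * w x" by (simp add: height_def w_def algebra_simps)
      ultimately show "(- \<epsilon>) * (w x + ((w x * gg (zt D1) x + w x * gg (zt D2) x) + w x * gg (zt D1) x * gg (zt D2) x)) = gg (zt D1) x - gg (zt D2) x"
        by simp
    qed
    moreover have "\<bar>- \<epsilon>\<bar> * (e + ((MC m * e * C + MC m * e * C) + MC m * (MC m * e * C) * C)) \<le> L * e"
      using mult_right_mono[OF L(2) e] by (simp add: algebra_simps)
    ultimately show "Hs m (gg (zt D1)) L \<and> Hs m (gg (zt D2)) L \<and> Hs m (\<lambda>x. gg (zt D1) x - gg (zt D2) x) (L * e)"
      using g Hs_mono L(1) by blast
  qed
qed

lemma Lp_phi: "Lp (\<lambda>D. phi \<epsilon> (zt D) (qu D))"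
proof (rule Lp_cong)
  show "Lp (\<lambda>D x. zt D x + ((\<epsilon> / 2) * (zt D x * zt D x) + (\<epsilon> * (qu D x * qu D x) + \<epsilon> * (qu D x * qu D x * gg (zt D) x))))"
    by (intro Lp_add Lp_cmult Lp_mult Lp_zt Lp_qu Lp_gg)
  fix N D x assume b: "Bd N D" "x \<in> Eb"
  have "ht D x \<noteq> 0" using Bd_height[OF b] by simp
  from phi_eq[OF this]
  show "zt D x + ((\<epsilon> / 2) * (zt D x * zt D x) + (\<epsilon> * (qu D x * qu D x) + \<epsilon> * (qu D x * qu D x * gg (zt D) x))) = phi \<epsilon> (zt D) (qu D) x" by simp
qed

definition phD :: "data \<Rightarrow> real \<Rightarrow> real" where "phD D = phi \<epsilon> (zt D) (qu D)"

text \<open>Linearity of the resolvent transfers the Lipschitz bound of phi. The supremum bounds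
  come from the Sobolev embedding.\<close>

lemma Lp_RU: "Lp (\<lambda>D. RU \<mu> (phD D))"
proof (rule LpI)
  fix N
  obtain L where "LB N L phD"
    using Lp_phi unfolding Lp_def phD_def[abs_def] by blast
  note L = LB_D[OF this]
  show "\<exists>L. LB N L (\<lambda>D. RU \<mu> (phD D))"
    unfolding LB_def
  proof (intro exI[of _ "CS * (CRk \<mu> m * L)"] allI impI)
    fix D1 D2 e assume q: "Q N e D1 D2"
    note l = L[OF q]
    have "Hb (Suc m) (RU \<mu> (phD D1)) (CRk \<mu> m * L)" "Hb (Suc m) (RU \<mu> (phD D2)) (CRk \<mu> m * L)"
      using RU_Hb[OF \<mu>] l Hs_D(1) by blast+
    moreover have "Hb (Suc m) (\<lambda>x. RU \<mu> (phD D1) x - RU \<mu> (phD D2) x) (CRk \<mu> m * (L * e))"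
      using RU_Hb_diff(1)[OF \<mu>] l Hs_D(1) by blast
    ultimately have "Hs (Suc m) (RU \<mu> (phD D1)) (CS * (CRk \<mu> m * L))" "Hs (Suc m) (RU \<mu> (phD D2)) (CS * (CRk \<mu> m * L))"
      "Hs (Suc m) (\<lambda>x. RU \<mu> (phD D1) x - RU \<mu> (phD D2) x) (CS * (CRk \<mu> m * (L * e)))" using Hb_imp_Hs by auto
    then show "Hs m (RU \<mu> (phD D1)) (CS * (CRk \<mu> m * L)) \<and> Hs m (RU \<mu> (phD D2)) (CS * (CRk \<mu> m * L)) \<and>
      Hs m (\<lambda>x. RU \<mu> (phD D1) x - RU \<mu> (phD D2) x) (CS * (CRk \<mu> m * L) * e)"
      using Hs_le[of "Suc m" _ _ m] by (simp add: mult.assoc)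
  qed
qed

lemma LsI: assumes "\<And>N. N \<ge> 1 \<Longrightarrow> \<exists>L. SB N L s"
  shows "Ls s"
  unfolding Ls_def
proof
  fix N
  show "\<exists>L. SB N L s"
    using assms Q_nonneg(2) unfolding SB_def by (cases "N \<ge> 1") blast+
qed

lemma Ls_eval: assumes "Lp f" "x \<in> Eb" shows "Ls (\<lambda>D. f D x)"
  unfolding Ls_def
proof
  fix N
  obtain L where "LB N L f"
    using assms(1) unfolding Lp_def by blast
  note L = LB_D[OF this]
  show "\<exists>L. SB N L (\<lambda>D. f D x)"
    unfolding SB_def by (intro exI[of _ L] allI impI) (use L assms(2) in \<open>auto simp: Hs_def\<close>)
qed

lemma Ls_const: "Ls (\<lambda>D. c)"
  unfolding Ls_def SB_def by (intro allI exI[of _ "\<bar>c\<bar>"]) (auto dest: Q_nonneg)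

lemma Ls_av: "Ls av"
  unfolding Ls_def
proof
  fix N
  show "\<exists>L. SB N L av"
    unfolding SB_def
  proof (intro exI[of _ N] allI impI)
    fix D1 D2 e assume q: "Q N e D1 D2"
    have "\<bar>av D1\<bar> \<le> N" "\<bar>av D2\<bar> \<le> N" "\<bar>av D1 - av D2\<bar> \<le> e" using q by (simp_all add: Q_def Bd_def)
    moreover have "e \<le> N * e" using mult_right_mono[OF Q_nonneg(2)[OF q] Q_nonneg(1)[OF q]] by simp
    ultimately show "\<bar>av D1\<bar> \<le> N \<and> \<bar>av D2\<bar> \<le> N \<and> \<bar>av D1 - av D2\<bar> \<le> N * e" by (intro conjI; linarith)
  qed
qed

lemma Ls_dv: "Ls dv"
  unfolding Ls_def
proof
  fix N
  show "\<exists>L. SB N L dv"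
    unfolding SB_def
  proof (intro exI[of _ N] allI impI)
    fix D1 D2 e assume q: "Q N e D1 D2"
    have "\<bar>dv D1\<bar> \<le> N" "\<bar>dv D2\<bar> \<le> N" "\<bar>dv D1 - dv D2\<bar> \<le> e" using q by (simp_all add: Q_def Bd_def)
    moreover have "e \<le> N * e" using mult_right_mono[OF Q_nonneg(2)[OF q] Q_nonneg(1)[OF q]] by simp
    ultimately show "\<bar>dv D1\<bar> \<le> N \<and> \<bar>dv D2\<bar> \<le> N \<and> \<bar>dv D1 - dv D2\<bar> \<le> N * e" by (intro conjI; linarith)
  qed
qed

lemma Ls_add: assumes "Ls s" "Ls t" shows "Ls (\<lambda>D. s D + t D)"
  unfolding Ls_def
proof
  fix N
  obtain L1 where "SB N L1 s" using assms(1) unfolding Ls_def by blast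
  note L1 = SB_D[OF this]
  obtain L2 where "SB N L2 t" using assms(2) unfolding Ls_def by blast
  note L2 = SB_D[OF this]
  show "\<exists>L. SB N L (\<lambda>D. s D + t D)"
    unfolding SB_def
  proof (intro exI[of _ "L1 + L2"] allI impI)
    fix D1 D2 e assume q: "Q N e D1 D2"
    show "\<bar>s D1 + t D1\<bar> \<le> L1 + L2 \<and> \<bar>s D2 + t D2\<bar> \<le> L1 + L2 \<and> \<bar>s D1 + t D1 - (s D2 + t D2)\<bar> \<le> (L1 + L2) * e"
      using L1[OF q] L2[OF q] by (auto simp: distrib_right abs_le_iff)
  qed
qed

lemma Ls_mult: assumes "Ls s" "Ls t" shows "Ls (\<lambda>D. s D * t D)"
  unfolding Ls_def
proof
  fix N
  obtain L1 where "SB N L1 s" using assms(1) unfolding Ls_def by blast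
  note L1 = SB_D[OF this]
  obtain L2 where "SB N L2 t" using assms(2) unfolding Ls_def by blast
  note L2 = SB_D[OF this]
  show "\<exists>L. SB N L (\<lambda>D. s D * t D)"
    unfolding SB_def
  proof (intro exI[of _ "2 * (L1 * L2)"] allI impI)
    fix D1 D2 e assume q: "Q N e D1 D2"
    have p: "L1 \<ge> 0" "L2 \<ge> 0" using L1[OF q] L2[OF q] by linarith+
    have b: "\<bar>s D1 * t D1\<bar> \<le> L1 * L2" "\<bar>s D2 * t D2\<bar> \<le> L1 * L2"
      using L1[OF q] L2[OF q] p by (auto simp: abs_mult intro!: mult_mono)
    have "s D1 * t D1 - s D2 * t D2 = (s D1 - s D2) * t D1 + s D2 * (t D1 - t D2)" by (simp add: algebra_simps)
    then have "\<bar>s D1 * t D1 - s D2 * t D2\<bar> \<le> \<bar>s D1 - s D2\<bar> * \<bar>t D1\<bar> + \<bar>s D2\<bar> * \<bar>t D1 - t D2\<bar>"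
      by (metis abs_mult abs_triangle_ineq)
    also have "\<dots> \<le> (L1 * e) * L2 + L1 * (L2 * e)"
      using L1[OF q] L2[OF q] p Q_nonneg(1)[OF q] by (intro add_mono mult_mono) auto
    finally have "\<bar>s D1 * t D1 - s D2 * t D2\<bar> \<le> 2 * (L1 * L2) * e" by (simp add: algebra_simps)
    then show "\<bar>s D1 * t D1\<bar> \<le> 2 * (L1 * L2) \<and> \<bar>s D2 * t D2\<bar> \<le> 2 * (L1 * L2) \<and> \<bar>s D1 * t D1 - s D2 * t D2\<bar> \<le> 2 * (L1 * L2) * e"
      using b mult_nonneg_nonneg[OF p] by auto
  qed
qed

lemma Ls_inverse: assumes "Ls s" "\<delta> > 0" "\<And>N D. Bd N D \<Longrightarrow> s D \<ge> \<delta>" shows "Ls (\<lambda>D. 1 / s D)"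
  unfolding Ls_def
proof
  fix N
  obtain L1 where "SB N L1 s" using assms(1) unfolding Ls_def by blast
  note L1 = SB_D[OF this]
  define L where "L = max (1 / \<delta>) (L1 * (1 / \<delta> * (1 / \<delta>)))"
  show "\<exists>L. SB N L (\<lambda>D. 1 / s D)"
    unfolding SB_def
  proof (intro exI[of _ L] allI impI)
    fix D1 D2 e assume q: "Q N e D1 D2"
    have s: "s D1 \<ge> \<delta>" "s D2 \<ge> \<delta>" using assms(3) q unfolding Q_def by blast+
    have i: "\<bar>1 / s D1\<bar> \<le> 1 / \<delta>" "\<bar>1 / s D2\<bar> \<le> 1 / \<delta>" using s assms(2) by (auto intro!: frac_le)
    have "1 / s D1 - 1 / s D2 = (s D2 - s D1) * (1 / s D1 * (1 / s D2))" using s assms(2) by (simp add: field_simps)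
    then have "\<bar>1 / s D1 - 1 / s D2\<bar> = \<bar>s D1 - s D2\<bar> * (\<bar>1 / s D1\<bar> * \<bar>1 / s D2\<bar>)" by (simp only: abs_mult abs_minus_commute)
    also have "\<dots> \<le> (L1 * e) * (1 / \<delta> * (1 / \<delta>))"
    proof (intro mult_mono i)
      show "\<bar>s D1 - s D2\<bar> \<le> L1 * e" using L1[OF q] by blast
      then show "0 \<le> L1 * e" by linarith
    qed (use assms(2) in auto)
    also have "\<dots> = L1 * (1 / \<delta> * (1 / \<delta>)) * e" by simp
    also have "\<dots> \<le> L * e" by (rule mult_right_mono[OF _ Q_nonneg(1)[OF q]]) (simp add: L_def)
    finally show "\<bar>1 / s D1\<bar> \<le> L \<and> \<bar>1 / s D2\<bar> \<le> L \<and> \<bar>1 / s D1 - 1 / s D2\<bar> \<le> L * e" using i by (auto simp: L_def)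
  qed
qed

section \<open>Averages over the bounded component\<close>

lemma average_eq: assumes "continuous_on {r..l} z" shows "average r l z = integral {r..l} z / (l - r)"
proof -
  have a: "z absolutely_integrable_on {r..l}" by (rule absolutely_integrable_continuous_real[OF assms])
  have "(LINT x:{r<..<l}|lebesgue. z x) = (LINT x:{r..l}|lebesgue. z x)"
    unfolding set_lebesgue_integral_def
  proof (rule integral_cong_AE)
    have "AE x in lebesgue. x \<notin> {r, l}" by (rule AE_I'[where N="{r, l}"]) (auto intro: finite_imp_null_set_lborel)
    then show "AE x in lebesgue. indicat_real {r<..<l} x *\<^sub>R z x = indicat_real {r..l} x *\<^sub>R z x"
      by eventually_elim (auto split: split_indicator)
    have "z absolutely_integrable_on {r<..<l}" by (rule set_integrable_subset[OF a]) auto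
    then show "(\<lambda>x. indicat_real {r<..<l} x *\<^sub>R z x) \<in> borel_measurable lebesgue" "(\<lambda>x. indicat_real {r..l} x *\<^sub>R z x) \<in> borel_measurable lebesgue"
      using a by (auto simp: set_integrable_def)
  qed
  then show ?thesis using set_lebesgue_integral_eq_integral(2)[OF a] by (simp add: average_def)
qed

lemma average_diff: assumes "continuous_on {r..l} z" "continuous_on {r..l} w"
  shows "average r l (\<lambda>x. z x - w x) = average r l z - average r l w"
  using average_eq[OF assms(1)] average_eq[OF assms(2)] average_eq[OF continuous_on_diff[OF assms]]
    Henstock_Kurzweil_Integration.integral_diff[OF integrable_continuous_interval[OF assms(1)] integrable_continuous_interval[OF assms(2)]]
  by (simp add: diff_divide_distrib)

lemma average_bound: assumes "continuous_on {r..l} z" "\<And>x. x \<in> {r..l} \<Longrightarrow> \<bar>z x\<bar> \<le> c"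
  shows "\<bar>average r l z\<bar> \<le> c"
proof -
  have "norm (integral {r..l} z) \<le> c * (l - r)"
    by (rule integral_bound) (use rl assms in auto)
  then show ?thesis unfolding average_eq[OF assms(1)] using rl by (simp add: field_simps)
qed

lemma Eb_rl: "{r..l} \<subseteq> Eb" by (auto simp: Eb_def)

lemma Hs_cont_rl: "Hb m f c \<Longrightarrow> continuous_on {r..l} f"
  using Hm_contB[of m f] m1 by (auto simp: Hm_def contB_def)

lemma Ls_average: "Ls (\<lambda>D. average r l (zt D))"
proof (rule LsI)
  fix N :: real assume N: "N \<ge> 1"
  show "\<exists>L. SB N L (\<lambda>D. average r l (zt D))"
    unfolding SB_def
  proof (intro exI[of _ N] allI impI)
    fix D1 D2 e assume q: "Q N e D1 D2"
    have h: "Hs m (zt D1) N" "Hs m (zt D2) N" "Hs m (\<lambda>x. zt D1 x - zt D2 x) e" using q by (auto simp: Q_def Bd_def)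
    note c = Hs_cont_rl[OF Hs_D(1)[OF h(1)]] Hs_cont_rl[OF Hs_D(1)[OF h(2)]] Hs_cont_rl[OF Hs_D(1)[OF h(3)]]
    have b: "\<bar>average r l (zt D1)\<bar> \<le> N" "\<bar>average r l (zt D2)\<bar> \<le> N" "\<bar>average r l (\<lambda>x. zt D1 x - zt D2 x)\<bar> \<le> e"
      by (rule average_bound, use c h Hs_D(2) Eb_rl in blast, use h Hs_D(2) Eb_rl in blast)+
    note average_diff[OF c(1,2)]
    moreover have "e \<le> N * e" using mult_right_mono[OF N Q_nonneg(1)[OF q]] by simp
    ultimately show "\<bar>average r l (zt D1)\<bar> \<le> N \<and> \<bar>average r l (zt D2)\<bar> \<le> N \<and> \<bar>average r l (zt D1) - average r l (zt D2)\<bar> \<le> N * e"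
      using b by simp
  qed
qed

section \<open>The acceleration of the interior discharge\<close>

definition iv :: "(real \<Rightarrow> real) \<Rightarrow> real \<Rightarrow> real" where "iv z x = 1 / height \<epsilon> z x"

definition den :: "data \<Rightarrow> real" where
  "den D = 2 * r / hw + \<mu> * (C1_coeff r l \<mu> * ((iv (zt D) r + iv (zt D) (-r)) / 2) + C2_coeff r l \<mu> * (iv (zt D) r - iv (zt D) (-r)))"

definition FF :: "data \<Rightarrow> real \<Rightarrow> real" where
  "FF D x = iv (zt D) x * (\<epsilon> * (zt D x)\<^sup>2 / 2 + RU \<mu> (phD D) x)"

text \<open>The right side of the transmission condition solved for the term with dq_i/dt; the
  memory integral is replaced by the unknown \<open>dv\<close>.\<close>

definition num :: "data \<Rightarrow> real" where
  "num D = \<epsilon> / 2 * ((iv (zt D) r)\<^sup>2 - (iv (zt D) (-r))\<^sup>2) * (av D)\<^sup>2 - (FF D r - FF D (-r)) - P0 * (average r l (zt D) - \<kappa> * dv D)"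

definition cc :: "data \<Rightarrow> real" where "cc D = num D * (1 / den D)"

text \<open>With s = (l - r)/\<mu>, the hyperbolic coefficients combine so that the bracket added to
  \<alpha> is \<mu> (coth(s) / h(r) + 1 / h(-r)), visibly nonnegative. It equals - \<mu>^2 times the
  jump of \<open>ed\<close> / h, the contribution of the lifting \<open>ef\<close> of the boundary
  values.\<close>

lemma den_ge: assumes "iv (zt D) r \<ge> 0" "iv (zt D) (-r) \<ge> 0" shows "den D \<ge> 2 * r / hw"
proof -
  define s where "s = (l - r) / \<mu>"
  have s: "s > 0" using rl \<mu> by (simp add: s_def)
  have sh: "sinh s > 0" using s by simp
  have e1: "C1_coeff r l \<mu> / 2 + C2_coeff r l \<mu> \<ge> 0"
    using sh by (simp add: C1_coeff_def C2_coeff_def s_def[symmetric])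
  have e2: "C1_coeff r l \<mu> / 2 - C2_coeff r l \<mu> = 1"
    using sh by (simp add: C1_coeff_def C2_coeff_def s_def[symmetric] diff_divide_distrib[symmetric] sinh_field_def field_simps)
  have "C1_coeff r l \<mu> * ((iv (zt D) r + iv (zt D) (-r)) / 2) + C2_coeff r l \<mu> * (iv (zt D) r - iv (zt D) (-r))
    = (C1_coeff r l \<mu> / 2 + C2_coeff r l \<mu>) * iv (zt D) r + (C1_coeff r l \<mu> / 2 - C2_coeff r l \<mu>) * iv (zt D) (-r)"
    by (simp add: algebra_simps)
  also have "\<dots> \<ge> 0" unfolding e2 using e1 assms by simp
  finally show ?thesis using \<mu> by (simp add: den_def)
qed

lemma \<alpha>_pos: "2 * r / hw > 0" using r0 hw by simp

lemma Ls_iv: "x \<in> Eb \<Longrightarrow> Ls (\<lambda>D. iv (zt D) x)"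
  using Ls_add[OF Ls_eval[OF Lp_gg] Ls_const[of 1]] by (simp add: gg_def iv_def)

lemma Ls_den: "Ls den"
proof -
  have "Ls (\<lambda>D. 2 * r / hw + \<mu> * (C1_coeff r l \<mu> * ((1 / 2) * (iv (zt D) r + iv (zt D) (-r))) + C2_coeff r l \<mu> * (iv (zt D) r + (-1) * iv (zt D) (-r))))"
    using bdry_Eb by (intro Ls_add Ls_mult Ls_const Ls_iv)
  then show ?thesis by (simp add: den_def[abs_def])
qed

lemma Ls_FF: assumes "x \<in> Eb" shows "Ls (\<lambda>D. FF D x)"
proof -
  have "Ls (\<lambda>D. iv (zt D) x * ((\<epsilon> / 2) * (zt D x * zt D x) + RU \<mu> (phD D) x))"
    by (intro Ls_mult Ls_add Ls_iv Ls_const Ls_eval[OF Lp_zt] Ls_eval[OF Lp_RU] assms)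
  then show ?thesis by (simp add: FF_def power2_eq_square)
qed

lemma Ls_num: "Ls num"
proof -
  have "Ls (\<lambda>D. (\<epsilon> / 2) * ((iv (zt D) r * iv (zt D) r + (-1) * (iv (zt D) (-r) * iv (zt D) (-r))) * (av D * av D))
     + ((-1) * (FF D r + (-1) * FF D (-r)) + (- P0) * (average r l (zt D) + (- \<kappa>) * dv D)))"
    using bdry_Eb by (intro Ls_mult Ls_add Ls_iv Ls_const Ls_FF Ls_average Ls_av Ls_dv)
  then show ?thesis by (simp add: num_def[abs_def] power2_eq_square algebra_simps)
qed

lemma Ls_cc: "Ls cc"
  unfolding cc_def[abs_def]
proof (intro Ls_mult Ls_num Ls_inverse[OF Ls_den \<alpha>_pos])
  fix N D assume "Bd N D"
  then have "ht D r > 0" "ht D (-r) > 0" using Bd_height bdry_Eb by blast+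
  then show "den D \<ge> 2 * r / hw" by (intro den_ge) (auto simp: iv_def)
qed

text \<open>The time derivative of \<open>q\<close>: a particular solution of the momentum equation with vanishing traces,
  corrected by the homogeneous solution with trace \<open>dq\<^sub>i/dt\<close> at \<open>\<plusminus>r\<close>.\<close>

definition Fq :: "data \<Rightarrow> real \<Rightarrow> real" where
  "Fq D x = (-1) * RW \<mu> (phD D) x + cc D * ef \<mu> x"

text \<open>All nontrivial components of the vector field estimated at once. The bound for
  \<open>Fq\<close> is one order above that of zeta because phi enters through
  \<open>RW\<close>.\<close>

lemma Fq_Lipschitz:
  "\<exists>L\<ge>0. \<forall>D1 D2 e. Q N e D1 D2 \<longrightarrow> Hb (Suc m) (Fq D1) L \<and> Hb (Suc m) (\<lambda>x. Fq D1 x - Fq D2 x) (L * e) \<and>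
     \<bar>cc D1\<bar> \<le> L \<and> \<bar>cc D1 - cc D2\<bar> \<le> L * e \<and> \<bar>average r l (zt D1)\<bar> \<le> L \<and> \<bar>average r l (zt D1) - average r l (zt D2)\<bar> \<le> L * e"
proof -
  obtain L1 where "LB N L1 phD"
    using Lp_phi unfolding Lp_def phD_def[abs_def] by blast
  note L1 = LB_D[OF this]
  obtain L2 where "SB N L2 cc" using Ls_cc unfolding Ls_def by blast
  note L2 = SB_D[OF this]
  obtain L3 where "SB N L3 (\<lambda>D. average r l (zt D))"
    using Ls_average unfolding Ls_def by blast
  note L3 = SB_D[OF this]
  obtain c where c: "Hb (Suc m) (ef \<mu>) c" using ef_props(3)[OF \<mu>, of "Suc m"] by (auto simp: Hm_def simp del: Hb.simps)
  have c0: "c \<ge> 0" by (rule Hb_nonneg[OF c])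
  define L where "L = \<bar>CRk \<mu> m * L1\<bar> + \<bar>L2\<bar> * c + \<bar>L2\<bar> + \<bar>L3\<bar>"
  have L: "CRk \<mu> m * L1 + \<bar>L2\<bar> * c \<le> L" "L2 \<le> L" "L3 \<le> L" "L \<ge> 0" using c0 by (auto simp: L_def add_increasing add_increasing2 intro: order_trans[OF abs_ge_self])
  show ?thesis
  proof (intro exI[of _ L] conjI allI impI)
    show "0 \<le> L" by (rule L)
    fix D1 D2 e assume q: "Q N e D1 D2"
    have e: "e \<ge> 0" by (rule Q_nonneg[OF q])
    note l1 = L1[OF q] and l2 = L2[OF q] and l3 = L3[OF q]
    have "Hb (Suc m) (RW \<mu> (phD D1)) (CRk \<mu> m * L1)" using RU_Hb[OF \<mu>] l1 Hs_D(1) by blast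
    from Hb_add[OF Hb_cmult[OF this, of "-1"] Hb_cmult[OF c, of "cc D1"]]
    have "Hb (Suc m) (Fq D1) (CRk \<mu> m * L1 + \<bar>cc D1\<bar> * c)" unfolding Fq_def[abs_def] by simp
    then show "Hb (Suc m) (Fq D1) L"
      by (rule Hb_mono) (use L(1) l2 mult_right_mono[of "\<bar>cc D1\<bar>" "\<bar>L2\<bar>" c] c0 in linarith)
    have "Hb (Suc m) (\<lambda>x. RW \<mu> (phD D1) x - RW \<mu> (phD D2) x) (CRk \<mu> m * (L1 * e))" using RU_Hb_diff(2)[OF \<mu>] l1 Hs_D(1) by blast
    from Hb_add[OF Hb_cmult[OF this, of "-1"] Hb_cmult[OF c, of "cc D1 - cc D2"]]
    have "Hb (Suc m) (\<lambda>x. (-1) * (RW \<mu> (phD D1) x - RW \<mu> (phD D2) x) + (cc D1 - cc D2) * ef \<mu> x) (CRk \<mu> m * (L1 * e) + \<bar>cc D1 - cc D2\<bar> * c)" by simp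
    moreover have "CRk \<mu> m * (L1 * e) + \<bar>cc D1 - cc D2\<bar> * c \<le> L * e"
    proof -
      have "L2 * e \<le> \<bar>L2\<bar> * e" using e by (intro mult_right_mono) auto
      then have "\<bar>cc D1 - cc D2\<bar> * c \<le> (\<bar>L2\<bar> * e) * c" using l2 c0 by (intro mult_right_mono) auto
      then show ?thesis using mult_right_mono[OF L(1) e] by (simp add: algebra_simps)
    qed
    ultimately have "Hb (Suc m) (\<lambda>x. (-1) * (RW \<mu> (phD D1) x - RW \<mu> (phD D2) x) + (cc D1 - cc D2) * ef \<mu> x) (L * e)" by (rule Hb_mono)
    then show "Hb (Suc m) (\<lambda>x. Fq D1 x - Fq D2 x) (L * e)"
      by (rule Hb_cong) (simp add: Fq_def algebra_simps)
    show "\<bar>cc D1\<bar> \<le> L" "\<bar>average r l (zt D1)\<bar> \<le> L" using l2 l3 L by auto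
    show "\<bar>cc D1 - cc D2\<bar> \<le> L * e" "\<bar>average r l (zt D1) - average r l (zt D2)\<bar> \<le> L * e"
      using l2 l3 mult_right_mono[OF L(2) e] mult_right_mono[OF L(3) e] by auto
  qed
qed

end

section \<open>Tame bounds\<close>

lemma linear_growth_le:
  assumes "a \<ge> 0" "b \<ge> 0" "T \<ge> (0::real)" shows "a * T + b \<le> (a + b) * (1 + T)"
  using assms mult_nonneg_nonneg[of b T] by (simp add: algebra_simps)

lemma abs_mult_le: "\<bar>c\<bar> \<le> 1 \<Longrightarrow> x \<ge> 0 \<Longrightarrow> \<bar>c\<bar> * x \<le> (x::real)"
  using mult_right_mono[of "\<bar>c\<bar>" 1 x] by simp

context prob
begin

lemma Hb0_mult: assumes "Hb 0 f a" "sqi (ext g)" "\<And>x. x \<in> Eb \<Longrightarrow> \<bar>g x\<bar> \<le> b" "b \<ge> 0"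
  shows "Hb 0 (\<lambda>x. f x * g x) (b * a)"
proof -
  note f = Hb_0D[OF assms(1)]
  have "\<bar>g x\<bar> \<le> b" if "x \<in> E" for x using assms(3)[OF subsetD[OF E_Eb that]] .
  note n = nE_mult[OF f(1) assms(2) this]
  have "nE (\<lambda>x. f x * g x) \<le> b * a" by (rule order_trans[OF n(2) mult_left_mono[OF f(2) assms(4)]])
  then show ?thesis using n(1) by simp
qed

lemma Hb_phD:
  assumes H: "Hb k (zt D) T" "Hb k (\<lambda>x. zt D x * zt D x) X" "Hb k (\<lambda>x. qu D x * qu D x) Y"
      "Hb k (\<lambda>x. qu D x * qu D x * gg (zt D) x) Z"
    and h: "A \<ge> 1" "\<And>x. x \<in> Eb \<Longrightarrow> ht D x \<ge> 1 / A"
  shows "Hb k (phD D) (T + (X + (Y + Z)))"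
proof -
  let ?e = "\<lambda>x. zt D x + ((\<epsilon> / 2) * (zt D x * zt D x) + (\<epsilon> * (qu D x * qu D x) + \<epsilon> * (qu D x * qu D x * gg (zt D) x)))"
  have "Hb k ?e (T + (\<bar>\<epsilon> / 2\<bar> * X + (\<bar>\<epsilon>\<bar> * Y + \<bar>\<epsilon>\<bar> * Z)))"
    by (intro Hb_add Hb_cmult H)
  moreover have "\<bar>\<epsilon> / 2\<bar> * X \<le> X" "\<bar>\<epsilon>\<bar> * Y \<le> Y" "\<bar>\<epsilon>\<bar> * Z \<le> Z"
    using \<epsilon> H(2-4)[THEN Hb_nonneg] by (intro abs_mult_le; simp)+
  then have "T + (\<bar>\<epsilon> / 2\<bar> * X + (\<bar>\<epsilon>\<bar> * Y + \<bar>\<epsilon>\<bar> * Z)) \<le> T + (X + (Y + Z))" by linarith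
  ultimately have "Hb k ?e (T + (X + (Y + Z)))" by (rule Hb_mono)
  then show ?thesis
  proof (rule Hb_cong)
    fix x assume x: "x \<in> Eb"
    have "1 / A > 0" using h(1) by simp
    then have "ht D x \<noteq> 0" using h(2)[OF x] by linarith
    from phi_eq[OF this, of "qu D"] show "?e x = phD D x" by (simp add: phD_def)
  qed
qed

text \<open>Start of the hierarchy: in L2 each product is estimated by the supremum of all factors
  but one, so the bound is linear in \<open>T\<close>.\<close>

lemma phi_tame_0:
  assumes A: "A \<ge> 1" and z: "Hb 0 (zt D) T" and q: "Hb 0 (qu D) T"
    and s: "\<And>x. x \<in> Eb \<Longrightarrow> \<bar>zt D x\<bar> \<le> A" "\<And>x. x \<in> Eb \<Longrightarrow> \<bar>qu D x\<bar> \<le> A" "\<And>x. x \<in> Eb \<Longrightarrow> ht D x \<ge> 1 / A"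
  shows "Hb 0 (phD D) ((1 + 2 * A + A * A) * (1 + T))"
proof -
  have T: "T \<ge> 0" by (rule Hb_nonneg[OF z])
  have A0: "A \<ge> 0" using A by simp
  have g: "sqi (ext (gg (zt D)))" "\<And>x. x \<in> Eb \<Longrightarrow> \<bar>gg (zt D) x\<bar> \<le> A"
    using gg_Hb0[OF z s(3) A] gg_sup[OF _ s(3) A] by auto
  have qq: "Hb 0 (\<lambda>x. qu D x * qu D x) (A * T)" using Hb0_mult[OF q Hb_0D(1)[OF q] s(2) A0] .
  have zz: "Hb 0 (\<lambda>x. zt D x * zt D x) (A * T)" using Hb0_mult[OF z Hb_0D(1)[OF z] s(1) A0] .
  have qqg: "Hb 0 (\<lambda>x. qu D x * qu D x * gg (zt D) x) (A * (A * T))" using Hb0_mult[OF qq g A0] .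
  have "(1 + 2 * A + A * A) * T + 0 \<le> (1 + 2 * A + A * A + 0) * (1 + T)"
    by (rule linear_growth_le) (use A0 T in auto)
  then have "T + (A * T + (A * T + A * (A * T))) \<le> (1 + 2 * A + A * A) * (1 + T)" by (simp add: algebra_simps)
  with Hb_phD[OF z zz qq qqg A s(3)] show ?thesis by (rule Hb_mono)
qed

text \<open>Norms of order k and suprema are absorbed into the constant; by
  \<open>Hb_mult_tame\<close> and \<open>gg_step\<close> the norm of order k+1 enters only to the
  first power.\<close>

lemma phi_tame_Suc:
  assumes A: "A \<ge> 1"
  shows "\<exists>C\<ge>0. \<forall>D T. Hs k (zt D) A \<longrightarrow> Hs k (qu D) A \<longrightarrow> (\<forall>x\<in>Eb. ht D x \<ge> 1 / A) \<longrightarrow>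
     Hb (Suc k) (zt D) T \<longrightarrow> Hb (Suc k) (qu D) T \<longrightarrow> Hb (Suc k) (phD D) (C * (1 + T))"
proof -
  obtain C1 where C1: "C1 \<ge> 1" "\<And>z. Hs k z A \<Longrightarrow> (\<forall>x\<in>Eb. height \<epsilon> z x \<ge> 1 / A) \<Longrightarrow> Hs k (gg z) C1" using gg_Hs[OF A, of k] by blast
  define B where "B = max A C1"
  have B: "B \<ge> 1" "A \<le> B" "C1 \<le> B" using A by (auto simp: B_def)
  obtain C2 where C2: "C2 \<ge> 0" "\<And>z T. Hs k (gg z) B \<Longrightarrow> (\<forall>x\<in>Eb. height \<epsilon> z x \<ge> 1 / B) \<Longrightarrow> Hb (Suc k) z T \<Longrightarrow> Hb (Suc k) (gg z) (B + C2 * T)"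
    using gg_step[OF B(1), of k] by blast
  define M where "M = MC k"
  have M: "M \<ge> 0" using MC_ge[of k] by (simp add: M_def)
  have B0: "B \<ge> 0" using B by simp
  \<comment> \<open>The coefficient of \<open>T\<close> and, next, the constant term obtained by
    adding the bounds of the four terms of phi.\<close>
  define a where "a = 1 + 4 * (M * B) + 2 * (M * (M * B) * B) + M * C2 * (M * B * B)"
  define b where "b = M * B * (M * B * B)"
  have ab: "a \<ge> 0" "b \<ge> 0" using M B0 C2(1) by (auto simp: a_def b_def)
  show ?thesis
  proof (intro exI[of _ "a + b"] conjI allI impI)
    show "0 \<le> a + b" using ab by simp
    fix D T assume z: "Hs k (zt D) A" and q: "Hs k (qu D) A" and h: "\<forall>x\<in>Eb. ht D x \<ge> 1 / A"
      and zT: "Hb (Suc k) (zt D) T" and qT: "Hb (Suc k) (qu D) T"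
    have T: "T \<ge> 0" by (rule Hb_nonneg[OF zT])
    have z': "Hs k (zt D) B" and q': "Hs k (qu D) B" using z q Hs_mono B by blast+
    have g: "Hs k (gg (zt D)) B" using Hs_mono[OF C1(2)[OF z h] B(3)] .
    have h': "\<forall>x\<in>Eb. ht D x \<ge> 1 / B"
    proof
      fix x assume "x \<in> Eb"
      have "1 / B \<le> 1 / A" using B A by (intro frac_le) auto
      then show "ht D x \<ge> 1 / B" using h \<open>x \<in> Eb\<close> by force
    qed
    have gT: "Hb (Suc k) (gg (zt D)) (B + C2 * T)" by (rule C2(2)[OF g h' zT])
    have zz: "Hb (Suc k) (\<lambda>x. zt D x * zt D x) (M * (T * B + T * B))" unfolding M_def by (rule Hb_mult_tame[OF z' zT z' zT])
    have qq: "Hb (Suc k) (\<lambda>x. qu D x * qu D x) (M * (T * B + T * B))" unfolding M_def by (rule Hb_mult_tame[OF q' qT q' qT])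
    have qqs: "Hs k (\<lambda>x. qu D x * qu D x) (M * B * B)" unfolding M_def by (rule Hs_mult[OF q' q'])
    have qqg: "Hb (Suc k) (\<lambda>x. qu D x * qu D x * gg (zt D) x) (M * ((M * (T * B + T * B)) * B + (B + C2 * T) * (M * B * B)))"
      unfolding M_def by (rule Hb_mult_tame[OF qqs[unfolded M_def] qq[unfolded M_def] g gT])
    let ?X = "M * (T * B + T * B)" and ?Y = "M * ((M * (T * B + T * B)) * B + (B + C2 * T) * (M * B * B))"
    have "T + (?X + (?X + ?Y)) = a * T + b" by (simp add: a_def b_def algebra_simps)
    then have le: "T + (?X + (?X + ?Y)) \<le> (a + b) * (1 + T)" using linear_growth_le[OF ab T] by simp
    show "Hb (Suc k) (phD D) ((a + b) * (1 + T))"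
      by (rule Hb_mono[OF Hb_phD[OF zT zz qq qqg A h[rule_format]] le])
  qed
qed

text \<open>The traces of R_1 phi are controlled by its H^1 norm, hence by the L2 norm of phi, so
  the bound is linear in that norm and in the memory term. The lower bound \<alpha> of the
  denominator makes it independent of how large 1/h is there.\<close>

lemma cc_bound:
  assumes A: "A \<ge> 1"
  shows "\<exists>C\<ge>0. \<forall>D T. contB (zt D) \<longrightarrow> (\<forall>x\<in>Eb. \<bar>zt D x\<bar> \<le> A) \<longrightarrow> (\<forall>x\<in>Eb. ht D x \<ge> 1 / A) \<longrightarrow> \<bar>av D\<bar> \<le> A \<longrightarrow>
    Hb 0 (phD D) T \<longrightarrow> \<bar>cc D\<bar> \<le> C * (1 + T + \<bar>dv D\<bar>)"
proof -
  define R where "R = CS * CRk \<mu> 0"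
  have R: "R \<ge> 0" using CS_ge CRk_nonneg[OF \<mu>, of 0] by (simp add: R_def)
  \<comment> \<open>The three summands bound the quadratic term in q_i, the jump of F and the
    pressure term with coefficient \<open>P0\<close>.\<close>
  define K where "K = A\<^sup>2 * A\<^sup>2 + 2 * (A * (A\<^sup>2 + R)) + P0 * (A + \<kappa>)"
  have K: "K \<ge> 0" using A R P0 \<kappa> by (simp add: K_def)
  define C where "C = K * (1 / (2 * r / hw))"
  show ?thesis
  proof (intro exI[of _ C] conjI allI impI)
    show "C \<ge> 0" unfolding C_def by (intro mult_nonneg_nonneg K divide_nonneg_pos \<alpha>_pos) simp
    fix D T assume cz: "contB (zt D)" and z: "\<forall>x\<in>Eb. \<bar>zt D x\<bar> \<le> A" and h: "\<forall>x\<in>Eb. ht D x \<ge> 1 / A" and a: "\<bar>av D\<bar> \<le> A"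
      and \<phi>: "Hb 0 (phD D) T"
    have T: "T \<ge> 0" by (rule Hb_nonneg[OF \<phi>])
    have A0: "A > 0" using A by simp
    have iv: "0 \<le> iv (zt D) x" "iv (zt D) x \<le> A" if "x \<in> Eb" for x
    proof -
      have "1 / A > 0" using A by simp
      moreover have ge: "ht D x \<ge> 1 / A" using h that by blast
      ultimately have "ht D x > 0" by linarith
      with ge have "ht D x > 0" "ht D x \<ge> 1 / A" by auto
      then show "0 \<le> iv (zt D) x" "iv (zt D) x \<le> A" using A0 by (auto simp: iv_def field_simps)
    qed
    have RU: "\<bar>RU \<mu> (phD D) x\<bar> \<le> R * T" if "x \<in> Eb" for x
      using Hb_sup[of "Suc 0" "RU \<mu> (phD D)" "CRk \<mu> 0 * T" x] RU_Hb[OF \<mu> \<phi>] that by (simp add: R_def del: Hb.simps CRk.simps)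
    have FF: "\<bar>FF D x\<bar> \<le> A * (A\<^sup>2 + R * T)" if x: "x \<in> Eb" for x
    proof -
      have "(zt D x)\<^sup>2 \<le> A\<^sup>2" using z x A0 by (simp add: abs_le_square_iff[symmetric])
      then have "\<bar>\<epsilon> * (zt D x)\<^sup>2 / 2\<bar> \<le> A\<^sup>2" using \<epsilon> mult_mono[of \<epsilon> 1 "(zt D x)\<^sup>2" "A\<^sup>2"] zero_le_power2[of A] by (simp, linarith)
      then have "\<bar>\<epsilon> * (zt D x)\<^sup>2 / 2 + RU \<mu> (phD D) x\<bar> \<le> A\<^sup>2 + R * T" using RU[OF x] by linarith
      then show ?thesis unfolding FF_def abs_mult using iv[OF x] A0 by (intro mult_mono) auto
    qed
    have av: "\<bar>average r l (zt D)\<bar> \<le> A"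
      by (rule average_bound) (use cz z Eb_rl in \<open>auto simp: contB_def\<close>)
    have t1: "\<bar>\<epsilon> / 2 * ((iv (zt D) r)\<^sup>2 - (iv (zt D) (-r))\<^sup>2) * (av D)\<^sup>2\<bar> \<le> A\<^sup>2 * A\<^sup>2"
    proof -
      have i2: "0 \<le> (iv (zt D) x)\<^sup>2" "(iv (zt D) x)\<^sup>2 \<le> A\<^sup>2" if "x \<in> Eb" for x using iv[OF that] by (auto intro: power_mono)
      have d: "\<bar>(iv (zt D) r)\<^sup>2 - (iv (zt D) (-r))\<^sup>2\<bar> \<le> A\<^sup>2" using i2[OF bdry_Eb(1)] i2[OF bdry_Eb(2)] by linarith
      have a2: "(av D)\<^sup>2 \<le> A\<^sup>2" using a A0 by (simp add: abs_le_square_iff[symmetric])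
      have "\<bar>\<epsilon> / 2\<bar> * \<bar>(iv (zt D) r)\<^sup>2 - (iv (zt D) (-r))\<^sup>2\<bar> * \<bar>(av D)\<^sup>2\<bar> \<le> 1 * A\<^sup>2 * A\<^sup>2"
        using \<epsilon> d a2 by (intro mult_mono) auto
      then show ?thesis by (simp add: abs_mult)
    qed
    have t3: "\<bar>P0 * (average r l (zt D) - \<kappa> * dv D)\<bar> \<le> P0 * (A + \<kappa> * \<bar>dv D\<bar>)"
    proof -
      have "\<bar>average r l (zt D) - \<kappa> * dv D\<bar> \<le> A + \<kappa> * \<bar>dv D\<bar>" using av abs_mult[of \<kappa> "dv D"] \<kappa> by linarith
      then show ?thesis using P0 by (simp add: abs_mult)
    qed
    have "\<bar>num D\<bar> \<le> A\<^sup>2 * A\<^sup>2 + 2 * (A * (A\<^sup>2 + R * T)) + P0 * (A + \<kappa> * \<bar>dv D\<bar>)"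
      unfolding num_def using t1 t3 FF[OF bdry_Eb(1)] FF[OF bdry_Eb(2)] by linarith
    also have "\<dots> \<le> K * (1 + T + \<bar>dv D\<bar>)"
    proof -
      have "0 \<le> A\<^sup>2 * A\<^sup>2 * (T + \<bar>dv D\<bar>)" "0 \<le> 2 * A * A\<^sup>2 * (T + \<bar>dv D\<bar>)" "0 \<le> 2 * A * R * (1 + \<bar>dv D\<bar>)" "0 \<le> P0 * A * (T + \<bar>dv D\<bar>)" "0 \<le> P0 * \<kappa> * (1 + T)"
        using A0 R T P0 \<kappa> by auto
      then show ?thesis by (simp add: K_def algebra_simps)
    qed
    finally have n: "\<bar>num D\<bar> \<le> K * (1 + T + \<bar>dv D\<bar>)" .
    have "den D \<ge> 2 * r / hw" by (rule den_ge) (use iv bdry_Eb in auto)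
    moreover from this have "den D > 0" using \<alpha>_pos by linarith
    ultimately have "\<bar>1 / den D\<bar> \<le> 1 / (2 * r / hw)" using frac_le[of 1 1 "2 * r / hw" "den D"] \<alpha>_pos by simp
    then have "\<bar>cc D\<bar> \<le> (K * (1 + T + \<bar>dv D\<bar>)) * (1 / (2 * r / hw))"
      unfolding cc_def abs_mult using n K T \<alpha>_pos by (intro mult_mono) auto
    then show "\<bar>cc D\<bar> \<le> C * (1 + T + \<bar>dv D\<bar>)" by (simp only: C_def ac_simps)
  qed
qed

end

section \<open>The evolution equation\<close>

lemma nat_bcontfun: "bounded (range (f :: nat \<Rightarrow> l2)) \<Longrightarrow> f \<in> bcontfun"
  by (auto simp: bcontfun_def)

text \<open>Differentiation in space acts on jets as an index shift, hence as a bounded operator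
  from order k+1 to order k.\<close>

definition shift :: "(nat \<Rightarrow>\<^sub>C l2) \<Rightarrow> (nat \<Rightarrow>\<^sub>C l2)" where
  "shift U = Bcontfun (\<lambda>k. apply_bcontfun U (Suc k))"

lemma shift_apply: "apply_bcontfun (shift U) k = apply_bcontfun U (Suc k)"
proof -
  have "(\<lambda>k. apply_bcontfun U (Suc k)) \<in> bcontfun"
    by (intro nat_bcontfun boundedI[of _ "norm U"]) (auto intro: norm_bounded)
  then show ?thesis unfolding shift_def by (subst Bcontfun_inverse) auto
qed

text \<open>The inclusion of a Sobolev space of high order into one of lower order, seen on
  jets.\<close>

definition trunc :: "nat \<Rightarrow> (nat \<Rightarrow>\<^sub>C l2) \<Rightarrow> (nat \<Rightarrow>\<^sub>C l2)" where
  "trunc n U = Bcontfun (\<lambda>k. if k \<le> n then apply_bcontfun U k else 0)"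

lemma trunc_apply: "apply_bcontfun (trunc n U) k = (if k \<le> n then apply_bcontfun U k else 0)"
  unfolding trunc_def by (subst Bcontfun_inverse[OF finite_support_bcontfun]) simp

lemma bounded_linear_shift: "bounded_linear shift"
proof (rule bounded_linear_intro[of _ 1])
  show "shift (U + V) = shift U + shift V" "shift (c *\<^sub>R U) = c *\<^sub>R shift U" for U V c
    by (rule bcontfun_eqI, simp add: shift_apply)+
  show "norm (shift U) \<le> norm U * 1" for U
    by (simp add: norm_bound norm_bounded shift_apply)
qed

lemma bounded_linear_trunc: "bounded_linear (trunc n)"
proof (rule bounded_linear_intro[of _ 1])
  show "trunc n (U + V) = trunc n U + trunc n V" "trunc n (c *\<^sub>R U) = c *\<^sub>R trunc n U" for U V c
    by (rule bcontfun_eqI, simp add: trunc_apply)+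
  show "norm (trunc n U) \<le> norm U * 1" for U
    by (simp add: norm_bound norm_bounded trunc_apply)
qed

lemma norm_shift: "norm (shift U) \<le> norm U"
  by (rule norm_bound) (simp add: shift_apply norm_bounded)

lemma norm_trunc_shift: "norm (trunc k (shift U)) \<le> norm (trunc (Suc k) U)"
proof (rule norm_bound)
  fix j
  show "norm (apply_bcontfun (trunc k (shift U)) j) \<le> norm (trunc (Suc k) U)"
    using norm_bounded[of "trunc (Suc k) U" "Suc j"] by (cases "j \<le> k") (simp_all add: trunc_apply shift_apply)
qed

text \<open>A qualitative Gronwall lemma by finitely many time steps. On a step the increment up to
  a maximum of the norm is at most half of 1 plus that maximum, so a bound B at the start becomes at
  most 2 B + 1.\<close>

lemma gronwall_bounded:
  fixes y :: "real \<Rightarrow> 'b::real_normed_vector"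
  assumes d: "\<And>t. t \<in> {a..<b} \<Longrightarrow> (y has_vector_derivative y' t) (at t within {a..<b})"
    and le: "\<And>t. t \<in> {a..<b} \<Longrightarrow> norm (y' t) \<le> C * (1 + norm (y t))" and C: "C > 0"
  shows "\<exists>B. \<forall>t\<in>{a..<b}. norm (y t) \<le> B"
proof -
  \<comment> \<open>The step length for which \<open>C\<close> times the step is 1/2; it does not
    depend on the bound reached so far.\<close>
  define \<eta> where "\<eta> = 1 / (2 * C)"
  have \<eta>: "\<eta> > 0" "C * \<eta> = 1 / 2" using C by (auto simp: \<eta>_def)
  have cont: "continuous_on {a..<b} y"
    unfolding continuous_on_eq_continuous_within using d has_vector_derivative_continuous by blast
  have "\<exists>B. \<forall>t\<in>{a..<b}. t \<le> a + real n * \<eta> \<longrightarrow> norm (y t) \<le> B" for n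
  proof (induction n)
    case 0
    show ?case by (intro exI[of _ "norm (y a)"]) auto
  next
    case (Suc n)
    then obtain B where B: "\<And>t. t \<in> {a..<b} \<Longrightarrow> t \<le> a + real n * \<eta> \<Longrightarrow> norm (y t) \<le> B" by blast
    define s where "s = a + real n * \<eta>"
    have s: "a \<le> s" using \<eta> by (simp add: s_def)
    show ?case
    proof (intro exI[of _ "max B (2 * B + 1)"] ballI impI)
      fix t assume t: "t \<in> {a..<b}" "t \<le> a + real (Suc n) * \<eta>"
      show "norm (y t) \<le> max B (2 * B + 1)"
      proof (cases "t \<le> s")
        case True
        then show ?thesis using B t by (auto simp: s_def intro: le_max_iff_disj[THEN iffD2])
      next
        case False
        have ts: "t - s \<le> \<eta>" using t(2) by (simp add: s_def algebra_simps)
        have sub: "{s..t} \<subseteq> {a..<b}" using s t by auto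
        have "\<exists>x\<in>{s..t}. \<forall>z\<in>{s..t}. norm (y z) \<le> norm (y x)"
          by (rule continuous_attains_sup[OF _ _ continuous_on_norm[OF continuous_on_subset[OF cont sub]]]) (use False in auto)
        then obtain x where x: "x \<in> {s..t}" "\<And>z. z \<in> {s..t} \<Longrightarrow> norm (y z) \<le> norm (y x)" by blast
        have "norm (y x - y s) \<le> (C * (1 + norm (y x))) * \<bar>x - s\<bar>"
        proof (rule vector_derivative_bound[of s t y y'])
          show "(y has_vector_derivative y' z) (at z within {s..t})" if "z \<in> {s..t}" for z
            using d[of z] sub that by (meson has_vector_derivative_within_subset subsetD)
          show "norm (y' z) \<le> C * (1 + norm (y x))" if "z \<in> {s..t}" for z
          proof -
            have "norm (y' z) \<le> C * (1 + norm (y z))" using le sub that by blast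
            also have "\<dots> \<le> C * (1 + norm (y x))" using x(2)[OF that] C by (intro mult_left_mono) auto
            finally show ?thesis .
          qed
        qed (use x False in auto)
        also have "\<dots> \<le> (C * (1 + norm (y x))) * \<eta>" using x ts C by (intro mult_left_mono) auto
        also have "\<dots> = (C * \<eta>) * (1 + norm (y x))" by simp
        finally have "norm (y x - y s) \<le> 1 / 2 * (1 + norm (y x))" using \<eta> by simp
        moreover have "norm (y x) \<le> norm (y s) + norm (y x - y s)" by (metis norm_triangle_sub)
        moreover have "norm (y s) \<le> B" by (rule B) (use s t False in \<open>auto simp: s_def\<close>)
        ultimately have "norm (y x) \<le> 2 * B + 1" by simp
        then show ?thesis using x(2)[of t] False by simp
      qed
    qed
  qed
  moreover obtain n :: nat where "(b - a) / \<eta> < real n" using reals_Archimedean2 by blast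
  then have "b \<le> a + real n * \<eta>" using \<eta> by (simp add: field_simps)
  ultimately show ?thesis by (metis atLeastLessThan_iff less_imp_le order_trans)
qed

section \<open>The state space and the vector field\<close>

type_synonym state = "(nat \<Rightarrow>\<^sub>C l2) \<times> (nat \<Rightarrow>\<^sub>C l2) \<times> real \<times> real"

context prob
begin

definition DD :: "state \<Rightarrow> data" where
  "DD u = (fn m (fst u), fn (Suc m) (fst (snd u)), fst (snd (snd u)), snd (snd (snd u)))"

lemma DD_simps: "zt (DD u) = fn m (fst u)" "qu (DD u) = fn (Suc m) (fst (snd u))" "av (DD u) = fst (snd (snd u))" "dv (DD u) = snd (snd (snd u))"
  by (simp_all add: DD_def zt_def qu_def av_def dv_def)

text \<open>The transmission condition and the condition at l as linear trace constraints tying the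
  jet of q to the number q_i; traces are continuous on H^(m+1), so the subspace is closed.\<close>

definition St :: "state set" where
  "St = {u. fst u \<in> hs m \<and> fst (snd u) \<in> hs (Suc m) \<and> fn (Suc m) (fst (snd u)) (-r) = fst (snd (snd u)) \<and>
     fn (Suc m) (fst (snd u)) r = fst (snd (snd u)) \<and> fn (Suc m) (fst (snd u)) l = 0}"

definition FX :: "state \<Rightarrow> state" where
  "FX u = (- shift (fst (snd u)), emb (Suc m) (Fq (DD u)), cc (DD u), average r l (zt (DD u)) - \<kappa> * dv (DD u))"

definition GX :: "state set" where
  "GX = {u \<in> St. \<exists>\<delta>>0. \<forall>x\<in>Eb. ht (DD u) x \<ge> \<delta>}"

text \<open>The supremum of 1/h measures the distance to vanishing depth, where the phase space
  \<open>GX\<close> ends.\<close>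

definition sizeX :: "state \<Rightarrow> real" where
  "sizeX u = norm (fst u) + norm (fst (snd u)) + \<bar>fst (snd (snd u))\<bar> + \<bar>snd (snd (snd u))\<bar> + (SUP x\<in>Eb. 1 / ht (DD u) x)"

lemma norm_state_le: "norm (u :: state) \<le> norm (fst u) + norm (fst (snd u)) + \<bar>fst (snd (snd u))\<bar> + \<bar>snd (snd (snd u))\<bar>"
proof -
  obtain U V a d where u: "u = (U, V, a, d)" by (metis prod_cases4)
  show ?thesis unfolding u using norm_Pair_le[of U "(V, a, d)"] norm_Pair_le[of V "(a, d)"] norm_Pair_le[of a d] by simp
qed

lemma norm_state_ge: "norm (fst u) \<le> norm (u :: state)" "norm (fst (snd u)) \<le> norm u" "\<bar>fst (snd (snd u))\<bar> \<le> norm u" "\<bar>snd (snd (snd u))\<bar> \<le> norm u"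
proof -
  obtain U V a d where u: "u = (U, V, a, d)" by (metis prod_cases4)
  have 1: "norm U \<le> norm u" "norm (V, a, d) \<le> norm u" unfolding u by (rule norm_fst_le, rule norm_snd_le)
  have 2: "norm V \<le> norm (V, a, d)" "norm (a, d) \<le> norm (V, a, d)" by (rule norm_fst_le, rule norm_snd_le)
  have 3: "norm a \<le> norm (a, d)" "norm d \<le> norm (a, d)" by (rule norm_fst_le, rule norm_snd_le)
  show "norm (fst u) \<le> norm u" "norm (fst (snd u)) \<le> norm u" "\<bar>fst (snd (snd u))\<bar> \<le> norm u" "\<bar>snd (snd (snd u))\<bar> \<le> norm u"
    using 1 2 3 by (auto simp: u)
qed

lemma St_subspace: "subspace St"
proof (rule subspaceI)
  have z: "fn k 0 x = 0" if "x \<in> Eb" "k \<ge> 1" for x k using fn_emb[OF Hm_zero that(2,1)] by (simp add: emb_zero)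
  show "0 \<in> St" using hs_subspace[of m] hs_subspace[of "Suc m"] bdry_Eb z[of _ "Suc m"]
    by (auto simp: St_def subspace_0 zero_prod_def)
next
  fix u v assume "u \<in> St" "v \<in> St"
  then show "u + v \<in> St"
    using subspace_add[OF hs_subspace] bdry_Eb fn_lin[of "fst (snd u)" "Suc m" "fst (snd v)" _ 1 1] by (auto simp: St_def)
next
  fix c u assume "u \<in> St"
  then show "c *\<^sub>R u \<in> St"
    using subspace_scale[OF hs_subspace] bdry_Eb fn_lin[of "fst (snd u)" "Suc m" "fst (snd u)" _ c 0] by (auto simp: St_def)
qed

lemma St_closed: "closed St"
  unfolding closed_sequential_limits
proof (intro allI impI, elim conjE)
  fix X u assume X: "\<forall>n. X n \<in> St" "X \<longlonglongrightarrow> u"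
  have l1: "(\<lambda>n. fst (X n)) \<longlonglongrightarrow> fst u" and l2: "(\<lambda>n. fst (snd (X n))) \<longlonglongrightarrow> fst (snd u)" and l3: "(\<lambda>n. fst (snd (snd (X n)))) \<longlonglongrightarrow> fst (snd (snd u))"
    using X(2) by (auto intro!: tendsto_fst tendsto_snd)
  have h1: "fst u \<in> hs m" by (rule closed_sequentially[OF hs_closed _ l1]) (use X in \<open>auto simp: St_def\<close>)
  have h2: "fst (snd u) \<in> hs (Suc m)" by (rule closed_sequentially[OF hs_closed _ l2]) (use X in \<open>auto simp: St_def\<close>)
  have t: "(\<lambda>n. fn (Suc m) (fst (snd (X n))) x) \<longlonglongrightarrow> fn (Suc m) (fst (snd u)) x" if "x \<in> Eb" for x
    by (rule fn_tendsto[OF l2 _ h2 _ that]) (use X in \<open>auto simp: St_def\<close>)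
  have "fn (Suc m) (fst (snd u)) (-r) = fst (snd (snd u))"
    by (rule LIMSEQ_unique[OF t[OF bdry_Eb(1)]]) (use X l3 in \<open>auto simp: St_def\<close>)
  moreover have "fn (Suc m) (fst (snd u)) r = fst (snd (snd u))"
    by (rule LIMSEQ_unique[OF t[OF bdry_Eb(2)]]) (use X l3 in \<open>auto simp: St_def\<close>)
  moreover have "fn (Suc m) (fst (snd u)) l = 0"
    by (rule LIMSEQ_unique[OF t[OF bdry_Eb(3)]]) (use X in \<open>auto simp: St_def\<close>)
  ultimately show "u \<in> St" using h1 h2 by (simp add: St_def)
qed

lemma shift_emb: assumes "AC Eb f g" "Hm k g" "Hm (Suc k) f" shows "shift (emb (Suc k) f) = emb k g"
proof (rule bcontfun_eqI)
  obtain u where u: "chain k u" "u 0 = g" using Hm_chain[OF assms(2)] by blast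
  let ?v = "\<lambda>j. case j of 0 \<Rightarrow> f | Suc i \<Rightarrow> u i"
  have "sqi (ext f)" using assms(3) by (auto simp: Hm_def)
  then have v: "chain (Suc k) ?v"
    using u assms(1) unfolding chain_def by (auto split: nat.split simp: less_Suc_eq_0_disj le_Suc_eq)
  fix j
  show "apply_bcontfun (shift (emb (Suc k) f)) j = apply_bcontfun (emb k g) j"
    using emb_chain[OF v, of f "Suc j"] emb_chain[OF u(1), of g j] u(2)
    by (cases "j \<le> k") (auto simp: shift_apply emb_apply)
qed

lemma shift_hs: assumes "U \<in> hs (Suc k)" shows "shift U \<in> hs k"
proof -
  have f: "Hm (Suc k) (fn (Suc k) U)" "emb (Suc k) (fn (Suc k) U) = U" using fn_Hm assms by auto
  then obtain c g where g: "AC Eb (fn (Suc k) U) g" "Hb k g c" by (auto simp: Hm_def)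
  then have "Hm k g" by (auto simp: Hm_def)
  from shift_emb[OF g(1) this f(1)] show ?thesis using f(2) \<open>Hm k g\<close> by (auto simp: hs_def)
qed

lemma GX_Bd: assumes "u \<in> GX" shows "\<exists>N. Bd N (DD u)"
proof -
  obtain \<delta> where \<delta>: "\<delta> > 0" "\<forall>x\<in>Eb. ht (DD u) x \<ge> \<delta>" using assms by (auto simp: GX_def)
  have S: "fst u \<in> hs m" "fst (snd u) \<in> hs (Suc m)" using assms by (auto simp: GX_def St_def)
  have h: "Hs m (zt (DD u)) (CS * norm (fst u))" "Hs (Suc m) (qu (DD u)) (CS * norm (fst (snd u)))"
    unfolding DD_simps using Hb_imp_Hs[OF fn_bound[OF S(1)] m1] Hb_imp_Hs[OF fn_bound[OF S(2)]] by auto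
  define N where "N = 1 + CS * norm (fst u) + CS * norm (fst (snd u)) + \<bar>av (DD u)\<bar> + \<bar>dv (DD u)\<bar> + 1 / \<delta>"
  have nn: "0 \<le> CS * norm (fst u)" "0 \<le> CS * norm (fst (snd u))" "0 \<le> 1 / \<delta>" using CS_ge \<delta> by auto
  have N: "N \<ge> 1" "CS * norm (fst u) \<le> N" "CS * norm (fst (snd u)) \<le> N" "\<bar>av (DD u)\<bar> \<le> N" "\<bar>dv (DD u)\<bar> \<le> N" "1 / \<delta> \<le> N"
    unfolding N_def using nn by linarith+
  have "1 / N \<le> \<delta>" using N(6) N(1) \<delta>(1) by (simp add: field_simps)
  then have "\<forall>x\<in>Eb. ht (DD u) x \<ge> 1 / N" using \<delta>(2) by force
  then show ?thesis unfolding Bd_def using N h Hs_mono by blast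
qed

lemma Bd_Q: "Bd N D \<Longrightarrow> Q N 0 D D"
proof -
  assume b: "Bd N D"
  have "Hs k (\<lambda>x. f x - f x) 0" for k and f :: "real \<Rightarrow> real" using Hb_zero[of 0 k] by (simp add: Hs_def)
  then show ?thesis using b unfolding Q_def by simp
qed

lemma FX_Hm: assumes "u \<in> GX" shows "Hm (Suc m) (Fq (DD u))" "Hm m (phD (DD u))"
proof -
  obtain N where N: "Bd N (DD u)" using GX_Bd[OF assms] by blast
  show "Hm (Suc m) (Fq (DD u))" using Fq_Lipschitz[of N] Bd_Q[OF N] unfolding Hm_def by blast
  have "\<exists>L. Hs m (phD (DD u)) L" using Lp_phi Bd_Q[OF N] unfolding Lp_def LB_def phD_def by blast
  then show "Hm m (phD (DD u))" using Hs_D(1) unfolding Hm_def by blast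
qed

text \<open>The field is tangent to the trace constraints: \<open>RW\<close> has zero traces and
  \<open>ef\<close> has traces 1, 1 and 0, so \<open>Fq\<close> has traces \<open>cc\<close>,
  \<open>cc\<close> and 0, matching the third component.\<close>

lemma FX_St: assumes "u \<in> GX" shows "FX u \<in> St"
proof -
  have S: "fst u \<in> hs m" "fst (snd u) \<in> hs (Suc m)" using assms by (auto simp: GX_def St_def)
  have s: "sqi (ext (phD (DD u)))" using FX_Hm(2)[OF assms] Hb_0D unfolding Hm_def by blast
  note H = FX_Hm(1)[OF assms]
  have w: "RW \<mu> (phD (DD u)) (-r) = 0" "RW \<mu> (phD (DD u)) r = 0" "RW \<mu> (phD (DD u)) l = 0"
    using RU_Neu[OF \<mu> s] by (auto simp: Neu_def)
  have e: "fn (Suc m) (emb (Suc m) (Fq (DD u))) x = Fq (DD u) x" if "x \<in> Eb" for x by (rule fn_emb[OF H _ that]) simp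
  show ?thesis
    using H shift_hs[OF S(2)] subspace_neg[OF hs_subspace] bdry_Eb w ef_props(5-7)[OF \<mu>]
    by (auto simp: St_def FX_def e Fq_def hs_def)
qed

lemma sizeX_D: assumes "u \<in> GX" "sizeX u \<le> M"
  shows "norm (fst u) \<le> M" "norm (fst (snd u)) \<le> M" "\<bar>fst (snd (snd u))\<bar> \<le> M" "\<bar>snd (snd (snd u))\<bar> \<le> M" "x \<in> Eb \<Longrightarrow> 1 / ht (DD u) x \<le> M"
    "x \<in> Eb \<Longrightarrow> ht (DD u) x > 0"
proof -
  obtain \<delta> where \<delta>: "\<delta> > 0" "\<forall>x\<in>Eb. ht (DD u) x \<ge> \<delta>" using assms by (auto simp: GX_def)
  show pos: "x \<in> Eb \<Longrightarrow> ht (DD u) x > 0" for x using \<delta> by force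
  have bdd: "bdd_above ((\<lambda>x. 1 / ht (DD u) x) ` Eb)"
    by (rule bdd_aboveI2[of _ _ "1 / \<delta>"]) (use \<delta> in \<open>auto intro!: frac_le\<close>)
  have up: "1 / ht (DD u) x \<le> (SUP x\<in>Eb. 1 / ht (DD u) x)" if "x \<in> Eb" for x
    by (rule cSUP_upper[OF that bdd])
  have s0: "0 \<le> (SUP x\<in>Eb. 1 / ht (DD u) x)" using up[OF bdry_Eb(1)] pos[OF bdry_Eb(1)]
    by (meson divide_nonneg_pos order_trans zero_le_one)
  have n0: "0 \<le> norm (fst u)" "0 \<le> norm (fst (snd u))" by simp_all
  show "norm (fst u) \<le> M" "norm (fst (snd u)) \<le> M" "\<bar>fst (snd (snd u))\<bar> \<le> M" "\<bar>snd (snd (snd u))\<bar> \<le> M"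
    using assms(2) s0 n0 unfolding sizeX_def by linarith+
  show "x \<in> Eb \<Longrightarrow> 1 / ht (DD u) x \<le> M"
    using assms(2) up[of x] n0 unfolding sizeX_def by linarith
qed

text \<open>A ball around a state of bounded size consists of data bounded by one constant
  \<open>N\<close>, so the Lipschitz estimates for data apply uniformly; norms and data differences
  are compared by the Sobolev constant \<open>CS\<close>.\<close>

lemma FX_locally_Lipschitz:
  "\<exists>\<rho>>0. \<exists>L. \<forall>u\<in>GX. sizeX u \<le> M \<longrightarrow> (\<forall>v\<in>St. norm (v - u) \<le> \<rho> \<longrightarrow> v \<in> GX \<and> norm (FX v) \<le> L \<and>
        (\<forall>w\<in>St. norm (w - u) \<le> \<rho> \<longrightarrow> norm (FX v - FX w) \<le> L * norm (v - w)))"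
proof -
  define M' where "M' = max M 1"
  have M': "M' \<ge> 1" "M \<le> M'" by (auto simp: M'_def)
  \<comment> \<open>A displacement of this radius changes the height by at most 1/(2 M'), half of
    its lower bound 1/M' at the centre.\<close>
  define \<rho> where "\<rho> = min 1 (1 / (2 * CS * M'))"
  have CS0: "CS > 0" using CS_ge by simp
  have \<rho>: "\<rho> > 0" "\<rho> \<le> 1" "CS * \<rho> \<le> 1 / (2 * M')"
  proof -
    show "\<rho> > 0" "\<rho> \<le> 1" using CS0 M' by (auto simp: \<rho>_def)
    have "CS * \<rho> \<le> CS * (1 / (2 * CS * M'))" using CS0 by (intro mult_left_mono) (auto simp: \<rho>_def)
    then show "CS * \<rho> \<le> 1 / (2 * M')" using CS0 by simp
  qed
  \<comment> \<open>Large enough for the supremum bounds CS (M' + 1) of the perturbed data and for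
    the inverse of the halved lower bound of the height.\<close>
  define N where "N = CS * (M' + 1) + 2 * M'"
  have N: "N \<ge> 1" "CS * (M' + 1) \<le> N" "M' + 1 \<le> N" "2 * M' \<le> N"
  proof -
    have "M' + 1 \<le> CS * (M' + 1)" using mult_right_mono[OF CS_ge, of "M' + 1"] M' by simp
    then show "N \<ge> 1" "CS * (M' + 1) \<le> N" "M' + 1 \<le> N" "2 * M' \<le> N" unfolding N_def using M' by linarith+
  qed
  obtain L where L: "L \<ge> 0" "\<And>D1 D2 e. Q N e D1 D2 \<Longrightarrow> Hb (Suc m) (Fq D1) L \<and> Hb (Suc m) (\<lambda>x. Fq D1 x - Fq D2 x) (L * e) \<and>
     \<bar>cc D1\<bar> \<le> L \<and> \<bar>cc D1 - cc D2\<bar> \<le> L * e \<and> \<bar>average r l (zt D1)\<bar> \<le> L \<and> \<bar>average r l (zt D1) - average r l (zt D2)\<bar> \<le> L * e"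
    using Fq_Lipschitz[of N] by blast
  define K where "K = N + L + L + (L + \<kappa> * N) + (1 + L * CS + L * CS + (L * CS + \<kappa>))"
  have K1: "N + L + L + (L + \<kappa> * N) \<le> K" "1 + L * CS + L * CS + (L * CS + \<kappa>) \<le> K"
    using N L CS0 \<kappa> by (auto simp: K_def)
  show ?thesis
  proof (rule exI[of _ \<rho>], intro conjI[OF \<rho>(1)], rule exI[of _ K], intro ballI impI conjI)
    fix u v assume u: "u \<in> GX" "sizeX u \<le> M" and v: "v \<in> St" "norm (v - u) \<le> \<rho>"
    have near: "Bd N (DD v)" "v \<in> GX" if v: "v \<in> St" "norm (v - u) \<le> \<rho>" for v
    proof -
      note sz = sizeX_D[OF u]
      have uS: "u \<in> St" using u by (simp add: GX_def)
      have dv: "norm (fst v - fst u) \<le> \<rho>" "norm (fst (snd v) - fst (snd u)) \<le> \<rho>" "\<bar>fst (snd (snd v)) - fst (snd (snd u))\<bar> \<le> \<rho>" "\<bar>snd (snd (snd v)) - snd (snd (snd u))\<bar> \<le> \<rho>"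
        using norm_state_ge[of "v - u"] v(2) by auto
      have n: "norm (fst v) \<le> M' + 1" "norm (fst (snd v)) \<le> M' + 1" "\<bar>fst (snd (snd v))\<bar> \<le> M' + 1" "\<bar>snd (snd (snd v))\<bar> \<le> M' + 1"
        using dv sz(1-4) M' \<rho>(2) norm_triangle_sub[of "fst v" "fst u"] norm_triangle_sub[of "fst (snd v)" "fst (snd u)"] by linarith+
      have hv: "fst v \<in> hs m" "fst (snd v) \<in> hs (Suc m)" and hu: "fst u \<in> hs m" using v uS by (auto simp: St_def)
      have "Hs m (fn m (fst v)) (CS * norm (fst v))" by (rule Hb_imp_Hs[OF fn_bound[OF hv(1)] m1])
      moreover have "CS * norm (fst v) \<le> CS * (M' + 1)" using n CS0 by (intro mult_left_mono) auto
      ultimately have b1: "Hs m (fn m (fst v)) N" using Hs_mono N(2) order_trans by blast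
      have "Hs (Suc m) (fn (Suc m) (fst (snd v))) (CS * norm (fst (snd v)))" by (rule Hb_imp_Hs[OF fn_bound[OF hv(2)]]) simp
      moreover have "CS * norm (fst (snd v)) \<le> CS * (M' + 1)" using n CS0 by (intro mult_left_mono) auto
      ultimately have b2: "Hs (Suc m) (fn (Suc m) (fst (snd v))) N" using Hs_mono N(2) order_trans by blast
      have b3: "height \<epsilon> (fn m (fst v)) x \<ge> 1 / (2 * M')" if x: "x \<in> Eb" for x
      proof -
        have "\<bar>fn m (fst v) x - fn m (fst u) x\<bar> \<le> CS * norm (fst v - fst u)" by (rule Hb_sup[OF fn_diff_bound[OF hv(1) hu] m1 x])
        also have "\<dots> \<le> CS * \<rho>" using dv(1) CS0 by simp
        finally have d: "\<bar>fn m (fst v) x - fn m (fst u) x\<bar> \<le> 1 / (2 * M')" using \<rho>(3) by linarith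
        have "\<epsilon> * \<bar>fn m (fst v) x - fn m (fst u) x\<bar> \<le> 1 * \<bar>fn m (fst v) x - fn m (fst u) x\<bar>" using \<epsilon> by (intro mult_right_mono) auto
        then have "\<bar>\<epsilon> * (fn m (fst v) x - fn m (fst u) x)\<bar> \<le> 1 / (2 * M')" using d \<epsilon> by (simp add: abs_mult)
        moreover have "height \<epsilon> (fn m (fst u)) x \<ge> 1 / M'"
          using sz(5,6)[OF x] M' by (simp add: DD_simps field_simps) (smt (verit) mult_right_mono)
        moreover have "height \<epsilon> (fn m (fst v)) x = height \<epsilon> (fn m (fst u)) x + \<epsilon> * (fn m (fst v) x - fn m (fst u) x)" by (simp add: height_def algebra_simps)
        moreover have "1 / M' = 1 / (2 * M') + 1 / (2 * M')" by simp
        ultimately show ?thesis by linarith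
      qed
      have "1 / N \<le> 1 / (2 * M')" using N(4) M' by (intro frac_le) auto
      then have b3': "\<forall>x\<in>Eb. height \<epsilon> (fn m (fst v)) x \<ge> 1 / N" using b3 by force
      show "Bd N (DD v)" unfolding Bd_def DD_simps using N b1 b2 b3' n by auto
      have "1 / N > 0" using N by simp
      then show "v \<in> GX" unfolding GX_def DD_simps using v(1) b3' by blast
    qed
    have Qvw: "Q N (CS * norm (v - w)) (DD v) (DD w)" if "v \<in> St" "norm (v - u) \<le> \<rho>" "w \<in> St" "norm (w - u) \<le> \<rho>" for v w
    proof -
      have h: "fst v \<in> hs m" "fst w \<in> hs m" "fst (snd v) \<in> hs (Suc m)" "fst (snd w) \<in> hs (Suc m)" using that by (auto simp: St_def)
      have 1: "Hs m (\<lambda>x. fn m (fst v) x - fn m (fst w) x) (CS * norm (v - w))"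
        by (rule Hs_mono[OF Hb_imp_Hs[OF fn_diff_bound[OF h(1,2)] m1]]) (use CS0 norm_state_ge(1)[of "v - w"] in auto)
      have 2: "Hs (Suc m) (\<lambda>x. fn (Suc m) (fst (snd v)) x - fn (Suc m) (fst (snd w)) x) (CS * norm (v - w))"
        by (rule Hs_mono[OF Hb_imp_Hs[OF fn_diff_bound[OF h(3,4)]]]) (use CS0 norm_state_ge(2)[of "v - w"] in auto)
      have 3: "norm (v - w) \<le> CS * norm (v - w)" using mult_right_mono[OF CS_ge, of "norm (v - w)"] by simp
      show ?thesis unfolding Q_def DD_simps
        using near(1)[OF that(1,2)] near(1)[OF that(3,4)] 1 2 norm_state_ge(3,4)[of "v - w"] 3 by (auto simp: DD_simps)
    qed
    show "v \<in> GX" by (rule near(2)[OF v])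
    have Bv: "Bd N (DD v)" by (rule near(1)[OF v])
    have Lv: "Hb (Suc m) (Fq (DD v)) L" "\<bar>cc (DD v)\<bar> \<le> L" "\<bar>average r l (zt (DD v))\<bar> \<le> L" using L(2)[OF Bd_Q[OF Bv]] by auto
    show "norm (FX v) \<le> K"
    proof -
      have hv: "fst (snd v) \<in> hs (Suc m)" using v by (simp add: St_def)
      have "norm (fst (snd v)) \<le> N"
        using norm_emb_le[OF Hs_D(1), of "Suc m" "qu (DD v)" N] Bv fn_Hm(2)[OF hv] by (simp add: Bd_def DD_simps)
      then have "norm (shift (fst (snd v))) \<le> N" using norm_shift order_trans by blast
      moreover have "norm (emb (Suc m) (Fq (DD v))) \<le> L" by (rule norm_emb_le[OF Lv(1)])
      moreover have "\<bar>average r l (zt (DD v)) - \<kappa> * dv (DD v)\<bar> \<le> L + \<kappa> * N"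
      proof -
        have "\<kappa> * \<bar>dv (DD v)\<bar> \<le> \<kappa> * N" using Bv \<kappa> by (intro mult_left_mono) (auto simp: Bd_def)
        then show ?thesis using Lv(3) abs_mult[of \<kappa> "dv (DD v)"] \<kappa> by linarith
      qed
      ultimately show ?thesis using norm_state_le[of "FX v"] Lv(2) K1 by (simp add: FX_def)
    qed
    fix w assume w: "w \<in> St" "norm (w - u) \<le> \<rho>"
    note q = Qvw[OF v w]
    note Lw = L(2)[OF q]
    have "Bd N (DD w)" by (rule near(1)[OF w])
    then have Hw: "Hm (Suc m) (Fq (DD w))" "Hm (Suc m) (Fq (DD v))" using L(2)[OF Bd_Q] Lv(1) unfolding Hm_def by blast+
    let ?n = "norm (v - w)"
    have 1: "norm (fst (FX v - FX w)) \<le> ?n"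
    proof -
      have "fst (FX v - FX w) = - shift (fst (snd (v - w)))"
        using bounded_linear_shift by (simp add: FX_def linear_diff bounded_linear.linear)
      then show ?thesis using norm_shift[of "fst (snd (v - w))"] norm_state_ge(2)[of "v - w"] by simp
    qed
    have 2: "norm (fst (snd (FX v - FX w))) \<le> L * (CS * ?n)"
    proof -
      have "fst (snd (FX v - FX w)) = emb (Suc m) (\<lambda>x. Fq (DD v) x - Fq (DD w) x)"
        using emb_diff[OF Hw(2,1)] by (simp add: FX_def)
      then show ?thesis using norm_emb_le Lw by metis
    qed
    have 3: "\<bar>fst (snd (snd (FX v - FX w)))\<bar> \<le> L * (CS * ?n)" using Lw by (simp add: FX_def)
    have 4: "\<bar>snd (snd (snd (FX v - FX w)))\<bar> \<le> L * (CS * ?n) + \<kappa> * ?n"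
    proof -
      have "\<bar>dv (DD v) - dv (DD w)\<bar> \<le> ?n" using norm_state_ge(4)[of "v - w"] by (simp add: DD_simps)
      then have "\<bar>\<kappa> * (dv (DD v) - dv (DD w))\<bar> \<le> \<kappa> * ?n" using \<kappa> by (simp add: abs_mult mult_left_mono)
      moreover have "snd (snd (snd (FX v - FX w))) = (average r l (zt (DD v)) - average r l (zt (DD w))) - \<kappa> * (dv (DD v) - dv (DD w))"
        by (simp add: FX_def algebra_simps)
      ultimately show ?thesis using Lw by linarith
    qed
    have "norm (FX v - FX w) \<le> ?n + L * (CS * ?n) + L * (CS * ?n) + (L * (CS * ?n) + \<kappa> * ?n)"
      using norm_state_le[of "FX v - FX w"] 1 2 3 4 by linarith
    also have "\<dots> = (1 + L * CS + L * CS + (L * CS + \<kappa>)) * ?n" by (simp add: algebra_simps)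
    also have "\<dots> \<le> K * ?n" by (rule mult_right_mono[OF K1(2)]) simp
    finally show "norm (FX v - FX w) \<le> K * norm (v - w)" .
  qed
qed

sublocale ode St GX FX sizeX
  by unfold_locales (use St_subspace St_closed FX_St FX_locally_Lipschitz in \<open>auto simp: GX_def\<close>)

end

section \<open>A priori bounds\<close>

context prob
begin

lemma trunc_emb: "k \<le> n \<Longrightarrow> trunc k (emb n f) = emb k f"
  by (rule bcontfun_eqI) (simp add: trunc_apply emb_apply)

text \<open>The part of the state treated at stage k: zeta in H^k, q in H^(k+1) and the memory term.
  The discharge q_i is left out since it is bounded by assumption there.\<close>

definition level :: "nat \<Rightarrow> state \<Rightarrow> (nat \<Rightarrow>\<^sub>C l2) \<times> (nat \<Rightarrow>\<^sub>C l2) \<times> real" where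
  "level k u = (trunc k (fst u), trunc (Suc k) (fst (snd u)), snd (snd (snd u)))"

lemma bounded_linear_level: "bounded_linear (level k)"
  unfolding level_def
  by (intro bounded_linear_Pair bounded_linear_compose[OF bounded_linear_trunc] bounded_linear_compose[OF bounded_linear_fst]
      bounded_linear_compose[OF bounded_linear_snd] bounded_linear_fst bounded_linear_snd)

lemma Hm_le: "Hm n f \<Longrightarrow> k \<le> n \<Longrightarrow> Hm k f"
  unfolding Hm_def using Hb_le by blast

lemma level_Hb:
  assumes "u \<in> St" "k \<le> m" "norm (level k u) \<le> T"
  shows "Hb k (zt (DD u)) T" "Hb (Suc k) (qu (DD u)) T" "\<bar>dv (DD u)\<bar> \<le> T" "norm (trunc (Suc k) (fst (snd u))) \<le> T"
proof -
  have h: "fst u \<in> hs m" "fst (snd u) \<in> hs (Suc m)" using assms(1) by (auto simp: St_def)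
  have 1: "norm (trunc k (fst u)) \<le> norm (level k u)" unfolding level_def by (rule norm_fst_le)
  have 2: "norm (trunc (Suc k) (fst (snd u)), snd (snd (snd u))) \<le> norm (level k u)" unfolding level_def by (rule norm_snd_le)
  have 3: "norm (trunc (Suc k) (fst (snd u))) \<le> norm (trunc (Suc k) (fst (snd u)), snd (snd (snd u)))" by (rule norm_fst_le)
  have 4: "norm (snd (snd (snd u))) \<le> norm (trunc (Suc k) (fst (snd u)), snd (snd (snd u)))" by (rule norm_snd_le)
  show "norm (trunc (Suc k) (fst (snd u))) \<le> T" using 2 3 assms(3) by linarith
  show "\<bar>dv (DD u)\<bar> \<le> T" using 2 4 assms(3) by (simp add: DD_simps)
  have z: "trunc k (fst u) = emb k (zt (DD u))" using trunc_emb[of k m "zt (DD u)"] assms(2) fn_Hm[OF h(1)] by (simp add: DD_simps)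
  have q: "trunc (Suc k) (fst (snd u)) = emb (Suc k) (qu (DD u))" using trunc_emb[of "Suc k" "Suc m" "qu (DD u)"] assms(2) fn_Hm[OF h(2)] by (simp add: DD_simps)
  have "Hm k (zt (DD u))" "Hm (Suc k) (qu (DD u))" unfolding DD_simps using Hm_le fn_Hm(1) h assms(2) by blast+
  then show "Hb k (zt (DD u)) T" "Hb (Suc k) (qu (DD u)) T" using Hb_iff_norm 1 2 3 assms(3) z q by (metis order_trans)+
qed

text \<open>The truncated state satisfies a differential inequality of linear growth as soon as phi
  grows at most linearly at order k: the resolvent supplies order k+1 for q, and the shift costs the
  derivative that q has in excess of zeta.\<close>

lemma level_bounded:
  assumes sol: "sol Tm U u" and t0: "0 \<le> t0" and A: "A \<ge> 1" and k: "k \<le> m"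
    and b: "\<And>t. t \<in> {t0..<Tm} \<Longrightarrow> (\<forall>x\<in>Eb. \<bar>zt (DD (U t)) x\<bar> \<le> A) \<and> (\<forall>x\<in>Eb. ht (DD (U t)) x \<ge> 1 / A) \<and> \<bar>av (DD (U t))\<bar> \<le> A"
    and C: "C \<ge> 0" and \<phi>: "\<And>t T. t \<in> {t0..<Tm} \<Longrightarrow> Hb k (zt (DD (U t))) T \<Longrightarrow> Hb k (qu (DD (U t))) T \<Longrightarrow> Hb k (phD (DD (U t))) (C * (1 + T))"
  shows "\<exists>B. \<forall>t\<in>{t0..<Tm}. norm (level k (U t)) \<le> B"
proof -
  obtain C1 where C1: "C1 \<ge> 0" "\<And>D T. contB (zt D) \<Longrightarrow> (\<forall>x\<in>Eb. \<bar>zt D x\<bar> \<le> A) \<Longrightarrow> (\<forall>x\<in>Eb. ht D x \<ge> 1 / A) \<Longrightarrow> \<bar>av D\<bar> \<le> A \<Longrightarrow>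
    Hb 0 (phD D) T \<Longrightarrow> \<bar>cc D\<bar> \<le> C1 * (1 + T + \<bar>dv D\<bar>)" using cc_bound[OF A] by blast
  obtain ce where ce: "Hb (Suc k) (ef \<mu>) ce" using ef_props(3)[OF \<mu>, of "Suc k"] unfolding Hm_def by blast
  have ce0: "ce \<ge> 0" by (rule Hb_nonneg[OF ce])
  define K1 where "K1 = C1 * (1 + C)"
  define K2 where "K2 = CRk \<mu> k * C + K1 * ce"
  define K where "K = 1 + K2 + (A + \<kappa>)"
  have K1: "K1 \<ge> 0" using C1 C by (simp add: K1_def)
  have K2: "K2 \<ge> 0" using K1 ce0 CRk_nonneg[OF \<mu>, of k] C by (simp add: K2_def)
  have K: "K > 0" using K2 A \<kappa> by (simp add: K_def)
  show ?thesis
  proof (rule gronwall_bounded[OF _ _ K])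
    fix t assume t: "t \<in> {t0..<Tm}"
    have t': "t \<in> {0..<Tm}" using t t0 by auto
    have G: "U t \<in> GX" and d: "(U has_vector_derivative FX (U t)) (at t within {0..<Tm})" using sol t' unfolding sol_def by blast+
    have S: "U t \<in> St" using G by (simp add: GX_def)
    have "(U has_vector_derivative FX (U t)) (at t within {t0..<Tm})"
      by (rule has_vector_derivative_within_subset[OF d]) (use t0 in auto)
    from bounded_linear.has_vector_derivative[OF bounded_linear_level this]
    show "((\<lambda>t. level k (U t)) has_vector_derivative level k (FX (U t))) (at t within {t0..<Tm})" .
    define T where "T = norm (level k (U t))"
    have T: "T \<ge> 0" by (simp add: T_def)
    note L = level_Hb[OF S k, of T, unfolded T_def, OF order_refl, folded T_def]
    let ?D = "DD (U t)"
    have p: "Hb k (phD ?D) (C * (1 + T))" by (rule \<phi>[OF t L(1) Hb_Suc_D[OF L(2)]])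
    have cB: "contB (zt ?D)" using Hm_contB[OF fn_Hm(1) m1] S by (simp add: St_def DD_simps)
    have "\<bar>cc ?D\<bar> \<le> C1 * (1 + C * (1 + T) + \<bar>dv ?D\<bar>)" by (rule C1(2)[OF cB _ _ _ Hb_le[OF p]]) (use b[OF t] in auto)
    also have "\<dots> \<le> C1 * (1 + C * (1 + T) + T)" using L(3) C1(1) by (intro mult_left_mono) auto
    also have "\<dots> = K1 * (1 + T)" by (simp add: K1_def algebra_simps)
    finally have c: "\<bar>cc ?D\<bar> \<le> K1 * (1 + T)" .
    have "Hb (Suc k) (RW \<mu> (phD ?D)) (CRk \<mu> k * (C * (1 + T)))" using RU_Hb[OF \<mu> p] by blast
    from Hb_add[OF Hb_cmult[OF this, of "-1"] Hb_cmult[OF ce, of "cc ?D"]]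
    have "Hb (Suc k) (Fq ?D) (CRk \<mu> k * (C * (1 + T)) + \<bar>cc ?D\<bar> * ce)" unfolding Fq_def[abs_def] by simp
    moreover have "CRk \<mu> k * (C * (1 + T)) + \<bar>cc ?D\<bar> * ce \<le> K2 * (1 + T)"
      using mult_right_mono[OF c ce0] by (simp add: K2_def algebra_simps)
    ultimately have "norm (emb (Suc k) (Fq ?D)) \<le> K2 * (1 + T)" by (intro norm_emb_le[OF Hb_mono])
    then have F: "norm (trunc (Suc k) (emb (Suc m) (Fq ?D))) \<le> K2 * (1 + T)"
      using trunc_emb[of "Suc k" "Suc m" "Fq ?D"] k by simp
    have s: "norm (trunc k (- shift (fst (snd (U t))))) \<le> 1 * (1 + T)"
      using norm_trunc_shift[of k "fst (snd (U t))"] L(4) bounded_linear.linear[OF bounded_linear_trunc] by (simp add: linear_neg)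
    have "\<bar>average r l (zt ?D)\<bar> \<le> A" by (rule average_bound) (use cB b[OF t] Eb_rl in \<open>auto simp: contB_def\<close>)
    moreover have "\<bar>\<kappa> * dv ?D\<bar> \<le> \<kappa> * T" using L(3) \<kappa> by (simp add: abs_mult mult_left_mono)
    ultimately have "\<bar>average r l (zt ?D) - \<kappa> * dv ?D\<bar> \<le> \<kappa> * T + A" by linarith
    also have "\<dots> \<le> (\<kappa> + A) * (1 + T)" by (rule linear_growth_le) (use \<kappa> A T in auto)
    finally have v: "\<bar>average r l (zt ?D) - \<kappa> * dv ?D\<bar> \<le> (\<kappa> + A) * (1 + T)" .
    have "norm (level k (FX (U t))) \<le> norm (trunc k (- shift (fst (snd (U t))))) + (norm (trunc (Suc k) (emb (Suc m) (Fq ?D))) + norm (average r l (zt ?D) - \<kappa> * dv ?D))"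
      unfolding level_def FX_def fst_conv snd_conv by (intro order_trans[OF norm_Pair_le] add_left_mono norm_Pair_le)
    also have "\<dots> \<le> 1 * (1 + T) + (K2 * (1 + T) + (\<kappa> + A) * (1 + T))" using s F v by simp
    also have "\<dots> = K * (1 + T)" by (simp add: K_def algebra_simps)
    finally show "norm (level k (FX (U t))) \<le> K * (1 + norm (level k (U t)))" by (simp add: T_def)
  qed
qed

text \<open>At stage 0 the supremum bounds alone give linear growth of phi. At stage k+1 the bound
  of stage k, together with the supremum bounds, provides the lower order control in
  \<open>phi_tame_Suc\<close>.\<close>

lemma a_priori_bound:
  assumes sol: "sol Tm U u" and t0: "0 \<le> t0" and A: "A \<ge> 1"
    and b: "\<And>t. t \<in> {t0..<Tm} \<Longrightarrow> (\<forall>x\<in>Eb. \<bar>zt (DD (U t)) x\<bar> \<le> A) \<and> (\<forall>x\<in>Eb. ht (DD (U t)) x \<ge> 1 / A) \<and> \<bar>av (DD (U t))\<bar> \<le> A"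
    and bq: "\<And>t x. t \<in> {t0..<Tm} \<Longrightarrow> x \<in> Eb \<Longrightarrow> \<bar>qu (DD (U t)) x\<bar> \<le> A"
  shows "\<exists>M. \<forall>t\<in>{t0..<Tm}. sizeX (U t) \<le> M"
proof -
  have St: "U t \<in> St" if "t \<in> {t0..<Tm}" for t
  proof -
    have "t \<in> {0..<Tm}" using that t0 by auto
    then have "U t \<in> GX" using sol unfolding sol_def by blast
    then show ?thesis by (simp add: GX_def)
  qed
  have "k \<le> m \<longrightarrow> (\<exists>B. \<forall>t\<in>{t0..<Tm}. norm (level k (U t)) \<le> B)" for k
  proof (induction k)
    case 0
    show ?case
    proof (intro impI level_bounded[OF sol t0 A _ b, where C="1 + 2 * A + A * A"])
      fix t T assume t: "t \<in> {t0..<Tm}" and h: "Hb 0 (zt (DD (U t))) T" "Hb 0 (qu (DD (U t))) T"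
      show "Hb 0 (phD (DD (U t))) ((1 + 2 * A + A * A) * (1 + T))"
        by (rule phi_tame_0[OF A h]) (use b[OF t] bq[OF t] in auto)
    qed (use A in auto)
  next
    case (Suc k)
    show ?case
    proof
      assume k: "Suc k \<le> m"
      then have "k \<le> m" by simp
      then obtain B where B: "\<And>t. t \<in> {t0..<Tm} \<Longrightarrow> norm (level k (U t)) \<le> B" using Suc by blast
      define A' where "A' = max A B"
      have A': "A' \<ge> 1" "A \<le> A'" "B \<le> A'" using A by (auto simp: A'_def)
      obtain C where C: "C \<ge> 0" "\<And>D T. Hs k (zt D) A' \<Longrightarrow> Hs k (qu D) A' \<Longrightarrow> (\<forall>x\<in>Eb. ht D x \<ge> 1 / A') \<Longrightarrow>
         Hb (Suc k) (zt D) T \<Longrightarrow> Hb (Suc k) (qu D) T \<Longrightarrow> Hb (Suc k) (phD D) (C * (1 + T))"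
        using phi_tame_Suc[OF A'(1), of k] by blast
      show "\<exists>B. \<forall>t\<in>{t0..<Tm}. norm (level (Suc k) (U t)) \<le> B"
      proof (rule level_bounded[OF sol t0 A k b C(1)])
        fix t T assume t: "t \<in> {t0..<Tm}" and h: "Hb (Suc k) (zt (DD (U t))) T" "Hb (Suc k) (qu (DD (U t))) T"
        have k': "k \<le> m" using k by simp
        note L = level_Hb[OF St[OF t] k' order_trans[OF B[OF t] A'(3)]]
        have 1: "Hs k (zt (DD (U t))) A'" unfolding Hs_def using L(1) b[OF t] A'(2) by force
        have 2: "Hs k (qu (DD (U t))) A'" unfolding Hs_def using Hb_Suc_D[OF L(2)] bq[OF t] A'(2) by force
        have "1 / A' \<le> 1 / A" using A' A by (intro frac_le) auto
        then have 3: "\<forall>x\<in>Eb. ht (DD (U t)) x \<ge> 1 / A'" using b[OF t] by force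
        show "Hb (Suc k) (phD (DD (U t))) (C * (1 + T))" by (rule C(2)[OF 1 2 3 h])
      qed
    qed
  qed
  from this[of m] obtain B where B: "\<And>t. t \<in> {t0..<Tm} \<Longrightarrow> norm (level m (U t)) \<le> B" by blast
  show ?thesis
  proof (intro exI[of _ "B + B + A + B + A"] ballI)
    fix t assume t: "t \<in> {t0..<Tm}"
    note L = level_Hb[OF St[OF t] order_refl B[OF t]]
    have h: "fst (U t) \<in> hs m" "fst (snd (U t)) \<in> hs (Suc m)" using St[OF t] by (auto simp: St_def)
    have "norm (fst (U t)) \<le> B" using norm_emb_le[OF L(1)] fn_Hm(2)[OF h(1)] by (simp add: DD_simps)
    moreover have "norm (fst (snd (U t))) \<le> B" using norm_emb_le[OF L(2)] fn_Hm(2)[OF h(2)] by (simp add: DD_simps)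
    moreover have "\<bar>fst (snd (snd (U t)))\<bar> \<le> A" "\<bar>snd (snd (snd (U t)))\<bar> \<le> B" using b[OF t] L(3) by (auto simp: DD_simps)
    moreover have "(SUP x\<in>Eb. 1 / ht (DD (U t)) x) \<le> A"
    proof (rule cSUP_least)
      show "Eb \<noteq> {}" using bdry_Eb by blast
      fix x assume x: "x \<in> Eb"
      have h: "ht (DD (U t)) x \<ge> 1 / A" using b[OF t] x by blast
      have "1 / A > 0" using A by simp
      then have "ht (DD (U t)) x > 0" using h by linarith
      then show "1 / ht (DD (U t)) x \<le> A" using h A by (simp add: field_simps)
    qed
    ultimately show "sizeX (U t) \<le> B + B + A + B + A" unfolding sizeX_def by linarith
  qed
qed

end

section \<open>Curves in Sobolev spaces\<close>

lemma has_vector_derivative_quotient: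
  fixes f :: "real \<Rightarrow> 'a::real_normed_vector"
  shows "(f has_vector_derivative D) (at t within I) \<longleftrightarrow> ((\<lambda>s. (1 / (s - t)) *\<^sub>R (f s - f t) - D) \<longlongrightarrow> 0) (at t within I)"
proof -
  have e: "norm (f s - f t - (s - t) *\<^sub>R D) / norm (s - t) = norm ((1 / (s - t)) *\<^sub>R (f s - f t) - D)" if "s \<noteq> t" for s
  proof -
    have "(1 / (s - t)) *\<^sub>R (f s - f t) - D = (1 / (s - t)) *\<^sub>R (f s - f t - (s - t) *\<^sub>R D)" using that by (simp add: scaleR_diff_right)
    then show ?thesis by simp
  qed
  have "(f has_vector_derivative D) (at t within I) \<longleftrightarrow> ((\<lambda>s. norm (f s - f t - (s - t) *\<^sub>R D) / norm (s - t)) \<longlongrightarrow> 0) (at t within I)"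
    unfolding has_vector_derivative_def has_derivative_iff_norm using bounded_linear_scaleR_left by auto
  also have "\<dots> \<longleftrightarrow> ((\<lambda>s. norm ((1 / (s - t)) *\<^sub>R (f s - f t) - D)) \<longlongrightarrow> 0) (at t within I)"
    by (rule filterlim_cong[OF refl refl]) (use e in \<open>auto simp: eventually_at_filter\<close>)
  also have "\<dots> \<longleftrightarrow> ((\<lambda>s. (1 / (s - t)) *\<^sub>R (f s - f t) - D) \<longlongrightarrow> 0) (at t within I)" by (rule tendsto_norm_zero_iff)
  finally show ?thesis .
qed

lemma at_within_Ico_nontrivial: assumes "t \<in> {0..<T::real}" shows "at t within {0..<T} \<noteq> bot"
proof -
  have "t islimpt {0..<T}"
    unfolding islimpt_approachable
  proof (intro allI impI)
    fix e :: real assume "e > 0"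
    then show "\<exists>x'\<in>{0..<T}. x' \<noteq> t \<and> dist x' t < e"
      using assms by (intro bexI[of _ "min (t + e / 2) ((t + T) / 2)"]) (auto simp: dist_real_def min_def)
  qed
  then show ?thesis by (simp add: trivial_limit_within)
qed

text \<open>Difference quotients lie in the subspace. Thereby trace conditions satisfied by a
  solution at every time are inherited by its time derivative.\<close>

lemma vector_derivative_mem_closed_subspace:
  fixes f :: "real \<Rightarrow> 'a::real_normed_vector"
  assumes S: "subspace S" "closed S" and f: "\<And>s. s \<in> I \<Longrightarrow> f s \<in> S" "(f has_vector_derivative D) (at t within I)" and t: "t \<in> I" "at t within I \<noteq> bot"
  shows "D \<in> S"
proof (rule Lim_in_closed_set[OF S(2) _ t(2)])
  show "((\<lambda>s. (1 / (s - t)) *\<^sub>R (f s - f t)) \<longlongrightarrow> D) (at t within I)"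
    by (rule LIM_zero_cancel) (use f(2) in \<open>simp add: has_vector_derivative_quotient\<close>)
  show "\<forall>\<^sub>F s in at t within I. (1 / (s - t)) *\<^sub>R (f s - f t) \<in> S"
    unfolding eventually_at_filter
    by (rule always_eventually) (use f(1) t(1) in \<open>blast intro: subspace_scale[OF S(1)] subspace_diff[OF S(1)]\<close>)
qed

context dom
begin

text \<open>The maximum and the Euclidean norm of the m+1 derivative norms are equivalent; so
  differentiability in time may be read in either.\<close>

lemma Sobolev_norm_emb: assumes "f \<in> Sobolev E m"
  shows "norm (emb m f) \<le> Sobolev_norm E m f" "Sobolev_norm E m f \<le> sqrt (real m + 1) * norm (emb m f)"
proof -
  obtain u where u: "chain m u" "AEE x. f x = u 0 x" using Sobolev_imp_chain[OF assms] .
  define a where "a k = nE (weak_deriv E k f)" for k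
  have a: "norm (apply_bcontfun (emb m f) k) = a k" if k: "k \<le> m" for k
  proof -
    have "sqi (ext (weak_deriv E k f))"
    proof (rule sqi_ext_cong)
      show "sqi (ext (u k))" using u(1) k by (simp add: chain_def)
      show "AEE x. u k x = weak_deriv E k f x" using chain_weak_deriv[OF u k] by eventually_elim auto
    qed
    then show ?thesis using k by (simp add: emb_apply norm_cl a_def)
  qed
  have S: "Sobolev_norm E m f = sqrt (\<Sum>k\<le>m. (a k)\<^sup>2)" by (simp add: Sobolev_norm_def nE_sq a_def)
  show "norm (emb m f) \<le> Sobolev_norm E m f"
  proof (rule norm_bound)
    fix k
    show "norm (apply_bcontfun (emb m f) k) \<le> Sobolev_norm E m f"
    proof (cases "k \<le> m")
      case True
      have "(a k)\<^sup>2 \<le> (\<Sum>k\<le>m. (a k)\<^sup>2)" by (rule member_le_sum) (use True in auto)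
      then show ?thesis unfolding S a[OF True] by (rule real_le_rsqrt)
    qed (simp add: emb_apply S sum_nonneg)
  qed
  have "(\<Sum>k\<le>m. (a k)\<^sup>2) \<le> (\<Sum>k\<le>m. (norm (emb m f))\<^sup>2)"
    by (intro sum_mono power_mono) (use a norm_bounded[of "emb m f"] in \<open>auto simp: a_def nE_nonneg\<close>, metis)
  also have "\<dots> = (real m + 1) * (norm (emb m f))\<^sup>2" by simp
  finally have "Sobolev_norm E m f \<le> sqrt ((real m + 1) * (norm (emb m f))\<^sup>2)" unfolding S by (rule real_sqrt_le_mono)
  then show "Sobolev_norm E m f \<le> sqrt (real m + 1) * norm (emb m f)" by (simp add: real_sqrt_mult)
qed

lemma Sobolev_lin: assumes "f \<in> Sobolev E m" "g \<in> Sobolev E m"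
  shows "(\<lambda>x. a * f x + b * g x) \<in> Sobolev E m" "emb m (\<lambda>x. a * f x + b * g x) = a *\<^sub>R emb m f + b *\<^sub>R emb m g"
proof -
  obtain f0 where f0: "Hm m f0" "AEE x. f x = f0 x" "emb m f = emb m f0" using Sobolev_rep[OF assms(1)] .
  obtain g0 where g0: "Hm m g0" "AEE x. g x = g0 x" "emb m g = emb m g0" using Sobolev_rep[OF assms(2)] .
  have "AEE x. a * f x + b * g x = a * f0 x + b * g0 x" using f0(2) g0(2) by eventually_elim auto
  note * = Hm_AE_Sobolev[OF Hm_lin[OF f0(1) g0(1)] this]
  show "(\<lambda>x. a * f x + b * g x) \<in> Sobolev E m" by (rule *(1))
  show "emb m (\<lambda>x. a * f x + b * g x) = a *\<^sub>R emb m f + b *\<^sub>R emb m g" unfolding *(2) f0(3) g0(3) by (rule emb_lin[OF f0(1) g0(1)])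
qed

lemma Sobolev_tendsto_0: assumes "\<forall>\<^sub>F s in F. g s \<in> Sobolev E m"
  shows "((\<lambda>s. Sobolev_norm E m (g s)) \<longlongrightarrow> 0) F \<longleftrightarrow> ((\<lambda>s. emb m (g s)) \<longlongrightarrow> 0) F"
proof
  assume h: "((\<lambda>s. Sobolev_norm E m (g s)) \<longlongrightarrow> 0) F"
  show "((\<lambda>s. emb m (g s)) \<longlongrightarrow> 0) F"
    by (rule Lim_null_comparison[OF _ h]) (use assms in \<open>eventually_elim, simp add: Sobolev_norm_emb\<close>)
next
  assume "((\<lambda>s. emb m (g s)) \<longlongrightarrow> 0) F"
  then have h: "((\<lambda>s. sqrt (real m + 1) * norm (emb m (g s))) \<longlongrightarrow> 0) F"
    using tendsto_mult_right_zero tendsto_norm_zero by blast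
  show "((\<lambda>s. Sobolev_norm E m (g s)) \<longlongrightarrow> 0) F"
  proof (rule Lim_null_comparison[OF _ h])
    show "\<forall>\<^sub>F s in F. norm (Sobolev_norm E m (g s)) \<le> sqrt (real m + 1) * norm (emb m (g s))"
      using assms
    proof eventually_elim
      case (elim s)
      have "0 \<le> Sobolev_norm E m (g s)" using Sobolev_norm_emb(1)[OF elim] norm_ge_zero order_trans by blast
      then show ?case using Sobolev_norm_emb(2)[OF elim] by simp
    qed
  qed
qed

lemma C1_Sobolev_iff:
  "C1_Sobolev E m I f f' \<longleftrightarrow> (\<forall>t\<in>I. f t \<in> Sobolev E m \<and> f' t \<in> Sobolev E m \<and>
     ((\<lambda>s. emb m (f s)) has_vector_derivative emb m (f' t)) (at t within I)) \<and> continuous_on I (\<lambda>t. emb m (f' t))"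
proof -
  have 1: "((\<lambda>s. Sobolev_norm E m (\<lambda>x. (f s x - f t x) / (s - t) - f' t x)) \<longlongrightarrow> 0) (at t within I) \<longleftrightarrow>
      ((\<lambda>s. emb m (f s)) has_vector_derivative emb m (f' t)) (at t within I)" (is ?A)
    "((\<lambda>s. Sobolev_norm E m (\<lambda>x. f' s x - f' t x)) \<longlongrightarrow> 0) (at t within I) \<longleftrightarrow> ((\<lambda>s. emb m (f' s)) \<longlongrightarrow> emb m (f' t)) (at t within I)" (is ?B)
    if mem: "\<And>t. t \<in> I \<Longrightarrow> f t \<in> Sobolev E m" "\<And>t. t \<in> I \<Longrightarrow> f' t \<in> Sobolev E m" and t: "t \<in> I" for t
  proof -
    have q: "(\<lambda>x. (f s x - f t x) / (s - t) - f' t x) \<in> Sobolev E m"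
      "emb m (\<lambda>x. (f s x - f t x) / (s - t) - f' t x) = (1 / (s - t)) *\<^sub>R (emb m (f s) - emb m (f t)) - emb m (f' t)" if s: "s \<in> I" for s
    proof -
      define c where "c = 1 / (s - t)"
      have e: "(\<lambda>x. (f s x - f t x) / (s - t) - f' t x) = (\<lambda>x. 1 * (c * f s x + (- c) * f t x) + (-1) * f' t x)"
        by (simp add: fun_eq_iff diff_divide_distrib c_def)
      note L = Sobolev_lin[OF mem(1)[OF s] mem(1)[OF t], of c "- c"]
      note L2 = Sobolev_lin[OF L(1) mem(2)[OF t], of 1 "-1"]
      show "(\<lambda>x. (f s x - f t x) / (s - t) - f' t x) \<in> Sobolev E m" unfolding e by (rule L2(1))
      show "emb m (\<lambda>x. (f s x - f t x) / (s - t) - f' t x) = (1 / (s - t)) *\<^sub>R (emb m (f s) - emb m (f t)) - emb m (f' t)"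
        unfolding e L2(2) L(2) c_def[symmetric] by (simp add: scaleR_diff_right)
    qed
    have ev: "\<forall>\<^sub>F s in at t within I. s \<in> I" by (simp add: eventually_at_filter)
    have "((\<lambda>s. Sobolev_norm E m (\<lambda>x. (f s x - f t x) / (s - t) - f' t x)) \<longlongrightarrow> 0) (at t within I) \<longleftrightarrow>
       ((\<lambda>s. emb m (\<lambda>x. (f s x - f t x) / (s - t) - f' t x)) \<longlongrightarrow> 0) (at t within I)"
      by (rule Sobolev_tendsto_0, rule eventually_mono[OF ev], rule q(1))
    also have "\<dots> \<longleftrightarrow> ((\<lambda>s. (1 / (s - t)) *\<^sub>R (emb m (f s) - emb m (f t)) - emb m (f' t)) \<longlongrightarrow> 0) (at t within I)"
      by (rule filterlim_cong[OF refl refl], rule eventually_mono[OF ev], rule q(2))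
    finally show ?A by (simp add: has_vector_derivative_quotient)
    have d: "(\<lambda>x. f' s x - f' t x) \<in> Sobolev E m" "emb m (\<lambda>x. f' s x - f' t x) = emb m (f' s) - emb m (f' t)" if s: "s \<in> I" for s
      using Sobolev_lin[OF mem(2)[OF s] mem(2)[OF t], of 1 "-1"] by simp_all
    have "((\<lambda>s. Sobolev_norm E m (\<lambda>x. f' s x - f' t x)) \<longlongrightarrow> 0) (at t within I) \<longleftrightarrow> ((\<lambda>s. emb m (\<lambda>x. f' s x - f' t x)) \<longlongrightarrow> 0) (at t within I)"
      by (rule Sobolev_tendsto_0, rule eventually_mono[OF ev], rule d(1))
    also have "\<dots> \<longleftrightarrow> ((\<lambda>s. emb m (f' s) - emb m (f' t)) \<longlongrightarrow> 0) (at t within I)"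
      by (rule filterlim_cong[OF refl refl], rule eventually_mono[OF ev], rule d(2))
    finally show ?B by (simp add: LIM_zero_iff)
  qed
  show ?thesis
  proof (cases "\<forall>t\<in>I. f t \<in> Sobolev E m \<and> f' t \<in> Sobolev E m")
    case True
    then show ?thesis unfolding C1_Sobolev_def continuous_on_def using 1 by (simp add: ball_conj_distrib)
  next
    case False
    then show ?thesis unfolding C1_Sobolev_def by blast
  qed
qed

lemma fn_emb_Sobolev: assumes "f \<in> Sobolev E m"
  shows "emb m f \<in> hs m" "Hm m (fn m (emb m f))" "AEE x. f x = fn m (emb m f) x"
proof -
  obtain g where g: "Hm m g" "AEE x. f x = g x" "emb m f = emb m g" using Sobolev_rep[OF assms] .
  show h: "emb m f \<in> hs m" using g by (auto simp: hs_def)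
  show H: "Hm m (fn m (emb m f))" by (rule fn_Hm(1)[OF h])
  have "emb m (\<lambda>x. g x - fn m (emb m f) x) = 0" using emb_diff[OF g(1) H] g(3) fn_Hm(2)[OF h] by simp
  moreover have "Hm m (\<lambda>x. g x - fn m (emb m f) x)" using Hm_lin[OF g(1) H, of 1 "-1"] by simp
  ultimately have "AEE x. g x - fn m (emb m f) x = 0" by (intro emb_eq_0_AE)
  then show "AEE x. f x = fn m (emb m f) x" using g(2) by eventually_elim auto
qed

text \<open>Were the inequality violated at a point, continuity would violate it on an interval of
  positive length in the same component. This promotes essential bounds to bounds up to the
  boundary.\<close>

lemma AE_le_AC: assumes AC: "AC Eb f g" and AE: "AEE x. c \<le> f x" and x: "x \<in> Eb"
  shows "c \<le> f x"
proof (rule ccontr)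
  assume n: "\<not> c \<le> f x"
  obtain a where a: "x \<in> {a..a + min 1 (l - r)}" "{a..a + min 1 (l - r)} \<subseteq> Eb" using interval_around[OF x] .
  define b where "b = a + min 1 (l - r)"
  have ab: "a < b" "x \<in> {a..b}" "{a..b} \<subseteq> Eb" using a rl by (auto simp: b_def)
  have "continuous_on {a..b} f" by (rule AC_continuous[OF AC ab(3)])
  then obtain d where d: "d > 0" "\<And>y. y \<in> {a..b} \<Longrightarrow> dist y x < d \<Longrightarrow> dist (f y) (f x) < c - f x"
    using n ab(2) unfolding continuous_on_iff by (metis diff_gt_0_iff_gt not_le)
  define p q where "p = max a (x - d)" and "q = min b (x + d)"
  have pq: "p < q" using ab d by (auto simp: p_def q_def)
  have "AE x in lebesgue. x \<in> Eb \<longrightarrow> c \<le> f x" by (rule AE_E_Eb[OF AE])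
  then have "AE y in lebesgue. y \<notin> {p<..<q}"
  proof eventually_elim
    case (elim y)
    have "f y < c" if "y \<in> {p<..<q}"
    proof -
      have "dist (f y) (f x) < c - f x" by (rule d(2)) (use that in \<open>auto simp: p_def q_def dist_real_def abs_less_iff\<close>)
      then show ?thesis by (simp add: dist_real_def abs_less_iff)
    qed
    moreover have "y \<in> Eb" if "y \<in> {p<..<q}" using ab(3) that by (auto simp: p_def q_def subset_iff)
    ultimately show ?case using elim by force
  qed
  then show False using not_AE_interval[OF pq] by blast
qed

section \<open>The Neumann resolvent\<close>

lemma chain_2I: assumes "AC Eb a b" "AC Eb b c" "sqi (ext a)" "sqi (ext b)" "sqi (ext c)"
  shows "chain 2 (\<lambda>k. if k = 0 then a else if k = 1 then b else c)"
  unfolding chain_def using assms by (auto dest!: less_2_cases)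

lemma sqi_ext_lin: "sqi (ext f) \<Longrightarrow> sqi (ext g) \<Longrightarrow> sqi (ext (\<lambda>x. a * f x + b * g x))"
  unfolding ext_add ext_cmult by (intro sqi_add sqi_cmult)

text \<open>As \<open>R1\<close> is a choice, two facts combine: \<open>RU\<close> solves the
  defining problem, so the choice is a solution; and any solution, passed to absolutely continuous
  representatives, solves \<open>Neu\<close>, whose solution is unique.\<close>

lemma R1_eq:
  assumes \<mu>: "\<mu> > 0" and \<phi>: "sqi (ext \<phi>)" and v: "AEE x. v x = \<phi> x"
  shows "AEE x. R1 r l \<mu> v x = RU \<mu> \<phi> x"
proof -
  note N = RU_Neu[OF \<mu> \<phi>]
  note N' = N[unfolded Neu_def]
  have \<mu>2: "\<mu>\<^sup>2 \<noteq> 0" using \<mu> by simp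
  have "solves_R1 r l \<mu> v (RU \<mu> \<phi>)"
  proof -
    have "sqi (ext (\<lambda>x. (1 / \<mu>\<^sup>2) * RU \<mu> \<phi> x + (- (1 / \<mu>\<^sup>2)) * \<phi> x))" using sqi_ext_lin N' \<phi> by blast
    then have "sqi (ext (\<lambda>x. (RU \<mu> \<phi> x - \<phi> x) / \<mu>\<^sup>2))" by (simp add: diff_divide_distrib)
    then have c: "chain 2 (\<lambda>k. if k = 0 then RU \<mu> \<phi> else if k = 1 then RW \<mu> \<phi> else (\<lambda>x. (RU \<mu> \<phi> x - \<phi> x) / \<mu>\<^sup>2))" (is "chain 2 ?u")
      using chain_2I N' by blast
    have ae: "AEE x. RU \<mu> \<phi> x = ?u 0 x" by simp
    have w2: "AEE x. weak_deriv E 2 (RU \<mu> \<phi>) x = ?u 2 x" by (rule chain_weak_deriv[OF c ae]) simp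
    have w1: "AEE x. weak_deriv E 1 (RU \<mu> \<phi>) x = ?u 1 x" by (rule chain_weak_deriv[OF c ae]) simp
    then have w1: "AEE x. weak_deriv E 1 (RU \<mu> \<phi>) x = RW \<mu> \<phi> x" by simp
    have cW: "contB (RW \<mu> \<phi>)" using AC_contB N' by blast
    have "chain 1 (\<lambda>k. if k = 0 then RW \<mu> \<phi> else (\<lambda>x. (RU \<mu> \<phi> x - \<phi> x) / \<mu>\<^sup>2))"
      using c N' unfolding chain_def by (auto dest!: spec[of _ "2::nat"])
    from chain_Hm[OF this] have HW: "Hm 1 (RW \<mu> \<phi>)" by simp
    have "AEE x. RU \<mu> \<phi> x - \<mu>\<^sup>2 * weak_deriv E 2 (RU \<mu> \<phi>) x = v x"
      using w2 v by eventually_elim (use \<mu>2 in simp)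
    moreover have "RU \<mu> \<phi> \<in> Sobolev E 2" by (rule chain_Sobolev[OF c]) simp
    moreover have "ess_tendsto (weak_deriv E 1 (RU \<mu> \<phi>)) 0 at_bot" by (rule Hm_decay[OF HW _ w1]) simp
    moreover have "RW \<mu> \<phi> (-r) = 0" "RW \<mu> \<phi> r = 0" "RW \<mu> \<phi> l = 0" using N' by auto
    ultimately show ?thesis unfolding solves_R1_def Let_def using trace(1-3)[OF cW w1] by simp
  qed
  then have "solves_R1 r l \<mu> v (R1 r l \<mu> v)" unfolding R1_def by (rule someI[of "solves_R1 r l \<mu> v"])
  then have u: "R1 r l \<mu> v \<in> Sobolev E 2" "AEE x. R1 r l \<mu> v x - \<mu>\<^sup>2 * weak_deriv E 2 (R1 r l \<mu> v) x = v x"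
    "ess_tendsto (weak_deriv E 1 (R1 r l \<mu> v)) 0 (at_left (- r))" "ess_tendsto (weak_deriv E 1 (R1 r l \<mu> v)) 0 (at_right r)"
    "ess_tendsto (weak_deriv E 1 (R1 r l \<mu> v)) 0 (at_left l)"
    unfolding solves_R1_def Let_def by auto
  obtain c where c: "chain 2 c" "AEE x. R1 r l \<mu> v x = c 0 x" using Sobolev_imp_chain[OF u(1)] .
  have w1: "AEE x. weak_deriv E 1 (R1 r l \<mu> v) x = c 1 x" by (rule chain_weak_deriv[OF c]) simp
  have w2: "AEE x. weak_deriv E 2 (R1 r l \<mu> v) x = c 2 x" by (rule chain_weak_deriv[OF c]) simp
  have A: "AC Eb (c 0) (c 1)" "AC Eb (c 1) (c 2)" "sqi (ext (c 0))" "sqi (ext (c 1))" using c(1) by (auto simp: chain_def numeral_2_eq_2)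
  have "AEE x. c 2 x = (c 0 x - \<phi> x) / \<mu>\<^sup>2"
    using u(2) c(2) w2 v by eventually_elim (use \<mu>2 in \<open>auto simp: field_simps\<close>)
  from AC_AE_cong[OF A(2) AE_E_Eb[OF this] Eb_sets] have A2: "AC Eb (c 1) (\<lambda>x. (c 0 x - \<phi> x) / \<mu>\<^sup>2)" .
  note tr = trace(1-3)[OF AC_contB[OF A(2)] w1]
  have "c 1 (-r) = 0" "c 1 r = 0" "c 1 l = 0"
    by (rule ess_tendsto_unique[OF thick_at_left tr(1) u(3)], rule ess_tendsto_unique[OF thick_at_right tr(2) u(4)], rule ess_tendsto_unique[OF thick_at_left tr(3) u(5)])
  then have "Neu \<mu> \<phi> (c 0) (c 1)" unfolding Neu_def using A A2 by blast
  then have "c 0 x = RU \<mu> \<phi> x" if "x \<in> Eb" for x using Neu_unique(1)[OF \<mu> _ N _ that] by simp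
  then show ?thesis using c(2) E_Eb by (auto elim!: eventually_mono)
qed

lemma average_cong: assumes "sqi (ext z)" "AEE x. f x = z x" shows "average r l f = average r l z"
proof -
  have s: "sqi (ext f)" by (rule sqi_ext_cong[OF assms(1)]) (use assms(2) in \<open>eventually_elim, auto\<close>)
  have e: "(\<lambda>x. indicat_real {r<..<l} x *\<^sub>R g x) = (\<lambda>x. indicat_real {r<..<l} x *\<^sub>R ext g x)" for g
    by (auto simp: ext_def domE_def split: split_indicator)
  have me: "(\<lambda>x. indicat_real {r<..<l} x *\<^sub>R g x) \<in> borel_measurable lebesgue" if "sqi (ext g)" for g
    by (subst e, intro borel_measurable_scaleR borel_measurable_indicator) (use that in \<open>auto simp: sqi_def\<close>)
  have "(LINT x:{r<..<l}|lebesgue. f x) = (LINT x:{r<..<l}|lebesgue. z x)"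
    unfolding set_lebesgue_integral_def
    by (rule integral_cong_AE[OF me[OF s] me[OF assms(1)]])
      (use assms(2) in \<open>eventually_elim, auto simp: domE_def split: split_indicator\<close>)
  then show ?thesis by (simp add: average_def)
qed

end

section \<open>The memory term\<close>

lemma duhamel_eq: assumes "continuous_on {0..t} f"
  shows "duhamel \<kappa> f t = exp (- \<kappa> * t) * integral {0..t} (\<lambda>s. exp (\<kappa> * s) * f s)"
proof -
  have c: "continuous_on {0..t} (\<lambda>s. exp (\<kappa> * s) * f s)" by (intro continuous_intros assms)
  have "(\<lambda>s. exp (- \<kappa> * (t - s)) * f s) = (\<lambda>s. exp (- \<kappa> * t) * (exp (\<kappa> * s) * f s))"
    by (simp add: fun_eq_iff exp_add[symmetric] algebra_simps)
  moreover have "(\<lambda>s. exp (- \<kappa> * t) * (exp (\<kappa> * s) * f s)) absolutely_integrable_on {0..t}"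
    by (intro absolutely_integrable_continuous_real continuous_on_mult_left c)
  ultimately show ?thesis
    using set_lebesgue_integral_eq_integral(2)[of "{0..t}" "\<lambda>s. exp (- \<kappa> * t) * (exp (\<kappa> * s) * f s)"] by (simp add: duhamel_def)
qed

lemma duhamel_derivative: assumes "continuous_on {0..<T} f" "t \<in> {0..<T}"
  shows "(duhamel \<kappa> f has_real_derivative f t - \<kappa> * duhamel \<kappa> f t) (at t within {0..<T})"
proof -
  define b where "b = (t + T) / 2"
  have b: "t < b" "b < T" "0 \<le> t" using assms(2) by (auto simp: b_def)
  have sub: "continuous_on {0..s} f" if "s < T" for s by (rule continuous_on_subset[OF assms(1)]) (use that in auto)
  define g where "g s = exp (\<kappa> * s) * f s" for s
  have "continuous_on {0..b} g" unfolding g_def by (intro continuous_intros sub b)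
  from integral_has_real_derivative[OF this, of t]
  have I: "((\<lambda>x. integral {0..x} g) has_real_derivative g t) (at t within {0..b})" using b by simp
  have "((\<lambda>s. exp (- \<kappa> * s) * integral {0..s} g) has_real_derivative
      (- \<kappa> * exp (- \<kappa> * t)) * integral {0..t} g + exp (- \<kappa> * t) * g t) (at t within {0..b})"
    by (rule derivative_eq_intros I refl | simp)+
  moreover have "(- \<kappa> * exp (- \<kappa> * t)) * integral {0..t} g + exp (- \<kappa> * t) * g t = f t - \<kappa> * duhamel \<kappa> f t"
  proof -
    have "exp (- \<kappa> * t) * exp (\<kappa> * t) = 1" by (simp add: exp_add[symmetric])
    then have "exp (- \<kappa> * t) * g t = f t" unfolding g_def by (metis mult.assoc mult_1)
    moreover have "duhamel \<kappa> f t = exp (- \<kappa> * t) * integral {0..t} g" using duhamel_eq[OF sub, of t \<kappa>] b by (simp add: g_def[abs_def])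
    ultimately show ?thesis by (simp add: mult.assoc)
  qed
  ultimately have d: "((\<lambda>s. exp (- \<kappa> * s) * integral {0..s} g) has_vector_derivative f t - \<kappa> * duhamel \<kappa> f t) (at t within {0..b})"
    by (simp add: has_real_derivative_iff_has_vector_derivative)
  have "(duhamel \<kappa> f has_vector_derivative f t - \<kappa> * duhamel \<kappa> f t) (at t within {0..<T})"
  proof (rule has_vector_derivative_local[OF d, where N="{..<b}"])
    show "exp (- \<kappa> * s) * integral {0..s} g = duhamel \<kappa> f s" if "s \<in> {0..<T} \<inter> {..<b}" for s
      using duhamel_eq[OF sub, of s \<kappa>] that b by (simp add: g_def[abs_def])
  qed (use b in auto)
  then show ?thesis by (simp add: has_real_derivative_iff_has_vector_derivative)
qed

lemma duhamel_0: "duhamel \<kappa> f 0 = 0"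
  using duhamel_eq[of 0 f \<kappa>] by simp

text \<open>Multiplication by the integrating factor exp(\<kappa> s) makes the difference of two
  solutions constant, and both start at 0.\<close>

lemma duhamel_unique:
  assumes c: "continuous_on {0..<T} f" and d: "\<And>t. t \<in> {0..<T} \<Longrightarrow> (y has_real_derivative f t - \<kappa> * y t) (at t within {0..<T})" "y 0 = 0"
    and t: "t \<in> {0..<T}"
  shows "y t = duhamel \<kappa> f t"
proof -
  define w where "w s = exp (\<kappa> * s) * (y s - duhamel \<kappa> f s)" for s
  have "(w has_field_derivative 0) (at s within {0..<T})" if s: "s \<in> {0..<T}" for s
    unfolding w_def
    by (rule derivative_eq_intros d(1)[OF s] duhamel_derivative[OF c s] refl | simp add: algebra_simps)+
  then have "\<exists>c. \<forall>x\<in>{0..<T}. w x = c" by (intro has_field_derivative_zero_constant) auto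
  then have "w t = w 0" using t by auto
  then show ?thesis by (simp add: w_def d(2) duhamel_0)
qed

section \<open>Equivalence with an ordinary differential equation\<close>

context prob
begin

lemma Hm_mult: assumes "Hm m f" "Hm m g" shows "Hm m (\<lambda>x. f x * g x)"
proof -
  obtain a b where ab: "Hb m f a" "Hb m g b" using assms unfolding Hm_def by blast
  show ?thesis unfolding Hm_def using Hb_mult[OF ab(1) Hb_imp_Hs[OF ab(2) m1]] by blast
qed

lemma Hm_sqi: "Hm k f \<Longrightarrow> sqi (ext f)"
  unfolding Hm_def using Hb_0D by blast

lemma GX_D: assumes "u \<in> GX"
  shows "Hm m (zt (DD u))" "Hm (Suc m) (qu (DD u))" "qu (DD u) (-r) = av (DD u)" "qu (DD u) r = av (DD u)" "qu (DD u) l = 0"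
    "x \<in> Eb \<Longrightarrow> ht (DD u) x > 0"
proof -
  have S: "fst u \<in> hs m" "fst (snd u) \<in> hs (Suc m)" using assms by (auto simp: GX_def St_def)
  show "Hm m (zt (DD u))" "Hm (Suc m) (qu (DD u))" unfolding DD_simps using fn_Hm S by auto
  show "qu (DD u) (-r) = av (DD u)" "qu (DD u) r = av (DD u)" "qu (DD u) l = 0"
    using assms unfolding GX_def St_def DD_simps by blast+
  obtain \<delta> where "\<delta> > 0" "\<forall>x\<in>Eb. ht (DD u) x \<ge> \<delta>" using assms by (auto simp: GX_def)
  then show "x \<in> Eb \<Longrightarrow> ht (DD u) x > 0" by force
qed

lemma ess_inf_pos_iff:
  assumes "Hm m z" "AEE x. \<zeta> x = z x"
  shows "ess_inf_pos E (height \<epsilon> \<zeta>) \<longleftrightarrow> (\<exists>\<delta>>0. \<forall>x\<in>Eb. height \<epsilon> z x \<ge> \<delta>)"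
proof
  assume "ess_inf_pos E (height \<epsilon> \<zeta>)"
  then obtain c where c: "c > 0" "AEE x. c \<le> height \<epsilon> \<zeta> x" unfolding ess_inf_pos_def by blast
  obtain u where u: "chain m u" "u 0 = z" using Hm_chain[OF assms(1)] by blast
  then have "AC Eb z (u 1)" using m1 by (auto simp: chain_def)
  from AC_add[OF AC_const[of Eb 1] AC_cmult[OF this, of \<epsilon>]]
  have A: "AC Eb (height \<epsilon> z) (\<lambda>x. 0 + \<epsilon> * u 1 x)" by (simp add: height_def[abs_def])
  have "AEE x. c \<le> height \<epsilon> z x" using c(2) assms(2) by eventually_elim (auto simp: height_def)
  then show "\<exists>\<delta>>0. \<forall>x\<in>Eb. height \<epsilon> z x \<ge> \<delta>" using AE_le_AC[OF A] c(1) by blast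
next
  assume "\<exists>\<delta>>0. \<forall>x\<in>Eb. height \<epsilon> z x \<ge> \<delta>"
  then obtain \<delta> where d: "\<delta> > 0" "\<And>x. x \<in> E \<Longrightarrow> height \<epsilon> z x \<ge> \<delta>" using E_Eb by blast
  have "AEE x. \<delta> \<le> height \<epsilon> \<zeta> x" using assms(2) by eventually_elim (use d in \<open>auto simp: height_def\<close>)
  then show "ess_inf_pos E (height \<epsilon> \<zeta>)" unfolding ess_inf_pos_def using d(1) by blast
qed

text \<open>The identity behind the reformulation: the derivative of zeta + \<epsilon> zeta^2 / 2 is
  h times the derivative of zeta, so the nonlinear terms add up to the derivative of phi.\<close>

lemma momentum_flux:
  assumes u: "u \<in> GX" and z: "AEE x. \<zeta> x = zt (DD u) x" and q: "AEE x. p x = qu (DD u) x"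
  obtains \<phi>' where "AC Eb (phD (DD u)) \<phi>'" "sqi (ext \<phi>')"
    "AEE x. \<epsilon> * weak_deriv E 1 (\<lambda>y. (p y)\<^sup>2 / height \<epsilon> \<zeta> y) x + height \<epsilon> \<zeta> x * weak_deriv E 1 \<zeta> x = \<phi>' x"
proof -
  let ?z = "zt (DD u)" and ?q = "qu (DD u)" and ?\<phi> = "phD (DD u)"
  obtain cz where cz: "chain m cz" "cz 0 = ?z" using Hm_chain[OF GX_D(1)[OF u]] by blast
  obtain cf where cf: "chain m cf" "cf 0 = ?\<phi>" using Hm_chain[OF FX_Hm(2)[OF u]] by blast
  have Az: "AC Eb ?z (cz 1)" and Af: "AC Eb ?\<phi> (cf 1)" and sf: "sqi (ext (cf 1))" using cz cf m1 by (auto simp: chain_def)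
  \<comment> \<open>Solving the definition of phi for q^2 / h shows that it is in H^m and gives its
    derivative in terms of those of phi and zeta.\<close>
  define G where "G x = (1 / \<epsilon>) * ?\<phi> x + (- (1 / \<epsilon>)) * (1 * ?z x + (\<epsilon> / 2) * (?z x * ?z x))" for x
  have HG: "Hm m G" unfolding G_def[abs_def] by (intro Hm_lin FX_Hm(2)[OF u] GX_D(1)[OF u] Hm_mult)
  obtain cg where cg: "chain m cg" "cg 0 = G" using Hm_chain[OF HG] by blast
  have Ag: "AC Eb G (cg 1)" using cg m1 by (auto simp: chain_def)
  have "AC Eb G (\<lambda>x. (1 / \<epsilon>) * cf 1 x + (- (1 / \<epsilon>)) * (1 * cz 1 x + (\<epsilon> / 2) * (cz 1 x * ?z x + ?z x * cz 1 x)))"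
    unfolding G_def[abs_def] by (intro AC_add AC_cmult AC_mult Af Az)
  note ug = AC_deriv_unique[OF Ag this]
  have G: "G x = (?q x)\<^sup>2 / height \<epsilon> ?z x" for x
  proof -
    define w where "w = (?q x)\<^sup>2 / height \<epsilon> ?z x"
    have "?\<phi> x = ?z x + \<epsilon> * (?z x)\<^sup>2 / 2 + \<epsilon> * w" by (simp add: phD_def phi_def w_def)
    then have "G x = w" using \<epsilon> by (simp add: G_def field_simps power2_eq_square)
    then show ?thesis by (simp add: w_def)
  qed
  have "AEE x. (p x)\<^sup>2 / height \<epsilon> \<zeta> x = cg 0 x" using z q by eventually_elim (auto simp: cg(2) G height_def)
  from chain_weak_deriv[OF cg(1) this m1]
  have wg: "AEE x. weak_deriv E 1 (\<lambda>y. (p y)\<^sup>2 / height \<epsilon> \<zeta> y) x = cg 1 x" .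
  have wz: "AEE x. weak_deriv E 1 \<zeta> x = cz 1 x" by (rule chain_weak_deriv[OF cz(1) _ m1]) (use z cz(2) in simp)
  have "AEE x. \<epsilon> * weak_deriv E 1 (\<lambda>y. (p y)\<^sup>2 / height \<epsilon> \<zeta> y) x + height \<epsilon> \<zeta> x * weak_deriv E 1 \<zeta> x = cf 1 x"
    using ug wg wz z
  proof eventually_elim
    case (elim x)
    have "\<epsilon> * ((1 / \<epsilon>) * cf 1 x + (- (1 / \<epsilon>)) * (1 * cz 1 x + (\<epsilon> / 2) * (cz 1 x * ?z x + ?z x * cz 1 x))) + (1 + \<epsilon> * ?z x) * cz 1 x = cf 1 x"
      using \<epsilon> by (simp add: field_simps)
    then show ?case using elim by (simp add: height_def)
  qed
  then show ?thesis using that Af sf by blast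
qed

lemma Neu_phD: assumes u: "u \<in> GX" and \<phi>: "AC Eb (phD (DD u)) \<phi>'"
  shows "AC Eb (RW \<mu> (phD (DD u))) (\<lambda>x. (RU \<mu> (phD (DD u)) x - phD (DD u) x) / \<mu>\<^sup>2)"
    "AC Eb (\<lambda>x. (RU \<mu> (phD (DD u)) x - phD (DD u) x) / \<mu>\<^sup>2) (\<lambda>x. (RW \<mu> (phD (DD u)) x - \<phi>' x) / \<mu>\<^sup>2)"
    "sqi (ext (RU \<mu> (phD (DD u))))" "sqi (ext (RW \<mu> (phD (DD u))))" "sqi (ext (phD (DD u)))"
    "RW \<mu> (phD (DD u)) (-r) = 0" "RW \<mu> (phD (DD u)) r = 0" "RW \<mu> (phD (DD u)) l = 0"
proof -
  show s: "sqi (ext (phD (DD u)))" by (rule Hm_sqi[OF FX_Hm(2)[OF u]])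
  have N: "AC Eb (RU \<mu> (phD (DD u))) (RW \<mu> (phD (DD u)))" "AC Eb (RW \<mu> (phD (DD u))) (\<lambda>x. (RU \<mu> (phD (DD u)) x - phD (DD u) x) / \<mu>\<^sup>2)"
    "sqi (ext (RU \<mu> (phD (DD u))))" "sqi (ext (RW \<mu> (phD (DD u))))"
    "RW \<mu> (phD (DD u)) (-r) = 0" "RW \<mu> (phD (DD u)) r = 0" "RW \<mu> (phD (DD u)) l = 0"
    using RU_Neu[OF \<mu> s] unfolding Neu_def by blast+
  show "AC Eb (RW \<mu> (phD (DD u))) (\<lambda>x. (RU \<mu> (phD (DD u)) x - phD (DD u) x) / \<mu>\<^sup>2)"
    "sqi (ext (RU \<mu> (phD (DD u))))" "sqi (ext (RW \<mu> (phD (DD u))))"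
    "RW \<mu> (phD (DD u)) (-r) = 0" "RW \<mu> (phD (DD u)) r = 0" "RW \<mu> (phD (DD u)) l = 0" by (fact N)+
  show "AC Eb (\<lambda>x. (RU \<mu> (phD (DD u)) x - phD (DD u) x) / \<mu>\<^sup>2) (\<lambda>x. (RW \<mu> (phD (DD u)) x - \<phi>' x) / \<mu>\<^sup>2)"
    using AC_cmult[OF AC_diff[OF N(1) \<phi>], of "1 / \<mu>\<^sup>2"] by simp
qed

lemma sqi_ext_div: "sqi (ext f) \<Longrightarrow> sqi (ext g) \<Longrightarrow> sqi (ext (\<lambda>x. (f x - g x) / c))"
  using sqi_ext_lin[of f g "1 / c" "- 1 / c"] by (simp add: diff_divide_distrib)

text \<open>If u solves the Neumann problem for phi, then - u' satisfies the equation with right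
  side - phi'; the multiple of \<open>ef\<close> solves the homogeneous equation.\<close>

lemma Fq_momentum:
  assumes u: "u \<in> GX" and \<phi>: "AC Eb (phD (DD u)) \<phi>'" "sqi (ext \<phi>')"
  shows "AEE x. Fq (DD u) x - \<mu>\<^sup>2 * weak_deriv E 2 (Fq (DD u)) x + \<phi>' x = 0"
proof -
  let ?\<phi> = "phD (DD u)" and ?F = "Fq (DD u)"
  note N = Neu_phD[OF u \<phi>(1)]
  have e: "sqi (ext (ef \<mu>))" "sqi (ext (ed \<mu>))" using Hm_sqi ef_props(3,4)[OF \<mu>] by blast+
  define F1 where "F1 x = (-1) * ((RU \<mu> ?\<phi> x - ?\<phi> x) / \<mu>\<^sup>2) + cc (DD u) * ed \<mu> x" for x
  define F2 where "F2 x = (-1) * ((RW \<mu> ?\<phi> x - \<phi>' x) / \<mu>\<^sup>2) + cc (DD u) * (ef \<mu> x / \<mu>\<^sup>2)" for x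
  have 1: "AC Eb ?F F1" unfolding Fq_def[abs_def] F1_def[abs_def] by (intro AC_add AC_cmult N ef_props(1)[OF \<mu>])
  have 2: "AC Eb F1 F2" unfolding F1_def[abs_def] F2_def[abs_def] by (intro AC_add AC_cmult N ef_props(2)[OF \<mu>])
  have s1: "sqi (ext F1)" unfolding F1_def[abs_def] by (intro sqi_ext_lin sqi_ext_div N e)
  have "sqi (ext (\<lambda>x. (-1) * ((RW \<mu> ?\<phi> x - \<phi>' x) / \<mu>\<^sup>2) + (cc (DD u) / \<mu>\<^sup>2) * ef \<mu> x))" by (intro sqi_ext_lin sqi_ext_div N \<phi>(2) e)
  then have s2: "sqi (ext F2)" unfolding F2_def[abs_def] by simp
  have s0: "sqi (ext ?F)" unfolding Fq_def[abs_def] by (intro sqi_ext_lin N e)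
  have "AEE x. weak_deriv E 2 ?F x = (if (2::nat) = 0 then ?F else if (2::nat) = 1 then F1 else F2) x"
    by (rule chain_weak_deriv[OF chain_2I[OF 1 2 s0 s1 s2]]) simp_all
  then have "AEE x. weak_deriv E 2 ?F x = F2 x" by simp
  moreover have "\<mu>\<^sup>2 * F2 x = (- RW \<mu> ?\<phi> x + \<phi>' x) + cc (DD u) * ef \<mu> x" for x
    using \<mu> by (simp add: F2_def distrib_left)
  ultimately show ?thesis
    by (auto simp: Fq_def elim!: eventually_mono)
qed

text \<open>Conversely, a solution of the momentum equation with these traces differs from the
  explicit one by a homogeneous solution with zero Dirichlet data, and
  \<open>homogeneous_zero\<close> applies.\<close>

lemma momentum_solution:
  assumes u: "u \<in> GX" and z: "AEE x. \<zeta> x = zt (DD u) x" and q: "AEE x. p x = qu (DD u) x"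
    and X: "Hm (Suc m) X" "AEE x. pt x = X x" and b: "X (-r) = b" "X r = b" "X l = 0"
    and eq: "AEE x. (pt x - \<mu>\<^sup>2 * weak_deriv E 2 pt x) + \<epsilon> * weak_deriv E 1 (\<lambda>y. (p y)\<^sup>2 / height \<epsilon> \<zeta> y) x
       + height \<epsilon> \<zeta> x * weak_deriv E 1 \<zeta> x = 0"
    and x: "x \<in> Eb"
  shows "X x = (-1) * RW \<mu> (phD (DD u)) x + b * ef \<mu> x"
proof -
  obtain \<phi>' where \<phi>: "AC Eb (phD (DD u)) \<phi>'" "sqi (ext \<phi>')"
    "AEE x. \<epsilon> * weak_deriv E 1 (\<lambda>y. (p y)\<^sup>2 / height \<epsilon> \<zeta> y) x + height \<epsilon> \<zeta> x * weak_deriv E 1 \<zeta> x = \<phi>' x"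
    by (rule momentum_flux[OF u z q])
  let ?\<phi> = "phD (DD u)"
  note N = Neu_phD[OF u \<phi>(1)]
  have e: "sqi (ext (ef \<mu>))" "sqi (ext (ed \<mu>))" using Hm_sqi ef_props(3,4)[OF \<mu>] by blast+
  obtain c where c: "chain (Suc m) c" "c 0 = X" using Hm_chain[OF X(1)] by blast
  have m2: "2 \<le> Suc m" using m1 by simp
  have A: "AC Eb X (c 1)" "AC Eb (c 1) (c 2)" "sqi (ext X)" "sqi (ext (c 1))"
    using c m1 unfolding chain_def by (auto simp: numeral_2_eq_2)
  have w2: "AEE x. weak_deriv E 2 pt x = c 2 x" by (rule chain_weak_deriv[OF c(1) _ m2]) (use X(2) c(2) in simp)
  define Y where "Y x = X x + (1 * RW \<mu> ?\<phi> x + (- b) * ef \<mu> x)" for x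
  define w where "w x = c 1 x + (1 * ((RU \<mu> ?\<phi> x - ?\<phi> x) / \<mu>\<^sup>2) + (- b) * ed \<mu> x)" for x
  have 1: "AC Eb Y w" unfolding Y_def[abs_def] w_def[abs_def] by (intro AC_add AC_cmult A N ef_props(1)[OF \<mu>])
  have 2: "AC Eb w (\<lambda>x. c 2 x + (1 * ((RW \<mu> ?\<phi> x - \<phi>' x) / \<mu>\<^sup>2) + (- b) * (ef \<mu> x / \<mu>\<^sup>2)))"
    unfolding w_def[abs_def] by (intro AC_add AC_cmult A N ef_props(2)[OF \<mu>])
  have "AEE x. c 2 x + (1 * ((RW \<mu> ?\<phi> x - \<phi>' x) / \<mu>\<^sup>2) + (- b) * (ef \<mu> x / \<mu>\<^sup>2)) = Y x / \<mu>\<^sup>2"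
    using eq w2 X(2) \<phi>(3)
  proof eventually_elim
    case (elim x)
    show ?case
    proof
      assume "x \<in> E"
      then have "\<mu>\<^sup>2 * c 2 x = X x + \<phi>' x" using elim by auto
      moreover have "\<mu>\<^sup>2 \<noteq> 0" using \<mu> by simp
      ultimately have "c 2 x = (X x + \<phi>' x) / \<mu>\<^sup>2" by (simp add: field_simps)
      then show "c 2 x + (1 * ((RW \<mu> ?\<phi> x - \<phi>' x) / \<mu>\<^sup>2) + (- b) * (ef \<mu> x / \<mu>\<^sup>2)) = Y x / \<mu>\<^sup>2"
        by (simp add: Y_def add_divide_distrib diff_divide_distrib)
    qed
  qed
  from AC_AE_cong[OF 2 AE_E_Eb[OF this] Eb_sets] have 2: "AC Eb w (\<lambda>x. Y x / \<mu>\<^sup>2)" .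
  have "sqi (ext (\<lambda>x. 1 * X x + 1 * (1 * RW \<mu> ?\<phi> x + (- b) * ef \<mu> x)))" by (intro sqi_ext_lin A N e)
  then have s1: "sqi (ext Y)" by (simp add: Y_def[abs_def])
  have "sqi (ext (\<lambda>x. 1 * c 1 x + 1 * (1 * ((RU \<mu> ?\<phi> x - ?\<phi> x) / \<mu>\<^sup>2) + (- b) * ed \<mu> x)))" by (intro sqi_ext_lin sqi_ext_div A N e)
  then have s2: "sqi (ext w)" by (simp add: w_def[abs_def])
  have "Y (-r) = 0" "Y r = 0" "Y l = 0" using b N(6-8) ef_props(5-7)[OF \<mu>] by (auto simp: Y_def)
  then have "Y x = 0" using homogeneous_zero(1)[OF \<mu> 1 2 s1 s2 _ _ _ x] by simp
  then show ?thesis by (simp add: Y_def)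
qed

text \<open>All jumps and means are evaluated by traces of continuous representatives; what remains
  is a scalar linear equation for \<open>b\<close> with coefficient \<open>den\<close>, which is
  positive.\<close>

lemma transmission_iff:
  assumes u: "u \<in> GX" and z: "AEE x. \<zeta> x = zt (DD u) x" and q: "AEE x. p x = qu (DD u) x"
  shows "(2 * r / hw + T_coeff r l \<mu> (height \<epsilon> \<zeta>)) * b - \<epsilon> / 2 * jump r (\<lambda>x. 1 / (height \<epsilon> \<zeta> x)\<^sup>2) * (av (DD u))\<^sup>2
      = - jump r (calF r l \<epsilon> \<mu> \<zeta> p) - P0 * (average r l \<zeta> - \<kappa> * dv (DD u)) \<longleftrightarrow> b = cc (DD u)"
proof -
  let ?D = "DD u" let ?z = "zt ?D"
  have cz: "contB ?z" by (rule Hm_contB[OF GX_D(1)[OF u] m1])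
  have nz: "1 + \<epsilon> * ?z x \<noteq> 0" if "x \<in> {-r-1..-r} \<union> {r..l}" for x
  proof -
    have "x \<in> Eb" using that by (auto simp: Eb_def)
    from GX_D(6)[OF u this] show ?thesis by (simp add: height_def)
  qed
  have ci: "contB (iv ?z)" using cz unfolding contB_def iv_def[abs_def] height_def
    by (intro conjI continuous_intros) (use nz in auto)
  have ci2: "contB (\<lambda>x. (iv ?z x)\<^sup>2)" using ci unfolding contB_def by (intro conjI continuous_intros) auto
  have s: "sqi (ext (phD ?D))" by (rule Hm_sqi[OF FX_Hm(2)[OF u]])
  have "contB (RU \<mu> (phD ?D))" using RU_Neu[OF \<mu> s] AC_contB unfolding Neu_def by blast
  then have cF: "contB (FF ?D)" using cz ci unfolding contB_def FF_def[abs_def] by (intro conjI continuous_intros) auto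
  have a1: "AEE x. 1 / height \<epsilon> \<zeta> x = iv ?z x" using z by eventually_elim (auto simp: iv_def height_def)
  have a2: "AEE x. 1 / (height \<epsilon> \<zeta> x)\<^sup>2 = (iv ?z x)\<^sup>2" using z by eventually_elim (auto simp: iv_def height_def power_divide)
  have "AEE x. phi \<epsilon> \<zeta> p x = phD ?D x" using z q by eventually_elim (auto simp: phD_def phi_def height_def)
  note R = R1_eq[OF \<mu> s this]
  have a3: "AEE x. calF r l \<epsilon> \<mu> \<zeta> p x = FF ?D x"
    using z R by eventually_elim (auto simp: calF_def FF_def iv_def height_def)
  have av: "average r l \<zeta> = average r l ?z" by (rule average_cong[OF Hm_sqi[OF GX_D(1)[OF u]] z])
  have d: "2 * r / hw + T_coeff r l \<mu> (height \<epsilon> \<zeta>) = den ?D"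
    unfolding T_coeff_def trace(6,7)[OF ci a1] den_def by simp
  have "iv ?z r > 0" "iv ?z (-r) > 0" using GX_D(6)[OF u] bdry_Eb by (auto simp: iv_def)
  then have dp: "den ?D > 0" using den_ge[of ?D] \<alpha>_pos by linarith
  have "den ?D * b - \<epsilon> / 2 * ((iv ?z r)\<^sup>2 - (iv ?z (-r))\<^sup>2) * (av ?D)\<^sup>2 = - (FF ?D r - FF ?D (-r)) - P0 * (average r l ?z - \<kappa> * dv ?D) \<longleftrightarrow> den ?D * b = num ?D"
    unfolding num_def by linarith
  also have "\<dots> \<longleftrightarrow> b = cc ?D" using dp by (auto simp: cc_def field_simps)
  finally show ?thesis unfolding d trace(6)[OF ci2 a2] trace(6)[OF cF a3] av .
qed

lemma continuity_iff:
  assumes q: "p \<in> Sobolev E (Suc m)" and z: "\<zeta>t \<in> Sobolev E m"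
  shows "(AEE x. \<zeta>t x + weak_deriv E 1 p x = 0) \<longleftrightarrow> emb m \<zeta>t = - shift (emb (Suc m) p)"
proof -
  note P = fn_emb_Sobolev[OF q] and Z = fn_emb_Sobolev[OF z]
  let ?q = "fn (Suc m) (emb (Suc m) p)" and ?y = "fn m (emb m \<zeta>t)"
  obtain c where c: "chain (Suc m) c" "c 0 = ?q" using Hm_chain[OF P(2)] by blast
  have A: "AC Eb ?q (c 1)" using c by (auto simp: chain_def)
  have "chain m (\<lambda>k. c (Suc k))" using c(1) by (auto simp: chain_def)
  from chain_Hm[OF this] have H: "Hm m (c 1)" by simp
  have sh: "shift (emb (Suc m) p) = emb m (c 1)"
    using shift_emb[OF A H P(2)] fn_Hm(2)[OF P(1)] by simp
  have w: "AEE x. weak_deriv E 1 p x = c 1 x" by (rule chain_weak_deriv[OF c(1)]) (use P(3) c(2) in simp_all)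
  have L: "emb m (\<lambda>x. ?y x + c 1 x) = emb m \<zeta>t + shift (emb (Suc m) p)"
    using emb_lin[OF Z(2) H, of 1 1] fn_Hm(2)[OF Z(1)] by (simp add: sh)
  have HL: "Hm m (\<lambda>x. ?y x + c 1 x)" using Hm_lin[OF Z(2) H, of 1 1] by simp
  have "(AEE x. \<zeta>t x + weak_deriv E 1 p x = 0) \<longleftrightarrow> (AEE x. ?y x + c 1 x = 0)"
  proof
    assume "AEE x. \<zeta>t x + weak_deriv E 1 p x = 0"
    then show "AEE x. ?y x + c 1 x = 0" using w Z(3) by eventually_elim auto
  next
    assume "AEE x. ?y x + c 1 x = 0"
    then show "AEE x. \<zeta>t x + weak_deriv E 1 p x = 0" using w Z(3) by eventually_elim auto
  qed
  also have "\<dots> \<longleftrightarrow> emb m (\<lambda>x. ?y x + c 1 x) = 0"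
  proof
    assume "AEE x. ?y x + c 1 x = 0"
    from Hm_AE_Sobolev(2)[OF Hm_zero this] show "emb m (\<lambda>x. ?y x + c 1 x) = 0" by (simp add: emb_zero)
  qed (rule emb_eq_0_AE[OF HL])
  also have "\<dots> \<longleftrightarrow> emb m \<zeta>t = - shift (emb (Suc m) p)" unfolding L by (rule add_eq_0_iff2)
  finally show ?thesis .
qed

end

section \<open>Passing between solutions of the problem and trajectories of the differential
  equation\<close>

context prob
begin

lemma GX_I:
  assumes z: "\<zeta> \<in> Sobolev E m" and q: "p \<in> Sobolev E (Suc m)" and h: "ess_inf_pos E (height \<epsilon> \<zeta>)"
    and j: "jump r p = 0" "mean r p = a" "ess_tendsto p 0 (at_left l)"
  shows "(emb m \<zeta>, emb (Suc m) p, a, d) \<in> GX" (is "?u \<in> GX")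
    "AEE x. \<zeta> x = zt (DD (emb m \<zeta>, emb (Suc m) p, a, d)) x" "AEE x. p x = qu (DD (emb m \<zeta>, emb (Suc m) p, a, d)) x"
proof -
  note Z = fn_emb_Sobolev[OF z] and P = fn_emb_Sobolev[OF q]
  show "AEE x. \<zeta> x = zt (DD (emb m \<zeta>, emb (Suc m) p, a, d)) x"
    "AEE x. p x = qu (DD (emb m \<zeta>, emb (Suc m) p, a, d)) x"
    unfolding DD_simps fst_conv snd_conv by (rule Z(3), rule P(3))
  have "contB (fn (Suc m) (emb (Suc m) p))" by (rule Hm_contB[OF P(2)]) simp
  note tr = trace[OF this P(3)]
  have 1: "fn (Suc m) (emb (Suc m) p) r - fn (Suc m) (emb (Suc m) p) (-r) = 0"
    "(fn (Suc m) (emb (Suc m) p) r + fn (Suc m) (emb (Suc m) p) (-r)) / 2 = a" using j(1,2) tr(6,7) by simp_all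
  have 2: "fn (Suc m) (emb (Suc m) p) l = 0" by (rule ess_tendsto_unique[OF thick_at_left tr(3) j(3)])
  have "\<exists>\<delta>>0. \<forall>x\<in>Eb. height \<epsilon> (fn m (emb m \<zeta>)) x \<ge> \<delta>" using ess_inf_pos_iff[OF Z(2,3)] h by blast
  then show "?u \<in> GX" using Z(1) P(1) 1 2 by (simp add: GX_def St_def DD_simps)
qed

lemma average_continuous:
  assumes z: "\<And>t. t \<in> I \<Longrightarrow> \<zeta> t \<in> Sobolev E m" and c: "continuous_on I (\<lambda>t. emb m (\<zeta> t))"
  shows "continuous_on I (\<lambda>t. average r l (\<zeta> t))"
  unfolding continuous_on_def
proof
  fix t assume t: "t \<in> I"
  have le: "\<bar>average r l (\<zeta> s) - average r l (\<zeta> t)\<bar> \<le> CS * norm (emb m (\<zeta> s) - emb m (\<zeta> t))" if s: "s \<in> I" for s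
  proof -
    note S = fn_emb_Sobolev[OF z[OF s]] and T = fn_emb_Sobolev[OF z[OF t]]
    have cs: "continuous_on {r..l} (fn m (emb m (\<zeta> s)))" "continuous_on {r..l} (fn m (emb m (\<zeta> t)))"
      using Hm_contB[OF S(2) m1] Hm_contB[OF T(2) m1] by (auto simp: contB_def)
    have "\<bar>average r l (\<lambda>x. fn m (emb m (\<zeta> s)) x - fn m (emb m (\<zeta> t)) x)\<bar> \<le> CS * norm (emb m (\<zeta> s) - emb m (\<zeta> t))"
    proof (rule average_bound)
      show "continuous_on {r..l} (\<lambda>x. fn m (emb m (\<zeta> s)) x - fn m (emb m (\<zeta> t)) x)" by (intro continuous_on_diff cs)
      show "\<bar>fn m (emb m (\<zeta> s)) x - fn m (emb m (\<zeta> t)) x\<bar> \<le> CS * norm (emb m (\<zeta> s) - emb m (\<zeta> t))" if "x \<in> {r..l}" for x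
        by (rule Hb_sup[OF fn_diff_bound[OF S(1) T(1)] m1]) (use that Eb_rl in blast)
    qed
    then show ?thesis
      unfolding average_diff[OF cs] average_cong[OF Hm_sqi[OF S(2)] S(3)] average_cong[OF Hm_sqi[OF T(2)] T(3)] .
  qed
  have lim: "((\<lambda>s. emb m (\<zeta> s)) \<longlongrightarrow> emb m (\<zeta> t)) (at t within I)" using c t by (simp add: continuous_on_def)
  show "((\<lambda>t. average r l (\<zeta> t)) \<longlongrightarrow> average r l (\<zeta> t)) (at t within I)"
  proof (rule LIM_zero_cancel, rule Lim_null_comparison)
    show "\<forall>\<^sub>F s in at t within I. norm (average r l (\<zeta> s) - average r l (\<zeta> t)) \<le> CS * norm (emb m (\<zeta> s) - emb m (\<zeta> t))"
      using le by (simp add: eventually_at_filter)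
    show "((\<lambda>s. CS * norm (emb m (\<zeta> s) - emb m (\<zeta> t))) \<longlongrightarrow> 0) (at t within I)"
      using lim by (auto intro!: tendsto_eq_intros tendsto_norm_zero simp: LIM_zero)
  qed
qed

lemma is_solution_Sobolev:
  assumes "is_solution r l hw P0 \<kappa> \<epsilon> \<mu> m \<zeta>in qin qiin T \<zeta> q qi" "t \<in> {0..<T}"
  shows "\<zeta> t \<in> Sobolev E m" "q t \<in> Sobolev E (Suc m)"
  using assms unfolding is_solution_def C1_Sobolev_def by auto

text \<open>Each equation of the problem identifies one component of the time derivative of the jets
  with that of the vector field; the trajectory is completed by the memory integral, which starts at
  0.\<close>

lemma solution_imp_sol:
  assumes "is_solution r l hw P0 \<kappa> \<epsilon> \<mu> m \<zeta>in qin qiin T \<zeta> q qi" and in0: "\<zeta>in \<in> Sobolev E m" "qin \<in> Sobolev E (Suc m)"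
  shows "sol T (\<lambda>t. (emb m (\<zeta> t), emb (Suc m) (q t), qi t, duhamel \<kappa> (\<lambda>s. average r l (\<zeta> s)) t)) (emb m \<zeta>in, emb (Suc m) qin, qiin, 0)"
    (is "sol T ?U _")
proof -
  obtain \<zeta>t qt qit where
    C: "C1_Sobolev E m {0..<T} \<zeta> \<zeta>t" "C1_Sobolev E (Suc m) {0..<T} q qt"
    and qi: "\<And>t. t \<in> {0..<T} \<Longrightarrow> (qi has_real_derivative qit t) (at t within {0..<T})"
    and init: "AEE x. \<zeta> 0 x = \<zeta>in x \<and> q 0 x = qin x" "qi 0 = qiin"
    and S: "\<And>t. t \<in> {0..<T} \<Longrightarrow> let h = height \<epsilon> (\<zeta> t) in
        ess_inf_pos E h \<and>
        (AEE x. \<zeta>t t x + weak_deriv E 1 (q t) x = 0) \<and>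
        (AEE x.
           (qt t x - \<mu>\<^sup>2 * weak_deriv E 2 (qt t) x)
           + \<epsilon> * weak_deriv E 1 (\<lambda>y. (q t y)\<^sup>2 / h y) x
           + h x * weak_deriv E 1 (\<zeta> t) x = 0) \<and>
        ess_tendsto (\<zeta> t) 0 at_bot \<and> ess_tendsto (q t) 0 at_bot \<and>
        ess_tendsto (q t) 0 (at_left l) \<and>
        jump r (q t) = 0 \<and> mean r (q t) = qi t \<and>
        (2 * r / hw + T_coeff r l \<mu> h) * qit t
          - \<epsilon> / 2 * jump r (\<lambda>x. 1 / (h x)\<^sup>2) * (qi t)\<^sup>2
        = - jump r (calF r l \<epsilon> \<mu> (\<zeta> t) (q t))
          - P0 * (average r l (\<zeta> t) - \<kappa> * duhamel \<kappa> (\<lambda>s. average r l (\<zeta> s)) t)"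
    using assms(1) unfolding is_solution_def Suc_eq_plus1 by blast
  note C1 = C(1)[unfolded C1_Sobolev_iff] and C2 = C(2)[unfolded C1_Sobolev_iff]
  have zS: "\<zeta> t \<in> Sobolev E m" "\<zeta>t t \<in> Sobolev E m" "q t \<in> Sobolev E (Suc m)" "qt t \<in> Sobolev E (Suc m)"
    and dz: "((\<lambda>s. emb m (\<zeta> s)) has_vector_derivative emb m (\<zeta>t t)) (at t within {0..<T})"
    and dq: "((\<lambda>s. emb (Suc m) (q s)) has_vector_derivative emb (Suc m) (qt t)) (at t within {0..<T})"
    if "t \<in> {0..<T}" for t using C1 C2 that by blast+
  have cz: "continuous_on {0..<T} (\<lambda>t. emb m (\<zeta> t))"
    unfolding continuous_on_eq_continuous_within using dz has_vector_derivative_continuous by blast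
  note ca = average_continuous[OF zS(1) cz]
  have GX: "?U t \<in> GX" "AEE x. \<zeta> t x = zt (DD (?U t)) x" "AEE x. q t x = qu (DD (?U t)) x"
    if t: "t \<in> {0..<T}" for t
    by (rule GX_I[OF zS(1)[OF t] zS(3)[OF t]]; use S[OF t] in \<open>simp add: Let_def\<close>)+
  show ?thesis
    unfolding sol_def
  proof (intro conjI ballI)
    obtain g where g: "Hm m g" "AEE x. \<zeta>in x = g x" "emb m \<zeta>in = emb m g" using Sobolev_rep[OF in0(1)] .
    obtain k where k: "Hm (Suc m) k" "AEE x. qin x = k x" "emb (Suc m) qin = emb (Suc m) k" using Sobolev_rep[OF in0(2)] .
    have "AEE x. \<zeta> 0 x = g x" using init(1) g(2) by eventually_elim auto
    from Hm_AE_Sobolev(2)[OF g(1) this] have 1: "emb m (\<zeta> 0) = emb m \<zeta>in" using g(3) by simp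
    have "AEE x. q 0 x = k x" using init(1) k(2) by eventually_elim auto
    from Hm_AE_Sobolev(2)[OF k(1) this] have 2: "emb (Suc m) (q 0) = emb (Suc m) qin" using k(3) by simp
    show "?U 0 = (emb m \<zeta>in, emb (Suc m) qin, qiin, 0)" using 1 2 init(2) by (simp add: duhamel_0)
    fix t assume t: "t \<in> {0..<T}"
    show G: "?U t \<in> GX" by (rule GX(1)[OF t])
    note ae = GX(2,3)[OF t]
    let ?D = "DD (?U t)"
    let ?d = "(emb m (\<zeta>t t), emb (Suc m) (qt t), qit t, average r l (\<zeta> t) - \<kappa> * duhamel \<kappa> (\<lambda>s. average r l (\<zeta> s)) t)"
    have d: "(?U has_vector_derivative ?d) (at t within {0..<T})"
      using dz[OF t] dq[OF t] qi[OF t] duhamel_derivative[OF ca t, of \<kappa>]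
      unfolding has_real_derivative_iff_has_vector_derivative by (intro has_vector_derivative_Pair)
    \<comment> \<open>The problem prescribes traces of q only. As the time derivative stays in the
      closed subspace, dq/dt has trace dq_i/dt at -r and r and trace 0 at l.\<close>
    have dS: "?d \<in> St"
      by (rule vector_derivative_mem_closed_subspace[OF St_subspace St_closed _ d t at_within_Ico_nontrivial[OF t]])
        (use GX(1) in \<open>simp add: GX_def\<close>)
    note X = fn_emb_Sobolev[OF zS(4)[OF t]]
    let ?X = "fn (Suc m) (emb (Suc m) (qt t))"
    have b: "?X (-r) = qit t" "?X r = qit t" "?X l = 0" using dS by (simp_all add: St_def)
    have avd: "av ?D = qi t" "dv ?D = duhamel \<kappa> (\<lambda>s. average r l (\<zeta> s)) t" by (simp_all add: DD_simps)
    have c: "qit t = cc ?D"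
      using S[OF t] transmission_iff[OF G ae, of "qit t"] unfolding avd Let_def by blast
    have X': "?X x = Fq ?D x" if "x \<in> Eb" for x
      using momentum_solution[OF G ae X(2,3) b _ that] S[OF t] unfolding Let_def by (simp add: Fq_def c)
    have "AEE x. qt t x = Fq ?D x" using X(3) by eventually_elim (use X' E_Eb in auto)
    from Hm_AE_Sobolev(2)[OF FX_Hm(1)[OF G] this] have e2: "emb (Suc m) (qt t) = emb (Suc m) (Fq ?D)" .
    have e1: "emb m (\<zeta>t t) = - shift (emb (Suc m) (q t))"
      using continuity_iff[OF zS(3)[OF t] zS(2)[OF t]] S[OF t] unfolding Let_def by blast
    have e4: "average r l (\<zeta> t) = average r l (zt ?D)" by (rule average_cong[OF Hm_sqi[OF GX_D(1)[OF G]] ae(1)])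
    have "?d = FX (?U t)" unfolding FX_def e1 e2 e4 c avd(2) by simp
    then show "(?U has_vector_derivative FX (?U t)) (at t within {0..<T})" using d by simp
  qed
qed

lemma sol_continuous_FX: assumes "sol T U u" shows "continuous_on {0..<T} (\<lambda>t. FX (U t))"
  unfolding continuous_on_def
proof
  fix t assume t: "t \<in> {0..<T}"
  have G: "U s \<in> GX" if "s \<in> {0..<T}" for s using assms that unfolding sol_def by blast
  have lim: "(U \<longlongrightarrow> U t) (at t within {0..<T})" using sol_continuous[OF assms] t by (simp add: continuous_on_def)
  obtain \<rho> L where \<rho>: "\<rho> > 0" and L: "\<And>v w. v \<in> St \<Longrightarrow> norm (v - U t) \<le> \<rho> \<Longrightarrow> w \<in> St \<Longrightarrow> norm (w - U t) \<le> \<rho> \<Longrightarrow> norm (FX v - FX w) \<le> L * norm (v - w)"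
    using FX_locally_Lipschitz[of "sizeX (U t)"] G[OF t] by blast
  have St: "U s \<in> St" if "s \<in> {0..<T}" for s using G[OF that] by (simp add: GX_def)
  show "((\<lambda>t. FX (U t)) \<longlongrightarrow> FX (U t)) (at t within {0..<T})"
  proof (rule LIM_zero_cancel, rule Lim_null_comparison)
    have "\<forall>\<^sub>F s in at t within {0..<T}. dist (U s) (U t) < \<rho>" using lim \<rho> by (rule tendstoD)
    moreover have "\<forall>\<^sub>F s in at t within {0..<T}. s \<in> {0..<T}" by (simp add: eventually_at_filter)
    ultimately show "\<forall>\<^sub>F s in at t within {0..<T}. norm (FX (U s) - FX (U t)) \<le> L * norm (U s - U t)"
    proof eventually_elim
      case (elim s)
      show ?case by (rule L[OF St[OF elim(2)] _ St[OF t]]) (use elim \<rho> in \<open>auto simp: dist_norm\<close>)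
    qed
    show "((\<lambda>s. L * norm (U s - U t)) \<longlongrightarrow> 0) (at t within {0..<T})"
      using lim by (auto intro!: tendsto_eq_intros tendsto_norm_zero simp: LIM_zero)
  qed
qed

text \<open>The components of the trajectory are read through \<open>fn\<close>, whose
  representatives have genuine traces; the spatial decay follows from membership in H^1.\<close>

lemma sol_imp_solution:
  assumes sol: "sol T U (emb m \<zeta>in, emb (Suc m) qin, qiin, 0)" and in0: "\<zeta>in \<in> Sobolev E m" "qin \<in> Sobolev E (Suc m)"
  shows "is_solution r l hw P0 \<kappa> \<epsilon> \<mu> m \<zeta>in qin qiin T (\<lambda>t. zt (DD (U t))) (\<lambda>t. qu (DD (U t))) (\<lambda>t. av (DD (U t)))"
proof -
  have U0: "U 0 = (emb m \<zeta>in, emb (Suc m) qin, qiin, 0)" using sol by (simp add: sol_def)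
  have G: "U t \<in> GX" and d: "(U has_vector_derivative FX (U t)) (at t within {0..<T})" if "t \<in> {0..<T}" for t
    using sol that unfolding sol_def by blast+
  have hsU: "fst (U t) \<in> hs m" "fst (snd (U t)) \<in> hs (Suc m)" "fst (FX (U t)) \<in> hs m" if "t \<in> {0..<T}" for t
    using G[OF that] FX_St[OF G[OF that]] by (auto simp: GX_def St_def)
  have cF: "continuous_on {0..<T} (\<lambda>t. FX (U t))" by (rule sol_continuous_FX[OF sol])
  define \<zeta>t where "\<zeta>t t = fn m (fst (FX (U t)))" for t
  have ez: "emb m (zt (DD (U t))) = fst (U t)" "emb (Suc m) (qu (DD (U t))) = fst (snd (U t))" "emb m (\<zeta>t t) = fst (FX (U t))"
    "emb (Suc m) (Fq (DD (U t))) = fst (snd (FX (U t)))" if "t \<in> {0..<T}" for t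
    using fn_Hm(2) hsU[OF that] by (simp_all add: DD_simps \<zeta>t_def) (simp add: FX_def)
  have zS: "zt (DD (U t)) \<in> Sobolev E m" "qu (DD (U t)) \<in> Sobolev E (Suc m)" "\<zeta>t t \<in> Sobolev E m" "Fq (DD (U t)) \<in> Sobolev E (Suc m)"
    if t: "t \<in> {0..<T}" for t
    using Hm_AE_Sobolev(1)[OF GX_D(1)[OF G[OF t]]] Hm_AE_Sobolev(1)[OF GX_D(2)[OF G[OF t]]] Hm_AE_Sobolev(1)[OF fn_Hm(1)[OF hsU(3)[OF t]]]
      Hm_AE_Sobolev(1)[OF FX_Hm(1)[OF G[OF t]]] by (simp_all add: \<zeta>t_def)
  have comp: "((\<lambda>s. fst (U s)) has_vector_derivative fst (FX (U t))) (at t within {0..<T})"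
    "((\<lambda>s. fst (snd (U s))) has_vector_derivative fst (snd (FX (U t)))) (at t within {0..<T})"
    "((\<lambda>s. av (DD (U s))) has_vector_derivative cc (DD (U t))) (at t within {0..<T})"
    "((\<lambda>s. dv (DD (U s))) has_vector_derivative average r l (zt (DD (U t))) - \<kappa> * dv (DD (U t))) (at t within {0..<T})" if t: "t \<in> {0..<T}" for t
  proof -
    note s = bounded_linear.has_vector_derivative[OF bounded_linear_snd d[OF t]]
    note ss = bounded_linear.has_vector_derivative[OF bounded_linear_snd s]
    show "((\<lambda>s. fst (U s)) has_vector_derivative fst (FX (U t))) (at t within {0..<T})"
      by (rule bounded_linear.has_vector_derivative[OF bounded_linear_fst d[OF t]])
    show "((\<lambda>s. fst (snd (U s))) has_vector_derivative fst (snd (FX (U t)))) (at t within {0..<T})"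
      by (rule bounded_linear.has_vector_derivative[OF bounded_linear_fst s])
    show "((\<lambda>s. av (DD (U s))) has_vector_derivative cc (DD (U t))) (at t within {0..<T})"
      using bounded_linear.has_vector_derivative[OF bounded_linear_fst ss] by (simp add: DD_simps FX_def)
    show "((\<lambda>s. dv (DD (U s))) has_vector_derivative average r l (zt (DD (U t))) - \<kappa> * dv (DD (U t))) (at t within {0..<T})"
      using bounded_linear.has_vector_derivative[OF bounded_linear_snd ss] by (simp add: DD_simps FX_def)
  qed
  have cU: "continuous_on {0..<T} (\<lambda>t. fst (U t))" using sol_continuous[OF sol] by (intro continuous_intros)
  have C1: "C1_Sobolev E m {0..<T} (\<lambda>t. zt (DD (U t))) \<zeta>t"
    unfolding C1_Sobolev_iff
  proof (intro conjI ballI)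
    show "continuous_on {0..<T} (\<lambda>t. emb m (\<zeta>t t))"
      using continuous_on_fst[OF cF] by (rule continuous_on_eq) (simp add: ez)
    fix t assume t: "t \<in> {0..<T}"
    show "zt (DD (U t)) \<in> Sobolev E m" "\<zeta>t t \<in> Sobolev E m" by (rule zS[OF t])+
    show "((\<lambda>s. emb m (zt (DD (U s)))) has_vector_derivative emb m (\<zeta>t t)) (at t within {0..<T})"
      unfolding ez(3)[OF t] by (rule has_vector_derivative_transform[OF t ez(1) comp(1)[OF t]])
  qed
  have C2: "C1_Sobolev E (Suc m) {0..<T} (\<lambda>t. qu (DD (U t))) (\<lambda>t. Fq (DD (U t)))"
    unfolding C1_Sobolev_iff
  proof (intro conjI ballI)
    show "continuous_on {0..<T} (\<lambda>t. emb (Suc m) (Fq (DD (U t))))"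
      using continuous_on_fst[OF continuous_on_snd[OF cF]] by (rule continuous_on_eq) (simp add: ez)
    fix t assume t: "t \<in> {0..<T}"
    show "qu (DD (U t)) \<in> Sobolev E (Suc m)" "Fq (DD (U t)) \<in> Sobolev E (Suc m)" by (rule zS[OF t])+
    show "((\<lambda>s. emb (Suc m) (qu (DD (U s)))) has_vector_derivative emb (Suc m) (Fq (DD (U t)))) (at t within {0..<T})"
      unfolding ez(4)[OF t] by (rule has_vector_derivative_transform[OF t ez(2) comp(2)[OF t]])
  qed
  have ca: "continuous_on {0..<T} (\<lambda>t. average r l (zt (DD (U t))))"
  proof (rule average_continuous[OF zS(1)])
    show "continuous_on {0..<T} (\<lambda>t. emb m (zt (DD (U t))))" using cU by (rule continuous_on_eq) (simp add: ez)
  qed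
  \<comment> \<open>The fourth component satisfies the linear equation of the memory term with zero
    initial value, so it is the Duhamel integral of the average.\<close>
  have duh: "dv (DD (U t)) = duhamel \<kappa> (\<lambda>s. average r l (zt (DD (U s)))) t" if t: "t \<in> {0..<T}" for t
    by (rule duhamel_unique[OF ca _ _ t, where y="\<lambda>t. dv (DD (U t))"])
      (use comp(4) in \<open>simp_all add: has_real_derivative_iff_has_vector_derivative DD_simps U0\<close>)
  have cc: "continuous_on {0..<T} (\<lambda>t. cc (DD (U t)))"
    using continuous_on_fst[OF continuous_on_snd[OF continuous_on_snd[OF cF]]] by (simp add: FX_def)
  show ?thesis
    unfolding is_solution_def
  proof (rule exI[of _ \<zeta>t], rule exI[of _ "\<lambda>t. Fq (DD (U t))"], rule exI[of _ "\<lambda>t. cc (DD (U t))"], intro conjI ballI)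
    show "C1_Sobolev E m {0..<T} (\<lambda>t. zt (DD (U t))) \<zeta>t" by (rule C1)
    show "C1_Sobolev E (m + 1) {0..<T} (\<lambda>t. qu (DD (U t))) (\<lambda>t. Fq (DD (U t)))" using C2 by simp
    show "continuous_on {0..<T} (\<lambda>t. cc (DD (U t)))" by (rule cc)
    show "av (DD (U 0)) = qiin" by (simp add: U0 DD_simps)
    show "AEE x. zt (DD (U 0)) x = \<zeta>in x \<and> qu (DD (U 0)) x = qin x"
      using fn_emb_Sobolev(3)[OF in0(1)] fn_emb_Sobolev(3)[OF in0(2)] unfolding U0 DD_simps fst_conv snd_conv
      by eventually_elim auto
    fix t assume t: "t \<in> {0..<T}"
    show "((\<lambda>t. av (DD (U t))) has_real_derivative cc (DD (U t))) (at t within {0..<T})"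
      using comp(3)[OF t] by (simp add: has_real_derivative_iff_has_vector_derivative)
    let ?D = "DD (U t)"
    have ae: "AEE x. zt ?D x = zt ?D x" "AEE x. qu ?D x = qu ?D x" by simp_all
    note H = GX_D[OF G[OF t]]
    have cq: "contB (qu ?D)" by (rule Hm_contB[OF H(2)]) simp
    have i: "ess_inf_pos E (ht ?D)" using ess_inf_pos_iff[OF H(1) ae(1)] G[OF t] by (simp add: GX_def)
    have c: "AEE x. \<zeta>t t x + weak_deriv E 1 (qu ?D) x = 0"
    proof (rule iffD2[OF continuity_iff[OF zS(2,3)[OF t]]])
      show "emb m (\<zeta>t t) = - shift (emb (Suc m) (qu ?D))" unfolding ez(2,3)[OF t] by (simp only: FX_def fst_conv)
    qed
    obtain \<phi>' where \<phi>: "AC Eb (phD ?D) \<phi>'" "sqi (ext \<phi>')"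
      "AEE x. \<epsilon> * weak_deriv E 1 (\<lambda>y. (qu ?D y)\<^sup>2 / ht ?D y) x + ht ?D x * weak_deriv E 1 (zt ?D) x = \<phi>' x"
      by (rule momentum_flux[OF G[OF t] ae])
    have mo: "AEE x. (Fq ?D x - \<mu>\<^sup>2 * weak_deriv E 2 (Fq ?D) x) + \<epsilon> * weak_deriv E 1 (\<lambda>y. (qu ?D y)\<^sup>2 / ht ?D y) x
       + ht ?D x * weak_deriv E 1 (zt ?D) x = 0"
      using Fq_momentum[OF G[OF t] \<phi>(1,2)] \<phi>(3) by eventually_elim auto
    have tr: "jump r (qu ?D) = 0" "mean r (qu ?D) = av ?D" "ess_tendsto (qu ?D) 0 (at_left l)"
      using trace(6,7,3)[OF cq ae(2)] H(3-5) by simp_all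
    have d1: "ess_tendsto (zt ?D) 0 at_bot" by (rule Hm_decay[OF H(1) m1 ae(1)])
    have d2: "ess_tendsto (qu ?D) 0 at_bot" by (rule Hm_decay[OF H(2) _ ae(2)]) simp
    have T: "(2 * r / hw + T_coeff r l \<mu> (ht ?D)) * cc ?D - \<epsilon> / 2 * jump r (\<lambda>x. 1 / (ht ?D x)\<^sup>2) * (av ?D)\<^sup>2
      = - jump r (calF r l \<epsilon> \<mu> (zt ?D) (qu ?D)) - P0 * (average r l (zt ?D) - \<kappa> * dv ?D)"
      using transmission_iff[OF G[OF t] ae, of "cc ?D"] by blast
    show "let h = ht ?D in
        ess_inf_pos E h \<and>
        (AEE x. \<zeta>t t x + weak_deriv E 1 (qu ?D) x = 0) \<and>
        (AEE x.
           (Fq ?D x - \<mu>\<^sup>2 * weak_deriv E 2 (Fq ?D) x)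
           + \<epsilon> * weak_deriv E 1 (\<lambda>y. (qu ?D y)\<^sup>2 / h y) x
           + h x * weak_deriv E 1 (zt ?D) x = 0) \<and>
        ess_tendsto (zt ?D) 0 at_bot \<and> ess_tendsto (qu ?D) 0 at_bot \<and>
        ess_tendsto (qu ?D) 0 (at_left l) \<and>
        jump r (qu ?D) = 0 \<and> mean r (qu ?D) = av ?D \<and>
        (2 * r / hw + T_coeff r l \<mu> h) * cc ?D
          - \<epsilon> / 2 * jump r (\<lambda>x. 1 / (h x)\<^sup>2) * (av ?D)\<^sup>2
        = - jump r (calF r l \<epsilon> \<mu> (zt ?D) (qu ?D))
          - P0 * (average r l (zt ?D) - \<kappa> * duhamel \<kappa> (\<lambda>s. average r l (zt (DD (U s)))) t)"
      unfolding Let_def duh[OF t, symmetric] by (intro conjI i c mo tr d1 d2 T)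
  qed
qed

lemma solution_unique:
  assumes s: "is_solution r l hw P0 \<kappa> \<epsilon> \<mu> m \<zeta>in qin qiin T \<zeta> q qi" "is_solution r l hw P0 \<kappa> \<epsilon> \<mu> m \<zeta>in qin qiin T \<zeta>2 q2 qi2"
    and in0: "\<zeta>in \<in> Sobolev E m" "qin \<in> Sobolev E (Suc m)" and t: "t \<in> {0..<T}"
  shows "(AEE x. \<zeta>2 t x = \<zeta> t x \<and> q2 t x = q t x) \<and> qi2 t = qi t"
proof -
  have e: "emb m (\<zeta>2 t) = emb m (\<zeta> t)" "emb (Suc m) (q2 t) = emb (Suc m) (q t)" "qi2 t = qi t"
    using sol_unique[OF solution_imp_sol[OF s(2) in0] solution_imp_sol[OF s(1) in0] t] unfolding prod.inject by blast+
  note z = fn_emb_Sobolev(3)[OF is_solution_Sobolev(1)[OF s(1) t]] fn_emb_Sobolev(3)[OF is_solution_Sobolev(1)[OF s(2) t], unfolded e]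
  note q = fn_emb_Sobolev(3)[OF is_solution_Sobolev(2)[OF s(1) t]] fn_emb_Sobolev(3)[OF is_solution_Sobolev(2)[OF s(2) t], unfolded e]
  have "AEE x. \<zeta>2 t x = \<zeta> t x \<and> q2 t x = q t x" using z q by eventually_elim simp
  then show ?thesis using e(3) by blast
qed

section \<open>Blow-up\<close>

text \<open>Finiteness of the sum in the extended reals bounds both summands once the essential
  supremum is known to be nonnegative.\<close>

lemma Linf_norm3_bound: assumes "Linf_norm3 E f1 f2 f3 + ereal \<bar>a\<bar> < ereal M"
  shows "\<bar>a\<bar> \<le> M" "AEE x. \<bar>f1 x\<bar> \<le> M \<and> \<bar>f2 x\<bar> \<le> M \<and> \<bar>f3 x\<bar> \<le> M"
proof -
  define S where "S = Linf_norm3 E f1 f2 f3"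
  have "AE x in restrict_space lebesgue E. ereal (max \<bar>f1 x\<bar> (max \<bar>f2 x\<bar> \<bar>f3 x\<bar>)) \<le> S"
    unfolding S_def Linf_norm3_def by (rule esssup_AE)
  moreover have "E \<inter> space lebesgue \<in> sets lebesgue" using E_sets by simp
  ultimately have AE: "AEE x. ereal (max \<bar>f1 x\<bar> (max \<bar>f2 x\<bar> \<bar>f3 x\<bar>)) \<le> S"
    by (simp only: AE_restrict_space_iff)
  \<comment> \<open>A negative value, minus infinity included, would force the set (r, l) of
    positive measure to be null.\<close>
  have S0: "S \<ge> 0"
  proof (rule ccontr)
    assume n: "\<not> S \<ge> 0"
    from AE have "AE x in lebesgue. x \<notin> {r<..<l}"
    proof eventually_elim
      case (elim x)
      have "ereal 0 \<le> ereal (max \<bar>f1 x\<bar> (max \<bar>f2 x\<bar> \<bar>f3 x\<bar>))" by (subst ereal_less_eq(3)) (simp add: le_max_iff_disj)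
      then have "x \<notin> E" using elim n order_trans unfolding zero_ereal_def by blast
      then show ?case by (simp add: domE_def)
    qed
    then show False using not_AE_interval[OF rl] by blast
  qed
  obtain s where s: "S = ereal s" using assms S0 by (cases S) (auto simp: S_def[symmetric])
  have "s \<ge> 0" "s + \<bar>a\<bar> < M" using S0 assms by (auto simp: s S_def[symmetric])
  then show "\<bar>a\<bar> \<le> M" by simp
  show "AEE x. \<bar>f1 x\<bar> \<le> M \<and> \<bar>f2 x\<bar> \<le> M \<and> \<bar>f3 x\<bar> \<le> M"
    using AE by eventually_elim (use \<open>s + \<bar>a\<bar> < M\<close> in \<open>auto simp: s\<close>)
qed

lemma Hm_AE_bound: assumes "Hm k f" "k \<ge> 1" "AEE x. \<bar>f x\<bar> \<le> M" "x \<in> Eb"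
  shows "\<bar>f x\<bar> \<le> M"
proof -
  obtain u where u: "chain k u" "u 0 = f" using Hm_chain[OF assms(1)] by blast
  then have A: "AC Eb f (u 1)" using assms(2) by (auto simp: chain_def)
  have "- M \<le> f x" by (rule AE_le_AC[OF A _ assms(4)]) (use assms(3) in \<open>eventually_elim, auto\<close>)
  moreover have "- M \<le> (-1) * f x" by (rule AE_le_AC[OF AC_cmult[OF A] _ assms(4)]) (use assms(3) in \<open>eventually_elim, auto\<close>)
  ultimately show ?thesis by simp
qed

text \<open>If the limit superior were finite, the quantities in it would be bounded on a left
  neighbourhood of \<open>Tm\<close>; the a priori bound would then bound \<open>sizeX\<close>
  there, contrary to \<open>unb\<close>.\<close>

lemma blow_up:
  assumes sol: "sol Tm U u" and Tm: "Tm > 0"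
    and unb: "\<And>M t0. t0 < Tm \<Longrightarrow> \<exists>t\<in>{t0..<Tm}. 0 \<le> t \<and> sizeX (U t) > M"
  shows "Limsup (at_left Tm) (\<lambda>t. Linf_norm3 E (zt (DD (U t))) (qu (DD (U t))) (\<lambda>x. 1 / ht (DD (U t)) x) + ereal \<bar>av (DD (U t))\<bar>) = \<infinity>"
    (is "Limsup _ ?f = _")
proof (rule ccontr)
  assume "Limsup (at_left Tm) ?f \<noteq> \<infinity>"
  then obtain n :: nat where "Limsup (at_left Tm) ?f < ereal (real n)" using less_PInf_Ex_of_nat by auto
  then have "eventually (\<lambda>t. ?f t < ereal (real n)) (at_left Tm)" by (rule Limsup_lessD)
  then have "\<exists>b<Tm. \<forall>t>b. t < Tm \<longrightarrow> ?f t < ereal (real n)" by (simp only: eventually_at_left[OF Tm])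
  then obtain t1 where t1: "t1 < Tm" "\<forall>t>t1. t < Tm \<longrightarrow> ?f t < ereal (real n)" by (elim exE conjE)
  \<comment> \<open>Strictly later than \<open>t1\<close>, so that the bound holds on the interval
    closed at \<open>t0\<close>.\<close>
  define t0 where "t0 = max 0 ((t1 + Tm) / 2)"
  have t0: "0 \<le> t0" "t0 < Tm" "t1 < t0" using t1(1) Tm by (auto simp: t0_def less_max_iff_disj)
  define A where "A = real n + 1"
  have A: "A \<ge> 1" by (simp add: A_def)
  have bd: "(\<forall>x\<in>Eb. \<bar>zt (DD (U t)) x\<bar> \<le> A) \<and> (\<forall>x\<in>Eb. ht (DD (U t)) x \<ge> 1 / A) \<and> \<bar>av (DD (U t))\<bar> \<le> A"
    "\<forall>x\<in>Eb. \<bar>qu (DD (U t)) x\<bar> \<le> A" if t: "t \<in> {t0..<Tm}" for t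
  proof -
    let ?D = "DD (U t)"
    have t': "t \<in> {0..<Tm}" using t t0(1) by auto
    have G: "U t \<in> GX" using sol t' unfolding sol_def by blast
    note H = GX_D[OF G]
    have "?f t < ereal (real n)" by (rule t1(2)[rule_format]) (use t t0 in auto)
    note B = Linf_norm3_bound[OF this]
    have nA: "real n \<le> A" by (simp add: A_def)
    have z: "\<bar>zt ?D x\<bar> \<le> A" if "x \<in> Eb" for x
      by (rule Hm_AE_bound[OF H(1) m1 _ that]) (use B(2) nA in \<open>eventually_elim, auto\<close>)
    have q: "\<bar>qu ?D x\<bar> \<le> A" if "x \<in> Eb" for x
      by (rule Hm_AE_bound[OF H(2) _ _ that], simp) (use B(2) nA in \<open>eventually_elim, auto\<close>)
    obtain c where c: "chain m c" "c 0 = zt ?D" using Hm_chain[OF H(1)] by blast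
    then have "AC Eb (zt ?D) (c 1)" using m1 by (auto simp: chain_def)
    from AC_add[OF AC_const[of Eb 1] AC_cmult[OF this, of \<epsilon>]]
    have Ah: "AC Eb (ht ?D) (\<lambda>x. 0 + \<epsilon> * c 1 x)" by (simp add: height_def[abs_def])
    have "AEE x. 1 / A \<le> ht ?D x"
      using B(2)
    proof eventually_elim
      case (elim x)
      show ?case
      proof
        assume x: "x \<in> E"
        then have "ht ?D x > 0" using H(6) E_Eb by blast
        moreover have "1 / ht ?D x \<le> A" using elim x nA by (smt (verit))
        ultimately show "1 / A \<le> ht ?D x" using A by (simp add: field_simps)
      qed
    qed
    then have h: "1 / A \<le> ht ?D x" if "x \<in> Eb" for x by (rule AE_le_AC[OF Ah _ that])
    show "(\<forall>x\<in>Eb. \<bar>zt ?D x\<bar> \<le> A) \<and> (\<forall>x\<in>Eb. ht ?D x \<ge> 1 / A) \<and> \<bar>av ?D\<bar> \<le> A" using z h B(1) nA by auto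
    show "\<forall>x\<in>Eb. \<bar>qu ?D x\<bar> \<le> A" using q by blast
  qed
  obtain M where M: "\<And>t. t \<in> {t0..<Tm} \<Longrightarrow> sizeX (U t) \<le> M"
    using a_priori_bound[OF sol t0(1) A bd(1)] bd(2) by blast
  obtain t where "t \<in> {t0..<Tm}" "sizeX (U t) > M" using unb[OF t0(2)] by blast
  then show False using M[of t] by simp
qed

text \<open>Solutions and trajectories exist on exactly the same intervals, so the maximal existence
  time of the problem is that of the differential equation, where continuation and blow-up are
  known.\<close>

lemma well_posedness:
  assumes in0: "\<zeta>in \<in> Sobolev E m" "qin \<in> Sobolev E (Suc m)" and u0: "(emb m \<zeta>in, emb (Suc m) qin, qiin, 0) \<in> GX" (is "?u \<in> GX")
  shows "\<exists>T>0. \<exists>\<zeta> q qi. is_unique_solution r l hw P0 \<kappa> \<epsilon> \<mu> m \<zeta>in qin qiin T \<zeta> q qi"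
    "max_existence_time r l hw P0 \<kappa> \<epsilon> \<mu> m \<zeta>in qin qiin = ereal Tmax \<Longrightarrow>
       \<exists>\<zeta> q qi. is_unique_solution r l hw P0 \<kappa> \<epsilon> \<mu> m \<zeta>in qin qiin Tmax \<zeta> q qi \<and>
          Limsup (at_left Tmax) (\<lambda>t. Linf_norm3 E (\<zeta> t) (q t) (\<lambda>x. 1 / height \<epsilon> (\<zeta> t) x) + ereal \<bar>qi t\<bar>) = \<infinity>"
proof -
  have uniq: "is_unique_solution r l hw P0 \<kappa> \<epsilon> \<mu> m \<zeta>in qin qiin T (\<lambda>t. zt (DD (U t))) (\<lambda>t. qu (DD (U t))) (\<lambda>t. av (DD (U t)))"
    if "sol T U ?u" for T U
    unfolding is_unique_solution_def
    using sol_imp_solution[OF that in0] solution_unique[OF sol_imp_solution[OF that in0] _ in0] by blast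
  obtain \<tau> U where "\<tau> > 0" "sol \<tau> U ?u" using sol_local[of "sizeX ?u"] u0 by blast
  then show "\<exists>T>0. \<exists>\<zeta> q qi. is_unique_solution r l hw P0 \<kappa> \<epsilon> \<mu> m \<zeta>in qin qiin T \<zeta> q qi" using uniq by blast
  assume mx: "max_existence_time r l hw P0 \<kappa> \<epsilon> \<mu> m \<zeta>in qin qiin = ereal Tmax"
  have "(\<exists>\<zeta> q qi. is_solution r l hw P0 \<kappa> \<epsilon> \<mu> m \<zeta>in qin qiin T \<zeta> q qi) \<longleftrightarrow> (\<exists>U. sol T U ?u)" for T
    using solution_imp_sol[OF _ in0] sol_imp_solution[OF _ in0] by blast
  then have "(SUP T\<in>{T. 0 < T \<and> (\<exists>U. sol T U ?u)}. ereal T) = ereal Tmax"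
    using mx by (simp add: max_existence_time_def setcompr_eq_image)
  note M = sol_maximal[OF this u0]
  obtain U where U: "sol Tmax U ?u" "\<forall>M. \<forall>t0<Tmax. \<exists>t\<in>{t0..<Tmax}. 0 \<le> t \<and> sizeX (U t) > M" using M(2) by blast
  have L: "Limsup (at_left Tmax) (\<lambda>t. Linf_norm3 E (zt (DD (U t))) (qu (DD (U t))) (\<lambda>x. 1 / ht (DD (U t)) x) + ereal \<bar>av (DD (U t))\<bar>) = \<infinity>"
    by (rule blow_up[OF U(1) M(1)]) (use U(2) in blast)
  show "\<exists>\<zeta> q qi. is_unique_solution r l hw P0 \<kappa> \<epsilon> \<mu> m \<zeta>in qin qiin Tmax \<zeta> q qi \<and>
          Limsup (at_left Tmax) (\<lambda>t. Linf_norm3 E (\<zeta> t) (q t) (\<lambda>x. 1 / height \<epsilon> (\<zeta> t) x) + ereal \<bar>qi t\<bar>) = \<infinity>"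
    by (intro exI conjI) (rule uniq[OF U(1)], rule L)
qed

end

theorem theorem4p10:
  fixes r l hw P0 \<kappa> \<epsilon> \<mu> qiin :: real
    and \<zeta>in qin :: "real \<Rightarrow> real"
    and m :: nat
  assumes "0 < r" and "r < l" and "hw > 0" and "P0 > 0" and "\<kappa> \<ge> 0"
    and "m \<ge> 1"
    and "0 < \<epsilon>" and "\<epsilon> \<le> 1" and "\<mu> > 0"
    and "\<zeta>in \<in> Sobolev (domE r l) m"
    and "qin \<in> Sobolev (domE r l) (m + 1)"
    and "ess_inf_pos (domE r l) (\<lambda>x. 1 + \<epsilon> * \<zeta>in x)"
    and "jump r qin = 0"
    and "mean r qin = qiin"
    and "ess_tendsto qin 0 (at_left l)"
  shows "(\<exists>T>0. \<exists>\<zeta> q qi. is_unique_solution r l hw P0 \<kappa> \<epsilon> \<mu> m \<zeta>in qin qiin T \<zeta> q qi) \<and>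
    (\<forall>Tmax::real. max_existence_time r l hw P0 \<kappa> \<epsilon> \<mu> m \<zeta>in qin qiin = ereal Tmax \<longrightarrow>
       (\<exists>\<zeta> q qi. is_unique_solution r l hw P0 \<kappa> \<epsilon> \<mu> m \<zeta>in qin qiin Tmax \<zeta> q qi \<and>
          Limsup (at_left Tmax)
            (\<lambda>t. Linf_norm3 (domE r l) (\<zeta> t) (q t) (\<lambda>x. 1 / height \<epsilon> (\<zeta> t) x) + ereal \<bar>qi t\<bar>) = \<infinity>))"
proof -
  interpret prob r l hw P0 \<kappa> \<epsilon> \<mu> m by unfold_locales (use assms in auto)
  have q: "qin \<in> Sobolev E (Suc m)" using assms(11) by simp
  have "ess_inf_pos E (height \<epsilon> \<zeta>in)" using assms(12) by (simp add: height_def[abs_def])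
  \<comment> \<open>The last component is the memory term at time 0, which vanishes.\<close>
  note u0 = GX_I(1)[OF assms(10) q this assms(13,14,15), of 0]
  show ?thesis using well_posedness[OF assms(10) q u0] by blast
qed

end
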